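(* Let $p, r \in \mathbb{N}$ and consider, for each sample size $T$, the path $(X_t)_{1 \le t \le T}$ generated by $$\Theta(L) X_t = \left(\alpha_0 + \alpha_1 \tfrac{t}{T} + \dots + \alpha_r \left(\tfrac{t}{T}\right)^r\right) \mathbb{I}_{\{\kappa \neq 0\}} + S_t^{\eta} + \varepsilon_t, \qquad 1 \le t \le T,$$ where $\Theta(z) = 1 - \theta_1 z - \dots - \theta_p z^p$ has all its zeroes outside the unit circle, $S_t^\eta = \rho S_{t-1}^\eta + \eta_t$ with $S_0^\eta = 0$ and $|\rho| = 1$, and $(\varepsilon_t)$, $(\eta_t)$ are uncorrelated (strong) white noises of variances $\sigma_\varepsilon^2 > 0$ and $\sigma_\eta^2 \ge 0$. Let $\widehat{K}_T$ be the test statistic defined in the context. Assume that $\sigma_\eta^2 > 0$. Then, as $T \to \infty$, for $\kappa \neq 0$ and $\rho = 1$, we have the weak convergence $$\frac{\widehat{K}_T}{T} \overset{\mathcal{D}}{\longrightarrow} \frac{\int_0^1 C_{r,1}^2(s)\, \mathrm{d}s}{\int_0^1 W_{r,0}^2(s)\, \mathrm{d}s},$$ where $(C_{r,1}(t), t\in[0,1])$ is the integrated Brownian bridge of order $r \times 1$ and $(W_{r,0}(t), t \in [0,1])$ is the detrended Wiener process of order $r \times 0$. In addition, for $\kappa = 0$ and $\rho = 1$, we have the weak convergence $$\frac{\widehat{K}_T}{T} \overset{\mathcal{D}}{\longrightarrow} \frac{\int_0^1 \left(W^{(1)}(s)\right)^2 \mathrm{d}s}{\int_0^1 W^2(s)\,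 \mathrm{d}s},$$ where $(W^{(1)}(t), t\in[0,1])$ is the integrated Wiener process of order $1$ and $(W(t), t\in[0,1])$ is the standard Wiener process. Finally, for $\rho = -1$ (whether $\kappa \ne 0$ or $\kappa = 0$), $$\widehat{K}_T \overset{\mathbb{P}}{\longrightarrow} 0.$$
   Context: Model conventions. $L$ is the lag operator ($L^0 = I$), $\mathbb{I}$ is the indicator function, and $\rho \in \{-1, 1\}$. White noises are understood in the strong sense: sequences of independent and identically distributed random variables, centered with finite variance. The coefficients $\theta_i$ and $\alpha_j$ are real. The initial values are $X_{-p+1} = \dots = X_{-1} = X_0 = 0$. The parameter $\kappa$ is a switch: $\kappa \ne 0$ means that a polynomial trend of order $r$ is present in the model and is fitted; $\kappa = 0$ means that no trend is present and none is fitted. Test statistic. Let $\check{\theta}_T = (\check\theta_1, \dots, \check\theta_p)$ be a consistent estimator of $\theta = (\theta_1, \dots, \theta_p)$ (i.e. $\check\theta_T \to \theta$ in probability as $T \to \infty$), and set $\check{X}_t = X_t - \check\theta_1 X_{t-1} - \dots - \check\theta_p X_{t-p}$ for $1 \le t \le T$. If $\kappa \neq 0$, let $\widehat\alpha_T = (\widehat\alpha_0, \dots, \widehat\alpha_r)$ be the ordinary least squares estimator in the regression of $\check X_t$ on $(1, t/T, \dots, (t/T)^r)$, $1 \le t \le T$. Define the residuals $$\widehat\varepsilon_t = \check X_t - \left(\widehat\alpha_0 + \widehat\alpha_1 \tfrac{t}{T} + \dots + \widehat\alpha_r \left(\tfrac{t}{T}\right)^r\right)\mathbb{I}_{\{\kappa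 \ne 0\}},$$ the partial sums $S_t = \sum_{k=1}^t \widehat\varepsilon_k$ and $Q_t = \sum_{k=1}^t \widehat\varepsilon_k^{\,2}$, and $$\widehat K_T = \frac{1}{T Q_T} \sum_{t=1}^T S_t^2.$$ Limiting processes (in each ratio, numerator and denominator are built from the same standard Wiener process $W$ on $[0,1]$). The integrated Wiener process of order $1$ is $W^{(1)}(t) = \int_0^t W(s)\,\mathrm{d}s$. Let $\Lambda(t) = (1, t, \dots, t^r)'$ and let $M$ be the $(r+1)\times(r+1)$ matrix with $M_{ij} = 1/(i+j-1)$. For $f \in C([0,1])$ with $f(0) = 0$, let $$h_r(f)(t) = f(t) - \left(\int_0^t \Lambda(s)\,\mathrm{d}s\right)' M^{-1} \left( \Lambda(1) f(1) - \int_0^1 \Lambda'(u) f(u)\, \mathrm{d}u \right),$$ where $\Lambda'(u) = (0, 1, 2u, \dots, r u^{r-1})'$ is the derivative of $\Lambda$. The integrated Brownian bridge of order $r \times 1$ is $C_{r,1}(t) = h_r(W^{(1)})(t)$. The detrended Wiener process of order $r \times 0$ is $$W_{r,0}(t) = \frac{\mathrm{d} C_{r,1}(t)}{\mathrm{d}t} = W(t) - \left(\int_0^1 \Lambda(s) W(s)\,\mathrm{d}s\right)' M^{-1} \Lambda(t).$$ For instance $C_{0,1}(t) = \int_0^t W(s)\,\mathrm{d}s - t\int_0^1 W(s)\,\mathrm{d}s$ and $W_{0,0}(t) = W(t) - \int_0^1 W(s)\,\mathrm{d}s$. *)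

theory Defs
  imports
    "HOL-Probability.Probability"
    "Jordan_Normal_Form.Gauss_Jordan_Elimination"
begin

section \<open>Noises and modes of convergence\<close>

text \<open>Strong white noise indexed by \<open>t \<ge> 1\<close>: i.i.d., square integrable, centred, of variance \<open>v\<close>.\<close>

definition strong_white_noise :: "'a measure \<Rightarrow> (nat \<Rightarrow> 'a \<Rightarrow> real) \<Rightarrow> real \<Rightarrow> bool" where
  "strong_white_noise M e v \<longleftrightarrow>
     prob_space M \<and>
     prob_space.indep_vars M (\<lambda>_. borel) e {1..} \<and>
     (\<forall>s\<ge>1. \<forall>t\<ge>1. distr M borel (e s) = distr M borel (e t)) \<and>
     (\<forall>t\<ge>1. integrable M (\<lambda>\<omega>. (e t \<omega>)\<^sup>2)) \<and>
     (\<forall>t\<ge>1. integral\<^sup>L M (e t) = 0) \<and>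
     (\<forall>t\<ge>1. integral\<^sup>L M (\<lambda>\<omega>. (e t \<omega> - integral\<^sup>L M (e t))\<^sup>2) = v)"

definition covariance :: "'a measure \<Rightarrow> ('a \<Rightarrow> real) \<Rightarrow> ('a \<Rightarrow> real) \<Rightarrow> real" where
  "covariance M Y Z = integral\<^sup>L M (\<lambda>\<omega>. (Y \<omega> - integral\<^sup>L M Y) * (Z \<omega> - integral\<^sup>L M Z))"

definition uncorrelated_noises :: "'a measure \<Rightarrow> (nat \<Rightarrow> 'a \<Rightarrow> real) \<Rightarrow> (nat \<Rightarrow> 'a \<Rightarrow> real) \<Rightarrow> bool" where
  "uncorrelated_noises M e h \<longleftrightarrow> (\<forall>s\<ge>1. \<forall>t\<ge>1. covariance M (e s) (h t) = 0)"

definition tendsto_in_prob :: "'a measure \<Rightarrow> (nat \<Rightarrow> 'a \<Rightarrow> real) \<Rightarrow> real \<Rightarrow> bool" where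
  "tendsto_in_prob M Y c \<longleftrightarrow>
     (\<forall>\<delta>>0. (\<lambda>n. measure M {\<omega> \<in> space M. \<bar>Y n \<omega> - c\<bar> > \<delta>}) \<longlonglongrightarrow> 0)"

text \<open>Only the coordinates \<open>1, \<dots>, p\<close> of \<open>\<theta>\<close> and of the estimator \<open>th T\<close> are meaningful;
  the convergence in probability is for the Euclidean norm of \<open>\<real>\<^sup>p\<close>.\<close>

definition consistent_estimator ::
  "'a measure \<Rightarrow> nat \<Rightarrow> (nat \<Rightarrow> nat \<Rightarrow> 'a \<Rightarrow> real) \<Rightarrow> (nat \<Rightarrow> real) \<Rightarrow> bool" where
  "consistent_estimator M p th \<theta> \<longleftrightarrow>
     (\<forall>T. \<forall>i\<in>{1..p}. th T i \<in> borel_measurable M) \<and>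
     tendsto_in_prob M (\<lambda>T \<omega>. L2_set (\<lambda>i. th T i \<omega> - \<theta> i) {1..p}) 0"


section \<open>The model\<close>

definition ar_poly :: "nat \<Rightarrow> (nat \<Rightarrow> real) \<Rightarrow> complex \<Rightarrow> complex" where
  "ar_poly p \<theta> z = 1 - (\<Sum>i=1..p. complex_of_real (\<theta> i) * z ^ i)"

text \<open>\<open>\<Theta>(L)\<close> applied to a path \<open>x\<close>; time is an integer because of the initial values
  at times \<open>-p + 1, \<dots>, 0\<close>.\<close>

definition ar_filter :: "nat \<Rightarrow> (nat \<Rightarrow> real) \<Rightarrow> (int \<Rightarrow> real) \<Rightarrow> int \<Rightarrow> real" where
  "ar_filter p \<theta> x t = x t - (\<Sum>i=1..p. \<theta> i * x (t - int i))"

definition trend :: "nat \<Rightarrow> (nat \<Rightarrow> real) \<Rightarrow> nat \<Rightarrow> nat \<Rightarrow> real" where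
  "trend r \<alpha> T t = (\<Sum>j=0..r. \<alpha> j * (real t / real T) ^ j)"

primrec S_eta :: "real \<Rightarrow> (nat \<Rightarrow> real) \<Rightarrow> nat \<Rightarrow> real" where
  "S_eta \<rho> h 0 = 0"
| "S_eta \<rho> h (Suc t) = \<rho> * S_eta \<rho> h t + h (Suc t)"

definition model_path ::
  "nat \<Rightarrow> nat \<Rightarrow> real \<Rightarrow> real \<Rightarrow> (nat \<Rightarrow> real) \<Rightarrow> (nat \<Rightarrow> real) \<Rightarrow>
   (nat \<Rightarrow> real) \<Rightarrow> (nat \<Rightarrow> real) \<Rightarrow> nat \<Rightarrow> (int \<Rightarrow> real) \<Rightarrow> bool" where
  "model_path p r \<kappa> \<rho> \<theta> \<alpha> e h T x \<longleftrightarrow>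
     (\<forall>t\<in>{- int p + 1..0}. x t = 0) \<and>
     (\<forall>t\<in>{1..T}. ar_filter p \<theta> x (int t) =
        trend r \<alpha> T t * of_bool (\<kappa> \<noteq> 0) + S_eta \<rho> h t + e t)"


section \<open>The test statistic\<close>

text \<open>A minimiser always exists, but it is unique only if \<open>T \<ge> r + 1\<close>; for smaller \<open>T\<close> the
  choice made by \<open>arg_min\<close> affects neither the fitted values at \<open>t = 1, \<dots>, T\<close>
  nor the asymptotics. The coefficients beyond \<open>r\<close> are padding.\<close>

definition ols_trend :: "nat \<Rightarrow> nat \<Rightarrow> (nat \<Rightarrow> real) \<Rightarrow> nat \<Rightarrow> real" where
  "ols_trend r T y =
     arg_min (\<lambda>a. \<Sum>t=1..T. (y t - trend r a T t)\<^sup>2) (\<lambda>a. \<forall>j>r. a j = 0)"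

definition residual ::
  "nat \<Rightarrow> nat \<Rightarrow> real \<Rightarrow> nat \<Rightarrow> (nat \<Rightarrow> real) \<Rightarrow> (int \<Rightarrow> real) \<Rightarrow> nat \<Rightarrow> real" where
  "residual p r \<kappa> T th x t =
     (let y = (\<lambda>s. ar_filter p th x (int s))
      in y t - trend r (ols_trend r T y) T t * of_bool (\<kappa> \<noteq> 0))"

definition K_stat ::
  "nat \<Rightarrow> nat \<Rightarrow> real \<Rightarrow> nat \<Rightarrow> (nat \<Rightarrow> real) \<Rightarrow> (int \<Rightarrow> real) \<Rightarrow> real" where
  "K_stat p r \<kappa> T th x =
     (let res = residual p r \<kappa> T th x;
          S = (\<lambda>t. \<Sum>k=1..t. res k);
          Q = (\<lambda>t. \<Sum>k=1..t. (res k)\<^sup>2)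
      in 1 / (real T * Q T) * (\<Sum>t=1..T. (S t)\<^sup>2))"


section \<open>The limiting processes\<close>

text \<open>Standard Wiener process on \<open>[0, 1]\<close>. All its paths start at 0 and are continuous, i.e. it is
  a random element of \<open>C([0, 1])\<close>, so that path functionals need no exceptional null set.\<close>

definition wiener_process :: "'b measure \<Rightarrow> (real \<Rightarrow> 'b \<Rightarrow> real) \<Rightarrow> bool" where
  "wiener_process N W \<longleftrightarrow>
     prob_space N \<and>
     (\<forall>t\<in>{0..1}. W t \<in> borel_measurable N) \<and>
     (\<forall>\<omega>\<in>space N. W 0 \<omega> = 0 \<and> continuous_on {0..1} (\<lambda>t. W t \<omega>)) \<and>
     (\<forall>n (\<tau> :: nat \<Rightarrow> real). mono_on {..n} \<tau> \<and> \<tau> ` {..n} \<subseteq> {0..1} \<longrightarrow>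
        prob_space.indep_vars N (\<lambda>_. borel) (\<lambda>i \<omega>. W (\<tau> (Suc i)) \<omega> - W (\<tau> i) \<omega>) {..<n}) \<and>
     (\<forall>s t. 0 \<le> s \<and> s < t \<and> t \<le> 1 \<longrightarrow>
        distributed N lborel (\<lambda>\<omega>. W t \<omega> - W s \<omega>) (normal_density 0 (sqrt (t - s))))"

text \<open>Vectors and matrices are indexed from 0.\<close>

definition Lam :: "nat \<Rightarrow> real \<Rightarrow> real vec" where
  "Lam r s = vec (r + 1) (\<lambda>i. s ^ i)"

definition dLam :: "nat \<Rightarrow> real \<Rightarrow> real vec" where
  "dLam r u = vec (r + 1) (\<lambda>i. real i * u ^ (i - 1))"

definition vec_integral :: "nat \<Rightarrow> real set \<Rightarrow> (real \<Rightarrow> real vec) \<Rightarrow> real vec" where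
  "vec_integral n A g = vec n (\<lambda>i. integral A (\<lambda>s. vec_index (g s) i))"

definition hilbert_mat :: "nat \<Rightarrow> real mat" where
  "hilbert_mat r = mat (r + 1) (r + 1) (\<lambda>(i, j). 1 / (real i + real j + 1))"

definition hilbert_inv :: "nat \<Rightarrow> real mat" where
  "hilbert_inv r = the (mat_inverse (hilbert_mat r))"

definition h_detrend :: "nat \<Rightarrow> (real \<Rightarrow> real) \<Rightarrow> real \<Rightarrow> real" where
  "h_detrend r f t = f t -
     scalar_prod (vec_integral (r + 1) {0..t} (Lam r))
       (hilbert_inv r *\<^sub>v
         (f 1 \<cdot>\<^sub>v Lam r 1 - vec_integral (r + 1) {0..1} (\<lambda>u. f u \<cdot>\<^sub>v dLam r u)))"

text \<open>The following act on a path \<open>w\<close> of the Wiener process.\<close>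

definition int_wiener :: "(real \<Rightarrow> real) \<Rightarrow> real \<Rightarrow> real" where
  "int_wiener w t = integral {0..t} w"

definition int_bridge :: "nat \<Rightarrow> (real \<Rightarrow> real) \<Rightarrow> real \<Rightarrow> real" where
  "int_bridge r w = h_detrend r (int_wiener w)"

definition detrended_wiener :: "nat \<Rightarrow> (real \<Rightarrow> real) \<Rightarrow> real \<Rightarrow> real" where
  "detrended_wiener r w t = w t -
     scalar_prod (vec_integral (r + 1) {0..1} (\<lambda>s. w s \<cdot>\<^sub>v Lam r s))
       (hilbert_inv r *\<^sub>v Lam r t)"

definition ratio_trend :: "nat \<Rightarrow> (real \<Rightarrow> real) \<Rightarrow> real" where
  "ratio_trend r w =
     integral {0..1} (\<lambda>s. (int_bridge r w s)\<^sup>2) / integral {0..1} (\<lambda>s. (detrended_wiener r w s)\<^sup>2)"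

definition ratio_no_trend :: "(real \<Rightarrow> real) \<Rightarrow> real" where
  "ratio_no_trend w =
     integral {0..1} (\<lambda>s. (int_wiener w s)\<^sup>2) / integral {0..1} (\<lambda>s. (w s)\<^sup>2)"

end

theory Submission
  imports Defs "Jordan_Normal_Form.Determinant" "HOL-Complex_Analysis.Complex_Analysis" "HOL-Real_Asymp.Real_Asymp"
begin

text \<open>
  The statistic is a ratio \<open>A / B\<close> of quadratic functionals of one path, and the law of
  \<open>A / B\<close> at \<open>x\<close> is governed by the single functional \<open>A - x B\<close>, which is Lipschitz on bounded sets
  of \<open>L\<^sup>2[0,1]\<close>. Replacing the random walk by its version constant on \<open>m\<close> blocks changes the path
  by \<open>O(1/m + 1/T)\<close> in mean square; the \<open>m\<close> block increments converge jointly by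
  the central limit theorem. Thus neither tightness nor a functional central limit theorem in
  \<open>C[0,1]\<close> is needed.

  Least squares removes the trend exactly, and discrete detrending differs from the projection in
  \<open>L\<^sup>2[0,1]\<close> by \<open>O(1/T)\<close>. The inverse of \<open>\<Theta>\<close> has summable coefficients, so \<open>\<Sum> X\<^sub>t\<^sup>2 = O\<^sub>P(T\<^sup>2)\<close> and the
  estimation error of \<open>\<theta>\<close> is negligible, as is \<open>\<epsilon>\<close>.

  For \<open>\<rho> = -1\<close> the random walk alternates in sign and its partial sums are only \<open>O\<^sub>P(\<surd>T)\<close>, whereas
  \<open>Q\<^sub>T\<close> is still of exact order \<open>T\<^sup>2\<close>.
\<close>

subsection \<open>Square integrable functions on the unit interval\<close>

text \<open>Numerator and denominator are built from the same path, so their separate limit laws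
  would not determine that of the ratio; the combinations \<open>Phi\<close>, one for each real
  \<open>x\<close>, carry exactly the joint information required. The noises offer second moments
  only. Quadratic quantities are therefore compared through Young's inequality with a free parameter
  \<open>l\<close>, which is linear in expected squared norms and never calls for a fourth moment.
  The interval is half open because the cell index \<open>floor (T * s) + 1\<close> of a path with
  \<open>T\<close> values would leave \<open>{1..T}\<close> at \<open>s = 1\<close>. The limiting
  ratio makes sense because its denominator is almost surely positive: otherwise the Wiener path
  would be a polynomial vanishing at 0, hence Lipschitz there. For \<rho> = -1 no limit law of the
  denominator is used, only a lower bound in probability; it comes from the even times, at which the
  alternating walk is an ordinary random walk whose increments are differences of neighbouring
  innovations.\<close>

definition U :: "real measure" where
  "U = restrict_space lborel {0..<1}"

lemma space_U [simp]: "space U = {0..<1}"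
  by (simp add: U_def space_restrict_space)

lemma prob_space_U: "prob_space U"
  by (rule prob_spaceI) (simp add: U_def space_restrict_space emeasure_restrict_space)

interpretation U: prob_space U by (rule prob_space_U)

lemma measure_U_space [simp]: "measure U {0..<1} = 1"
  using U.prob_space by simp

lemma measurable_U_borel [measurable (raw)]: "f \<in> borel_measurable borel \<Longrightarrow> f \<in> borel_measurable U"
  unfolding U_def by (rule measurable_restrict_space1) simp

text \<open>Functions are kept pointwise rather than up to null sets. Step functions, monomials,
  continuous paths and primitives all lie in this class, which is an algebra, so integrability of
  every product that occurs is automatic.\<close>

definition bounded_meas :: "(real \<Rightarrow> real) \<Rightarrow> bool" where
  "bounded_meas f \<longleftrightarrow> f \<in> borel_measurable U \<and> (\<exists>B. \<forall>s\<in>{0..<1}. \<bar>f s\<bar> \<le> B)"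

lemma bounded_measI: "f \<in> borel_measurable U \<Longrightarrow> (\<And>s. 0 \<le> s \<Longrightarrow> s < 1 \<Longrightarrow> \<bar>f s\<bar> \<le> B) \<Longrightarrow> bounded_meas f"
  unfolding bounded_meas_def by (metis atLeastLessThan_iff)

lemma bounded_meas_measurable: "bounded_meas f \<Longrightarrow> f \<in> borel_measurable U"
  unfolding bounded_meas_def by blast

lemma bounded_meas_const [simp, intro!]: "bounded_meas (\<lambda>s. c)"
  by (rule bounded_measI[of _ "\<bar>c\<bar>"]) auto

lemma bounded_meas_power [simp, intro!]: "bounded_meas (\<lambda>s. s ^ k)"
  by (rule bounded_measI[of _ 1]) (auto simp: power_abs intro!: power_le_one)

lemma bounded_meas_add [intro!]: assumes "bounded_meas f" "bounded_meas g" shows "bounded_meas (\<lambda>s. f s + g s)"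
proof -
  obtain A B where AB: "\<forall>s\<in>{0..<1}. \<bar>f s\<bar> \<le> A" "\<forall>s\<in>{0..<1}. \<bar>g s\<bar> \<le> B" using assms unfolding bounded_meas_def by blast
  show ?thesis
  proof (rule bounded_measI)
    show "(\<lambda>s. f s + g s) \<in> borel_measurable U" by (intro borel_measurable_add bounded_meas_measurable assms)
    fix s :: real assume "0 \<le> s" "s < 1"
    then have "\<bar>f s\<bar> \<le> A" "\<bar>g s\<bar> \<le> B" using AB by auto
    then show "\<bar>f s + g s\<bar> \<le> A + B" by linarith
  qed
qed

lemma bounded_meas_mult [intro!]: assumes "bounded_meas f" "bounded_meas g" shows "bounded_meas (\<lambda>s. f s * g s)"
proof -
  obtain A B where AB: "\<forall>s\<in>{0..<1}. \<bar>f s\<bar> \<le> A" "\<forall>s\<in>{0..<1}. \<bar>g s\<bar> \<le> B" using assms unfolding bounded_meas_def by blast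
  show ?thesis
  proof (rule bounded_measI)
    show "(\<lambda>s. f s * g s) \<in> borel_measurable U" by (intro borel_measurable_times bounded_meas_measurable assms)
    fix s :: real assume "0 \<le> s" "s < 1"
    then have "\<bar>f s\<bar> \<le> A" "\<bar>g s\<bar> \<le> B" using AB by auto
    then show "\<bar>f s * g s\<bar> \<le> A * B" unfolding abs_mult by (intro mult_mono) auto
  qed
qed

lemma bounded_meas_cmult: "bounded_meas f \<Longrightarrow> bounded_meas (\<lambda>s. c * f s)"
  by (rule bounded_meas_mult[OF bounded_meas_const])

lemma bounded_meas_diff [intro!]: assumes "bounded_meas f" "bounded_meas g" shows "bounded_meas (\<lambda>s. f s - g s)"
  using bounded_meas_add[OF assms(1) bounded_meas_cmult[OF assms(2), of "-1"]] by simp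

lemma bounded_meas_sum [intro!]: "(\<And>i. i \<in> I \<Longrightarrow> bounded_meas (f i)) \<Longrightarrow> bounded_meas (\<lambda>s. \<Sum>i\<in>I. f i s)"
  by (induction I rule: infinite_finite_induct) auto

lemma bounded_meas_square [intro!]: "bounded_meas f \<Longrightarrow> bounded_meas (\<lambda>s. (f s)\<^sup>2)"
  unfolding power2_eq_square by auto

lemma bounded_meas_divide [intro!]: "bounded_meas f \<Longrightarrow> bounded_meas (\<lambda>s. f s / c)"
  using bounded_meas_cmult[of f "1 / c"] by simp

lemma bounded_meas_indicator [intro!]: "A \<in> sets borel \<Longrightarrow> bounded_meas (indicator A)"
  by (intro bounded_measI[of _ 1] measurable_U_borel) (auto simp: indicator_def)

lemma bounded_meas_integrable [intro]: assumes "bounded_meas f" shows "integrable U f"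
proof -
  obtain B where "\<forall>s\<in>{0..<1}. \<bar>f s\<bar> \<le> B" using assms unfolding bounded_meas_def by blast
  then show ?thesis
    by (intro U.integrable_const_bound[of _ B] AE_I2 bounded_meas_measurable assms) auto
qed

lemma bounded_meas_continuous_on: assumes "continuous_on {0..1} f" shows "bounded_meas f"
proof -
  have "compact (f ` {0..1})" using assms compact_continuous_image compact_Icc by blast
  then obtain B where "\<forall>y\<in>f ` {0..1}. norm y \<le> B" using compact_imp_bounded bounded_iff by blast
  moreover have "f \<in> borel_measurable U"
    unfolding U_def
    by (subst measurable_cong_sets[OF sets_restrict_space_cong[OF sets_lborel] refl],
        rule borel_measurable_continuous_on_restrict, rule continuous_on_subset[OF assms]) auto
  ultimately show ?thesis by (intro bounded_measI[of _ B]) auto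
qed

lemma integral_U_eq:
  fixes f :: "real \<Rightarrow> real"
  assumes "continuous_on {0..1} f"
  shows "(LINT s|U. f s) = integral {0..1} f"
proof -
  have "set_integrable lborel {0..<1} f"
    by (rule set_integrable_subset[OF borel_integrable_atLeastAtMost'[OF assms]]) auto
  then have "(LINT s:{0..<1}|lborel. f s) = integral {0..<1} f"
    by (rule set_borel_integral_eq_integral)
  also have "\<dots> = integral {0..1} f"
    by (rule integral_subset_negligible) (auto intro!: negligible_subset[OF negligible_sing[of 1]])
  finally show ?thesis
    by (simp add: U_def integral_restrict_space set_lebesgue_integral_def)
qed

definition sq_norm :: "(real \<Rightarrow> real) \<Rightarrow> real" where
  "sq_norm f = (LINT s|U. (f s)\<^sup>2)"

lemma sq_norm_nonneg [simp]: "0 \<le> sq_norm f"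
  unfolding sq_norm_def by (rule integral_nonneg_AE) auto

lemma integral_U_mono: "bounded_meas f \<Longrightarrow> bounded_meas g \<Longrightarrow> (\<And>s. 0 \<le> s \<Longrightarrow> s < 1 \<Longrightarrow> f s \<le> g s) \<Longrightarrow> (LINT s|U. f s) \<le> (LINT s|U. g s)"
  by (rule integral_mono) auto

lemma sq_norm_mono:
  assumes "bounded_meas f" "bounded_meas g" "\<And>s. 0 \<le> s \<Longrightarrow> s < 1 \<Longrightarrow> \<bar>f s\<bar> \<le> \<bar>g s\<bar>" shows "sq_norm f \<le> sq_norm g"
  unfolding sq_norm_def using assms by (intro integral_U_mono) (auto simp: abs_le_square_iff)

lemma sq_norm_bounded: assumes "bounded_meas f" "\<And>s. 0 \<le> s \<Longrightarrow> s < 1 \<Longrightarrow> \<bar>f s\<bar> \<le> B" shows "sq_norm f \<le> B\<^sup>2"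
proof -
  have "0 \<le> B" using assms(2)[of 0] by (auto intro: order_trans[OF abs_ge_zero])
  then have "sq_norm f \<le> sq_norm (\<lambda>s. B)" using assms by (intro sq_norm_mono) auto
  then show ?thesis by (simp add: sq_norm_def)
qed

lemma sq_norm_cmult: "sq_norm (\<lambda>s. c * f s) = c\<^sup>2 * sq_norm f"
  unfolding sq_norm_def by (simp add: power_mult_distrib)

text \<open>The variance of \<open>f\<close> under the uniform law is nonnegative.\<close>

lemma integral_U_square_le: assumes "bounded_meas f" shows "(LINT s|U. f s)\<^sup>2 \<le> sq_norm f"
proof -
  let ?m = "LINT s|U. f s"
  have "0 \<le> (LINT s|U. (f s - ?m)\<^sup>2)" by (rule integral_nonneg_AE) auto
  also have "\<dots> = (LINT s|U. (f s)\<^sup>2 - (2 * ?m) * f s + ?m\<^sup>2)"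
    by (rule Bochner_Integration.integral_cong) (auto simp: power2_diff)
  also have "\<dots> = sq_norm f - 2 * ?m * ?m + ?m\<^sup>2"
    using assms by (subst Bochner_Integration.integral_add, auto simp: sq_norm_def)
       (subst Bochner_Integration.integral_diff, auto intro!: bounded_meas_integrable)
  finally show ?thesis by (simp add: power2_eq_square)
qed

lemma sq_norm_add_le: assumes "bounded_meas f" "bounded_meas g" shows "sq_norm (\<lambda>s. f s + g s) \<le> 2 * sq_norm f + 2 * sq_norm g"
proof -
  have "sq_norm (\<lambda>s. f s + g s) \<le> (LINT s|U. 2 * (f s)\<^sup>2 + 2 * (g s)\<^sup>2)"
    unfolding sq_norm_def using assms by (intro integral_U_mono) (auto simp: power2_sum add.commute intro: sum_squares_bound)
  also have "\<dots> = 2 * sq_norm f + 2 * sq_norm g"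
    using assms unfolding sq_norm_def by (subst Bochner_Integration.integral_add) auto
  finally show ?thesis .
qed

lemma sq_norm_diff_le: assumes "bounded_meas f" "bounded_meas g" shows "sq_norm (\<lambda>s. f s - g s) \<le> 2 * sq_norm f + 2 * sq_norm g"
  using sq_norm_add_le[OF assms(1) bounded_meas_cmult[OF assms(2), of "-1"]] sq_norm_cmult[of "-1" g] by simp

lemma sq_norm_sum_le:
  assumes "finite I" "\<And>i. i \<in> I \<Longrightarrow> bounded_meas (f i)"
  shows "sq_norm (\<lambda>s. \<Sum>i\<in>I. f i s) \<le> card I * (\<Sum>i\<in>I. sq_norm (f i))"
proof -
  have "sq_norm (\<lambda>s. \<Sum>i\<in>I. f i s) \<le> (LINT s|U. card I * (\<Sum>i\<in>I. (f i s)\<^sup>2))"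
    unfolding sq_norm_def using assms
    by (intro integral_U_mono) (auto simp: mult.commute[of "real (card I)"] sum_squared_le_sum_of_squares)
  also have "\<dots> = card I * (\<Sum>i\<in>I. sq_norm (f i))"
    using assms unfolding sq_norm_def by (subst integral_mult_right_zero, subst Bochner_Integration.integral_sum) auto
  finally show ?thesis .
qed

text \<open>Young's inequality under the integral. A large \<open>l\<close> makes the second term
  small when the norms are bounded; the first is then small if \<open>f\<close> is close enough to
  \<open>g\<close>.\<close>

lemma sq_norm_diff_abs_le:
  assumes "bounded_meas f" "bounded_meas g" "l > 0"
  shows "\<bar>sq_norm f - sq_norm g\<bar> \<le> l * sq_norm (\<lambda>s. f s - g s) + (sq_norm f + sq_norm g) / l"
proof -
  have *: "\<bar>x\<^sup>2 - y\<^sup>2\<bar> \<le> l * (x - y)\<^sup>2 + (x\<^sup>2 + y\<^sup>2) / l" for x y :: real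
  proof -
    \<comment> \<open>Young's inequality for the pair \<open>l * |x - y|\<close> and
      \<open>|x + y| / 2\<close>.\<close>
    have "0 \<le> (l * \<bar>x - y\<bar> - \<bar>x + y\<bar> / 2)\<^sup>2" by simp
    then have "l * (\<bar>x - y\<bar> * \<bar>x + y\<bar>) \<le> l\<^sup>2 * (x - y)\<^sup>2 + (x + y)\<^sup>2 / 4"
      by (simp add: power2_diff power_mult_distrib power_divide)
    also have "\<dots> \<le> l\<^sup>2 * (x - y)\<^sup>2 + (x\<^sup>2 + y\<^sup>2)"
      using sum_squares_bound[of x y] by (simp add: power2_sum) (smt (verit) zero_le_power2)
    finally have "\<bar>x - y\<bar> * \<bar>x + y\<bar> \<le> (l\<^sup>2 * (x - y)\<^sup>2 + (x\<^sup>2 + y\<^sup>2)) / l"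
      using assms(3) by (simp add: field_simps)
    then show ?thesis using assms(3)
      by (simp add: abs_mult[symmetric] square_diff_square_factored power2_eq_square add_divide_distrib mult.commute)
  qed
  have "\<bar>sq_norm f - sq_norm g\<bar> = \<bar>LINT s|U. (f s)\<^sup>2 - (g s)\<^sup>2\<bar>"
    unfolding sq_norm_def using assms by (subst Bochner_Integration.integral_diff) auto
  also have "\<dots> \<le> (LINT s|U. \<bar>(f s)\<^sup>2 - (g s)\<^sup>2\<bar>)" by (rule integral_abs_bound)
  also have "\<dots> \<le> (LINT s|U. l * (f s - g s)\<^sup>2 + ((f s)\<^sup>2 + (g s)\<^sup>2) / l)"
    using assms by (intro integral_mono) (auto simp: * intro!: integrable_abs)
  also have "\<dots> = l * sq_norm (\<lambda>s. f s - g s) + (sq_norm f + sq_norm g) / l"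
    using assms unfolding sq_norm_def
    by (subst Bochner_Integration.integral_add, auto intro!: bounded_meas_integrable)
       (subst Bochner_Integration.integral_add, auto intro!: bounded_meas_integrable)
  finally show ?thesis .
qed

subsection \<open>Step functions\<close>

text \<open>\<open>v t\<close> occupies the cell \<open>[(t - 1) / T, t / T)\<close>, so exactly the
  values \<open>v 1, ..., v T\<close> are seen and the integral is their average.\<close>

definition step_fun :: "nat \<Rightarrow> (nat \<Rightarrow> real) \<Rightarrow> real \<Rightarrow> real" where
  "step_fun T v s = v (nat \<lfloor>real T * s\<rfloor> + 1)"

lemma step_fun_index:
  assumes "T > 0" "0 \<le> s" "s < 1"
  shows "nat \<lfloor>real T * s\<rfloor> + 1 \<in> {1..T}"
    and "(real (nat \<lfloor>real T * s\<rfloor> + 1) - 1) / real T \<le> s" and "s < real (nat \<lfloor>real T * s\<rfloor> + 1) / real T"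
proof -
  have *: "real T * s < real T" using assms by simp
  then have "\<lfloor>real T * s\<rfloor> < int T" by (simp add: floor_less_iff)
  then show "nat \<lfloor>real T * s\<rfloor> + 1 \<in> {1..T}" using assms by auto
  have "0 \<le> \<lfloor>real T * s\<rfloor>" using assms by simp
  then have e: "real (nat \<lfloor>real T * s\<rfloor>) = of_int \<lfloor>real T * s\<rfloor>" by simp
  show "(real (nat \<lfloor>real T * s\<rfloor> + 1) - 1) / real T \<le> s" "s < real (nat \<lfloor>real T * s\<rfloor> + 1) / real T"
    using assms(1) unfolding of_nat_add e by (simp_all add: pos_divide_le_eq pos_less_divide_eq mult.commute[of s])
qed

lemma bounded_meas_step_fun [intro]: assumes "T > 0" shows "bounded_meas (step_fun T v)"
proof (rule bounded_measI[of _ "\<Sum>t=1..T. \<bar>v t\<bar>"])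
  have "(\<lambda>s. nat \<lfloor>real T * s\<rfloor> + 1) \<in> measurable borel (count_space UNIV)" by measurable
  then have "(\<lambda>s. v (nat \<lfloor>real T * s\<rfloor> + 1)) \<in> borel_measurable borel"
    by (rule measurable_compose) simp
  then show "step_fun T v \<in> borel_measurable U"
    unfolding step_fun_def[abs_def] by (rule measurable_U_borel)
  fix s :: real assume "0 \<le> s" "s < 1"
  then show "\<bar>step_fun T v s\<bar> \<le> (\<Sum>t=1..T. \<bar>v t\<bar>)"
    unfolding step_fun_def using step_fun_index(1)[OF assms, of s]
    by (intro member_le_sum[where f = "\<lambda>t. \<bar>v t\<bar>"]) auto
qed

lemma integral_step_fun: assumes "T > 0" shows "(LINT s|U. step_fun T v s) = (\<Sum>t=1..T. v t) / real T"
proof -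
  have ind: "(t = nat \<lfloor>real T * s\<rfloor> + 1) \<longleftrightarrow> s \<in> {(real t - 1) / real T..<real t / real T}"
    if "t \<in> {1..T}" "0 \<le> s" "s < 1" for t s
  proof
    assume "t = nat \<lfloor>real T * s\<rfloor> + 1"
    with step_fun_index(2,3)[OF assms that(2,3)] show "s \<in> {(real t - 1) / real T..<real t / real T}" by auto
  next
    assume "s \<in> {(real t - 1) / real T..<real t / real T}"
    then have "real t - 1 \<le> real T * s" "real T * s < real t"
      using assms by (auto simp: field_simps)
    then have "\<lfloor>real T * s\<rfloor> = int t - 1" by (simp add: floor_eq_iff)
    then show "t = nat \<lfloor>real T * s\<rfloor> + 1" using that by auto
  qed
  have "(LINT s|U. step_fun T v s) = (LINT s|U. (\<Sum>t=1..T. v t * indicator {(real t - 1) / real T..<real t / real T} s))"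
  proof (rule Bochner_Integration.integral_cong[OF refl])
    fix s assume "s \<in> space U"
    then have s: "0 \<le> s" "s < 1" by auto
    have "(\<Sum>t=1..T. v t * indicator {(real t - 1) / real T..<real t / real T} s)
      = (\<Sum>t=1..T. if t = nat \<lfloor>real T * s\<rfloor> + 1 then v t else 0)"
      using ind[OF _ s] by (intro sum.cong) (auto simp: indicator_def)
    also have "\<dots> = step_fun T v s" using step_fun_index(1)[OF assms s] by (simp add: step_fun_def)
    finally show "step_fun T v s = (\<Sum>t=1..T. v t * indicator {(real t - 1) / real T..<real t / real T} s)" ..
  qed
  also have "\<dots> = (\<Sum>t=1..T. v t * (LINT s|U. indicator {(real t - 1) / real T..<real t / real T} s))"
    by (subst Bochner_Integration.integral_sum) (auto intro!: bounded_meas_integrable bounded_meas_cmult)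
  also have "\<dots> = (\<Sum>t=1..T. v t * (1 / real T))"
  proof (intro sum.cong refl arg_cong2[where f = "(*)"])
    fix t assume t: "t \<in> {1..T}"
    have sub: "{(real t - 1) / real T..<real t / real T} \<subseteq> {0..<1}" using t assms by (auto simp: field_simps)
    have "(LINT s|U. indicator {(real t - 1) / real T..<real t / real T} s) = measure U {(real t - 1) / real T..<real t / real T}"
      by (subst Bochner_Integration.integral_indicator) (use sub in \<open>simp_all only: space_U Int_absorb2\<close>)
    also have "\<dots> = measure lborel {(real t - 1) / real T..<real t / real T}"
      unfolding U_def using sub by (subst measure_restrict_space) auto
    also have "\<dots> = 1 / real T" using assms by (simp add: divide_right_mono diff_divide_distrib)
    finally show "(LINT s|U. indicator {(real t - 1) / real T..<real t / real T} s) = 1 / real T" .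
  qed
  finally show ?thesis by (simp add: sum_divide_distrib)
qed

lemma sq_norm_step_fun: "T > 0 \<Longrightarrow> sq_norm (step_fun T v) = (\<Sum>t=1..T. (v t)\<^sup>2) / real T"
  using integral_step_fun[of T "\<lambda>t. (v t)\<^sup>2"] by (simp add: sq_norm_def step_fun_def)

lemma sq_add_le: "(a + b)\<^sup>2 \<le> 2 * a\<^sup>2 + 2 * (b::real)\<^sup>2"
  using sum_squares_bound[of a b] by (simp add: power2_sum)

subsection \<open>The limiting functional\<close>

text \<open>The kernel \<open>G\<close> will be the inverse Hilbert matrix, which makes \<open>detrend\<close> the projection off the
  polynomials of degree at most \<open>r\<close>, or zero when no trend is fitted.\<close>

definition coef :: "(nat \<Rightarrow> nat \<Rightarrow> real) \<Rightarrow> nat \<Rightarrow> (real \<Rightarrow> real) \<Rightarrow> nat \<Rightarrow> real" where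
  "coef G r f j = (\<Sum>k\<le>r. G j k * (LINT s|U. s ^ k * f s))"

definition detrend :: "(nat \<Rightarrow> nat \<Rightarrow> real) \<Rightarrow> nat \<Rightarrow> (real \<Rightarrow> real) \<Rightarrow> real \<Rightarrow> real" where
  "detrend G r f s = f s - (\<Sum>j\<le>r. coef G r f j * s ^ j)"

text \<open>The cut at \<open>s\<close> sits in the integrand over the fixed space \<open>U\<close>,
  so that joint measurability in a random path and \<open>s\<close> is that of a parametrised
  integral.\<close>

definition primitive :: "(real \<Rightarrow> real) \<Rightarrow> real \<Rightarrow> real" where
  "primitive f s = (LINT u|U. (if u < s then f u else 0))"

definition Phi :: "(nat \<Rightarrow> nat \<Rightarrow> real) \<Rightarrow> nat \<Rightarrow> real \<Rightarrow> (real \<Rightarrow> real) \<Rightarrow> real" where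
  "Phi G r x f = sq_norm (primitive (detrend G r f)) - x * sq_norm (detrend G r f)"

text \<open>The constant of Cauchy-Schwarz along one row of length \<open>r + 1\<close>, with the
  squares of the row enlarged to those of the whole matrix so that it serves all rows.\<close>

definition Gsq :: "(nat \<Rightarrow> nat \<Rightarrow> real) \<Rightarrow> nat \<Rightarrow> real" where
  "Gsq G r = real (r + 1) * (\<Sum>j\<le>r. \<Sum>k\<le>r. (G j k)\<^sup>2)"

lemma Gsq_nonneg [simp]: "0 \<le> Gsq G r"
  unfolding Gsq_def by (auto intro!: sum_nonneg mult_nonneg_nonneg)

lemma power_integral_sq_le: assumes "bounded_meas f" shows "(LINT s|U. s ^ k * f s)\<^sup>2 \<le> sq_norm f"
proof -
  have "(LINT s|U. s ^ k * f s)\<^sup>2 \<le> sq_norm (\<lambda>s. s ^ k * f s)" using assms by (intro integral_U_square_le) auto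
  also have "\<dots> \<le> sq_norm f"
    using assms by (intro sq_norm_mono) (auto simp: abs_mult power_abs intro!: mult_left_le_one_le power_le_one)
  finally show ?thesis .
qed

lemma row_sum_sq_le:
  assumes "j \<le> r" "\<And>k. k \<le> r \<Longrightarrow> (m k)\<^sup>2 \<le> B" "0 \<le> B"
  shows "(\<Sum>k\<le>r. G j k * m k)\<^sup>2 \<le> Gsq G r * B"
proof -
  have "(\<Sum>k\<le>r. G j k * m k)\<^sup>2 \<le> (\<Sum>k\<le>r. (G j k * m k)\<^sup>2) * real (card {..r})"
    by (rule sum_squared_le_sum_of_squares)
  also have "\<dots> \<le> (\<Sum>k\<le>r. (G j k)\<^sup>2 * B) * real (card {..r})"
    using assms by (intro mult_right_mono sum_mono) (auto simp: power_mult_distrib intro!: mult_left_mono)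
  also have "\<dots> = ((\<Sum>k\<le>r. (G j k)\<^sup>2) * real (r + 1)) * B"
    by (simp add: sum_distrib_right[symmetric])
  also have "\<dots> \<le> ((\<Sum>j\<le>r. \<Sum>k\<le>r. (G j k)\<^sup>2) * real (r + 1)) * B"
    using assms by (intro mult_right_mono member_le_sum[where f = "\<lambda>j. \<Sum>k\<le>r. (G j k)\<^sup>2"]) (auto intro!: sum_nonneg)
  finally show ?thesis unfolding Gsq_def by (simp add: mult.commute)
qed

lemma coef_sq_le: "bounded_meas f \<Longrightarrow> j \<le> r \<Longrightarrow> (coef G r f j)\<^sup>2 \<le> Gsq G r * sq_norm f"
  unfolding coef_def by (rule row_sum_sq_le) (auto intro: power_integral_sq_le)

lemma bounded_meas_detrend [intro!]: "bounded_meas f \<Longrightarrow> bounded_meas (detrend G r f)"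
  unfolding detrend_def[abs_def] by auto

lemma coef_diff: "bounded_meas f \<Longrightarrow> bounded_meas g \<Longrightarrow> coef G r (\<lambda>s. f s - g s) j = coef G r f j - coef G r g j"
  unfolding coef_def by (simp add: right_diff_distrib bounded_meas_integrable bounded_meas_mult sum_subtractf)

lemma detrend_diff: "bounded_meas f \<Longrightarrow> bounded_meas g \<Longrightarrow> detrend G r (\<lambda>s. f s - g s) s = detrend G r f s - detrend G r g s"
  unfolding detrend_def by (simp add: coef_diff left_diff_distrib sum_subtractf)

lemma poly_sum_sq_norm_le:
  assumes "\<And>j. j \<le> r \<Longrightarrow> bounded_meas (f j)" "\<And>j. j \<le> r \<Longrightarrow> sq_norm (f j) \<le> B"
  shows "sq_norm (\<lambda>s. \<Sum>j\<le>r. f j s) \<le> (real r + 1)\<^sup>2 * B"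
proof -
  have "sq_norm (\<lambda>s. \<Sum>j\<le>r. f j s) \<le> card {..r} * (\<Sum>j\<le>r. sq_norm (f j))"
    using assms by (intro sq_norm_sum_le) auto
  also have "\<dots> \<le> card {..r} * (\<Sum>j\<le>r. B)" using assms by (intro mult_left_mono sum_mono) auto
  finally show ?thesis by (simp add: power2_eq_square algebra_simps)
qed

lemma sq_norm_power_le: "sq_norm (\<lambda>s. c * s ^ j) \<le> c\<^sup>2"
proof -
  have "sq_norm (\<lambda>s. s ^ j) \<le> 1\<^sup>2" by (rule sq_norm_bounded) (auto simp: power_abs intro!: power_le_one)
  then have "c\<^sup>2 * sq_norm (\<lambda>s. s ^ j) \<le> c\<^sup>2 * 1" by (intro mult_left_mono) auto
  then show ?thesis by (simp add: sq_norm_cmult)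
qed

text \<open>Bounds the squared operator norm of \<open>detrend\<close>: the 2s come from
  \<open>(a - b)^2 <= 2 a^2 + 2 b^2\<close>, the factor \<open>(r + 1)^2\<close> from adding
  \<open>r + 1\<close> monomials.\<close>

definition detrend_bound :: "(nat \<Rightarrow> nat \<Rightarrow> real) \<Rightarrow> nat \<Rightarrow> real" where
  "detrend_bound G r = 2 + 2 * (real r + 1)\<^sup>2 * Gsq G r"

lemma detrend_bound_nonneg [simp]: "0 \<le> detrend_bound G r"
  unfolding detrend_bound_def by auto

lemma sq_norm_detrend_le: assumes "bounded_meas f" shows "sq_norm (detrend G r f) \<le> detrend_bound G r * sq_norm f"
proof -
  have "sq_norm (detrend G r f) \<le> 2 * sq_norm f + 2 * sq_norm (\<lambda>s. \<Sum>j\<le>r. coef G r f j * s ^ j)"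
    unfolding detrend_def[abs_def] using assms by (intro sq_norm_diff_le) auto
  also have "sq_norm (\<lambda>s. \<Sum>j\<le>r. coef G r f j * s ^ j) \<le> (real r + 1)\<^sup>2 * (Gsq G r * sq_norm f)"
    using assms by (intro poly_sum_sq_norm_le order_trans[OF sq_norm_power_le coef_sq_le]) auto
  finally show ?thesis by (simp add: detrend_bound_def algebra_simps)
qed

lemma bounded_meas_cut: "bounded_meas f \<Longrightarrow> bounded_meas (\<lambda>u. if u < s then f u else 0)"
  using bounded_meas_mult[OF bounded_meas_indicator[of "{..<s}"], of f] unfolding indicator_def
  by (rule back_subst[of bounded_meas]) (auto simp: fun_eq_iff)

lemma primitive_sq_le: assumes "bounded_meas f" shows "(primitive f s)\<^sup>2 \<le> sq_norm f"
proof -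
  have "(primitive f s)\<^sup>2 \<le> sq_norm (\<lambda>u. if u < s then f u else 0)"
    unfolding primitive_def using assms by (intro integral_U_square_le bounded_meas_cut)
  also have "\<dots> \<le> sq_norm f" using assms by (intro sq_norm_mono bounded_meas_cut) auto
  finally show ?thesis .
qed

lemma bounded_meas_primitive [intro!]: assumes "bounded_meas f" shows "bounded_meas (primitive f)"
proof (rule bounded_measI)
  have [measurable]: "f \<in> borel_measurable U" using assms by (rule bounded_meas_measurable)
  have [measurable]: "(\<lambda>u. u) \<in> borel_measurable U" by (rule measurable_U_borel) simp
  have "(\<lambda>s. LINT u|U. (if u < s then f u else 0)) \<in> borel_measurable borel" by measurable
  then show "primitive f \<in> borel_measurable U" unfolding primitive_def[abs_def] by (rule measurable_U_borel)
  show "\<bar>primitive f s\<bar> \<le> sqrt (sq_norm f)" for s using primitive_sq_le[OF assms] by (intro real_le_rsqrt) simp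
qed

lemma sq_norm_primitive_le: assumes "bounded_meas f" shows "sq_norm (primitive f) \<le> sq_norm f"
proof -
  have "sq_norm (primitive f) \<le> (sqrt (sq_norm f))\<^sup>2"
    using primitive_sq_le[OF assms] assms by (intro sq_norm_bounded real_le_rsqrt bounded_meas_primitive) auto
  then show ?thesis by simp
qed

lemma primitive_diff: assumes "bounded_meas f" "bounded_meas g" shows "primitive (\<lambda>s. f s - g s) s = primitive f s - primitive g s"
proof -
  have "primitive (\<lambda>s. f s - g s) s = (LINT u|U. (if u < s then f u else 0) - (if u < s then g u else 0))"
    unfolding primitive_def by (rule Bochner_Integration.integral_cong) auto
  then show ?thesis unfolding primitive_def using assms by (simp add: bounded_meas_cut bounded_meas_integrable)
qed

text \<open>\<open>detrend\<close> and \<open>primitive\<close> are linear and bounded on square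
  integrable functions, so the difference of two values of \<open>Phi\<close> reduces to Young's
  inequality for the images of \<open>f\<close> and \<open>g\<close>.\<close>

lemma Phi_diff_le:
  assumes "bounded_meas f" "bounded_meas g" "l > 0"
  shows "\<bar>Phi G r x f - Phi G r x g\<bar>
    \<le> (1 + \<bar>x\<bar>) * detrend_bound G r * (l * sq_norm (\<lambda>s. f s - g s) + (sq_norm f + sq_norm g) / l)"
proof -
  let ?R = "detrend_bound G r * (l * sq_norm (\<lambda>s. f s - g s) + (sq_norm f + sq_norm g) / l)"
  have d: "(\<lambda>s. detrend G r f s - detrend G r g s) = detrend G r (\<lambda>s. f s - g s)"
    using assms by (simp add: fun_eq_iff detrend_diff)
  have p: "(\<lambda>s. primitive (detrend G r f) s - primitive (detrend G r g) s) = primitive (detrend G r (\<lambda>s. f s - g s))"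
    using assms by (simp add: fun_eq_iff d[symmetric] primitive_diff bounded_meas_detrend)
  have fg: "bounded_meas (\<lambda>s. f s - g s)" using assms by auto
  have le: "l * a + (b + c) / l \<le> ?R"
    if "a \<le> detrend_bound G r * sq_norm (\<lambda>s. f s - g s)" "b \<le> detrend_bound G r * sq_norm f" "c \<le> detrend_bound G r * sq_norm g" for a b c
  proof -
    have "l * a + (b + c) / l \<le> l * (detrend_bound G r * sq_norm (\<lambda>s. f s - g s)) + (detrend_bound G r * sq_norm f + detrend_bound G r * sq_norm g) / l"
      using that assms(3) by (intro add_mono mult_left_mono divide_right_mono) auto
    then show ?thesis by (simp add: algebra_simps add_divide_distrib)
  qed
  have 1: "\<bar>sq_norm (detrend G r f) - sq_norm (detrend G r g)\<bar> \<le> ?R"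
    using assms fg by (intro order_trans[OF sq_norm_diff_abs_le[OF _ _ assms(3)]] le) (auto simp: d intro: sq_norm_detrend_le)
  have 2: "\<bar>sq_norm (primitive (detrend G r f)) - sq_norm (primitive (detrend G r g))\<bar> \<le> ?R"
    using assms fg by (intro order_trans[OF sq_norm_diff_abs_le[OF _ _ assms(3)]] le)
      (auto simp: p intro!: order_trans[OF sq_norm_primitive_le sq_norm_detrend_le])
  have "\<bar>Phi G r x f - Phi G r x g\<bar> \<le> \<bar>sq_norm (primitive (detrend G r f)) - sq_norm (primitive (detrend G r g))\<bar> + \<bar>x\<bar> * \<bar>sq_norm (detrend G r f) - sq_norm (detrend G r g)\<bar>"
  proof -
    have "Phi G r x f - Phi G r x g = (sq_norm (primitive (detrend G r f)) - sq_norm (primitive (detrend G r g))) - x * (sq_norm (detrend G r f) - sq_norm (detrend G r g))"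
      by (simp add: Phi_def algebra_simps)
    then show ?thesis by (metis abs_mult abs_triangle_ineq4)
  qed
  also have "\<dots> \<le> ?R + \<bar>x\<bar> * ?R" using 1 2 by (intro add_mono mult_left_mono) auto
  finally show ?thesis by (simp add: algebra_simps)
qed

subsection \<open>Discretisation\<close>

definition scaled_power :: "nat \<Rightarrow> nat \<Rightarrow> nat \<Rightarrow> real" where
  "scaled_power T k t = (real t / real T) ^ k"

lemma abs_power_diff_le:
  fixes a b :: real assumes "0 \<le> a" "a \<le> 1" "0 \<le> b" "b \<le> 1" shows "\<bar>a ^ k - b ^ k\<bar> \<le> real k * \<bar>a - b\<bar>"
  using norm_power_diff[of a b k] assms by simp

lemma step_fun_scaled_power_le: assumes "T > 0" "0 \<le> s" "s < 1" shows "0 \<le> step_fun T (scaled_power T k) s" "step_fun T (scaled_power T k) s \<le> 1"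
  using step_fun_index(1)[OF assms] assms(1) unfolding step_fun_def scaled_power_def by (auto intro!: power_le_one)

lemma step_fun_scaled_power_diff: assumes "T > 0" "0 \<le> s" "s < 1" "k \<le> r"
  shows "\<bar>step_fun T (scaled_power T k) s - s ^ k\<bar> \<le> real r / real T"
proof -
  let ?t = "nat \<lfloor>real T * s\<rfloor> + 1"
  have "\<bar>step_fun T (scaled_power T k) s - s ^ k\<bar> \<le> real k * \<bar>real ?t / real T - s\<bar>"
    unfolding step_fun_def scaled_power_def using step_fun_index(1)[OF assms(1-3)] assms by (intro abs_power_diff_le) auto
  also have "\<bar>real ?t / real T - s\<bar> \<le> 1 / real T"
    using step_fun_index(2,3)[OF assms(1-3)] by (simp add: diff_divide_distrib add_divide_distrib)
  then have "real k * \<bar>real ?t / real T - s\<bar> \<le> real r * (1 / real T)"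
    using assms by (intro mult_mono) auto
  finally show ?thesis by simp
qed

lemma step_fun_mult: "step_fun T (\<lambda>t. a t * b t) s = step_fun T a s * step_fun T b s"
  by (simp add: step_fun_def)

lemma step_fun_scaled_power_moment: "T > 0 \<Longrightarrow> (\<Sum>t=1..T. scaled_power T k t * z t) / real T = (LINT s|U. step_fun T (scaled_power T k) s * step_fun T z s)"
  using integral_step_fun[of T "\<lambda>t. scaled_power T k t * z t"] by (simp add: step_fun_mult)

text \<open>The coefficients \<open>a\<close> are free up to a relative error \<open>C1 / T\<close>,
  which fits the least squares coefficients as well as zero coefficients for the zero kernel.
  \<open>C\<close> does not depend on \<open>T\<close>, \<open>z\<close>, \<open>a\<close> or
  \<open>w\<close>, because these will be random. The term \<open>sq_norm w / T^2\<close> is the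
  price of replacing \<open>s ^ k\<close> by its value at the right end of the cell.\<close>

lemma discretisation:
  fixes C1 :: real
  assumes C1: "0 \<le> C1"
  obtains C where "0 \<le> C" and
    "\<And>T z a w. T > 0 \<Longrightarrow> bounded_meas w \<Longrightarrow>
      (\<And>j. j \<le> r \<Longrightarrow> \<bar>a j - (\<Sum>k\<le>r. G j k * ((\<Sum>t=1..T. scaled_power T k t * z t) / real T))\<bar>
          \<le> C1 / real T * (\<Sum>k\<le>r. \<bar>(\<Sum>t=1..T. scaled_power T k t * z t) / real T\<bar>)) \<Longrightarrow>
      sq_norm (\<lambda>s. step_fun T (\<lambda>t. z t - (\<Sum>j\<le>r. a j * scaled_power T j t)) s - detrend G r w s)
        \<le> C * (sq_norm (\<lambda>s. step_fun T z s - w s) + sq_norm w / (real T)\<^sup>2)"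
proof -
  \<comment> \<open>\<open>K\<close> bounds the squared coefficient error against \<open>?D\<close>
    below: the first part stems from the tolerance \<open>C1 / T\<close> on \<open>a\<close>, the
    second from replacing the moments of \<open>z\<close> by those of \<open>w\<close>.\<close>
  define K where "K = 4 * C1\<^sup>2 * (real r + 1)\<^sup>2 + 4 * Gsq G r * (1 + (real r)\<^sup>2)"
  have K0: "0 \<le> K" unfolding K_def by auto
  define C where "C = 2 + 4 * (real r + 1)\<^sup>2 * (K + Gsq G r * (real r)\<^sup>2) * 1"
  show ?thesis
  proof (rule that[of C])
    show "0 \<le> C" unfolding C_def using K0 by auto
    fix T :: nat and z a w
    assume T: "T > 0" and w: "bounded_meas w"
    define g where "g k = (\<Sum>t=1..T. scaled_power T k t * z t) / real T" for k
    assume "\<And>j. j \<le> r \<Longrightarrow> \<bar>a j - (\<Sum>k\<le>r. G j k * ((\<Sum>t=1..T. scaled_power T k t * z t) / real T))\<bar>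
          \<le> C1 / real T * (\<Sum>k\<le>r. \<bar>(\<Sum>t=1..T. scaled_power T k t * z t) / real T\<bar>)"
    then have a: "\<bar>a j - (\<Sum>k\<le>r. G j k * g k)\<bar> \<le> C1 / real T * (\<Sum>k\<le>r. \<bar>g k\<bar>)" if "j \<le> r" for j
      using that unfolding g_def by blast
    define e where "e s = step_fun T z s - w s" for s
    let ?E = "sq_norm e" and ?V = "sq_norm w"
    let ?D = "?E + ?V / (real T)\<^sup>2"
    have bz: "bounded_meas (step_fun T z)" and bp: "bounded_meas (step_fun T (scaled_power T k))" for k using T by auto
    have be: "bounded_meas e" unfolding e_def[abs_def] using bz w by auto
    have T1: "1 \<le> (real T)\<^sup>2" using T by (intro one_le_power) simp
    have D0: "0 \<le> ?D" "?E \<le> ?D" "?V / (real T)\<^sup>2 \<le> ?D" by auto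
    have zE: "sq_norm (step_fun T z) \<le> 2 * ?E + 2 * ?V"
      using sq_norm_add_le[OF be w] by (simp add: e_def)
    have gk: "(g k)\<^sup>2 \<le> 2 * ?E + 2 * ?V" for k
    proof -
      have "(g k)\<^sup>2 \<le> sq_norm (\<lambda>s. step_fun T (scaled_power T k) s * step_fun T z s)"
        unfolding g_def step_fun_scaled_power_moment[OF T] using bz bp by (intro integral_U_square_le) auto
      also have "\<dots> \<le> sq_norm (step_fun T z)"
        using bz bp step_fun_scaled_power_le[OF T] by (intro sq_norm_mono) (auto simp: abs_mult intro!: mult_left_le_one_le)
      finally show ?thesis using zE by simp
    qed
    have gm: "(g k - (LINT s|U. s ^ k * w s))\<^sup>2 \<le> 2 * (1 + (real r)\<^sup>2) * ?D" if k: "k \<le> r" for k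
    proof -
      have "g k - (LINT s|U. s ^ k * w s) = (LINT s|U. step_fun T (scaled_power T k) s * step_fun T z s - s ^ k * w s)"
        unfolding g_def step_fun_scaled_power_moment[OF T] using bz bp w
        by (subst Bochner_Integration.integral_diff) (auto intro!: bounded_meas_integrable)
      \<comment> \<open>The product error splits into the path error under a weight at most 1 and
        the monomial error against the fixed \<open>w\<close>.\<close>
      also have "\<dots> = (LINT s|U. step_fun T (scaled_power T k) s * e s + (step_fun T (scaled_power T k) s - s ^ k) * w s)"
        by (rule Bochner_Integration.integral_cong) (auto simp: e_def algebra_simps)
      finally have "(g k - (LINT s|U. s ^ k * w s))\<^sup>2 \<le> sq_norm (\<lambda>s. step_fun T (scaled_power T k) s * e s + (step_fun T (scaled_power T k) s - s ^ k) * w s)"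
        using be bp w by (auto intro!: integral_U_square_le)
      also have "\<dots> \<le> 2 * sq_norm (\<lambda>s. step_fun T (scaled_power T k) s * e s) + 2 * sq_norm (\<lambda>s. (step_fun T (scaled_power T k) s - s ^ k) * w s)"
        using be bp w by (intro sq_norm_add_le) auto
      also have "sq_norm (\<lambda>s. step_fun T (scaled_power T k) s * e s) \<le> ?E"
        using be bp step_fun_scaled_power_le[OF T] by (intro sq_norm_mono) (auto simp: abs_mult intro!: mult_left_le_one_le)
      also have "sq_norm (\<lambda>s. (step_fun T (scaled_power T k) s - s ^ k) * w s) \<le> sq_norm (\<lambda>s. (real r / real T) * w s)"
        using w bp step_fun_scaled_power_diff[OF T _ _ k] mult_right_mono[OF step_fun_scaled_power_diff[OF T _ _ k] abs_ge_zero]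
        by (intro sq_norm_mono) (auto simp: abs_mult)
      also have "\<dots> = (real r)\<^sup>2 * (?V / (real T)\<^sup>2)" by (simp only: sq_norm_cmult) (simp add: power_divide)
      also have "2 * ?E + 2 * ((real r)\<^sup>2 * (?V / (real T)\<^sup>2)) \<le> 2 * ?D + 2 * ((real r)\<^sup>2 * ?D)"
        using D0 by (intro add_mono mult_left_mono) auto
      finally show ?thesis by (simp add: algebra_simps)
    qed
    have ac: "(a j - coef G r w j)\<^sup>2 \<le> K * ?D" if j: "j \<le> r" for j
    proof -
      let ?A = "a j - (\<Sum>k\<le>r. G j k * g k)" and ?B = "\<Sum>k\<le>r. G j k * (g k - (LINT s|U. s ^ k * w s))"
      have eq: "a j - coef G r w j = ?A + ?B"
        by (simp add: coef_def right_diff_distrib sum_subtractf)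
      have "(a j - coef G r w j)\<^sup>2 \<le> 2 * ?A\<^sup>2 + 2 * ?B\<^sup>2"
        unfolding eq by (rule sq_add_le)
      also have "?B\<^sup>2 \<le> Gsq G r * (2 * (1 + (real r)\<^sup>2) * ?D)"
        using j gm D0 by (intro row_sum_sq_le) auto
      also have "?A\<^sup>2 \<le> (C1\<^sup>2 / (real T)\<^sup>2) * ((\<Sum>k\<le>r. 2 * ?E + 2 * ?V) * real (card {..r}))"
      proof -
        have "?A\<^sup>2 \<le> (C1 / real T * (\<Sum>k\<le>r. \<bar>g k\<bar>))\<^sup>2"
          using power_mono[OF a[OF j] abs_ge_zero, of 2] by (simp only: power2_abs)
        also have "\<dots> = (C1\<^sup>2 / (real T)\<^sup>2) * (\<Sum>k\<le>r. \<bar>g k\<bar>)\<^sup>2" by (simp add: power_mult_distrib power_divide)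
        also have "\<dots> \<le> (C1\<^sup>2 / (real T)\<^sup>2) * ((\<Sum>k\<le>r. \<bar>g k\<bar>\<^sup>2) * real (card {..r}))"
          by (intro mult_left_mono sum_squared_le_sum_of_squares) auto
        also have "\<dots> \<le> (C1\<^sup>2 / (real T)\<^sup>2) * ((\<Sum>k\<le>r. 2 * ?E + 2 * ?V) * real (card {..r}))"
          using gk by (intro mult_left_mono mult_right_mono sum_mono) auto
        finally show ?thesis .
      qed
      also have "2 * ((C1\<^sup>2 / (real T)\<^sup>2) * ((\<Sum>k\<le>r. 2 * ?E + 2 * ?V) * real (card {..r}))) + 2 * (Gsq G r * (2 * (1 + (real r)\<^sup>2) * ?D))
        = 4 * C1\<^sup>2 * (real r + 1)\<^sup>2 * ((?E + ?V) / (real T)\<^sup>2) + 4 * Gsq G r * (1 + (real r)\<^sup>2) * ?D"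
        by (simp add: power2_eq_square field_simps)
      also have "\<dots> \<le> 4 * C1\<^sup>2 * (real r + 1)\<^sup>2 * ?D + 4 * Gsq G r * (1 + (real r)\<^sup>2) * ?D"
      proof -
        have "(?E + ?V) / (real T)\<^sup>2 \<le> ?D"
          using T1 mult_right_mono[OF T1, of ?E] by (simp add: add_divide_distrib divide_le_eq mult.commute)
        then show ?thesis by (intro add_right_mono mult_left_mono) auto
      qed
      finally show ?thesis unfolding K_def by (simp add: algebra_simps)
    qed
    \<comment> \<open>Each fitted monomial differs from its limit by a coefficient error on the
      discrete monomial and a discretisation error under the limiting coefficient.\<close>
    define h where "h j s = (a j - coef G r w j) * step_fun T (scaled_power T j) s + coef G r w j * (step_fun T (scaled_power T j) s - s ^ j)" for j s
    have bh: "bounded_meas (h j)" for j unfolding h_def[abs_def] using bp by auto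
    have hN: "sq_norm (h j) \<le> 2 * (K + Gsq G r * (real r)\<^sup>2) * ?D" if j: "j \<le> r" for j
    proof -
      have "sq_norm (h j) \<le> 2 * sq_norm (\<lambda>s. (a j - coef G r w j) * step_fun T (scaled_power T j) s) + 2 * sq_norm (\<lambda>s. coef G r w j * (step_fun T (scaled_power T j) s - s ^ j))"
        unfolding h_def[abs_def] using bp by (intro sq_norm_add_le) auto
      also have "sq_norm (\<lambda>s. (a j - coef G r w j) * step_fun T (scaled_power T j) s) \<le> (a j - coef G r w j)\<^sup>2 * 1\<^sup>2"
        unfolding sq_norm_cmult using bp step_fun_scaled_power_le[OF T] by (intro mult_left_mono sq_norm_bounded) auto
      also have "\<dots> \<le> K * ?D" using ac[OF j] by simp
      also have "sq_norm (\<lambda>s. coef G r w j * (step_fun T (scaled_power T j) s - s ^ j)) \<le> (coef G r w j)\<^sup>2 * (real r / real T)\<^sup>2"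
        unfolding sq_norm_cmult using bp step_fun_scaled_power_diff[OF T _ _ j] by (intro mult_left_mono sq_norm_bounded) auto
      also have "\<dots> \<le> (Gsq G r * ?V) * (real r / real T)\<^sup>2"
        using w j by (intro mult_right_mono coef_sq_le) auto
      also have "\<dots> = Gsq G r * (real r)\<^sup>2 * (?V / (real T)\<^sup>2)" by (simp add: power_divide)
      also have "\<dots> \<le> Gsq G r * (real r)\<^sup>2 * ?D" using D0 by (intro mult_left_mono) auto
      finally show ?thesis by (simp add: algebra_simps)
    qed
    have "sq_norm (\<lambda>s. step_fun T (\<lambda>t. z t - (\<Sum>j\<le>r. a j * scaled_power T j t)) s - detrend G r w s) = sq_norm (\<lambda>s. e s - (\<Sum>j\<le>r. h j s))"
      by (rule arg_cong[where f = sq_norm]) (simp add: fun_eq_iff e_def h_def detrend_def step_fun_def algebra_simps sum.distrib sum_subtractf)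
    also have "\<dots> \<le> 2 * ?E + 2 * sq_norm (\<lambda>s. \<Sum>j\<le>r. h j s)" using be bh by (intro sq_norm_diff_le) auto
    also have "sq_norm (\<lambda>s. \<Sum>j\<le>r. h j s) \<le> (real r + 1)\<^sup>2 * (2 * (K + Gsq G r * (real r)\<^sup>2) * ?D)"
      using bh hN by (intro poly_sum_sq_norm_le) auto
    also have "2 * ?E + 2 * ((real r + 1)\<^sup>2 * (2 * (K + Gsq G r * (real r)\<^sup>2) * ?D)) \<le> C * ?D"
      using D0 unfolding C_def by (simp add: algebra_simps)
    finally show "sq_norm (\<lambda>s. step_fun T (\<lambda>t. z t - (\<Sum>j\<le>r. a j * scaled_power T j t)) s - detrend G r w s)
        \<le> C * (sq_norm (\<lambda>s. step_fun T z s - w s) + sq_norm w / (real T)\<^sup>2)"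
      unfolding e_def[abs_def] by simp
  qed
qed

text \<open>Inside the cell of \<open>s\<close> the partial sum already counts the whole value
  \<open>y t\<close>, whereas the primitive counts only the part of the cell before
  \<open>s\<close>; the discrepancy is \<open>y t\<close> times a length at most
  \<open>1 / T\<close>.\<close>

lemma cumulative_step:
  assumes T: "T > 0"
  shows "sq_norm (\<lambda>s. step_fun T (\<lambda>t. (\<Sum>k=1..t. y k) / real T) s - primitive (step_fun T y) s) \<le> sq_norm (step_fun T y) / (real T)\<^sup>2"
proof -
  have "sq_norm (\<lambda>s. step_fun T (\<lambda>t. (\<Sum>k=1..t. y k) / real T) s - primitive (step_fun T y) s) \<le> sq_norm (\<lambda>s. (1 / real T) * step_fun T y s)"
  proof (rule sq_norm_mono)
    fix s :: real assume s: "0 \<le> s" "s < 1"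
    define t where "t = nat \<lfloor>real T * s\<rfloor> + 1"
    note t = step_fun_index[OF T s, folded t_def]
    have "step_fun T (\<lambda>t. (\<Sum>k=1..t. y k) / real T) s = (\<Sum>k=1..T. if k \<le> t then y k else 0) / real T"
    proof -
      have "(\<Sum>k=1..t. y k) = (\<Sum>k=1..T. if k \<le> t then y k else 0)"
        using t(1) by (intro sum.mono_neutral_cong_left) auto
      then show ?thesis by (simp add: step_fun_def t_def)
    qed
    also have "\<dots> = (LINT u|U. step_fun T (\<lambda>k. if k \<le> t then y k else 0) u)"
      by (rule integral_step_fun[OF T, symmetric])
    finally have "step_fun T (\<lambda>t. (\<Sum>k=1..t. y k) / real T) s - primitive (step_fun T y) s
      = (LINT u|U. step_fun T (\<lambda>k. if k \<le> t then y k else 0) u - (if u < s then step_fun T y u else 0))"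
      unfolding primitive_def using T by (subst Bochner_Integration.integral_diff) (auto intro!: bounded_meas_integrable bounded_meas_cut)
    \<comment> \<open>The two integrands agree except on the rest of the current cell, from
      \<open>s\<close> to \<open>t / T\<close>.\<close>
    also have "\<dots> = (LINT u|U. y t * indicator {s..<real t / real T} u)"
    proof (rule Bochner_Integration.integral_cong[OF refl])
      fix u assume "u \<in> space U" then have u: "0 \<le> u" "u < 1" by auto
      define k where "k = nat \<lfloor>real T * u\<rfloor> + 1"
      note k = step_fun_index[OF T u, folded k_def]
      have le: "k \<le> t \<longleftrightarrow> u < real t / real T"
      proof
        assume "k \<le> t" then have "real k / real T \<le> real t / real T" by (intro divide_right_mono) auto
        then show "u < real t / real T" using k by auto
      next
        assume "u < real t / real T"
        then have "(real k - 1) / real T < real t / real T" using k by auto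
        then have "real k - 1 < real t" using T by (simp add: divide_less_cancel)
        then show "k \<le> t" by linarith
      qed
      have eq: "k = t" if "s \<le> u" "k \<le> t"
      proof -
        have "(real t - 1) / real T < real k / real T" using that t k by auto
        then have "real t - 1 < real k" using T by (simp add: divide_less_cancel)
        then show ?thesis using that by linarith
      qed
      show "step_fun T (\<lambda>k. if k \<le> t then y k else 0) u - (if u < s then step_fun T y u else 0)
        = y t * indicator {s..<real t / real T} u"
        using le eq t unfolding step_fun_def k_def[symmetric] by (auto simp: indicator_def)
    qed
    also have "\<dots> = y t * measure U ({s..<real t / real T} \<inter> space U)"
      by simp
    finally have E: "\<bar>step_fun T (\<lambda>t. (\<Sum>k=1..t. y k) / real T) s - primitive (step_fun T y) s\<bar> = \<bar>y t\<bar> * measure U ({s..<real t / real T} \<inter> space U)"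
      by (simp add: abs_mult)
    have m: "measure U ({s..<real t / real T} \<inter> space U) \<le> 1 / real T"
    proof -
      have "{s..<real t / real T} \<inter> space U = {s..<real t / real T}" using t(1) s T by (auto simp: field_simps)
      then have "measure U ({s..<real t / real T} \<inter> space U) = real t / real T - s"
        unfolding U_def using t s by (subst measure_restrict_space) (auto simp: space_restrict_space)
      then show ?thesis using t by (simp add: diff_divide_distrib)
    qed
    have "step_fun T y s = y t" by (simp add: step_fun_def t_def)
    then show "\<bar>step_fun T (\<lambda>t. (\<Sum>k=1..t. y k) / real T) s - primitive (step_fun T y) s\<bar> \<le> \<bar>1 / real T * step_fun T y s\<bar>"
      using mult_left_mono[OF m, of "\<bar>y t\<bar>"] by (simp only: E abs_mult) (simp add: mult.commute)
  qed (use T in auto)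
  then show ?thesis by (simp only: sq_norm_cmult) (simp add: power_divide)
qed

subsection \<open>Least squares\<close>

text \<open>A trivial kernel gives a nonzero determinant, so \<open>mat_inverse\<close> returns a
  value. The form with sums over \<open>{..r}\<close> serves both the Hilbert matrix and, for each
  large \<open>T\<close>, the Gram matrix.\<close>

lemma matrix_inverse_entries:
  fixes A :: "nat \<Rightarrow> nat \<Rightarrow> real"
  assumes ker: "\<And>v. (\<And>i. i \<le> r \<Longrightarrow> (\<Sum>j\<le>r. A i j * v j) = 0) \<Longrightarrow> (\<forall>j\<le>r. v j = 0)"
  defines "B \<equiv> \<lambda>i j. the (mat_inverse (mat (r + 1) (r + 1) (\<lambda>(i, j). A i j))) $$ (i, j)"
  shows "the (mat_inverse (mat (r + 1) (r + 1) (\<lambda>(i, j). A i j))) \<in> carrier_mat (r + 1) (r + 1)"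
    and "\<And>i j. i \<le> r \<Longrightarrow> j \<le> r \<Longrightarrow> (\<Sum>k\<le>r. A i k * B k j) = of_bool (i = j)"
    and "\<And>i j. i \<le> r \<Longrightarrow> j \<le> r \<Longrightarrow> (\<Sum>k\<le>r. B i k * A k j) = of_bool (i = j)"
proof -
  let ?n = "r + 1"
  let ?M = "mat ?n ?n (\<lambda>(i, j). A i j)"
  have set: "{0..<?n} = {..r}" by auto
  have C: "?M \<in> carrier_mat ?n ?n" by simp
  have "det ?M \<noteq> 0"
  proof
    assume "det ?M = 0"
    then obtain v where v: "v \<in> carrier_vec ?n" "v \<noteq> 0\<^sub>v ?n" "?M *\<^sub>v v = 0\<^sub>v ?n"
      using det_0_iff_vec_prod_zero_field[OF C] by blast
    have "(\<Sum>j\<le>r. A i j * v $ j) = 0" if "i \<le> r" for i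
    proof -
      have "(\<Sum>j\<le>r. A i j * v $ j) = (?M *\<^sub>v v) $ i"
        using that v(1) by (simp add: scalar_prod_def set[symmetric])
      also have "\<dots> = 0" using v(3) that by simp
      finally show ?thesis .
    qed
    then have "\<forall>j\<le>r. v $ j = 0" by (rule ker)
    then have "v = 0\<^sub>v ?n" using v(1) by (intro eq_vecI) auto
    then show False using v(2) by simp
  qed
  from Determinant.det_non_zero_imp_unit[OF C this, of "()"]
  obtain I where I: "mat_inverse ?M = Some I"
    using mat_inverse(1)[OF C, of "()"] by (cases "mat_inverse ?M") auto
  note inv = mat_inverse(2)[OF C I]
  then have IC: "I \<in> carrier_mat ?n ?n" by blast
  show "the (mat_inverse ?M) \<in> carrier_mat ?n ?n" using inv I by simp
  have B: "B i j = I $$ (i, j)" for i j unfolding B_def I by simp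
  show "(\<Sum>k\<le>r. A i k * B k j) = of_bool (i = j)" if "i \<le> r" "j \<le> r" for i j
  proof -
    have "(\<Sum>k\<le>r. A i k * B k j) = (?M * I) $$ (i, j)"
      using that IC by (simp add: scalar_prod_def B set[symmetric] del: sum.op_ivl_Suc)
    also have "\<dots> = of_bool (i = j)" using inv that by simp
    finally show ?thesis .
  qed
  show "(\<Sum>k\<le>r. B i k * A k j) = of_bool (i = j)" if "i \<le> r" "j \<le> r" for i j
  proof -
    have "(\<Sum>k\<le>r. B i k * A k j) = (I * ?M) $$ (i, j)"
      using that IC by (simp add: scalar_prod_def B set[symmetric] del: sum.op_ivl_Suc)
    also have "\<dots> = of_bool (i = j)" using inv that by simp
    finally show ?thesis .
  qed
qed

section \<open>Monomial moments and the inverse Hilbert matrix\<close>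

lemma integral_power_U: "(LINT s|U. s ^ k) = 1 / (real k + 1)"
proof -
  have "((\<lambda>s::real. s ^ k) has_integral (1 ^ (k + 1) / (real k + 1) - 0 ^ (k + 1) / (real k + 1))) {0..1}"
  proof (rule fundamental_theorem_of_calculus)
    fix x :: real
    have "((\<lambda>s. s ^ Suc k / (real k + 1)) has_real_derivative real (Suc k) * x ^ k / (real k + 1)) (at x within {0..1})"
      by (auto intro!: derivative_eq_intros simp del: power_Suc)
    then show "((\<lambda>s. s ^ (k + 1) / (real k + 1)) has_vector_derivative x ^ k) (at x within {0..1})"
      by (simp add: has_real_derivative_iff_has_vector_derivative[symmetric] add.commute del: power_Suc)
  qed simp
  then have "integral {0..1} (\<lambda>s::real. s ^ k) = 1 / (real k + 1)"
    by (simp add: integral_unique)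
  then show ?thesis by (subst integral_U_eq) (auto intro!: continuous_intros)
qed

lemma sq_norm_eq_0_D:
  assumes "continuous_on {0..1} f" "sq_norm f = 0" "s \<in> {0..1}" shows "f s = 0"
proof -
  have c: "continuous_on {0..1} (\<lambda>s. (f s)\<^sup>2)" using assms(1) by (intro continuous_intros)
  then have "integral {0..1} (\<lambda>s. (f s)\<^sup>2) = 0"
    using assms(2) integral_U_eq[OF c] by (simp add: sq_norm_def)
  then have "(f s)\<^sup>2 = 0" using integral_eq_0_iff[OF c] assms(3) by auto
  then show ?thesis by simp
qed

text \<open>The quadratic form of the Hilbert matrix at \<open>v\<close> is the squared norm of the
  polynomial with coefficients \<open>v\<close>. A kernel vector therefore yields a polynomial
  vanishing on the whole interval, which has too many roots.\<close>

lemma hilbert_kernel: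
  assumes "\<And>i. i \<le> r \<Longrightarrow> (\<Sum>j\<le>r. 1 / (real i + real j + 1) * v j) = 0"
  shows "\<forall>j\<le>r. v j = 0"
proof -
  let ?p = "\<lambda>s::real. \<Sum>j\<le>r. v j * s ^ j"
  have "sq_norm ?p = (LINT s|U. (\<Sum>i\<le>r. \<Sum>j\<le>r. v i * v j * s ^ (i + j)))"
    unfolding sq_norm_def by (rule Bochner_Integration.integral_cong)
      (auto simp: power2_eq_square sum_product power_add mult_ac)
  also have "\<dots> = (\<Sum>i\<le>r. \<Sum>j\<le>r. v i * v j * (1 / (real (i + j) + 1)))"
    by (simp add: Bochner_Integration.integral_sum bounded_meas_integrable bounded_meas_sum bounded_meas_mult integral_power_U)
  also have "\<dots> = (\<Sum>i\<le>r. v i * (\<Sum>j\<le>r. 1 / (real i + real j + 1) * v j))"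
    by (simp add: sum_distrib_left mult_ac)
  also have "\<dots> = 0" using assms by simp
  finally have "sq_norm ?p = 0" .
  then have "?p s = 0" if "s \<in> {0..1}" for s
    using that by (intro sq_norm_eq_0_D[of ?p]) (auto intro!: continuous_intros)
  then have "{0..1} \<subseteq> {s. ?p s = 0}" by auto
  then have "infinite {s. ?p s = 0}" using infinite_super[of "{0..1::real}"] by simp
  then show ?thesis using polyfun_finite_roots[of v r] by auto
qed

definition hilbert_entry :: "nat \<Rightarrow> nat \<Rightarrow> nat \<Rightarrow> real" where
  "hilbert_entry r i j = hilbert_inv r $$ (i, j)"

lemma hilbert_inv_carrier: "hilbert_inv r \<in> carrier_mat (r + 1) (r + 1)"
  and hilbert_entry_right: "i \<le> r \<Longrightarrow> j \<le> r \<Longrightarrow> (\<Sum>k\<le>r. 1 / (real i + real k + 1) * hilbert_entry r k j) = of_bool (i = j)"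
  and hilbert_entry_left: "i \<le> r \<Longrightarrow> j \<le> r \<Longrightarrow> (\<Sum>k\<le>r. hilbert_entry r i k * (1 / (real k + real j + 1))) = of_bool (i = j)"
  using matrix_inverse_entries[of r "\<lambda>i j. 1 / (real i + real j + 1)", OF hilbert_kernel]
  unfolding hilbert_entry_def hilbert_inv_def hilbert_mat_def by blast+

text \<open>The inverse of a symmetric matrix is symmetric. This reconciles \<open>coef\<close>,
  which applies a row of the inverse to the moments, with the transposed product in
  \<open>detrended_wiener\<close>.\<close>

lemma hilbert_entry_sym: assumes "i \<le> r" "j \<le> r" shows "hilbert_entry r i j = hilbert_entry r j i"
proof -
  have "hilbert_entry r i j = (\<Sum>k\<le>r. hilbert_entry r i k * of_bool (k = j))" using assms by (simp add: sum.delta)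
  also have "\<dots> = (\<Sum>k\<le>r. hilbert_entry r i k * (\<Sum>l\<le>r. hilbert_entry r j l * (1 / (real l + real k + 1))))"
    by (intro sum.cong refl arg_cong2[where f = "(*)"], subst hilbert_entry_left[OF assms(2)]) auto
  also have "\<dots> = (\<Sum>l\<le>r. hilbert_entry r j l * (\<Sum>k\<le>r. hilbert_entry r i k * (1 / (real k + real l + 1))))"
    unfolding sum_distrib_left by (subst sum.swap) (simp add: mult_ac add_ac)
  also have "\<dots> = (\<Sum>l\<le>r. hilbert_entry r j l * of_bool (i = l))"
    by (intro sum.cong refl arg_cong2[where f = "(*)"], subst hilbert_entry_left[OF assms(1)]) auto
  also have "\<dots> = hilbert_entry r j i" using assms by (simp add: sum.delta)
  finally show ?thesis .
qed

section \<open>Gram matrices, normal equations and the least squares trend\<close>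

definition gram :: "nat \<Rightarrow> nat \<Rightarrow> nat \<Rightarrow> real" where
  "gram T i j = (\<Sum>t=1..T. scaled_power T i t * scaled_power T j t) / real T"

definition moment :: "nat \<Rightarrow> (nat \<Rightarrow> real) \<Rightarrow> nat \<Rightarrow> real" where
  "moment T y k = (\<Sum>t=1..T. scaled_power T k t * y t) / real T"

lemma trend_eq: "trend r a T t = (\<Sum>j\<le>r. a j * scaled_power T j t)"
  by (simp add: trend_def scaled_power_def atLeast0AtMost)

lemma moment_trend: "moment T (trend r a T) i = (\<Sum>j\<le>r. gram T i j * a j)"
proof -
  have "moment T (trend r a T) i = (\<Sum>t=1..T. \<Sum>j\<le>r. scaled_power T i t * scaled_power T j t * a j) / real T"
    by (simp add: moment_def trend_eq sum_distrib_left mult_ac)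
  also have "\<dots> = (\<Sum>j\<le>r. gram T i j * a j)"
    by (subst sum.swap) (simp add: gram_def sum_distrib_right sum_divide_distrib)
  finally show ?thesis .
qed

lemma moment_add: "moment T (\<lambda>t. y t + z t) k = moment T y k + moment T z k"
  by (simp add: moment_def distrib_left sum.distrib add_divide_distrib)

lemma moment_diff: "moment T (\<lambda>t. y t - z t) k = moment T y k - moment T z k"
  by (simp add: moment_def right_diff_distrib sum_subtractf diff_divide_distrib)

text \<open>The Gram entry is a Riemann sum for the integral of \<open>s ^ (i + j)\<close>; the 2
  appears because the exponent may reach \<open>2 * r\<close>.\<close>

lemma gram_close: assumes "T > 0" "i \<le> r" "j \<le> r"
  shows "\<bar>gram T i j - 1 / (real i + real j + 1)\<bar> \<le> 2 * real r / real T"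
proof -
  have e: "scaled_power T i t * scaled_power T j t = scaled_power T (i + j) t" for t by (simp add: scaled_power_def power_add)
  have "gram T i j - 1 / (real i + real j + 1) = (LINT s|U. step_fun T (scaled_power T (i + j)) s - s ^ (i + j))"
    unfolding gram_def e integral_step_fun[OF assms(1), symmetric] using assms(1) integral_power_U[of "i + j"]
    by (subst Bochner_Integration.integral_diff) (auto intro!: bounded_meas_integrable)
  also have "\<bar>\<dots>\<bar> \<le> (LINT s|U. \<bar>step_fun T (scaled_power T (i + j)) s - s ^ (i + j)\<bar>)"
    by (rule integral_abs_bound)
  also have "\<dots> \<le> (LINT s|U. real (2 * r) / real T)"
    using assms by (intro integral_mono integrable_abs bounded_meas_integrable step_fun_scaled_power_diff) auto
  finally show ?thesis by simp
qed

text \<open>\<open>arg_min\<close> only promises some minimiser, so the formula needs existence and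
  uniqueness. The normal equations and Pythagoras give a minimiser; the invertible Gram matrix makes
  it the only one among coefficient sequences supported on \<open>{..r}\<close>.\<close>

lemma ols_trend_eq:
  assumes T: "T > 0"
    and B1: "\<And>i j. i \<le> r \<Longrightarrow> j \<le> r \<Longrightarrow> (\<Sum>k\<le>r. gram T i k * B k j) = of_bool (i = j)"
    and B2: "\<And>i j. i \<le> r \<Longrightarrow> j \<le> r \<Longrightarrow> (\<Sum>k\<le>r. B i k * gram T k j) = of_bool (i = j)"
  shows "ols_trend r T y = (\<lambda>j. if j \<le> r then \<Sum>k\<le>r. B j k * moment T y k else 0)" (is "_ = ?a")
proof -
  let ?f = "\<lambda>a. \<Sum>t=1..T. (y t - trend r a T t)\<^sup>2"
  let ?P = "\<lambda>a. \<forall>j>r. a j = (0::real)"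
  have ne: "moment T (\<lambda>t. y t - trend r ?a T t) i = 0" if i: "i \<le> r" for i
  proof -
    have "(\<Sum>j\<le>r. gram T i j * ?a j) = (\<Sum>j\<le>r. \<Sum>k\<le>r. gram T i j * B j k * moment T y k)"
      by (simp add: sum_distrib_left mult.assoc)
    also have "\<dots> = (\<Sum>k\<le>r. (\<Sum>j\<le>r. gram T i j * B j k) * moment T y k)"
      by (subst sum.swap) (simp add: sum_distrib_right)
    also have "\<dots> = (\<Sum>k\<le>r. of_bool (i = k) * moment T y k)" using i by (simp add: B1)
    also have "\<dots> = moment T y i" using i by (simp add: sum.delta')
    finally show ?thesis unfolding moment_diff moment_trend by simp
  qed
  have orth: "(\<Sum>t=1..T. (y t - trend r ?a T t) * trend r d T t) = 0" for d
  proof -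
    have "(\<Sum>t=1..T. (y t - trend r ?a T t) * trend r d T t)
      = (\<Sum>t=1..T. \<Sum>j\<le>r. d j * (scaled_power T j t * (y t - trend r ?a T t)))"
      unfolding trend_eq[of r d] sum_distrib_left by (intro sum.cong refl) simp
    also have "\<dots> = (\<Sum>j\<le>r. d j * (real T * moment T (\<lambda>t. y t - trend r ?a T t) j))"
      using T by (subst sum.swap) (simp add: moment_def sum_distrib_left[symmetric])
    also have "\<dots> = 0" using ne by simp
    finally show ?thesis .
  qed
  \<comment> \<open>The residual of \<open>?a\<close> is orthogonal to every trend, so the cross
    term vanishes.\<close>
  have pyth: "?f a = ?f ?a + (\<Sum>t=1..T. (trend r (\<lambda>j. ?a j - a j) T t)\<^sup>2)" for a
  proof -
    have "(y t - trend r a T t)\<^sup>2 = (y t - trend r ?a T t)\<^sup>2 + (trend r (\<lambda>j. ?a j - a j) T t)\<^sup>2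
       + 2 * ((y t - trend r ?a T t) * trend r (\<lambda>j. ?a j - a j) T t)" for t
    proof -
      have "y t - trend r a T t = (y t - trend r ?a T t) + trend r (\<lambda>j. ?a j - a j) T t"
        by (simp add: trend_eq left_diff_distrib sum_subtractf)
      then show ?thesis by (simp only: power2_sum) 
    qed
    then show ?thesis using orth[of "\<lambda>j. ?a j - a j"] by (simp only: sum.distrib sum_distrib_left[symmetric])
  qed
  have min: "is_arg_min ?f ?P ?a"
    unfolding is_arg_min_linorder
  proof (intro conjI allI impI)
    show "?f ?a \<le> ?f a" for a
      unfolding pyth[of a] le_add_same_cancel1 by (intro sum_nonneg) simp
  qed simp
  then have "is_arg_min ?f ?P (ols_trend r T y)"
    unfolding ols_trend_def arg_min_def by (rule someI[of "is_arg_min ?f ?P"])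
  then have ols: "?P (ols_trend r T y) \<and> (\<forall>b. ?P b \<longrightarrow> ?f (ols_trend r T y) \<le> ?f b)"
    unfolding is_arg_min_linorder .
  have "?f (ols_trend r T y) \<le> ?f ?a"
    by (rule conjunct2[OF ols, rule_format]) simp
  note o = conjunct1[OF ols] this
  let ?d = "\<lambda>j. ?a j - ols_trend r T y j"
  \<comment> \<open>Uniqueness: by Pythagoras the trend of the difference vanishes at all sample
    points, so the Gram matrix annihilates the difference and its inverse recovers it as
    zero.\<close>
  have "(\<Sum>t=1..T. (trend r ?d T t)\<^sup>2) \<le> 0" using o(2) pyth[of "ols_trend r T y"] by linarith
  then have "(\<Sum>t=1..T. (trend r ?d T t)\<^sup>2) = 0" by (rule antisym) (intro sum_nonneg zero_le_power2)
  then have z: "trend r ?d T t = 0" if "t \<in> {1..T}" for t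
    using that by (subst (asm) sum_nonneg_eq_0_iff) auto
  have g0: "(\<Sum>j\<le>r. gram T i j * ?d j) = 0" for i
    unfolding moment_trend[symmetric] using z by (subst moment_def) (simp add: sum.neutral)
  have "?d i = 0" if i: "i \<le> r" for i
  proof -
    have "?d i = (\<Sum>j\<le>r. of_bool (i = j) * ?d j)" using i by (simp add: sum.delta')
    also have "\<dots> = (\<Sum>j\<le>r. \<Sum>k\<le>r. B i k * gram T k j * ?d j)"
      unfolding sum_distrib_right[symmetric] using i by (intro sum.cong) (auto simp: B2)
    also have "\<dots> = (\<Sum>k\<le>r. B i k * (\<Sum>j\<le>r. gram T k j * ?d j))"
      by (subst sum.swap) (simp add: sum_distrib_left mult.assoc)
    finally show ?thesis using g0 by simp
  qed
  then have "ols_trend r T y j = ?a j" for j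
    using o(1) by (cases "j \<le> r") (auto simp: not_le)
  then show ?thesis by blast
qed

definition gsum :: "nat \<Rightarrow> real" where
  "gsum r = (\<Sum>i\<le>r. \<Sum>j\<le>r. \<bar>hilbert_entry r i j\<bar>)"

lemma gsum_nonneg: "0 \<le> gsum r" unfolding gsum_def by (auto intro!: sum_nonneg)

lemma hilbert_entry_apply_bound:
  assumes "\<And>k. k \<le> r \<Longrightarrow> \<bar>x k\<bar> \<le> b" "0 \<le> b"
  shows "(\<Sum>j\<le>r. \<bar>\<Sum>k\<le>r. hilbert_entry r j k * x k\<bar>) \<le> gsum r * b"
proof -
  have "(\<Sum>j\<le>r. \<bar>\<Sum>k\<le>r. hilbert_entry r j k * x k\<bar>) \<le> (\<Sum>j\<le>r. \<Sum>k\<le>r. \<bar>hilbert_entry r j k\<bar> * b)"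
    using assms by (intro sum_mono order_trans[OF sum_abs]) (auto simp: abs_mult intro!: mult_left_mono)
  then show ?thesis by (simp add: gsum_def sum_distrib_right)
qed

text \<open>The Gram matrix of the regressors differs from the Hilbert matrix by \<open>O(1/T)\<close>, so a
  solution of one linear system nearly solves the other.\<close>

lemma gram_solve:
  assumes T: "T > 0" and Tr: "real T \<ge> 4 * real r * gsum r"
    and sol: "\<And>i. i \<le> r \<Longrightarrow> (\<Sum>k\<le>r. gram T i k * a k) = g i"
  shows "(\<Sum>j\<le>r. \<bar>a j\<bar>) \<le> 2 * gsum r * (\<Sum>k\<le>r. \<bar>g k\<bar>)"
    and "\<And>j. j \<le> r \<Longrightarrow> \<bar>a j - (\<Sum>k\<le>r. hilbert_entry r j k * g k)\<bar> \<le> 4 * real r * (gsum r)\<^sup>2 / real T * (\<Sum>k\<le>r. \<bar>g k\<bar>)"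
proof -
  \<comment> \<open>\<open>a\<close> solves the Hilbert system with right-hand side
    \<open>g + h\<close>, where \<open>h\<close> is the difference of the two matrices applied to
    \<open>a\<close>.\<close>
  define h where "h i = (\<Sum>k\<le>r. (1 / (real i + real k + 1) - gram T i k) * a k)" for i
  let ?A = "\<Sum>j\<le>r. \<bar>a j\<bar>" and ?S = "\<Sum>k\<le>r. \<bar>g k\<bar>"
  have hb: "\<bar>h i\<bar> \<le> 2 * real r / real T * ?A" if i: "i \<le> r" for i
  proof -
    have "\<bar>h i\<bar> \<le> (\<Sum>k\<le>r. \<bar>1 / (real i + real k + 1) - gram T i k\<bar> * \<bar>a k\<bar>)"
      unfolding h_def abs_mult[symmetric] by (rule sum_abs)
    also have "\<dots> \<le> (\<Sum>k\<le>r. 2 * real r / real T * \<bar>a k\<bar>)"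
      using gram_close[OF T i] by (intro sum_mono mult_right_mono) (auto simp: abs_minus_commute)
    finally show ?thesis by (simp add: sum_distrib_left)
  qed
  have sum0: "0 \<le> ?A" "0 \<le> ?S" by (auto intro!: sum_nonneg)
  have rep: "a j - (\<Sum>k\<le>r. hilbert_entry r j k * g k) = (\<Sum>i\<le>r. hilbert_entry r j i * h i)" if j: "j \<le> r" for j
  proof -
    have gh: "g i + h i = (\<Sum>k\<le>r. 1 / (real i + real k + 1) * a k)" if "i \<le> r" for i
      using sol[OF that] by (simp add: h_def left_diff_distrib sum_subtractf)
    have "a j = (\<Sum>k\<le>r. of_bool (j = k) * a k)" using j by (simp add: sum.delta')
    also have "\<dots> = (\<Sum>k\<le>r. \<Sum>i\<le>r. hilbert_entry r j i * (1 / (real i + real k + 1)) * a k)"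
      unfolding sum_distrib_right[symmetric]
      by (intro sum.cong refl arg_cong2[where f = "(*)"], subst hilbert_entry_left[OF j]) auto
    also have "\<dots> = (\<Sum>i\<le>r. hilbert_entry r j i * (\<Sum>k\<le>r. 1 / (real i + real k + 1) * a k))"
      by (subst sum.swap) (simp add: sum_distrib_left mult.assoc)
    also have "\<dots> = (\<Sum>i\<le>r. hilbert_entry r j i * (g i + h i))"
      by (intro sum.cong) (auto simp: gh)
    finally show ?thesis by (simp add: distrib_left sum.distrib)
  qed
  have e: "(\<Sum>j\<le>r. \<bar>a j - (\<Sum>k\<le>r. hilbert_entry r j k * g k)\<bar>) \<le> gsum r * (2 * real r / real T * ?A)"
    using hilbert_entry_apply_bound[of r h "2 * real r / real T * ?A"] hb sum0 by (simp add: rep)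
  \<comment> \<open>The threshold on \<open>T\<close> makes the perturbation at most half of the sum
    of the absolute coefficients, so that it can be absorbed on the left.\<close>
  have "gsum r * (2 * real r / real T * ?A) = (4 * real r * gsum r) / real T * (?A / 2)" by simp
  also have "\<dots> \<le> 1 * (?A / 2)"
    using T Tr sum0 by (intro mult_right_mono) (auto simp: divide_le_eq)
  finally have e2: "gsum r * (2 * real r / real T * ?A) \<le> ?A / 2" by simp
  have "?A \<le> (\<Sum>j\<le>r. \<bar>a j - (\<Sum>k\<le>r. hilbert_entry r j k * g k)\<bar> + \<bar>\<Sum>k\<le>r. hilbert_entry r j k * g k\<bar>)"
    by (intro sum_mono) simp
  also have "\<dots> \<le> ?A / 2 + gsum r * ?S"
    unfolding sum.distrib using e e2 sum0
    by (intro add_mono hilbert_entry_apply_bound member_le_sum[where f = "\<lambda>k. \<bar>g k\<bar>"]) auto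
  finally show A: "?A \<le> 2 * gsum r * ?S" by simp
  show "\<bar>a j - (\<Sum>k\<le>r. hilbert_entry r j k * g k)\<bar> \<le> 4 * real r * (gsum r)\<^sup>2 / real T * ?S" if j: "j \<le> r" for j
  proof -
    have "\<bar>a j - (\<Sum>k\<le>r. hilbert_entry r j k * g k)\<bar> \<le> (\<Sum>j\<le>r. \<bar>a j - (\<Sum>k\<le>r. hilbert_entry r j k * g k)\<bar>)"
      using j by (intro member_le_sum[where f = "\<lambda>j. \<bar>a j - (\<Sum>k\<le>r. hilbert_entry r j k * g k)\<bar>"]) auto
    also note e
    also have "gsum r * (2 * real r / real T * ?A) \<le> gsum r * (2 * real r / real T * (2 * gsum r * ?S))"
      using A gsum_nonneg by (intro mult_left_mono) auto
    finally show ?thesis by (simp add: power2_eq_square mult_ac)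
  qed
qed

text \<open>Beyond the threshold of \<open>gram_solve\<close> the Gram matrix is invertible, and the
  bounds are those of that perturbation argument; equivariance under an added trend is its
  uniqueness part. The linear form with a matrix depending only on \<open>T\<close> is what later
  makes the residuals measurable.\<close>

lemma ols_asymptotics:
  obtains C T0 where "0 \<le> C" "0 < T0"
    "\<And>T y j. T \<ge> T0 \<Longrightarrow> j \<le> r \<Longrightarrow>
       \<bar>ols_trend r T y j - (\<Sum>k\<le>r. hilbert_entry r j k * moment T y k)\<bar> \<le> C / real T * (\<Sum>k\<le>r. \<bar>moment T y k\<bar>)"
    "\<And>T y. T \<ge> T0 \<Longrightarrow> (\<Sum>j\<le>r. \<bar>ols_trend r T y j\<bar>) \<le> C * (\<Sum>k\<le>r. \<bar>moment T y k\<bar>)"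
    "\<And>T. T \<ge> T0 \<Longrightarrow> \<exists>B. \<forall>y. \<forall>j\<le>r. ols_trend r T y j = (\<Sum>k\<le>r. B j k * moment T y k)"
    "\<And>T y \<alpha> j. T \<ge> T0 \<Longrightarrow> j \<le> r \<Longrightarrow>
       ols_trend r T (\<lambda>t. y t + trend r \<alpha> T t) j = ols_trend r T y j + \<alpha> j"
proof -
  \<comment> \<open>Large enough for the absorption in \<open>gram_solve\<close>; the
    \<open>+ 1\<close> also keeps \<open>T\<close> positive.\<close>
  define T0 where "T0 = nat \<lceil>4 * real r * gsum r\<rceil> + 1"
  define C where "C = 4 * real r * (gsum r)\<^sup>2 + 2 * gsum r"
  have C: "4 * real r * (gsum r)\<^sup>2 \<le> C" "2 * gsum r \<le> C" "0 \<le> C" unfolding C_def using gsum_nonneg by auto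
  have *: "\<exists>B. (\<forall>i\<le>r. \<forall>j\<le>r. (\<Sum>k\<le>r. gram T i k * B k j) = of_bool (i = j)) \<and>
      (\<forall>i\<le>r. \<forall>j\<le>r. (\<Sum>k\<le>r. B i k * gram T k j) = of_bool (i = j)) \<and>
      (\<forall>y. ols_trend r T y = (\<lambda>j. if j \<le> r then \<Sum>k\<le>r. B j k * moment T y k else 0))"
    and T: "0 < T" "real T \<ge> 4 * real r * gsum r" if "T \<ge> T0" for T
  proof -
    show T: "0 < T" using that unfolding T0_def by simp
    show Tr: "real T \<ge> 4 * real r * gsum r" using that unfolding T0_def by linarith
    have "\<forall>j\<le>r. v j = 0" if "\<And>i. i \<le> r \<Longrightarrow> (\<Sum>j\<le>r. gram T i j * v j) = 0" for v
    proof -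
      \<comment> \<open>With right-hand side zero the bound forces a zero solution: the Gram matrix
        has trivial kernel.\<close>
      have "(\<Sum>j\<le>r. \<bar>v j\<bar>) \<le> 0" using gram_solve(1)[OF T Tr, of v "\<lambda>_. 0"] that by simp
      then have "(\<Sum>j\<le>r. \<bar>v j\<bar>) = 0" by (intro antisym) (auto intro: sum_nonneg)
      then show ?thesis by (subst (asm) sum_nonneg_eq_0_iff) auto
    qed
    note inv = matrix_inverse_entries(2,3)[of r "gram T", OF this]
    show "\<exists>B. (\<forall>i\<le>r. \<forall>j\<le>r. (\<Sum>k\<le>r. gram T i k * B k j) = of_bool (i = j)) \<and>
      (\<forall>i\<le>r. \<forall>j\<le>r. (\<Sum>k\<le>r. B i k * gram T k j) = of_bool (i = j)) \<and>
      (\<forall>y. ols_trend r T y = (\<lambda>j. if j \<le> r then \<Sum>k\<le>r. B j k * moment T y k else 0))"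
      by (intro exI conjI allI impI, rule inv, assumption, assumption, assumption,
          rule inv, assumption, assumption, assumption, rule ols_trend_eq[OF T inv]) assumption+
  qed
  have sol: "(\<Sum>k\<le>r. gram T i k * ols_trend r T y k) = moment T y i" if "T \<ge> T0" "i \<le> r" for T y i
  proof -
    from *[OF that(1)] obtain B where B: "\<And>i j. i\<le>r \<Longrightarrow> j\<le>r \<Longrightarrow> (\<Sum>k\<le>r. gram T i k * B k j) = of_bool (i = j)"
      and o: "\<And>y. ols_trend r T y = (\<lambda>j. if j \<le> r then \<Sum>k\<le>r. B j k * moment T y k else 0)" by blast
    have "(\<Sum>k\<le>r. gram T i k * ols_trend r T y k) = (\<Sum>k\<le>r. \<Sum>j\<le>r. gram T i k * B k j * moment T y j)"
      by (simp add: o sum_distrib_left mult.assoc)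
    also have "\<dots> = (\<Sum>j\<le>r. (\<Sum>k\<le>r. gram T i k * B k j) * moment T y j)"
      by (subst sum.swap) (simp add: sum_distrib_right)
    also have "\<dots> = (\<Sum>j\<le>r. of_bool (i = j) * moment T y j)" using that by (simp add: B)
    also have "\<dots> = moment T y i" using that by (simp add: sum.delta')
    finally show ?thesis .
  qed
  show ?thesis
  proof (rule that[of C T0])
    show "0 \<le> C" by (rule C)
    show "0 < T0" by (simp add: T0_def)
    fix T y assume T0: "T \<ge> T0"
    have S: "0 \<le> (\<Sum>k\<le>r. \<bar>moment T y k\<bar>)" by (auto intro: sum_nonneg)
    show "\<bar>ols_trend r T y j - (\<Sum>k\<le>r. hilbert_entry r j k * moment T y k)\<bar> \<le> C / real T * (\<Sum>k\<le>r. \<bar>moment T y k\<bar>)"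
      if "j \<le> r" for j
      using S C T[OF T0] by (intro order_trans[OF gram_solve(2)[OF T[OF T0] sol[OF T0] that]] mult_right_mono divide_right_mono) auto
    show "(\<Sum>j\<le>r. \<bar>ols_trend r T y j\<bar>) \<le> C * (\<Sum>k\<le>r. \<bar>moment T y k\<bar>)"
      using S C by (intro order_trans[OF gram_solve(1)[OF T[OF T0] sol[OF T0]]] mult_right_mono) auto
    show "\<exists>B. \<forall>y. \<forall>j\<le>r. ols_trend r T y j = (\<Sum>k\<le>r. B j k * moment T y k)"
    proof -
      obtain B where "\<And>y. ols_trend r T y = (\<lambda>j. if j \<le> r then \<Sum>k\<le>r. B j k * moment T y k else 0)"
        using *[OF T0] by blast
      then have "\<forall>y. \<forall>j\<le>r. ols_trend r T y j = (\<Sum>k\<le>r. B j k * moment T y k)" by simp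
      then show ?thesis by (rule exI[of _ B])
    qed
    fix \<alpha> j assume j: "j \<le> r"
    \<comment> \<open>Both candidates solve the same normal equations, so their difference lies in
      the kernel of the Gram matrix.\<close>
    let ?d = "\<lambda>j. ols_trend r T (\<lambda>t. y t + trend r \<alpha> T t) j - (ols_trend r T y j + \<alpha> j)"
    have "(\<Sum>k\<le>r. gram T i k * ?d k) = 0" if "i \<le> r" for i
      using sol[OF T0 that, of "\<lambda>t. y t + trend r \<alpha> T t"] sol[OF T0 that, of y]
      by (simp add: moment_add moment_trend right_diff_distrib distrib_left sum.distrib sum_subtractf)
    then have "(\<Sum>j\<le>r. \<bar>?d j\<bar>) \<le> 0" using gram_solve(1)[OF T[OF T0], of ?d "\<lambda>_. 0"] by simp
    then have "(\<Sum>j\<le>r. \<bar>?d j\<bar>) = 0" by (intro antisym) (auto intro: sum_nonneg)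
    then have "?d j = 0" using j by (subst (asm) sum_nonneg_eq_0_iff) auto
    then show "ols_trend r T (\<lambda>t. y t + trend r \<alpha> T t) j = ols_trend r T y j + \<alpha> j" by simp
  qed
qed

section \<open>The limiting processes as functionals of a continuous path\<close>

lemma primitive_eq_integral:
  assumes f: "continuous_on {0..1} f" and s: "s \<in> {0..1}"
  shows "primitive f s = integral {0..s} f"
proof -
  have "set_integrable lborel {0..<s} f"
    using s by (intro set_integrable_subset[OF borel_integrable_atLeastAtMost'[OF f]]) auto
  then have "(LINT u:{0..<s}|lborel. f u) = integral {0..<s} f"
    by (rule set_borel_integral_eq_integral)
  also have "\<dots> = integral {0..s} f"
    by (rule integral_subset_negligible) (auto intro!: negligible_subset[OF negligible_sing[of s]])
  also have "(LINT u:{0..<s}|lborel. f u) = primitive f s"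
    unfolding primitive_def U_def set_lebesgue_integral_def
    by (subst integral_restrict_space) (use s in \<open>auto simp: indicator_def intro!: Bochner_Integration.integral_cong\<close>)
  finally show ?thesis by simp
qed

lemma continuous_on_detrend: "continuous_on A w \<Longrightarrow> continuous_on A (detrend G r w)"
  unfolding detrend_def[abs_def] by (intro continuous_intros)

lemma vec_integral_nth: "i < n \<Longrightarrow> vec_integral n A g $ i = integral A (\<lambda>s. g s $ i)"
  by (simp add: vec_integral_def)

lemma moment_continuous:
  "continuous_on {0..1} w \<Longrightarrow> (LINT s|U. s ^ k * w s) = integral {0..1} (\<lambda>s. w s * s ^ k)"
  by (subst integral_U_eq) (auto intro!: continuous_intros simp: mult.commute)

lemma bilinear_hilbert:
  assumes "u \<in> carrier_vec (r + 1)" "v \<in> carrier_vec (r + 1)"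
  shows "scalar_prod u (hilbert_inv r *\<^sub>v v) = (\<Sum>i\<le>r. \<Sum>j\<le>r. u $ i * hilbert_entry r i j * v $ j)"
proof -
  have set: "{0..<r + 1} = {..r}" by auto
  have "(hilbert_inv r *\<^sub>v v) $ i = (\<Sum>j\<le>r. hilbert_entry r i j * v $ j)" if "i \<le> r" for i
    using that assms(2) hilbert_inv_carrier[of r]
    by (simp add: scalar_prod_def hilbert_entry_def set[symmetric] del: sum.op_ivl_Suc)
  then show ?thesis
    using assms hilbert_inv_carrier[of r]
    by (simp add: scalar_prod_def set[symmetric] sum_distrib_left mult.assoc del: sum.op_ivl_Suc)
qed

lemma detrended_wiener_eq:
  assumes w: "continuous_on {0..1} w"
  shows "detrended_wiener r w = detrend (hilbert_entry r) r w"
proof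
  fix t
  have "scalar_prod (vec_integral (r + 1) {0..1} (\<lambda>s. w s \<cdot>\<^sub>v Lam r s)) (hilbert_inv r *\<^sub>v Lam r t)
      = (\<Sum>i\<le>r. \<Sum>j\<le>r. (LINT s|U. s ^ i * w s) * hilbert_entry r i j * t ^ j)"
    using w by (subst bilinear_hilbert) (auto simp: vec_integral_def Lam_def moment_continuous intro!: sum.cong)
  also have "\<dots> = (\<Sum>j\<le>r. coef (hilbert_entry r) r w j * t ^ j)"
    unfolding coef_def sum_distrib_right by (subst sum.swap) (auto intro!: sum.cong simp: hilbert_entry_sym)
  finally show "detrended_wiener r w t = detrend (hilbert_entry r) r w t"
    by (simp add: detrended_wiener_def detrend_def)
qed

text \<open>Integration by parts: for the primitive of \<open>w\<close>, the boundary term minus the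
  integral against \<open>dLam\<close> in the definition of the bridge is the vector of moments of
  \<open>w\<close> itself. For \<open>i = 0\<close> the factor \<open>real i\<close> removes the
  spurious power.\<close>

lemma int_wiener_moment:
  assumes w: "continuous_on {0..1} w"
  shows "int_wiener w 1 - integral {0..1} (\<lambda>u. int_wiener w u * (real i * u ^ (i - 1))) = (LINT s|U. s ^ i * w s)"
proof -
  have d: "(int_wiener w has_real_derivative w u) (at u within {0..1})" if "u \<in> {0..1}" for u
    unfolding int_wiener_def[abs_def] by (rule integral_has_real_derivative[OF w that])
  have c: "continuous_on {0..1} (int_wiener w)"
    using d by (intro DERIV_continuous_on)
  have "((\<lambda>u. w u * u ^ i + int_wiener w u * (real i * u ^ (i - 1))) has_integral
      (int_wiener w 1 * 1 ^ i - int_wiener w 0 * 0 ^ i)) {0..1}"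
  proof (rule fundamental_theorem_of_calculus)
    fix u :: real assume u: "u \<in> {0..1}"
    have "((\<lambda>u. int_wiener w u * u ^ i) has_real_derivative w u * u ^ i + real i * u ^ (i - 1) * 1 * int_wiener w u) (at u within {0..1})"
      by (rule DERIV_mult[OF d[OF u]]) (auto intro!: derivative_eq_intros)
    then show "((\<lambda>u. int_wiener w u * u ^ i) has_vector_derivative w u * u ^ i + int_wiener w u * (real i * u ^ (i - 1))) (at u within {0..1})"
      by (simp add: has_real_derivative_iff_has_vector_derivative[symmetric] mult_ac)
  qed simp
  then have "integral {0..1} (\<lambda>u. w u * u ^ i + int_wiener w u * (real i * u ^ (i - 1))) = int_wiener w 1"
    by (simp add: integral_unique int_wiener_def)
  then have "integral {0..1} (\<lambda>u. w u * u ^ i) + integral {0..1} (\<lambda>u. int_wiener w u * (real i * u ^ (i - 1))) = int_wiener w 1"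
    using w c by (subst (asm) Henstock_Kurzweil_Integration.integral_add) (auto intro!: integrable_continuous_real continuous_intros)
  then show ?thesis using w by (simp add: moment_continuous)
qed

text \<open>Its coefficients being the moments of \<open>w\<close>, the bridge subtracts from the
  primitive of \<open>w\<close> the primitive of the fitted polynomial.\<close>

lemma int_bridge_eq:
  assumes w: "continuous_on {0..1} w" and s: "s \<in> {0..1}"
  shows "int_bridge r w s = primitive (detrend (hilbert_entry r) r w) s"
proof -
  have sub: "{0..s} \<subseteq> {0..1}" using s by auto
  define v where "v = int_wiener w 1 \<cdot>\<^sub>v Lam r 1 - vec_integral (r + 1) {0..1} (\<lambda>u. int_wiener w u \<cdot>\<^sub>v dLam r u)"
  have v: "v \<in> carrier_vec (r + 1)" by (simp add: v_def Lam_def vec_integral_def)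
  have vi: "v $ i = (LINT s|U. s ^ i * w s)" if "i \<le> r" for i
    using that int_wiener_moment[OF w, of i] by (simp add: v_def Lam_def dLam_def vec_integral_def)
  have "scalar_prod (vec_integral (r + 1) {0..s} (Lam r)) (hilbert_inv r *\<^sub>v v)
      = (\<Sum>i\<le>r. \<Sum>j\<le>r. integral {0..s} (\<lambda>s. s ^ i) * hilbert_entry r i j * (LINT s|U. s ^ j * w s))"
    using v by (subst bilinear_hilbert) (auto simp: vi vec_integral_nth Lam_def intro!: sum.cong, simp add: vec_integral_def)
  also have "\<dots> = (\<Sum>j\<le>r. coef (hilbert_entry r) r w j * integral {0..s} (\<lambda>s. s ^ j))"
    unfolding coef_def sum_distrib_right by (intro sum.cong refl) simp
  finally have "int_bridge r w s = int_wiener w s - (\<Sum>j\<le>r. coef (hilbert_entry r) r w j * integral {0..s} (\<lambda>s. s ^ j))"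
    by (simp add: int_bridge_def h_detrend_def v_def)
  also have "\<dots> = integral {0..s} w - integral {0..s} (\<lambda>s. \<Sum>j\<le>r. coef (hilbert_entry r) r w j * s ^ j)"
    by (subst integral_sum) (auto intro!: integrable_continuous_real continuous_intros simp: int_wiener_def)
  also have "\<dots> = integral {0..s} (detrend (hilbert_entry r) r w)"
    unfolding detrend_def[abs_def] using continuous_on_subset[OF w sub]
    by (subst Henstock_Kurzweil_Integration.integral_diff) (auto intro!: integrable_continuous_real continuous_intros)
  also have "\<dots> = primitive (detrend (hilbert_entry r) r w) s"
    by (rule primitive_eq_integral[symmetric, OF continuous_on_detrend[OF w] s])
  finally show ?thesis .
qed

lemma continuous_on_primitive: 
  assumes "continuous_on {0..1} f" shows "continuous_on {0..1} (primitive f)"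
proof -
  have "continuous_on {0..1} (\<lambda>s. integral {0..s} f)"
    by (rule indefinite_integral_continuous_1[OF integrable_continuous_real[OF assms]])
  then show ?thesis by (rule continuous_on_eq) (simp add: primitive_eq_integral[OF assms])
qed

lemma sq_norm_continuous: "continuous_on {0..1} f \<Longrightarrow> sq_norm f = integral {0..1} (\<lambda>s. (f s)\<^sup>2)"
  unfolding sq_norm_def by (subst integral_U_eq) (auto intro!: continuous_intros)

lemma ratio_trend_eq:
  assumes w: "continuous_on {0..1} w"
  shows "ratio_trend r w = sq_norm (primitive (detrend (hilbert_entry r) r w)) / sq_norm (detrend (hilbert_entry r) r w)"
  unfolding ratio_trend_def detrended_wiener_eq[OF w] sq_norm_continuous[OF continuous_on_detrend[OF w]]
    sq_norm_continuous[OF continuous_on_primitive[OF continuous_on_detrend[OF w]]]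
  by (intro arg_cong2[where f = "(/)"] refl Henstock_Kurzweil_Integration.integral_cong) (simp add: int_bridge_eq[OF w])

lemma detrend_0: "detrend (\<lambda>_ _. 0) r w = w"
  by (simp add: fun_eq_iff detrend_def coef_def)

lemma ratio_no_trend_eq:
  assumes w: "continuous_on {0..1} w"
  shows "ratio_no_trend w = sq_norm (primitive (detrend (\<lambda>_ _. 0) r w)) / sq_norm (detrend (\<lambda>_ _. 0) r w)"
  unfolding ratio_no_trend_def detrend_0 sq_norm_continuous[OF w] sq_norm_continuous[OF continuous_on_primitive[OF w]]
  by (intro arg_cong2[where f = "(/)"] refl Henstock_Kurzweil_Integration.integral_cong) (simp add: int_wiener_def primitive_eq_integral[OF w])

text \<open>A path annihilated by detrending is a polynomial, hence Lipschitz at the origin.\<close>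

lemma detrend_null_lipschitz:
  assumes w: "continuous_on {0..1} w" "w 0 = 0" and z: "sq_norm (detrend G r w) = 0"
  shows "\<exists>C. \<forall>s\<in>{0..1}. \<bar>w s\<bar> \<le> C * s"
proof -
  let ?c = "coef G r w"
  have p: "w s = (\<Sum>j\<le>r. ?c j * s ^ j)" if "s \<in> {0..1}" for s
    using sq_norm_eq_0_D[OF continuous_on_detrend[OF w(1)] z that] by (simp add: detrend_def)
  \<comment> \<open>\<open>w 0 = 0\<close> kills the constant coefficient, which is what makes the
    polynomial bounded by a multiple of \<open>s\<close>.\<close>
  have c0: "?c 0 = 0"
    using p[of 0] w(2) by (simp add: power_0_left sum.delta' if_distrib[of "\<lambda>x. _ * x"] cong: if_cong)
  have "\<bar>w s\<bar> \<le> (\<Sum>j\<le>r. \<bar>?c j\<bar>) * s" if s: "s \<in> {0..1}" for s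
  proof -
    have "\<bar>w s\<bar> \<le> (\<Sum>j\<le>r. \<bar>?c j * s ^ j\<bar>)" unfolding p[OF s] by (rule sum_abs)
    also have "\<dots> \<le> (\<Sum>j\<le>r. \<bar>?c j\<bar> * s)"
    proof (intro sum_mono)
      fix j show "\<bar>?c j * s ^ j\<bar> \<le> \<bar>?c j\<bar> * s"
      proof (cases j)
        case (Suc k)
        have "s ^ j \<le> s" using s by (simp add: Suc mult_left_le power_le_one)
        then show ?thesis using s by (auto simp: abs_mult power_abs intro!: mult_left_mono)
      qed (simp add: c0)
    qed
    finally show ?thesis by (simp add: sum_distrib_right)
  qed
  then show ?thesis by blast
qed

subsection \<open>Stochastic orders of magnitude\<close>

text \<open>The exceptional events are arbitrary measurable sets, so that no measurability of the
  variables themselves is needed.\<close>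

definition mostly :: "'a measure \<Rightarrow> real \<Rightarrow> ('a \<Rightarrow> bool) \<Rightarrow> bool" where
  "mostly M d P \<longleftrightarrow> (\<exists>A\<in>sets M. measure M A \<le> d \<and> (\<forall>\<omega>\<in>space M - A. P \<omega>))"

text \<open>Convergence to zero in probability in the Ky Fan form: a single \<open>d\<close> bounds
  both the size and the exceptional probability.\<close>

definition small :: "'a measure \<Rightarrow> (nat \<Rightarrow> 'a \<Rightarrow> real) \<Rightarrow> bool" where
  "small M Y \<longleftrightarrow> (\<forall>d>0. \<forall>\<^sub>F n in sequentially. mostly M d (\<lambda>\<omega>. \<bar>Y n \<omega>\<bar> \<le> d))"

definition bounded_in_prob :: "'a measure \<Rightarrow> (nat \<Rightarrow> 'a \<Rightarrow> real) \<Rightarrow> bool" where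
  "bounded_in_prob M Y \<longleftrightarrow> (\<forall>d>0. \<exists>B>0. \<forall>\<^sub>F n in sequentially. mostly M d (\<lambda>\<omega>. \<bar>Y n \<omega>\<bar> \<le> B))"

definition bounded_away_in_prob :: "'a measure \<Rightarrow> (nat \<Rightarrow> 'a \<Rightarrow> real) \<Rightarrow> bool" where
  "bounded_away_in_prob M Y \<longleftrightarrow> (\<forall>d>0. \<exists>c>0. \<forall>\<^sub>F n in sequentially. mostly M d (\<lambda>\<omega>. c \<le> Y n \<omega>))"

lemma mostly_mono: "mostly M d P \<Longrightarrow> (\<And>\<omega>. \<omega> \<in> space M \<Longrightarrow> P \<omega> \<Longrightarrow> Q \<omega>) \<Longrightarrow> mostly M d Q"
  unfolding mostly_def by blast

lemma mostly_all: "0 \<le> d \<Longrightarrow> (\<And>\<omega>. \<omega> \<in> space M \<Longrightarrow> P \<omega>) \<Longrightarrow> mostly M d P"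
  unfolding mostly_def by (intro bexI[of _ "{}"]) auto

lemma mostly_conj:
  assumes "prob_space M" "mostly M a P" "mostly M b Q" "\<And>\<omega>. \<omega> \<in> space M \<Longrightarrow> P \<omega> \<Longrightarrow> Q \<omega> \<Longrightarrow> R \<omega>" "a + b \<le> d"
  shows "mostly M d R"
proof -
  interpret prob_space M by fact
  obtain A B where A: "A \<in> sets M" "measure M A \<le> a" "\<forall>\<omega>\<in>space M - A. P \<omega>"
    and B: "B \<in> sets M" "measure M B \<le> b" "\<forall>\<omega>\<in>space M - B. Q \<omega>" using assms(2,3) unfolding mostly_def by blast
  have "measure M (A \<union> B) \<le> d"
    using measure_Un_le[OF A(1) B(1)] A(2) B(2) assms(5) by linarith
  moreover have "A \<union> B \<in> sets M" using A B by auto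
  moreover have "\<forall>\<omega>\<in>space M - (A \<union> B). R \<omega>" using A B assms(4) by auto
  ultimately show ?thesis unfolding mostly_def by blast
qed

lemma smallD: "small M Y \<Longrightarrow> d > 0 \<Longrightarrow> \<forall>\<^sub>F n in sequentially. mostly M d (\<lambda>\<omega>. \<bar>Y n \<omega>\<bar> \<le> d)"
  unfolding small_def by blast

lemma smallI: "(\<And>d. d > 0 \<Longrightarrow> \<forall>\<^sub>F n in sequentially. mostly M d (\<lambda>\<omega>. \<bar>Y n \<omega>\<bar> \<le> d)) \<Longrightarrow> small M Y"
  unfolding small_def by blast

lemma bounded_in_probE:
  assumes "bounded_in_prob M Y" "d > 0"
  obtains B where "B > 0" "\<forall>\<^sub>F n in sequentially. mostly M d (\<lambda>\<omega>. \<bar>Y n \<omega>\<bar> \<le> B)"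
  using assms unfolding bounded_in_prob_def by blast

lemma bounded_in_probI:
  "(\<And>d. d > 0 \<Longrightarrow> \<exists>B>0. \<forall>\<^sub>F n in sequentially. mostly M d (\<lambda>\<omega>. \<bar>Y n \<omega>\<bar> \<le> B)) \<Longrightarrow> bounded_in_prob M Y"
  unfolding bounded_in_prob_def by blast

lemma small_mono:
  assumes "small M Y" "\<forall>\<^sub>F n in sequentially. \<forall>\<omega>\<in>space M. \<bar>X n \<omega>\<bar> \<le> \<bar>Y n \<omega>\<bar>" shows "small M X"
proof (rule smallI)
  fix d :: real assume "d > 0"
  from smallD[OF assms(1) this] assms(2)
  show "\<forall>\<^sub>F n in sequentially. mostly M d (\<lambda>\<omega>. \<bar>X n \<omega>\<bar> \<le> d)"
    by eventually_elim (erule mostly_mono, force)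
qed

lemma bounded_in_prob_mono:
  assumes "bounded_in_prob M Y" "\<forall>\<^sub>F n in sequentially. \<forall>\<omega>\<in>space M. \<bar>X n \<omega>\<bar> \<le> \<bar>Y n \<omega>\<bar>" shows "bounded_in_prob M X"
proof (rule bounded_in_probI)
  fix d :: real assume "d > 0"
  with assms(1) obtain B where B: "B > 0" "\<forall>\<^sub>F n in sequentially. mostly M d (\<lambda>\<omega>. \<bar>Y n \<omega>\<bar> \<le> B)"
    by (rule bounded_in_probE)
  have "\<forall>\<^sub>F n in sequentially. mostly M d (\<lambda>\<omega>. \<bar>X n \<omega>\<bar> \<le> B)"
    using B(2) assms(2) by eventually_elim (erule mostly_mono, force)
  with B(1) show "\<exists>B>0. \<forall>\<^sub>F n in sequentially. mostly M d (\<lambda>\<omega>. \<bar>X n \<omega>\<bar> \<le> B)" by blast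
qed

context prob_space
begin

lemma small_add:
  assumes "small M X" "small M Y" shows "small M (\<lambda>n \<omega>. X n \<omega> + Y n \<omega>)"
proof (rule smallI)
  fix d :: real assume "d > 0"
  then have d: "d / 2 > 0" by simp
  from smallD[OF assms(1) d] smallD[OF assms(2) d]
  show "\<forall>\<^sub>F n in sequentially. mostly M d (\<lambda>\<omega>. \<bar>X n \<omega> + Y n \<omega>\<bar> \<le> d)"
    by eventually_elim (rule mostly_conj[OF prob_space_axioms], assumption, assumption, linarith, simp)
qed

lemma bounded_in_prob_add:
  assumes "bounded_in_prob M X" "bounded_in_prob M Y" shows "bounded_in_prob M (\<lambda>n \<omega>. X n \<omega> + Y n \<omega>)"
proof (rule bounded_in_probI)
  fix d :: real assume "d > 0"
  then have d: "d / 2 > 0" by simp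
  obtain A where A: "A > 0" "\<forall>\<^sub>F n in sequentially. mostly M (d / 2) (\<lambda>\<omega>. \<bar>X n \<omega>\<bar> \<le> A)"
    using assms(1) d by (rule bounded_in_probE)
  obtain B where B: "B > 0" "\<forall>\<^sub>F n in sequentially. mostly M (d / 2) (\<lambda>\<omega>. \<bar>Y n \<omega>\<bar> \<le> B)"
    using assms(2) d by (rule bounded_in_probE)
  have "\<forall>\<^sub>F n in sequentially. mostly M d (\<lambda>\<omega>. \<bar>X n \<omega> + Y n \<omega>\<bar> \<le> A + B)"
    using A(2) B(2)
    by eventually_elim (rule mostly_conj[OF prob_space_axioms], assumption, assumption, linarith, simp)
  moreover have "A + B > 0" using A B by simp
  ultimately show "\<exists>B>0. \<forall>\<^sub>F n in sequentially. mostly M d (\<lambda>\<omega>. \<bar>X n \<omega> + Y n \<omega>\<bar> \<le> B)" by blast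
qed

lemma small_mult:
  assumes "small M X" "bounded_in_prob M Y" shows "small M (\<lambda>n \<omega>. X n \<omega> * Y n \<omega>)"
proof (rule smallI)
  fix d :: real assume d: "d > 0"
  then obtain B where B: "B > 0" "\<forall>\<^sub>F n in sequentially. mostly M (d / 2) (\<lambda>\<omega>. \<bar>Y n \<omega>\<bar> \<le> B)"
    using bounded_in_probE[OF assms(2), of "d / 2"] by auto
  define e where "e = min (d / 2) (d / B)"
  have e: "e > 0" "e + d / 2 \<le> d" "e * B \<le> d" using d B(1) unfolding e_def by (auto simp: min_def field_simps)
  from smallD[OF assms(1) e(1)] B(2)
  show "\<forall>\<^sub>F n in sequentially. mostly M d (\<lambda>\<omega>. \<bar>X n \<omega> * Y n \<omega>\<bar> \<le> d)"
  proof eventually_elim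
    case (elim n)
    show ?case
    proof (rule mostly_conj[OF prob_space_axioms elim _ e(2)])
      fix \<omega> assume "\<bar>X n \<omega>\<bar> \<le> e" "\<bar>Y n \<omega>\<bar> \<le> B"
      then have "\<bar>X n \<omega> * Y n \<omega>\<bar> \<le> e * B" unfolding abs_mult using e B by (intro mult_mono) auto
      then show "\<bar>X n \<omega> * Y n \<omega>\<bar> \<le> d" using e by simp
    qed
  qed
qed

lemma bounded_in_prob_const: "bounded_in_prob M (\<lambda>n \<omega>. c)"
  by (rule bounded_in_probI, rule exI[of _ "\<bar>c\<bar> + 1"]) (auto intro!: mostly_all)

lemma small_seq: assumes "c \<longlonglongrightarrow> 0" shows "small M (\<lambda>n \<omega>. c n)"
proof (rule smallI)
  fix d :: real assume "d > 0"
  then have "\<forall>\<^sub>F n in sequentially. \<bar>c n\<bar> < d" using tendstoD[OF assms] by (simp add: dist_real_def)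
  then show "\<forall>\<^sub>F n in sequentially. mostly M d (\<lambda>\<omega>. \<bar>c n\<bar> \<le> d)"
    by (rule eventually_mono) (use \<open>d > 0\<close> in \<open>auto intro!: mostly_all\<close>)
qed

lemma small_cmult: "small M X \<Longrightarrow> small M (\<lambda>n \<omega>. c * X n \<omega>)"
  using small_mult[OF _ bounded_in_prob_const[of c], of X] by (simp add: mult.commute)

lemma markov_mostly:
  assumes "integrable M Y" "\<And>\<omega>. \<omega> \<in> space M \<Longrightarrow> 0 \<le> Y \<omega>" "expectation Y \<le> a * b" "0 < b"
  shows "mostly M a (\<lambda>\<omega>. \<bar>Y \<omega>\<bar> \<le> b)"
  unfolding mostly_def
proof (intro bexI[of _ "{\<omega>\<in>space M. Y \<omega> \<ge> b}"] conjI ballI)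
  have [measurable]: "Y \<in> borel_measurable M" using assms(1) by auto
  show "{\<omega>\<in>space M. Y \<omega> \<ge> b} \<in> sets M" by measurable
  have "measure M {\<omega>\<in>space M. Y \<omega> \<ge> b} \<le> expectation Y / b"
    using assms by (intro integral_Markov_inequality_measure[where A = "{}"]) auto
  also have "\<dots> \<le> a" using assms(3,4) by (simp add: divide_le_eq)
  finally show "measure M {\<omega>\<in>space M. Y \<omega> \<ge> b} \<le> a" .
  fix \<omega> assume "\<omega> \<in> space M - {\<omega>\<in>space M. Y \<omega> \<ge> b}"
  then show "\<bar>Y \<omega>\<bar> \<le> b" using assms(2)[of \<omega>] by auto
qed

lemma small_of_expectation:
  assumes "\<forall>\<^sub>F n in sequentially. integrable M (Y n) \<and> (\<forall>\<omega>\<in>space M. 0 \<le> Y n \<omega>) \<and> expectation (Y n) \<le> c n"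
    and "c \<longlonglongrightarrow> 0"
  shows "small M Y"
proof (rule smallI)
  fix d :: real assume d: "d > 0"
  then have "\<forall>\<^sub>F n in sequentially. \<bar>c n\<bar> < d * d" using tendstoD[OF assms(2), of "d * d"] by (simp add: dist_real_def)
  with assms(1) show "\<forall>\<^sub>F n in sequentially. mostly M d (\<lambda>\<omega>. \<bar>Y n \<omega>\<bar> \<le> d)"
    by eventually_elim (rule markov_mostly, use d in auto)
qed

lemma bounded_in_prob_of_expectation:
  assumes "\<forall>\<^sub>F n in sequentially. integrable M (Y n) \<and> (\<forall>\<omega>\<in>space M. 0 \<le> Y n \<omega>) \<and> expectation (Y n) \<le> c"
  shows "bounded_in_prob M Y"
proof (rule bounded_in_probI)
  fix d :: real assume d: "d > 0"
  show "\<exists>B>0. \<forall>\<^sub>F n in sequentially. mostly M d (\<lambda>\<omega>. \<bar>Y n \<omega>\<bar> \<le> B)"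
  proof (intro exI[of _ "(\<bar>c\<bar> + 1) / d"] conjI)
    show "(\<bar>c\<bar> + 1) / d > 0" using d by (auto intro!: divide_pos_pos)
    with assms show "\<forall>\<^sub>F n in sequentially. mostly M d (\<lambda>\<omega>. \<bar>Y n \<omega>\<bar> \<le> (\<bar>c\<bar> + 1) / d)"
      by (elim eventually_mono) (rule markov_mostly, use d in auto)
  qed
qed

lemma small_imp_tendsto_in_prob:
  assumes "small M Y" shows "tendsto_in_prob M Y 0"
  unfolding tendsto_in_prob_def
proof (intro allI impI)
  fix d :: real assume d: "d > 0"
  show "(\<lambda>n. measure M {\<omega> \<in> space M. \<bar>Y n \<omega> - 0\<bar> > d}) \<longlonglongrightarrow> 0"
  proof (rule tendstoI)
    fix e :: real assume e: "e > 0"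
    define h where "h = min d (e / 2)"
    have h: "h > 0" "h \<le> d" "h < e" using d e unfolding h_def by auto
    show "\<forall>\<^sub>F n in sequentially. dist (measure M {\<omega> \<in> space M. \<bar>Y n \<omega> - 0\<bar> > d}) 0 < e"
      using smallD[OF assms h(1)]
    proof (rule eventually_mono)
      fix n assume "mostly M h (\<lambda>\<omega>. \<bar>Y n \<omega>\<bar> \<le> h)"
      then obtain A where A: "A \<in> sets M" "measure M A \<le> h" "\<forall>\<omega>\<in>space M - A. \<bar>Y n \<omega>\<bar> \<le> h"
        unfolding mostly_def by blast
      have "{\<omega> \<in> space M. \<bar>Y n \<omega> - 0\<bar> > d} \<subseteq> A" using A(3) h(2) by force
      \<comment> \<open>\<open>tendsto_in_prob\<close> does not ask for a measurable event; a
        non-measurable one has measure 0 by convention.\<close>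
      then have "measure M {\<omega> \<in> space M. \<bar>Y n \<omega> - 0\<bar> > d} \<le> measure M A"
        using A(1) by (cases "{\<omega> \<in> space M. \<bar>Y n \<omega> - 0\<bar> > d} \<in> sets M")
          (auto intro: finite_measure_mono simp: measure_notin_sets)
      then show "dist (measure M {\<omega> \<in> space M. \<bar>Y n \<omega> - 0\<bar> > d}) 0 < e" using A(2) h(3) by simp
    qed
  qed
qed

lemma tendsto_in_prob_imp_small:
  assumes "tendsto_in_prob M Y 0" "\<And>n. Y n \<in> borel_measurable M" shows "small M Y"
proof (rule smallI)
  fix d :: real assume d: "d > 0"
  have [measurable]: "Y n \<in> borel_measurable M" for n by (rule assms(2))
  have "(\<lambda>n. measure M {\<omega> \<in> space M. \<bar>Y n \<omega> - 0\<bar> > d}) \<longlonglongrightarrow> 0"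
    using assms(1) d unfolding tendsto_in_prob_def by blast
  then have "\<forall>\<^sub>F n in sequentially. measure M {\<omega> \<in> space M. \<bar>Y n \<omega> - 0\<bar> > d} < d"
    using d by (rule order_tendstoD)
  then show "\<forall>\<^sub>F n in sequentially. mostly M d (\<lambda>\<omega>. \<bar>Y n \<omega>\<bar> \<le> d)"
  proof (rule eventually_mono)
    fix n assume *: "measure M {\<omega> \<in> space M. \<bar>Y n \<omega> - 0\<bar> > d} < d"
    show "mostly M d (\<lambda>\<omega>. \<bar>Y n \<omega>\<bar> \<le> d)"
      unfolding mostly_def by (rule bexI[of _ "{\<omega> \<in> space M. \<bar>Y n \<omega> - 0\<bar> > d}"]) (use * in auto)
  qed
qed

lemma bounded_away_in_prob_inverse: assumes "bounded_away_in_prob M Y" shows "bounded_in_prob M (\<lambda>n \<omega>. 1 / Y n \<omega>)"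
proof (rule bounded_in_probI)
  fix d :: real assume "d > 0"
  then obtain c where c: "c > 0" "\<forall>\<^sub>F n in sequentially. mostly M d (\<lambda>\<omega>. c \<le> Y n \<omega>)"
    using assms unfolding bounded_away_in_prob_def by blast
  have "\<bar>1 / y\<bar> \<le> 1 / c" if "c \<le> y" for y using that c(1) by (simp add: frac_le)
  then have "\<forall>\<^sub>F n in sequentially. mostly M d (\<lambda>\<omega>. \<bar>1 / Y n \<omega>\<bar> \<le> 1 / c)"
    using c(2) by (elim eventually_mono) (erule mostly_mono, blast)
  then show "\<exists>B>0. \<forall>\<^sub>F n in sequentially. mostly M d (\<lambda>\<omega>. \<bar>1 / Y n \<omega>\<bar> \<le> B)"
    using c(1) by (intro exI[of _ "1 / c"]) auto
qed

lemma bounded_away_in_prob_diff: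
  assumes "bounded_away_in_prob M Y" "small M X" "\<forall>\<^sub>F n in sequentially. \<forall>\<omega>\<in>space M. Y n \<omega> - X n \<omega> \<le> Z n \<omega>" shows "bounded_away_in_prob M Z"
  unfolding bounded_away_in_prob_def
proof (intro allI impI)
  fix d :: real assume d: "d > 0"
  then have "d / 2 > 0" by simp
  then obtain c where c: "c > 0" "\<forall>\<^sub>F n in sequentially. mostly M (d / 2) (\<lambda>\<omega>. c \<le> Y n \<omega>)"
    using assms(1) unfolding bounded_away_in_prob_def by blast
  define e where "e = min (d / 2) (c / 2)"
  have e: "e > 0" "d / 2 + e \<le> d" "e \<le> c / 2" using c d unfolding e_def by auto
  have "\<forall>\<^sub>F n in sequentially. mostly M d (\<lambda>\<omega>. c / 2 \<le> Z n \<omega>)"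
    using c(2) smallD[OF assms(2) e(1)] assms(3)
  proof eventually_elim
    case (elim n)
    show ?case
    proof (rule mostly_conj[OF prob_space_axioms elim(1,2) _ e(2)])
      fix \<omega> assume "\<omega> \<in> space M" "c \<le> Y n \<omega>" "\<bar>X n \<omega>\<bar> \<le> e"
      then show "c / 2 \<le> Z n \<omega>" using elim(3) e(3) by force
    qed
  qed
  then show "\<exists>c>0. \<forall>\<^sub>F n in sequentially. mostly M d (\<lambda>\<omega>. c \<le> Z n \<omega>)"
    using c(1) by (intro exI[of _ "c / 2"]) auto
qed

end

section \<open>Slutsky's theorem and the law of a ratio\<close>

lemma cts_step_max_min: "a < b \<Longrightarrow> cts_step a b x = max 0 (min 1 ((b - x) / (b - a)))"
  unfolding cts_step_def by (auto simp: max_def min_def divide_simps)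

lemma cts_step_Lipschitz:
  assumes "a < b" shows "\<bar>cts_step a b x - cts_step a b y\<bar> \<le> \<bar>x - y\<bar> / (b - a)"
proof -
  have "\<bar>max 0 (min 1 u) - max 0 (min 1 v)\<bar> \<le> \<bar>u - v\<bar>" for u v :: real by (simp add: max_def min_def)
  then have "\<bar>cts_step a b x - cts_step a b y\<bar> \<le> \<bar>(b - x) / (b - a) - (b - y) / (b - a)\<bar>"
    by (simp only: cts_step_max_min[OF assms])
  also have "\<dots> = \<bar>x - y\<bar> / (b - a)"
    using assms by (simp add: diff_divide_distrib[symmetric] abs_divide abs_minus_commute)
  finally show ?thesis .
qed

lemma cts_step_range: "a < b \<Longrightarrow> 0 \<le> cts_step a b x" "a < b \<Longrightarrow> cts_step a b x \<le> 1"
  unfolding cts_step_def by (auto simp: field_simps)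

lemma cts_step_measurable [measurable]: "cts_step a b \<in> borel_measurable borel"
  unfolding cts_step_def[abs_def] by measurable

lemma (in prob_space) integrable_cts_step:
  assumes "a < b" "Y \<in> borel_measurable M" shows "integrable M (\<lambda>\<omega>. cts_step a b (Y \<omega>))"
  by (rule integrable_const_bound[of _ 1]) (use assms cts_step_range[OF assms(1)] in \<open>auto simp: abs_of_nonneg\<close>)

text \<open>The test functions lie between 0 and 1 and have Lipschitz constant
  \<open>1 / (b - a)\<close>, so the two expectations differ by at most the exceptional probability
  plus \<open>d / (b - a)\<close>. Measurability is asked only eventually, since the fit is under
  control only for large samples.\<close>

lemma (in prob_space) slutsky:
  assumes ab: "a < b" and s: "small M (\<lambda>n \<omega>. Y n \<omega> - V n \<omega>)"
    and mY: "\<forall>\<^sub>F n in sequentially. Y n \<in> borel_measurable M"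
    and mV: "\<forall>\<^sub>F n in sequentially. V n \<in> borel_measurable M"
    and lim: "(\<lambda>n. expectation (\<lambda>\<omega>. cts_step a b (V n \<omega>))) \<longlonglongrightarrow> L"
  shows "(\<lambda>n. expectation (\<lambda>\<omega>. cts_step a b (Y n \<omega>))) \<longlonglongrightarrow> L"
proof -
  have "(\<lambda>n. expectation (\<lambda>\<omega>. cts_step a b (Y n \<omega>)) - expectation (\<lambda>\<omega>. cts_step a b (V n \<omega>))) \<longlonglongrightarrow> 0"
  proof (rule tendstoI)
    fix e :: real assume e: "e > 0"
    define d where "d = min (e / 4) (e * (b - a) / 4)"
    have d: "d > 0" "d \<le> e / 4" "d / (b - a) \<le> e / 4"
      using e ab unfolding d_def by (auto simp: min_def field_simps)
    show "\<forall>\<^sub>F n in sequentially. dist (expectation (\<lambda>\<omega>. cts_step a b (Y n \<omega>)) - expectation (\<lambda>\<omega>. cts_step a b (V n \<omega>))) 0 < e"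
      using smallD[OF s d(1)] mY mV
    proof eventually_elim
      case (elim n)
      then obtain A where A: "A \<in> sets M" "measure M A \<le> d" "\<forall>\<omega>\<in>space M - A. \<bar>Y n \<omega> - V n \<omega>\<bar> \<le> d"
        unfolding mostly_def by blast
      note i = integrable_cts_step[OF ab elim(2)] integrable_cts_step[OF ab elim(3)]
      have "\<bar>expectation (\<lambda>\<omega>. cts_step a b (Y n \<omega>)) - expectation (\<lambda>\<omega>. cts_step a b (V n \<omega>))\<bar>
         = \<bar>expectation (\<lambda>\<omega>. cts_step a b (Y n \<omega>) - cts_step a b (V n \<omega>))\<bar>"
        using i by simp
      also have "\<dots> \<le> expectation (\<lambda>\<omega>. \<bar>cts_step a b (Y n \<omega>) - cts_step a b (V n \<omega>)\<bar>)"
        by (rule integral_abs_bound)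
      also have "\<dots> \<le> expectation (\<lambda>\<omega>. e / 4 + indicator A \<omega>)"
      proof (rule integral_mono)
        show "integrable M (\<lambda>\<omega>. \<bar>cts_step a b (Y n \<omega>) - cts_step a b (V n \<omega>)\<bar>)" using i by auto
        show "integrable M (\<lambda>\<omega>. e / 4 + indicator A \<omega>)" using A(1)
          by (intro Bochner_Integration.integrable_add integrable_const integrable_real_indicator) (auto simp: emeasure_eq_measure)
        fix \<omega> assume w: "\<omega> \<in> space M"
        show "\<bar>cts_step a b (Y n \<omega>) - cts_step a b (V n \<omega>)\<bar> \<le> e / 4 + indicator A \<omega>"
        proof (cases "\<omega> \<in> A")
          case True
          then show ?thesis using cts_step_range[OF ab, of "Y n \<omega>"] cts_step_range[OF ab, of "V n \<omega>"] e by (simp add: abs_le_iff)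
        next
          case False
          then have "\<bar>Y n \<omega> - V n \<omega>\<bar> / (b - a) \<le> d / (b - a)" using A(3) w ab by (intro divide_right_mono) auto
          moreover have "indicator A \<omega> = (0::real)" using False by simp
          ultimately show ?thesis using cts_step_Lipschitz[OF ab, of "Y n \<omega>" "V n \<omega>"] d(3) by linarith
        qed
      qed
      also have "\<dots> = e / 4 + measure M A"
        using A(1) by (subst Bochner_Integration.integral_add)
          (auto simp: prob_space emeasure_eq_measure intro!: integrable_real_indicator)
      finally show ?case using A(2) d(2) e by (simp add: dist_real_def)
    qed
  qed
  from tendsto_add[OF this lim] show ?thesis by simp
qed

text \<open>The event \<open>A / B \<le> x\<close> lies between \<open>A - x B < 0\<close> and \<open>A - x B \<le> 0\<close>, so the law of a ratio is
  controlled by the laws of the linear combinations \<open>A - x B\<close>.\<close>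

lemma ratio_weak_conv:
  fixes A B :: "nat \<Rightarrow> 'a \<Rightarrow> real" and Nu De :: "'b \<Rightarrow> real"
  assumes M: "prob_space M" and N: "prob_space N"
    and mA: "\<forall>\<^sub>F n in sequentially. A n \<in> borel_measurable M \<and> B n \<in> borel_measurable M"
    and AB: "\<forall>\<^sub>F n in sequentially. \<forall>\<omega>\<in>space M. 0 \<le> B n \<omega> \<and> (B n \<omega> = 0 \<longrightarrow> A n \<omega> = 0) \<and> K n \<omega> = A n \<omega> / B n \<omega>"
    and [measurable]: "Nu \<in> borel_measurable N" "De \<in> borel_measurable N"
    and De: "AE \<omega> in N. 0 < De \<omega>"
    and conv: "\<And>x a b. a < b \<Longrightarrow> (\<lambda>n. integral\<^sup>L M (\<lambda>\<omega>. cts_step a b (A n \<omega> - x * B n \<omega>)))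
        \<longlonglongrightarrow> integral\<^sup>L N (\<lambda>\<omega>. cts_step a b (Nu \<omega> - x * De \<omega>))"
  shows "weak_conv_m (\<lambda>n. distr M borel (K n)) (distr N borel (\<lambda>\<omega>. Nu \<omega> / De \<omega>))"
  unfolding weak_conv_m_def weak_conv_def
proof (intro allI impI)
  interpret M: prob_space M by fact
  interpret N: prob_space N by fact
  let ?R = "\<lambda>\<omega>. Nu \<omega> / De \<omega>"
  interpret R: real_distribution "distr N borel ?R" by (rule N.real_distribution_distr) measurable
  fix x assume "isCont (cdf (distr N borel ?R)) x"
  then have "measure (distr N borel ?R) {x} = 0" by (simp add: R.isCont_cdf)
  then have Rx: "measure N {\<omega>\<in>space N. ?R \<omega> = x} = 0"
    by (subst (asm) measure_distr) (auto simp: vimage_def Int_def conj_commute)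
  define Y where "Y \<omega> = Nu \<omega> - x * De \<omega>" for \<omega>
  have [measurable]: "Y \<in> borel_measurable N" unfolding Y_def[abs_def] by measurable
  \<comment> \<open>At the finitely many indices without measurability \<open>Z\<close> is set to 0,
    so that its law is a genuine distribution throughout.\<close>
  define G where "G n \<longleftrightarrow> A n \<in> borel_measurable M \<and> B n \<in> borel_measurable M" for n
  define Z where "Z n = (if G n then (\<lambda>\<omega>. A n \<omega> - x * B n \<omega>) else (\<lambda>\<omega>. 0))" for n
  have Zm [measurable]: "Z n \<in> borel_measurable M" for n by (auto simp: Z_def G_def)
  interpret Zd: real_distribution "distr M borel (Z n)" for n by (rule M.real_distribution_distr) measurable
  interpret Yd: real_distribution "distr N borel Y" by (rule N.real_distribution_distr) measurable
  have wc: "weak_conv_m (\<lambda>n. distr M borel (Z n)) (distr N borel Y)"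
  proof (rule integral_cts_step_conv_imp_weak_conv)
    fix a b :: real assume ab: "a < b"
    have "\<forall>\<^sub>F n in sequentially. integral\<^sup>L M (\<lambda>\<omega>. cts_step a b (A n \<omega> - x * B n \<omega>)) = integral\<^sup>L (distr M borel (Z n)) (cts_step a b)"
      using mA by eventually_elim (subst integral_distr, auto simp: Z_def G_def)
    with conv[OF ab, of x] have "(\<lambda>n. integral\<^sup>L (distr M borel (Z n)) (cts_step a b)) \<longlonglongrightarrow> integral\<^sup>L N (\<lambda>\<omega>. cts_step a b (Nu \<omega> - x * De \<omega>))"
      by (rule Lim_transform_eventually)
    then show "(\<lambda>n. integral\<^sup>L (distr M borel (Z n)) (cts_step a b)) \<longlonglongrightarrow> integral\<^sup>L (distr N borel Y) (cts_step a b)"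
      by (subst integral_distr) (auto simp: Y_def)
  qed (rule Zd.real_distribution_axioms Yd.real_distribution_axioms)+
  have De': "AE \<omega> in N. (Y \<omega> = 0 \<longleftrightarrow> ?R \<omega> = x) \<and> (Y \<omega> \<le> 0 \<longleftrightarrow> ?R \<omega> \<le> x)"
    using De by eventually_elim (auto simp: Y_def field_simps)
  \<comment> \<open>A continuity point of the law of the ratio carries no atom. As \<open>De\<close>
    is positive almost surely, this says that \<open>Y\<close> has no atom at 0, so both half-lines
    ending at 0 are continuity sets.\<close>
  have Y0: "measure N {\<omega>\<in>space N. Y \<omega> = 0} = 0"
    using Rx by (subst (asm) N.finite_measure_eq_AE[where B = "{\<omega>\<in>space N. Y \<omega> = 0}"]) (use De' in auto)
  have YR: "measure N {\<omega>\<in>space N. Y \<omega> \<le> 0} = cdf (distr N borel ?R) x"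
    unfolding cdf_def
    by (subst measure_distr, simp, simp, rule N.finite_measure_eq_AE) (use De' in auto)
  have Yd0: "emeasure (distr N borel Y) {0} = 0"
    using Y0 by (subst Yd.emeasure_eq_measure, subst measure_distr) (auto simp: vimage_def Int_def conj_commute)
  have fr: "emeasure (distr N borel Y) (frontier {..<0}) = 0" "emeasure (distr N borel Y) (frontier {..0}) = 0"
    using Yd0 by simp_all
  have 1: "(\<lambda>n. measure (distr M borel (Z n)) {..0}) \<longlonglongrightarrow> measure (distr N borel Y) {..0}"
    by (rule weak_conv_imp_continuity_set_conv[OF _ _ wc])
      (use fr in \<open>auto intro: Zd.real_distribution_axioms Yd.real_distribution_axioms\<close>)
  have 2: "(\<lambda>n. measure (distr M borel (Z n)) {..<0}) \<longlonglongrightarrow> measure (distr N borel Y) {..<0}"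
    by (rule weak_conv_imp_continuity_set_conv[OF _ _ wc])
      (use fr in \<open>auto intro: Zd.real_distribution_axioms Yd.real_distribution_axioms\<close>)
  have Y1: "measure (distr N borel Y) {..0} = cdf (distr N borel ?R) x"
    by (subst measure_distr, simp, simp, subst YR[symmetric]) (auto intro!: arg_cong[where f = "measure N"])
  have "{..0} = insert 0 {..<0::real}" by auto
  then have "measure (distr N borel Y) {..0} = measure (distr N borel Y) {0} + measure (distr N borel Y) {..<0}"
    using Yd.finite_measure_Union[of "{0}" "{..<0}"] by simp
  then have Y2: "measure (distr N borel Y) {..<0} = cdf (distr N borel ?R) x"
    using Y1 Yd0 by (simp add: measure_def)
  have ev: "\<forall>\<^sub>F n in sequentially. measure (distr M borel (Z n)) {..<0} \<le> cdf (distr M borel (K n)) x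
      \<and> cdf (distr M borel (K n)) x \<le> measure (distr M borel (Z n)) {..0}"
    using mA AB
  proof eventually_elim
    case (elim n)
    have Kn: "K n \<omega> = A n \<omega> / B n \<omega>" if "\<omega> \<in> space M" for \<omega> using elim that by blast
    have "(\<lambda>\<omega>. A n \<omega> / B n \<omega>) \<in> borel_measurable M" using elim by auto
    then have [measurable]: "K n \<in> borel_measurable M" using measurable_cong[of M "K n", OF Kn] by simp
    have Zn: "Z n \<omega> = A n \<omega> - x * B n \<omega>" for \<omega> using elim by (simp add: Z_def G_def)
    \<comment> \<open>Where \<open>B n\<close> vanishes so does \<open>A n\<close>; then
      \<open>Z n\<close> is 0, the first premise fails and the second conclusion holds.\<close>
    have s: "Z n \<omega> < 0 \<Longrightarrow> K n \<omega> \<le> x" "K n \<omega> \<le> x \<Longrightarrow> Z n \<omega> \<le> 0" if w: "\<omega> \<in> space M" for \<omega>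
    proof -
      have "0 \<le> B n \<omega>" "B n \<omega> = 0 \<longrightarrow> A n \<omega> = 0" using elim w by auto
      then show "Z n \<omega> < 0 \<Longrightarrow> K n \<omega> \<le> x" "K n \<omega> \<le> x \<Longrightarrow> Z n \<omega> \<le> 0"
        unfolding Zn Kn[OF w] by (cases "B n \<omega> = 0", auto simp: field_simps)+
    qed
    show ?case
      unfolding cdf_def by (auto simp: measure_distr intro!: M.finite_measure_mono s)
  qed
  show "(\<lambda>n. cdf (distr M borel (K n)) x) \<longlonglongrightarrow> cdf (distr N borel ?R) x"
    by (rule tendsto_sandwich[OF _ _ 2[unfolded Y2] 1[unfolded Y1]]) (use ev in \<open>auto elim: eventually_mono\<close>)
qed

subsection \<open>Joint convergence of independent variables\<close>

text \<open>The two measures agree on boxes, since a componentwise preimage of a box is a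
  box.\<close>

lemma distr_PiM_componentwise:
  fixes \<Omega> :: "'i \<Rightarrow> 'a measure" and f :: "'i \<Rightarrow> 'a \<Rightarrow> real"
  assumes I: "finite I" and p: "\<And>i. prob_space (\<Omega> i)" and [measurable]: "\<And>i. f i \<in> borel_measurable (\<Omega> i)"
  shows "distr (PiM I \<Omega>) (PiM I (\<lambda>_. borel)) (\<lambda>y. \<lambda>i\<in>I. f i (y i)) = PiM I (\<lambda>i. distr (\<Omega> i) borel (f i))"
proof -
  interpret P: product_prob_space \<Omega> I by (rule product_prob_spaceI) (rule p)
  have q: "prob_space (distr (\<Omega> i) borel (f i))" for i by (intro prob_space.prob_space_distr p) simp
  interpret Q: product_prob_space "\<lambda>i. distr (\<Omega> i) borel (f i)" I
    by (rule product_prob_spaceI) (rule q)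
  have [measurable]: "(\<lambda>y. \<lambda>i\<in>I. f i (y i)) \<in> measurable (PiM I \<Omega>) (PiM I (\<lambda>_. borel))"
    by (intro measurable_restrict) measurable
  show ?thesis
  proof (rule Q.PiM_eqI[OF I])
    show "sets (distr (PiM I \<Omega>) (PiM I (\<lambda>_. borel)) (\<lambda>y. \<lambda>i\<in>I. f i (y i))) = sets (PiM I (\<lambda>i. distr (\<Omega> i) borel (f i)))"
      unfolding sets_distr by (intro sets_PiM_cong) auto
    fix A :: "'i \<Rightarrow> real set" assume "\<And>i. i \<in> I \<Longrightarrow> A i \<in> sets (distr (\<Omega> i) borel (f i))"
    then have A: "\<And>i. i \<in> I \<Longrightarrow> A i \<in> sets borel" by simp
    have "emeasure (distr (PiM I \<Omega>) (PiM I (\<lambda>_. borel)) (\<lambda>y. \<lambda>i\<in>I. f i (y i))) (Pi\<^sub>E I A)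
      = emeasure (PiM I \<Omega>) ((\<lambda>y. \<lambda>i\<in>I. f i (y i)) -` Pi\<^sub>E I A \<inter> space (PiM I \<Omega>))"
      using A I by (intro emeasure_distr sets_PiM_I_finite) auto
    also have "(\<lambda>y. \<lambda>i\<in>I. f i (y i)) -` Pi\<^sub>E I A \<inter> space (PiM I \<Omega>) = Pi\<^sub>E I (\<lambda>i. f i -` A i \<inter> space (\<Omega> i))"
      by (auto simp: space_PiM PiE_iff extensional_def)
    also have "emeasure (PiM I \<Omega>) \<dots> = (\<Prod>i\<in>I. emeasure (\<Omega> i) (f i -` A i \<inter> space (\<Omega> i)))"
      by (intro P.emeasure_PiM I measurable_sets[OF assms(3)] A)
    also have "\<dots> = (\<Prod>i\<in>I. emeasure (distr (\<Omega> i) borel (f i)) (A i))"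
      using A by (intro prod.cong refl) (simp add: emeasure_distr)
    finally show "emeasure (distr (PiM I \<Omega>) (PiM I (\<lambda>_. borel)) (\<lambda>y. \<lambda>i\<in>I. f i (y i))) (Pi\<^sub>E I A)
      = (\<Prod>i\<in>I. emeasure (distr (\<Omega> i) borel (f i)) (A i))" .
  qed
qed

text \<open>Skorohod representations of the coordinates, placed on a product space, turn weak convergence
  of each coordinate into pointwise convergence of the whole vector.\<close>

lemma indep_vector_convergence:
  fixes V :: "nat \<Rightarrow> nat \<Rightarrow> 'a \<Rightarrow> real" and Z :: "nat \<Rightarrow> 'b \<Rightarrow> real" and g :: "(nat \<Rightarrow> real) \<Rightarrow> real"
  assumes M: "prob_space M" and N: "prob_space N" and m: "0 < m"
    and V: "\<And>n i. V n i \<in> borel_measurable M" and Z: "\<And>i. i < m \<Longrightarrow> Z i \<in> borel_measurable N"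
    and iV: "\<And>n. prob_space.indep_vars M (\<lambda>_. borel) (V n) {..<m}"
    and iZ: "prob_space.indep_vars N (\<lambda>_. borel) Z {..<m}"
    and nu: "real_distribution \<nu>"
    and wc: "\<And>i. weak_conv_m (\<lambda>n. distr M borel (V n i)) \<nu>"
    and dZ: "\<And>i. i < m \<Longrightarrow> distr N borel (Z i) = \<nu>"
    and gm [measurable]: "g \<in> borel_measurable (PiM {..<m} (\<lambda>_. borel))"
    and gb: "\<And>u. \<bar>g u\<bar> \<le> B"
    and gc: "\<And>u v. (\<And>i. i < m \<Longrightarrow> (\<lambda>n. u n i) \<longlonglongrightarrow> v i) \<Longrightarrow> (\<lambda>n. g (u n)) \<longlonglongrightarrow> g v"
  shows "(\<lambda>n. integral\<^sup>L M (\<lambda>\<omega>. g (\<lambda>i\<in>{..<m}. V n i \<omega>))) \<longlonglongrightarrow> integral\<^sup>L N (\<lambda>\<omega>. g (\<lambda>i\<in>{..<m}. Z i \<omega>))"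
proof -
  interpret M: prob_space M by fact
  interpret N: prob_space N by fact
  let ?I = "{..<m}"
  have I: "finite ?I" "?I \<noteq> {}" using m by auto
  have rdV: "real_distribution (distr M borel (V n i))" for n i by (rule M.real_distribution_distr[OF V])
  \<comment> \<open>One representation per coordinate, on unrelated spaces; their product then
    restores independence.\<close>
  have "\<exists>\<Omega> Ys Y. prob_space (\<Omega> :: real measure) \<and> (\<forall>n. Ys n \<in> measurable \<Omega> borel) \<and>
    (\<forall>n. distr \<Omega> borel (Ys n) = distr M borel (V n i)) \<and> Y \<in> measurable \<Omega> lborel \<and>
    distr \<Omega> borel Y = \<nu> \<and> (\<forall>x \<in> space \<Omega>. (\<lambda>n. Ys n x) \<longlonglongrightarrow> (Y x :: real))" for i
    by (rule Skorohod[OF rdV nu wc])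
  then obtain \<Omega> Ys Y where S: "\<And>i. prob_space (\<Omega> i :: real measure)" "\<And>i n. Ys i n \<in> borel_measurable (\<Omega> i)"
    "\<And>i n. distr (\<Omega> i) borel (Ys i n) = distr M borel (V n i)" "\<And>i. Y i \<in> measurable (\<Omega> i) lborel"
    "\<And>i. distr (\<Omega> i) borel (Y i) = \<nu>" "\<And>i x. x \<in> space (\<Omega> i) \<Longrightarrow> (\<lambda>n. Ys i n x) \<longlonglongrightarrow> (Y i x :: real)"
    by metis
  have Ym: "Y i \<in> borel_measurable (\<Omega> i)" for i using S(4)[of i] by simp
  let ?P = "PiM ?I \<Omega>"
  interpret P: product_prob_space \<Omega> ?I by (rule product_prob_spaceI) (rule S)
  interpret PP: prob_space ?P by (rule P.prob_space_axioms)
  have mS: "(\<lambda>y. \<lambda>i\<in>?I. Ys i n (y i)) \<in> measurable ?P (PiM ?I (\<lambda>_. borel))" for n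
    using S(2) by (intro measurable_restrict) (auto intro: measurable_compose[OF measurable_component_singleton])
  have mY: "(\<lambda>y. \<lambda>i\<in>?I. Y i (y i)) \<in> measurable ?P (PiM ?I (\<lambda>_. borel))"
    using Ym by (intro measurable_restrict) (auto intro: measurable_compose[OF measurable_component_singleton])
  have mV: "(\<lambda>\<omega>. \<lambda>i\<in>?I. V n i \<omega>) \<in> measurable M (PiM ?I (\<lambda>_. borel))" for n
    using V by (intro measurable_restrict) auto
  have mZ: "(\<lambda>\<omega>. \<lambda>i\<in>?I. Z i \<omega>) \<in> measurable N (PiM ?I (\<lambda>_. borel))"
    using Z by (intro measurable_restrict) auto
  \<comment> \<open>Independence makes the joint law the product of the marginals, and these are
    shared by the Skorohod copies.\<close>
  have eV: "integral\<^sup>L M (\<lambda>\<omega>. g (\<lambda>i\<in>?I. V n i \<omega>)) = integral\<^sup>L ?P (\<lambda>y. g (\<lambda>i\<in>?I. Ys i n (y i)))" for n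
  proof -
    have "distr M (PiM ?I (\<lambda>_. borel)) (\<lambda>\<omega>. \<lambda>i\<in>?I. V n i \<omega>) = PiM ?I (\<lambda>i. distr M borel (V n i))"
      using M.indep_vars_iff_distr_eq_PiM'[OF I(2), of "V n" "\<lambda>_. borel"] V iV by auto
    also have "\<dots> = distr ?P (PiM ?I (\<lambda>_. borel)) (\<lambda>y. \<lambda>i\<in>?I. Ys i n (y i))"
      using distr_PiM_componentwise[OF I(1) S(1), of "\<lambda>i. Ys i n"] S(2,3) by simp
    finally show ?thesis
      using integral_distr[OF mV gm, of n] integral_distr[OF mS gm, of n] by simp
  qed
  have eZ: "integral\<^sup>L N (\<lambda>\<omega>. g (\<lambda>i\<in>?I. Z i \<omega>)) = integral\<^sup>L ?P (\<lambda>y. g (\<lambda>i\<in>?I. Y i (y i)))"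
  proof -
    have "distr N (PiM ?I (\<lambda>_. borel)) (\<lambda>\<omega>. \<lambda>i\<in>?I. Z i \<omega>) = PiM ?I (\<lambda>i. distr N borel (Z i))"
      using N.indep_vars_iff_distr_eq_PiM'[OF I(2), of Z "\<lambda>_. borel"] Z iZ by auto
    also have "\<dots> = PiM ?I (\<lambda>i. distr (\<Omega> i) borel (Y i))"
      using dZ S(5) by (intro PiM_cong) auto
    also have "\<dots> = distr ?P (PiM ?I (\<lambda>_. borel)) (\<lambda>y. \<lambda>i\<in>?I. Y i (y i))"
      using distr_PiM_componentwise[OF I(1) S(1), of Y] Ym by simp
    finally show ?thesis
      using integral_distr[OF mZ gm] integral_distr[OF mY gm] by simp
  qed
  show ?thesis
    unfolding eV eZ
  proof (rule integral_dominated_convergence[where w = "\<lambda>_. B"])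
    show "(\<lambda>y. g (\<lambda>i\<in>?I. Y i (y i))) \<in> borel_measurable ?P" by (rule measurable_compose[OF mY gm])
    show "(\<lambda>y. g (\<lambda>i\<in>?I. Ys i n (y i))) \<in> borel_measurable ?P" for n by (rule measurable_compose[OF mS gm])
    show "AE y in ?P. (\<lambda>n. g (\<lambda>i\<in>?I. Ys i n (y i))) \<longlonglongrightarrow> g (\<lambda>i\<in>?I. Y i (y i))"
      by (intro AE_I2 gc) (auto simp: space_PiM PiE_iff intro!: S(6))
  qed (auto simp: gb)
qed

subsection \<open>Random walks\<close>

text \<open>Increments have unit variance and are indexed from 0; the noises of the model enter
  after division by their scale and a shift of the index.\<close>

locale iid_walk = prob_space M for M :: "'a measure" +
  fixes \<xi> :: "nat \<Rightarrow> 'a \<Rightarrow> real"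
  assumes indep: "indep_vars (\<lambda>_. borel) \<xi> UNIV"
    and mean: "\<And>n. expectation (\<xi> n) = 0"
    and sq_int: "\<And>n. integrable M (\<lambda>\<omega>. (\<xi> n \<omega>)\<^sup>2)"
    and var: "\<And>n. expectation (\<lambda>\<omega>. (\<xi> n \<omega>)\<^sup>2) = 1"
    and ident: "\<And>n. distr M borel (\<xi> n) = distr M borel (\<xi> 0)"
begin

definition R :: "nat \<Rightarrow> 'a \<Rightarrow> real" where
  "R n \<omega> = (\<Sum>i<n. \<xi> i \<omega>)"

lemma xi_measurable [measurable]: "\<xi> n \<in> borel_measurable M"
  using indep unfolding indep_vars_def2 by simp

lemma R_measurable [measurable]: "R n \<in> borel_measurable M"
  unfolding R_def[abs_def] by measurable

lemma xi_integrable: "integrable M (\<xi> n)"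
  by (rule square_integrable_imp_integrable[OF _ sq_int]) simp

lemma xi_product: "integrable M (\<lambda>\<omega>. \<xi> i \<omega> * \<xi> j \<omega>)" "expectation (\<lambda>\<omega>. \<xi> i \<omega> * \<xi> j \<omega>) = of_bool (i = j)"
proof -
  have "integrable M (\<lambda>\<omega>. \<xi> i \<omega> * \<xi> j \<omega>) \<and> expectation (\<lambda>\<omega>. \<xi> i \<omega> * \<xi> j \<omega>) = of_bool (i = j)"
  proof (cases "i = j")
    case True
    then show ?thesis using sq_int[of j] var[of j] by (simp add: power2_eq_square)
  next
    case False
    have *: "indep_vars (\<lambda>_. borel) \<xi> {i, j}" by (rule indep_vars_subset[OF indep]) simp
    show ?thesis
      using indep_vars_integrable[OF _ *] indep_vars_lebesgue_integral[OF _ *] False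
      by (simp add: xi_integrable mean)
  qed
  then show "integrable M (\<lambda>\<omega>. \<xi> i \<omega> * \<xi> j \<omega>)" "expectation (\<lambda>\<omega>. \<xi> i \<omega> * \<xi> j \<omega>) = of_bool (i = j)" by auto
qed

text \<open>The increments are orthonormal. Arbitrary weights are allowed so that alternating signs
  are covered too.\<close>

lemma weighted_second_moment:
  assumes "finite I"
  shows "integrable M (\<lambda>\<omega>. (\<Sum>i\<in>I. c i * \<xi> i \<omega>)\<^sup>2)"
    and "expectation (\<lambda>\<omega>. (\<Sum>i\<in>I. c i * \<xi> i \<omega>)\<^sup>2) = (\<Sum>i\<in>I. (c i)\<^sup>2)"
proof -
  have e: "(\<Sum>i\<in>I. c i * \<xi> i \<omega>)\<^sup>2 = (\<Sum>i\<in>I. \<Sum>j\<in>I. (c i * c j) * (\<xi> i \<omega> * \<xi> j \<omega>))" for \<omega>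
    by (simp add: power2_eq_square sum_product mult_ac)
  show "integrable M (\<lambda>\<omega>. (\<Sum>i\<in>I. c i * \<xi> i \<omega>)\<^sup>2)" unfolding e by (intro Bochner_Integration.integrable_sum integrable_mult_right xi_product)
  have "expectation (\<lambda>\<omega>. (\<Sum>i\<in>I. c i * \<xi> i \<omega>)\<^sup>2) = (\<Sum>i\<in>I. \<Sum>j\<in>I. (c i * c j) * of_bool (i = j))"
    unfolding e by (simp add: Bochner_Integration.integral_sum xi_product)
  also have "\<dots> = (\<Sum>i\<in>I. (c i)\<^sup>2)"
    using assms by (simp add: sum.delta' power2_eq_square of_bool_def if_distrib cong: if_cong)
  finally show "expectation (\<lambda>\<omega>. (\<Sum>i\<in>I. c i * \<xi> i \<omega>)\<^sup>2) = (\<Sum>i\<in>I. (c i)\<^sup>2)" .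
qed

lemma R_diff: "a \<le> b \<Longrightarrow> R b \<omega> - R a \<omega> = (\<Sum>i\<in>{a..<b}. \<xi> i \<omega>)"
  unfolding R_def using sum_diff[of "{..<b}" "{..<a}" "\<lambda>i. \<xi> i \<omega>"]
  by (simp add: lessThan_minus_lessThan)

lemma R_increment:
  assumes "a \<le> b"
  shows "integrable M (\<lambda>\<omega>. (R b \<omega> - R a \<omega>)\<^sup>2)" "expectation (\<lambda>\<omega>. (R b \<omega> - R a \<omega>)\<^sup>2) = real b - real a"
  using weighted_second_moment[of "{a..<b}" "\<lambda>_. 1"] assms by (simp_all add: R_diff of_nat_diff)

lemma R_0 [simp]: "R 0 \<omega> = 0" by (simp add: R_def)

lemma R_sq: "integrable M (\<lambda>\<omega>. (R n \<omega>)\<^sup>2)" "expectation (\<lambda>\<omega>. (R n \<omega>)\<^sup>2) = real n"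
  using R_increment[of 0 n] by simp_all

lemma R_clt: "weak_conv_m (\<lambda>n. distr M borel (\<lambda>\<omega>. R n \<omega> / sqrt (real n))) std_normal_distribution"
proof -
  have "variance (\<xi> n) = 1\<^sup>2" for n using var mean by simp
  then have "weak_conv_m (\<lambda>n. distr M borel (\<lambda>x. (\<Sum>i<n. \<xi> i x) / sqrt (real n * 1\<^sup>2))) std_normal_distribution"
    by (intro central_limit_theorem_zero_mean[where \<mu> = "distr M borel (\<xi> 0)"] indep mean sq_int ident) auto
  then show ?thesis by (simp add: R_def[abs_def])
qed

text \<open>The characteristic function of a sum of i.i.d. increments depends on their number, not
  on their position.\<close>

lemma distr_R_increment: "distr M borel (\<lambda>\<omega>. R (a + n) \<omega> - R a \<omega>) = distr M borel (R n)"
proof (rule Levy_uniqueness)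
  show "real_distribution (distr M borel (\<lambda>\<omega>. R (a + n) \<omega> - R a \<omega>))" by (rule real_distribution_distr) measurable
  show "real_distribution (distr M borel (R n))" by (rule real_distribution_distr) measurable
  have c: "char (distr M borel (\<lambda>\<omega>. \<Sum>i\<in>I. \<xi> i \<omega>)) t = char (distr M borel (\<xi> 0)) t ^ card I" for I t
  proof -
    have "char (distr M borel (\<xi> i)) t = char (distr M borel (\<xi> 0)) t" for i by (simp only: ident[of i])
    then have "(\<Prod>i\<in>I. char (distr M borel (\<xi> i)) t) = char (distr M borel (\<xi> 0)) t ^ card I"
      unfolding prod_constant[symmetric] by (rule prod.cong[OF refl])
    then show ?thesis using char_distr_sum[OF indep_vars_subset[OF indep], of I t] by simp
  qed
  show "char (distr M borel (\<lambda>\<omega>. R (a + n) \<omega> - R a \<omega>)) = char (distr M borel (R n))"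
    unfolding R_diff[OF le_add1] unfolding R_def[abs_def] by (rule ext) (simp only: c card_atLeastLessThan card_lessThan add_diff_cancel_left')
qed

text \<open>The increment has the law of \<open>R (len T)\<close>. Divided by
  \<open>sqrt (len T)\<close> it obeys the central limit theorem along the diverging sequence
  \<open>len\<close>, and the deterministic factor \<open>sqrt (len T / T)\<close> is exchanged for
  its limit \<open>sqrt c\<close> by Slutsky's theorem.\<close>

lemma scaled_clt:
  fixes len st :: "nat \<Rightarrow> nat"
  assumes c: "0 \<le> c" and lim: "(\<lambda>T. real (len T) / real T) \<longlonglongrightarrow> c" and inf: "filterlim len at_top sequentially"
  shows "weak_conv_m (\<lambda>T. distr M borel (\<lambda>\<omega>. (R (st T + len T) \<omega> - R (st T) \<omega>) / sqrt (real T)))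
    (distr std_normal_distribution borel (\<lambda>x. sqrt c * x))"
proof (rule integral_cts_step_conv_imp_weak_conv)
  interpret S: real_distribution std_normal_distribution by (rule real_dist_normal_dist)
  show "real_distribution (distr M borel (\<lambda>\<omega>. (R (st T + len T) \<omega> - R (st T) \<omega>) / sqrt (real T)))" for T
    by (rule real_distribution_distr) measurable
  have sm: "(\<lambda>x. sqrt c * x) \<in> borel_measurable std_normal_distribution" by simp
  then show "real_distribution (distr std_normal_distribution borel (\<lambda>x. sqrt c * x))"
    by (rule S.real_distribution_distr)
  fix a b :: real assume ab: "a < b"
  define Y where "Y n \<omega> = R n \<omega> / sqrt (real n)" for n \<omega>
  have [measurable]: "Y n \<in> borel_measurable M" for n unfolding Y_def[abs_def] by measurable
  have rd: "real_distribution (distr M borel (Y n))" for n by (rule real_distribution_distr) measurable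
  have wY: "weak_conv_m (\<lambda>n. distr M borel (Y n)) std_normal_distribution"
    using R_clt by (simp add: Y_def[abs_def])
  have cont: "isCont (\<lambda>x. cts_step a b (sqrt c * x)) x" for x
  proof -
    have "continuous_on UNIV (\<lambda>x. cts_step a b (sqrt c * x))"
      unfolding cts_step_max_min[OF ab] by (intro continuous_intros) (use ab in auto)
    then show ?thesis by (simp add: continuous_on_eq_continuous_at)
  qed
  have "(\<lambda>n. integral\<^sup>L (distr M borel (Y n)) (\<lambda>x. cts_step a b (sqrt c * x))) \<longlonglongrightarrow>
      integral\<^sup>L std_normal_distribution (\<lambda>x. cts_step a b (sqrt c * x))"
    by (rule weak_conv_imp_integral_bdd_continuous_conv[OF rd real_dist_normal_dist wY cont, of 1])
      (use cts_step_range[OF ab] in \<open>auto simp: abs_of_nonneg\<close>)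
  then have "(\<lambda>n. expectation (\<lambda>\<omega>. cts_step a b (sqrt c * Y n \<omega>))) \<longlonglongrightarrow>
      integral\<^sup>L std_normal_distribution (\<lambda>x. cts_step a b (sqrt c * x))"
    by (simp add: integral_distr)
  then have L: "(\<lambda>T. expectation (\<lambda>\<omega>. cts_step a b (sqrt c * Y (len T) \<omega>))) \<longlonglongrightarrow>
      integral\<^sup>L std_normal_distribution (\<lambda>x. cts_step a b (sqrt c * x))"
    by (rule filterlim_compose[OF _ inf])
  define d where "d T = sqrt (real (len T) / real T)" for T
  have "d \<longlonglongrightarrow> sqrt c" unfolding d_def[abs_def] by (rule tendsto_real_sqrt[OF lim])
  then have "(\<lambda>T. d T - sqrt c) \<longlonglongrightarrow> 0" by (simp add: LIM_zero)
  moreover have "bounded_in_prob M (\<lambda>T \<omega>. Y (len T) \<omega>)"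
  proof (rule bounded_in_prob_mono)
    \<comment> \<open>\<open>|y| <= 1 + y^2\<close> turns a bound on second moments into boundedness
      in probability.\<close>
    show "bounded_in_prob M (\<lambda>T \<omega>. 1 + (Y (len T) \<omega>)\<^sup>2)"
    proof (rule bounded_in_prob_of_expectation[where c = 2], rule always_eventually, intro allI conjI ballI)
      fix T
      have e: "(Y n \<omega>)\<^sup>2 = (R n \<omega>)\<^sup>2 / real n" for n \<omega> by (simp add: Y_def power_divide)
      show "integrable M (\<lambda>\<omega>. 1 + (Y (len T) \<omega>)\<^sup>2)" unfolding e by (auto intro!: R_sq)
      show "expectation (\<lambda>\<omega>. 1 + (Y (len T) \<omega>)\<^sup>2) \<le> 2"
        unfolding e by (subst Bochner_Integration.integral_add) (auto simp: R_sq prob_space)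
    qed auto
    have "\<bar>y\<bar> \<le> \<bar>1 + y\<^sup>2\<bar>" for y :: real
    proof -
      have "0 \<le> (\<bar>y\<bar> - 1)\<^sup>2" by simp
      then show ?thesis by (simp add: power2_diff)
    qed
    then show "\<forall>\<^sub>F T in sequentially. \<forall>\<omega>\<in>space M. \<bar>Y (len T) \<omega>\<bar> \<le> \<bar>1 + (Y (len T) \<omega>)\<^sup>2\<bar>" by simp
  qed
  ultimately have "small M (\<lambda>T \<omega>. (d T - sqrt c) * Y (len T) \<omega>)" by (rule small_mult[OF small_seq])
  then have sm2: "small M (\<lambda>T \<omega>. d T * Y (len T) \<omega> - sqrt c * Y (len T) \<omega>)" by (simp add: left_diff_distrib)
  have "(\<lambda>T. expectation (\<lambda>\<omega>. cts_step a b (d T * Y (len T) \<omega>))) \<longlonglongrightarrow>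
      integral\<^sup>L std_normal_distribution (\<lambda>x. cts_step a b (sqrt c * x))"
    by (rule slutsky[OF ab sm2 _ _ L]) auto
  moreover have "expectation (\<lambda>\<omega>. cts_step a b (d T * Y (len T) \<omega>)) =
     integral\<^sup>L (distr M borel (\<lambda>\<omega>. (R (st T + len T) \<omega> - R (st T) \<omega>) / sqrt (real T))) (cts_step a b)" for T
  proof -
    \<comment> \<open>For \<open>len T = 0\<close> both sides vanish, since \<open>R 0\<close> is
      0.\<close>
    have "d T * Y (len T) \<omega> = R (len T) \<omega> / sqrt (real T)" for \<omega>
      by (cases "len T = 0") (simp_all add: d_def Y_def real_sqrt_divide)
    then have "expectation (\<lambda>\<omega>. cts_step a b (d T * Y (len T) \<omega>)) = integral\<^sup>L (distr M borel (R (len T))) (\<lambda>x. cts_step a b (x / sqrt (real T)))"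
      by (simp add: integral_distr)
    also have "\<dots> = expectation (\<lambda>\<omega>. cts_step a b ((R (st T + len T) \<omega> - R (st T) \<omega>) / sqrt (real T)))"
      unfolding distr_R_increment[of "st T", symmetric] by (subst integral_distr) auto
    finally show ?thesis by (simp add: integral_distr)
  qed
  ultimately show "(\<lambda>T. integral\<^sup>L (distr M borel (\<lambda>\<omega>. (R (st T + len T) \<omega> - R (st T) \<omega>) / sqrt (real T))) (cts_step a b))
    \<longlonglongrightarrow> integral\<^sup>L (distr std_normal_distribution borel (\<lambda>x. sqrt c * x)) (cts_step a b)"
    using sm by (simp add: integral_distr)
qed

end

subsection \<open>Convergence of the functional along the walk\<close>

lemma sq_norm_measurable:
  assumes [measurable]: "(\<lambda>(\<omega>, s). w \<omega> s) \<in> borel_measurable (M \<Otimes>\<^sub>M U)"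
  shows "(\<lambda>\<omega>. sq_norm (w \<omega>)) \<in> borel_measurable M"
  unfolding sq_norm_def by measurable

lemma detrend_joint_measurable:
  assumes [measurable]: "(\<lambda>(\<omega>, s). w \<omega> s) \<in> borel_measurable (M \<Otimes>\<^sub>M U)"
  shows "(\<lambda>(\<omega>, s). detrend G r (w \<omega>) s) \<in> borel_measurable (M \<Otimes>\<^sub>M U)"
proof -
  have [measurable]: "(\<lambda>s. s) \<in> borel_measurable U" by (rule measurable_U_borel) simp
  show ?thesis unfolding detrend_def coef_def by measurable
qed

lemma primitive_joint_measurable:
  assumes [measurable]: "(\<lambda>(\<omega>, s). w \<omega> s) \<in> borel_measurable (M \<Otimes>\<^sub>M U)"
  shows "(\<lambda>(\<omega>, s). primitive (w \<omega>) s) \<in> borel_measurable (M \<Otimes>\<^sub>M U)"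
proof -
  have [measurable]: "(\<lambda>s. s) \<in> borel_measurable U" by (rule measurable_U_borel) simp
  show ?thesis unfolding primitive_def by measurable
qed

lemma Phi_measurable:
  assumes "(\<lambda>(\<omega>, s). w \<omega> s) \<in> borel_measurable (M \<Otimes>\<^sub>M U)"
  shows "(\<lambda>\<omega>. sq_norm (detrend G r (w \<omega>))) \<in> borel_measurable M"
    and "(\<lambda>\<omega>. sq_norm (primitive (detrend G r (w \<omega>)))) \<in> borel_measurable M"
    and "(\<lambda>\<omega>. Phi G r x (w \<omega>)) \<in> borel_measurable M"
proof -
  show 1: "(\<lambda>\<omega>. sq_norm (detrend G r (w \<omega>))) \<in> borel_measurable M"
    by (rule sq_norm_measurable[OF detrend_joint_measurable[OF assms]])
  show 2: "(\<lambda>\<omega>. sq_norm (primitive (detrend G r (w \<omega>)))) \<in> borel_measurable M"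
    by (rule sq_norm_measurable[OF primitive_joint_measurable[OF detrend_joint_measurable[OF assms]]])
  show "(\<lambda>\<omega>. Phi G r x (w \<omega>)) \<in> borel_measurable M"
    unfolding Phi_def using 1 2 by measurable
qed

text \<open>Tonelli exchanges the expectation with the integral over \<open>U\<close>, so a second
  moment bound at each time suffices; working with nonnegative integrals first yields integrability
  as well.\<close>

lemma (in prob_space) expectation_sq_norm_le:
  assumes m: "(\<lambda>(\<omega>, s). w \<omega> s) \<in> borel_measurable (M \<Otimes>\<^sub>M U)"
    and b: "\<And>\<omega>. \<omega> \<in> space M \<Longrightarrow> bounded_meas (w \<omega>)"
    and e: "\<And>s. 0 \<le> s \<Longrightarrow> s < 1 \<Longrightarrow> integrable M (\<lambda>\<omega>. (w \<omega> s)\<^sup>2) \<and> expectation (\<lambda>\<omega>. (w \<omega> s)\<^sup>2) \<le> c"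
  shows "integrable M (\<lambda>\<omega>. sq_norm (w \<omega>))" "expectation (\<lambda>\<omega>. sq_norm (w \<omega>)) \<le> c"
proof -
  interpret P: pair_sigma_finite M U by standard
  have c: "0 \<le> c"
  proof -
    have "0 \<le> expectation (\<lambda>\<omega>. (w \<omega> 0)\<^sup>2)" by (rule integral_nonneg_AE) auto
    also have "\<dots> \<le> c" using e[of 0] by auto
    finally show ?thesis .
  qed
  have [measurable]: "(\<lambda>\<omega>. sq_norm (w \<omega>)) \<in> borel_measurable M" by (rule sq_norm_measurable[OF m])
  have [measurable]: "(\<lambda>(\<omega>, s). ennreal ((w \<omega> s)\<^sup>2)) \<in> borel_measurable (M \<Otimes>\<^sub>M U)"
    using m by measurable
  have "(\<integral>\<^sup>+\<omega>. ennreal (sq_norm (w \<omega>)) \<partial>M) = (\<integral>\<^sup>+\<omega>. \<integral>\<^sup>+s. ennreal ((w \<omega> s)\<^sup>2) \<partial>U \<partial>M)"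
    unfolding sq_norm_def using b by (intro nn_integral_cong nn_integral_eq_integral[symmetric]) auto
  also have "\<dots> = (\<integral>\<^sup>+s. \<integral>\<^sup>+\<omega>. ennreal ((w \<omega> s)\<^sup>2) \<partial>M \<partial>U)"
    using P.Fubini'[of "\<lambda>\<omega> s. ennreal ((w \<omega> s)\<^sup>2)"] by simp
  also have "\<dots> \<le> (\<integral>\<^sup>+s. ennreal c \<partial>U)"
  proof (rule nn_integral_mono)
    fix s assume "s \<in> space U"
    then have i: "integrable M (\<lambda>\<omega>. (w \<omega> s)\<^sup>2)" and l: "expectation (\<lambda>\<omega>. (w \<omega> s)\<^sup>2) \<le> c" using e[of s] by auto
    show "(\<integral>\<^sup>+\<omega>. ennreal ((w \<omega> s)\<^sup>2) \<partial>M) \<le> ennreal c"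
      by (subst nn_integral_eq_integral[OF i]) (auto intro!: ennreal_leI l)
  qed
  also have "\<dots> = ennreal c" using U.emeasure_space_1 by simp
  finally have *: "(\<integral>\<^sup>+\<omega>. ennreal (sq_norm (w \<omega>)) \<partial>M) \<le> ennreal c" .
  show i: "integrable M (\<lambda>\<omega>. sq_norm (w \<omega>))"
    by (rule integrableI_nonneg) (use * in \<open>auto intro: le_less_trans\<close>)
  show "expectation (\<lambda>\<omega>. sq_norm (w \<omega>)) \<le> c"
    using * c by (subst (asm) nn_integral_eq_integral[OF i]) (auto simp: ennreal_le_iff)
qed

text \<open>In \<open>Phi_diff_le\<close> the parameter \<open>l\<close> is fixed first, large
  compared with the norms, and only then is \<open>f n\<close> taken close to
  \<open>g\<close>.\<close>

lemma Phi_tendsto: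
  assumes b: "\<And>n. bounded_meas (f n)" "bounded_meas g" and lim: "(\<lambda>n. sq_norm (\<lambda>s. f n s - g s)) \<longlonglongrightarrow> 0"
  shows "(\<lambda>n. Phi G r x (f n)) \<longlonglongrightarrow> Phi G r x g"
proof (rule LIM_zero_cancel, rule tendstoI)
  fix e :: real assume e: "e > 0"
  define C where "C = (1 + \<bar>x\<bar>) * detrend_bound G r"
  have C: "0 \<le> C" unfolding C_def by simp
  \<comment> \<open>Once \<open>f n\<close> is within squared distance 1 of \<open>g\<close>, its
    squared norm is at most \<open>2 + 2 * sq_norm g\<close>; adding \<open>sq_norm g\<close> gives
    \<open>K\<close>.\<close>
  define K where "K = 3 * sq_norm g + 2"
  have K: "0 < K" unfolding K_def using sq_norm_nonneg[of g] by linarith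
  define l where "l = 2 * (C * K + 1) / e"
  have l: "0 < l" unfolding l_def using e C K by (auto intro!: divide_pos_pos add_nonneg_pos)
  have CK: "C * (K / l) < e / 2"
  proof -
    have "C * K + 1 > 0" using C K by (intro add_nonneg_pos) auto
    then have "C * (K / l) = (e / 2) * (C * K / (C * K + 1))" unfolding l_def using e by (simp add: field_simps)
    also have "\<dots> < (e / 2) * 1" using e \<open>C * K + 1 > 0\<close> by (intro mult_strict_left_mono) (auto simp: divide_less_eq)
    finally show ?thesis by simp
  qed
  have "e / (2 * (C * l + 1)) > 0" using e C l by (auto intro!: divide_pos_pos add_nonneg_pos)
  then have "0 < min 1 (e / (2 * (C * l + 1)))" by simp
  from order_tendstoD(2)[OF lim this]
  show "\<forall>\<^sub>F n in sequentially. dist (Phi G r x (f n) - Phi G r x g) 0 < e"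
  proof eventually_elim
    case (elim n)
    let ?d = "sq_norm (\<lambda>s. f n s - g s)"
    have fK: "sq_norm (f n) + sq_norm g \<le> K"
      using sq_norm_add_le[of "\<lambda>s. f n s - g s" g] b elim by (simp add: K_def bounded_meas_diff)
    have "\<bar>Phi G r x (f n) - Phi G r x g\<bar> \<le> C * (l * ?d + (sq_norm (f n) + sq_norm g) / l)"
      unfolding C_def by (rule Phi_diff_le[OF b(1) b(2) l])
    also have "\<dots> \<le> C * (l * ?d + K / l)"
      using fK C l by (intro mult_left_mono add_left_mono divide_right_mono) auto
    also have "\<dots> = (C * l) * ?d + C * (K / l)" by (simp add: algebra_simps)
    also have "(C * l) * ?d \<le> (C * l + 1) * ?d" by (simp add: algebra_simps)
    also have "\<dots> \<le> e / 2"
    proof -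
      have "0 < 2 * (C * l + 1)" using C l by (intro mult_pos_pos add_nonneg_pos) auto
      then have "?d * (2 * (C * l + 1)) < e" using elim by (simp add: pos_less_divide_eq)
      then show ?thesis by (simp add: algebra_simps)
    qed
    finally have "\<bar>Phi G r x (f n) - Phi G r x g\<bar> < e" using CK by linarith
    then show ?case by (simp add: dist_real_def)
  qed
qed

text \<open>The increment \<open>u i\<close> counts from time \<open>(i + 1) / m\<close> on. For the
  increments of a path this is the path frozen at the last grid point, so \<open>m\<close> numbers
  determine the whole function.\<close>

definition stepm :: "nat \<Rightarrow> (nat \<Rightarrow> real) \<Rightarrow> real \<Rightarrow> real" where
  "stepm m u s = (\<Sum>i<m. if real i + 1 \<le> real m * s then u i else 0)"

lemma stepm_restrict [simp]: "stepm m (\<lambda>i\<in>{..<m}. u i) = stepm m u"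
  by (auto simp: fun_eq_iff stepm_def intro!: sum.cong)

lemma stepm_abs_le: "\<bar>stepm m u s\<bar> \<le> (\<Sum>i<m. \<bar>u i\<bar>)"
  unfolding stepm_def by (intro order_trans[OF sum_abs] sum_mono) auto

lemma stepm_joint_measurable:
  assumes [measurable]: "\<And>i. i < m \<Longrightarrow> (\<lambda>\<omega>. V \<omega> i) \<in> borel_measurable M"
  shows "(\<lambda>(\<omega>, s). stepm m (V \<omega>) s) \<in> borel_measurable (M \<Otimes>\<^sub>M U)"
proof -
  have [measurable]: "(\<lambda>s. s) \<in> borel_measurable U" by (rule measurable_U_borel) simp
  have "(\<lambda>p. \<Sum>i<m. if real i + 1 \<le> real m * snd p then V (fst p) i else 0) \<in> borel_measurable (M \<Otimes>\<^sub>M U)"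
  proof (rule borel_measurable_sum)
    fix i assume "i \<in> {..<m}"
    then have [measurable]: "(\<lambda>\<omega>. V \<omega> i) \<in> borel_measurable M" by simp
    show "(\<lambda>p. if real i + 1 \<le> real m * snd p then V (fst p) i else 0) \<in> borel_measurable (M \<Otimes>\<^sub>M U)" by measurable
  qed
  then show ?thesis by (simp add: stepm_def case_prod_beta')
qed

lemma bounded_meas_stepm [intro!]: "bounded_meas (stepm m u)"
proof (rule bounded_measI)
  have "(\<lambda>s. \<Sum>i<m. if real i + 1 \<le> real m * s then u i else 0) \<in> borel_measurable borel" by measurable
  then show "stepm m u \<in> borel_measurable U" unfolding stepm_def[abs_def] by (rule measurable_U_borel)
qed (rule stepm_abs_le)

lemma stepm_diff: "stepm m u s - stepm m v s = stepm m (\<lambda>i. u i - v i) s"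
  unfolding stepm_def sum_subtractf[symmetric] by (intro sum.cong) auto

text \<open>\<open>stepm\<close> is linear in \<open>u\<close> and bounded in supremum by the sum of
  the \<open>|u i|\<close>. The functional thus becomes a continuous function of finitely many
  increments, as the joint limit theorem demands.\<close>

lemma Phi_stepm_continuous:
  assumes "\<And>i. i < m \<Longrightarrow> (\<lambda>n. u n i) \<longlonglongrightarrow> v i"
  shows "(\<lambda>n. Phi G r x (stepm m (u n))) \<longlonglongrightarrow> Phi G r x (stepm m v)"
proof (rule Phi_tendsto)
  have "(\<lambda>n. (\<Sum>i<m. \<bar>u n i - v i\<bar>)\<^sup>2) \<longlonglongrightarrow> (\<Sum>i<m. \<bar>v i - v i\<bar>)\<^sup>2"
    using assms by (intro tendsto_intros) auto
  then have lim: "(\<lambda>n. (\<Sum>i<m. \<bar>u n i - v i\<bar>)\<^sup>2) \<longlonglongrightarrow> 0" by simp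
  show "(\<lambda>n. sq_norm (\<lambda>s. stepm m (u n) s - stepm m v s)) \<longlonglongrightarrow> 0"
    by (rule tendsto_sandwich[OF _ _ tendsto_const lim])
      (auto simp: stepm_diff intro!: always_eventually sq_norm_bounded stepm_abs_le)
qed auto

lemma stepm_telescope:
  assumes m: "0 < m" and s: "0 \<le> s" "s < 1"
  shows "stepm m (\<lambda>i. f (Suc i) - f i) s = f (nat \<lfloor>real m * s\<rfloor>) - f 0"
proof -
  define k where "k = nat \<lfloor>real m * s\<rfloor>"
  have "real m * s < real m" using m s by simp
  then have km: "k \<le> m" unfolding k_def by linarith
  have iff: "real i + 1 \<le> real m * s \<longleftrightarrow> i < k" for i
  proof -
    have "0 \<le> real m * s" using s by simp
    then show ?thesis unfolding k_def by linarith
  qed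
  have "stepm m (\<lambda>i. f (Suc i) - f i) s = (\<Sum>i<k. f (Suc i) - f i)"
    unfolding stepm_def iff using km by (intro sum.mono_neutral_cong_right) auto
  then show ?thesis by (simp add: sum_lessThan_telescope k_def)
qed

lemma nat_div_bounds:
  fixes n m :: nat assumes "0 < m"
  shows "real (n div m) \<le> real n / real m" "real n / real m \<le> real (n div m) + 1"
proof -
  have "real n = real m * real (n div m) + real (n mod m)" by (metis mult_div_mod_eq of_nat_add of_nat_mult)
  moreover have "real (n mod m) \<le> real m" using assms by (simp add: less_imp_le)
  ultimately show "real (n div m) \<le> real n / real m" "real n / real m \<le> real (n div m) + 1"
    using assms by (simp_all add: field_simps)
qed

lemma floor_index: 
  assumes "0 < T" "0 \<le> s" "s < 1" shows "real (nat \<lfloor>real T * s\<rfloor>) \<le> real T * s" "real T * s < real (nat \<lfloor>real T * s\<rfloor>) + 1"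
proof -
  have "0 \<le> real T * s" using assms by simp
  then show "real (nat \<lfloor>real T * s\<rfloor>) \<le> real T * s" "real T * s < real (nat \<lfloor>real T * s\<rfloor>) + 1" by linarith+
qed

section \<open>Block approximation of the rescaled walk\<close>

context iid_walk
begin

text \<open>The value at the last completed step, so that the path starts at 0 like the Wiener
  process; as a step function its cell \<open>t\<close> carries \<open>R (t - 1)\<close>.\<close>

definition wT :: "nat \<Rightarrow> 'a \<Rightarrow> real \<Rightarrow> real" where
  "wT T \<omega> s = R (nat \<lfloor>real T * s\<rfloor>) \<omega> / sqrt (real T)"

lemma wT_joint_measurable: "(\<lambda>(\<omega>, s). wT T \<omega> s) \<in> borel_measurable (M \<Otimes>\<^sub>M U)"
proof -
  have [measurable]: "(\<lambda>s. s) \<in> borel_measurable U" by (rule measurable_U_borel) simp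
  have "(\<lambda>p. R (nat \<lfloor>real T * snd p\<rfloor>) (fst p)) \<in> borel_measurable (M \<Otimes>\<^sub>M U)"
    by (rule measurable_compose_countable[where f = "\<lambda>n p. R n (fst p)"]) measurable
  then show ?thesis unfolding wT_def case_prod_beta' by measurable
qed

lemma wT_step_fun: "wT T \<omega> = step_fun T (\<lambda>t. R (t - 1) \<omega> / sqrt (real T))"
  by (simp add: fun_eq_iff wT_def step_fun_def)

lemma bounded_meas_wT [intro]: "T > 0 \<Longrightarrow> bounded_meas (wT T \<omega>)"
  unfolding wT_step_fun by auto

lemma wT_sq_norm: assumes T: "T > 0"
  shows "integrable M (\<lambda>\<omega>. sq_norm (wT T \<omega>))" "expectation (\<lambda>\<omega>. sq_norm (wT T \<omega>)) \<le> 1"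
proof -
  have e: "integrable M (\<lambda>\<omega>. (wT T \<omega> s)\<^sup>2) \<and> expectation (\<lambda>\<omega>. (wT T \<omega> s)\<^sup>2) \<le> 1" if s: "0 \<le> s" "s < 1" for s
  proof -
    have "real T * s \<le> real T" using s by (simp add: mult_left_le)
    define n where "n = nat \<lfloor>real T * s\<rfloor>"
    have "real n \<le> real T" using floor_index(1)[OF T s] \<open>real T * s \<le> real T\<close> unfolding n_def by linarith
    then show ?thesis unfolding wT_def power_divide n_def[symmetric] using T
      by (simp add: R_sq divide_le_eq)
  qed
  show "integrable M (\<lambda>\<omega>. sq_norm (wT T \<omega>))" "expectation (\<lambda>\<omega>. sq_norm (wT T \<omega>)) \<le> 1"
    using expectation_sq_norm_le[OF wT_joint_measurable _ e] T by auto
qed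

text \<open>The blocks end at \<open>T * i div m\<close>, which works without divisibility of
  \<open>T\<close> by \<open>m\<close>.\<close>

definition VT :: "nat \<Rightarrow> nat \<Rightarrow> nat \<Rightarrow> 'a \<Rightarrow> real" where
  "VT m T i \<omega> = (R (T * Suc i div m) \<omega> - R (T * i div m) \<omega>) / sqrt (real T)"

lemma VT_measurable [measurable]: "VT m T i \<in> borel_measurable M"
  unfolding VT_def[abs_def] by measurable

lemma block_path:
  assumes "0 < m" "0 \<le> s" "s < 1"
  shows "stepm m (\<lambda>i. VT m T i \<omega>) s = R (T * nat \<lfloor>real m * s\<rfloor> div m) \<omega> / sqrt (real T)"
  using stepm_telescope[OF assms, of "\<lambda>i. R (T * i div m) \<omega> / sqrt (real T)"]
  by (simp add: VT_def diff_divide_distrib)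

text \<open>Rounding \<open>s\<close> down to the block grid costs at most \<open>1 / m\<close> in
  time, that is \<open>T / m\<close> steps, and the integer division at most one further
  step.\<close>

lemma block_index:
  assumes "0 < m" "0 < T" "0 \<le> s" "s < 1"
  shows "T * nat \<lfloor>real m * s\<rfloor> div m \<le> nat \<lfloor>real T * s\<rfloor>"
    and "real (nat \<lfloor>real T * s\<rfloor>) - real (T * nat \<lfloor>real m * s\<rfloor> div m) \<le> real T / real m + 1"
    and "real (T * nat \<lfloor>real m * s\<rfloor> div m) \<le> real T"
proof -
  let ?k = "nat \<lfloor>real m * s\<rfloor>" let ?q = "T * ?k div m"
  note km = floor_index[OF assms(1,3,4)] and kT = floor_index[OF assms(2-4)]
  have q1: "real ?q \<le> real T * real ?k / real m"
    using nat_div_bounds(1)[OF assms(1), of "T * ?k"] by simp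
  have "real T * real ?k / real m \<le> real T * (real m * s) / real m"
    using km by (intro divide_right_mono mult_left_mono) auto
  also have "\<dots> = real T * s" using assms by simp
  finally have q2: "real ?q \<le> real T * s" using q1 by simp
  then show "?q \<le> nat \<lfloor>real T * s\<rfloor>" by linarith
  have "real T * s \<le> real T" using assms by (simp add: mult_left_le)
  with q2 show "real ?q \<le> real T" by linarith
  have "real T * real ?k / real m \<le> real ?q + 1"
    using nat_div_bounds(2)[OF assms(1), of "T * ?k"] by simp
  moreover have "real T * s - real T / real m \<le> real T * real ?k / real m"
  proof -
    have "real T * (real m * s - 1) / real m \<le> real T * real ?k / real m"
      using km by (intro divide_right_mono mult_left_mono) auto
    then show ?thesis using assms by (simp add: right_diff_distrib diff_divide_distrib)
  qed
  ultimately show "real (nat \<lfloor>real T * s\<rfloor>) - real ?q \<le> real T / real m + 1" using kT by linarith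
qed

text \<open>The mean square of a walk increment is its number of steps, which
  \<open>block_index\<close> bounds by \<open>T / m + 1\<close>; the scaling divides this by
  \<open>T\<close>.\<close>

lemma block_approximation:
  assumes m: "0 < m" and T: "0 < T"
  shows "integrable M (\<lambda>\<omega>. sq_norm (\<lambda>s. wT T \<omega> s - stepm m (\<lambda>i. VT m T i \<omega>) s))"
    "expectation (\<lambda>\<omega>. sq_norm (\<lambda>s. wT T \<omega> s - stepm m (\<lambda>i. VT m T i \<omega>) s)) \<le> 1 / real m + 1 / real T"
    "integrable M (\<lambda>\<omega>. sq_norm (stepm m (\<lambda>i. VT m T i \<omega>)))"
    "expectation (\<lambda>\<omega>. sq_norm (stepm m (\<lambda>i. VT m T i \<omega>))) \<le> 1"
proof -
  have j: "(\<lambda>(\<omega>, s). stepm m (\<lambda>i. VT m T i \<omega>) s) \<in> borel_measurable (M \<Otimes>\<^sub>M U)"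
    by (rule stepm_joint_measurable) measurable
  have j2: "(\<lambda>(\<omega>, s). wT T \<omega> s - stepm m (\<lambda>i. VT m T i \<omega>) s) \<in> borel_measurable (M \<Otimes>\<^sub>M U)"
    using borel_measurable_diff[OF wT_joint_measurable j] by (simp add: case_prod_beta')
  have e1: "integrable M (\<lambda>\<omega>. (stepm m (\<lambda>i. VT m T i \<omega>) s)\<^sup>2) \<and> expectation (\<lambda>\<omega>. (stepm m (\<lambda>i. VT m T i \<omega>) s)\<^sup>2) \<le> 1"
    if s: "0 \<le> s" "s < 1" for s
    unfolding block_path[OF m s] power_divide using block_index(3)[OF m T s] T
    by (simp add: R_sq divide_le_eq)
  have e2: "integrable M (\<lambda>\<omega>. (wT T \<omega> s - stepm m (\<lambda>i. VT m T i \<omega>) s)\<^sup>2) \<and>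
      expectation (\<lambda>\<omega>. (wT T \<omega> s - stepm m (\<lambda>i. VT m T i \<omega>) s)\<^sup>2) \<le> 1 / real m + 1 / real T"
    if s: "0 \<le> s" "s < 1" for s
  proof -
    have "(real (nat \<lfloor>real T * s\<rfloor>) - real (T * nat \<lfloor>real m * s\<rfloor> div m)) / real T \<le> (real T / real m + 1) / real T"
      by (intro divide_right_mono block_index(2)[OF m T s]) simp
    also have "\<dots> = 1 / real m + 1 / real T" using T by (simp add: add_divide_distrib)
    finally show ?thesis
      unfolding block_path[OF m s] wT_def diff_divide_distrib[symmetric] power_divide
      using R_increment[OF block_index(1)[OF m T s]] by simp
  qed
  show "integrable M (\<lambda>\<omega>. sq_norm (\<lambda>s. wT T \<omega> s - stepm m (\<lambda>i. VT m T i \<omega>) s))"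
    "expectation (\<lambda>\<omega>. sq_norm (\<lambda>s. wT T \<omega> s - stepm m (\<lambda>i. VT m T i \<omega>) s)) \<le> 1 / real m + 1 / real T"
    using expectation_sq_norm_le[OF j2 _ e2] T by auto
  show "integrable M (\<lambda>\<omega>. sq_norm (stepm m (\<lambda>i. VT m T i \<omega>)))"
    "expectation (\<lambda>\<omega>. sq_norm (stepm m (\<lambda>i. VT m T i \<omega>))) \<le> 1"
    using expectation_sq_norm_le[OF j _ e1] T by auto
qed

lemma cts_step_block_error:
  assumes ab: "a < b" and m: "0 < m" and T: "0 < T"
  shows "\<bar>expectation (\<lambda>\<omega>. cts_step a b (Phi G r x (wT T \<omega>))) - expectation (\<lambda>\<omega>. cts_step a b (Phi G r x (stepm m (\<lambda>i. VT m T i \<omega>))))\<bar>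
    \<le> (1 + \<bar>x\<bar>) * detrend_bound G r / (b - a) * (3 / sqrt (real m) + sqrt (real m) / real T)"
proof -
  let ?w = "\<lambda>\<omega>. wT T \<omega>" and ?v = "\<lambda>\<omega>. stepm m (\<lambda>i. VT m T i \<omega>)"
  define C where "C = (1 + \<bar>x\<bar>) * detrend_bound G r"
  have C: "0 \<le> C / (b - a)" unfolding C_def using ab by simp
  \<comment> \<open>\<open>l = sqrt m\<close> balances the term \<open>l / m\<close> against
    \<open>2 / l\<close>; together they give \<open>3 / sqrt m\<close>.\<close>
  define l where "l = sqrt (real m)"
  have l: "0 < l" and ll: "l * l = real m" using m by (auto simp: l_def)
  have mw: "(\<lambda>\<omega>. Phi G r x (?w \<omega>)) \<in> borel_measurable M" by (rule Phi_measurable[OF wT_joint_measurable])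
  have mv: "(\<lambda>\<omega>. Phi G r x (?v \<omega>)) \<in> borel_measurable M" by (rule Phi_measurable[OF stepm_joint_measurable]) measurable
  note i = integrable_cts_step[OF ab mw] integrable_cts_step[OF ab mv]
  note bl = block_approximation[OF m T] wT_sq_norm[OF T]
  have "\<bar>expectation (\<lambda>\<omega>. cts_step a b (Phi G r x (?w \<omega>))) - expectation (\<lambda>\<omega>. cts_step a b (Phi G r x (?v \<omega>)))\<bar>
     = \<bar>expectation (\<lambda>\<omega>. cts_step a b (Phi G r x (?w \<omega>)) - cts_step a b (Phi G r x (?v \<omega>)))\<bar>"
    using i by simp
  also have "\<dots> \<le> expectation (\<lambda>\<omega>. \<bar>cts_step a b (Phi G r x (?w \<omega>)) - cts_step a b (Phi G r x (?v \<omega>))\<bar>)"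
    by (rule integral_abs_bound)
  also have "\<dots> \<le> expectation (\<lambda>\<omega>. C / (b - a) * (l * sq_norm (\<lambda>s. ?w \<omega> s - ?v \<omega> s) + (sq_norm (?w \<omega>) + sq_norm (?v \<omega>)) / l))"
  proof (rule integral_mono)
    show "integrable M (\<lambda>\<omega>. \<bar>cts_step a b (Phi G r x (?w \<omega>)) - cts_step a b (Phi G r x (?v \<omega>))\<bar>)" using i by auto
    show "integrable M (\<lambda>\<omega>. C / (b - a) * (l * sq_norm (\<lambda>s. ?w \<omega> s - ?v \<omega> s) + (sq_norm (?w \<omega>) + sq_norm (?v \<omega>)) / l))"
      using bl by (intro integrable_mult_right Bochner_Integration.integrable_add Bochner_Integration.integrable_divide) auto
    fix \<omega>
    have "\<bar>Phi G r x (?w \<omega>) - Phi G r x (?v \<omega>)\<bar> / (b - a) \<le> C * (l * sq_norm (\<lambda>s. ?w \<omega> s - ?v \<omega> s) + (sq_norm (?w \<omega>) + sq_norm (?v \<omega>)) / l) / (b - a)"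
      using T ab unfolding C_def by (intro divide_right_mono Phi_diff_le[OF _ _ l]) auto
    then show "\<bar>cts_step a b (Phi G r x (?w \<omega>)) - cts_step a b (Phi G r x (?v \<omega>))\<bar>
      \<le> C / (b - a) * (l * sq_norm (\<lambda>s. ?w \<omega> s - ?v \<omega> s) + (sq_norm (?w \<omega>) + sq_norm (?v \<omega>)) / l)"
      using cts_step_Lipschitz[OF ab, of "Phi G r x (?w \<omega>)" "Phi G r x (?v \<omega>)"] by simp
  qed
  also have "\<dots> = C / (b - a) * (l * expectation (\<lambda>\<omega>. sq_norm (\<lambda>s. ?w \<omega> s - ?v \<omega> s)) +
      (expectation (\<lambda>\<omega>. sq_norm (?w \<omega>)) + expectation (\<lambda>\<omega>. sq_norm (?v \<omega>))) / l)"
    using bl by simp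
  also have "\<dots> \<le> C / (b - a) * (l * (1 / real m + 1 / real T) + (1 + 1) / l)"
    using bl l C by (intro mult_left_mono add_mono divide_right_mono) auto
  also have "l * (1 / real m + 1 / real T) + (1 + 1) / l = 3 / l + l / real T"
    using l by (simp add: ll[symmetric] field_simps)
  finally show ?thesis by (simp add: C_def l_def)
qed

text \<open>Different blocks use disjoint sets of increments.\<close>

lemma block_indep: assumes m: "0 < m" shows "indep_vars (\<lambda>_. borel) (VT m T) {..<m}"
proof -
  define J where "J i = {T * i div m..<T * Suc i div m}" for i
  have mono: "T * i div m \<le> T * j div m" if "i \<le> j" for i j :: nat using that by (intro div_le_mono mult_le_mono) auto
  have dis: "disjoint_family_on J {..<m}"
    unfolding disjoint_family_on_def
  proof (intro ballI impI)
    fix i j :: nat assume "i \<noteq> j"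
    then consider "Suc i \<le> j" | "Suc j \<le> i" by linarith
    then show "J i \<inter> J j = {}" using mono[of "Suc i" j] mono[of "Suc j" i] unfolding J_def by cases auto
  qed
  have "indep_vars (\<lambda>j. PiM (J j) (\<lambda>_. borel)) (\<lambda>j \<omega>. restrict (\<lambda>i. \<xi> i \<omega>) (J j)) {..<m}"
    by (rule indep_vars_restrict[OF indep _ dis]) simp
  then have "indep_vars (\<lambda>_. borel) (\<lambda>j \<omega>. (\<lambda>x. (\<Sum>i\<in>J j. x i) / sqrt (real T)) (restrict (\<lambda>i. \<xi> i \<omega>) (J j))) {..<m}"
    by (rule indep_vars_compose2) measurable
  then show ?thesis
  proof (rule indep_vars_cong[THEN iffD1, rotated -1])
    fix i show "(\<lambda>\<omega>. (\<lambda>x. (\<Sum>i\<in>J i. x i) / sqrt (real T)) (restrict (\<lambda>i. \<xi> i \<omega>) (J i))) = VT m T i"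
      using R_diff[OF mono[of i "Suc i"]] by (simp add: VT_def J_def fun_eq_iff)
  qed auto
qed

lemma block_clt: assumes m: "0 < m"
  shows "weak_conv_m (\<lambda>T. distr M borel (VT m T i)) (distr std_normal_distribution borel (\<lambda>x. sqrt (1 / real m) * x))"
proof -
  define st where "st T = T * i div m" for T
  define len where "len T = T * Suc i div m - T * i div m" for T
  have le: "T * i div m \<le> T * Suc i div m" for T by (intro div_le_mono mult_le_mono) auto
  have sl: "st T + len T = T * Suc i div m" for T using le[of T] by (simp add: st_def len_def)
  \<comment> \<open>Both end points are rounded down by at most one step, so the length errs by at
    most one.\<close>
  have bd: "\<bar>real (len T) - real T / real m\<bar> \<le> 1" for T
  proof -
    have "real (T * Suc i div m) \<le> real (T * Suc i) / real m" "real (T * Suc i) / real m - real (T * Suc i div m) \<le> 1"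
      "real (T * i div m) \<le> real (T * i) / real m" "real (T * i) / real m - real (T * i div m) \<le> 1"
      using nat_div_bounds[OF m, of "T * Suc i"] nat_div_bounds[OF m, of "T * i"] by linarith+
    moreover have "real (T * Suc i) / real m = real (T * i) / real m + real T / real m"
      by (simp add: add_divide_distrib distrib_left add.commute)
    moreover have "real (len T) = real (T * Suc i div m) - real (T * i div m)" unfolding len_def using le[of T] by (simp add: of_nat_diff)
    ultimately show ?thesis by linarith
  qed
  have lim: "(\<lambda>T. real (len T) / real T) \<longlonglongrightarrow> 1 / real m"
  proof (rule LIM_zero_cancel, rule tendsto_sandwich[where f = "\<lambda>T. - (1 / real T)" and h = "\<lambda>T. 1 / real T"])
    have eq: "real (len T) / real T - 1 / real m = (real (len T) - real T / real m) / real T" if "T > 0" for T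
      using that by (simp add: diff_divide_distrib)
    show "\<forall>\<^sub>F T in sequentially. - (1 / real T) \<le> real (len T) / real T - 1 / real m"
      using eventually_gt_at_top[of 0]
    proof eventually_elim
      case (elim T)
      have "- 1 / real T \<le> (real (len T) - real T / real m) / real T" using bd[of T] by (intro divide_right_mono) auto
      then show ?case using eq[OF elim] by simp
    qed
    show "\<forall>\<^sub>F T in sequentially. real (len T) / real T - 1 / real m \<le> 1 / real T"
      using eventually_gt_at_top[of 0]
    proof eventually_elim
      case (elim T)
      have "(real (len T) - real T / real m) / real T \<le> 1 / real T" using bd[of T] by (intro divide_right_mono) auto
      then show ?case using eq[OF elim] by simp
    qed
  qed (auto intro: lim_1_over_n tendsto_minus_cancel_left[THEN iffD1] tendsto_eq_intros)
  have inf: "filterlim len at_top sequentially"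
    unfolding filterlim_at_top
  proof
    fix Z
    show "\<forall>\<^sub>F T in sequentially. Z \<le> len T"
      using eventually_ge_at_top[of "m * (Z + 1)"]
    proof eventually_elim
      case (elim T)
      have "real (m * (Z + 1)) \<le> real T" using elim by (simp only: of_nat_le_iff)
      then have "real Z + 1 \<le> real T / real m" using m by (simp add: field_simps)
      then show ?case using bd[of T] by linarith
    qed
  qed
  have "VT m T i = (\<lambda>\<omega>. (R (st T + len T) \<omega> - R (st T) \<omega>) / sqrt (real T))" for T
    unfolding sl by (simp add: VT_def st_def fun_eq_iff)
  then show ?thesis using scaled_clt[OF _ lim inf, of st] by simp
qed

end

subsection \<open>The Wiener process\<close>

text \<open>The normal density is at most 1, so the mass is at most the length of the
  interval.\<close>

lemma normal_ball_le:
  assumes "0 \<le> d" shows "measure std_normal_distribution {x. \<bar>x\<bar> \<le> d} \<le> 2 * d"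
proof -
  interpret S: real_distribution std_normal_distribution by (rule real_dist_normal_dist)
  have le1: "std_normal_density x \<le> 1" for x
  proof -
    have "1 / sqrt (2 * pi) * exp (- x\<^sup>2 / 2) \<le> 1 * 1"
      using pi_ge_two by (intro mult_mono) (auto simp: real_le_rsqrt)
    then show ?thesis by (simp add: std_normal_density_def)
  qed
  have eq: "{x. \<bar>x\<bar> \<le> d} = {-d..d}" by auto
  have "emeasure std_normal_distribution {-d..d} = (\<integral>\<^sup>+x. ennreal (std_normal_density x) * indicator {-d..d} x \<partial>lborel)"
    by (subst emeasure_density) auto
  also have "\<dots> \<le> (\<integral>\<^sup>+x. 1 * indicator {-d..d} x \<partial>lborel)"
    using le1 by (intro nn_integral_mono mult_right_mono) (auto simp: ennreal_le_1)
  also have "\<dots> = ennreal (2 * d)" using assms by simp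
  finally show ?thesis unfolding eq S.emeasure_eq_measure using assms by (simp add: ennreal_le_iff)
qed

lemma distr_normal_scale:
  assumes N: "prob_space N" and d: "distributed N lborel Z (normal_density 0 (sqrt v))" and v: "0 < v"
  shows "distr N borel Z = distr std_normal_distribution borel (\<lambda>x. sqrt v * x)"
    and "distr N borel (\<lambda>\<omega>. Z \<omega> / sqrt v) = std_normal_distribution"
proof -
  interpret N: prob_space N by fact
  interpret S: real_distribution std_normal_distribution by (rule real_dist_normal_dist)
  have Zm: "Z \<in> borel_measurable N" using distributed_measurable[OF d] by simp
  have "distributed N lborel (\<lambda>x. 0 + 1 / sqrt v * Z x) (normal_density (0 + 1 / sqrt v * 0) (\<bar>1 / sqrt v\<bar> * sqrt v))"
    using v by (intro N.normal_density_affine[OF d]) auto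
  then have "distributed N lborel (\<lambda>\<omega>. Z \<omega> / sqrt v) std_normal_density" using v by simp
  then have "distr N lborel (\<lambda>\<omega>. Z \<omega> / sqrt v) = std_normal_distribution" by (rule distributed_distr_eq_density)
  moreover have "distr N lborel (\<lambda>\<omega>. Z \<omega> / sqrt v) = distr N borel (\<lambda>\<omega>. Z \<omega> / sqrt v)" by (rule distr_cong) auto
  ultimately show 1: "distr N borel (\<lambda>\<omega>. Z \<omega> / sqrt v) = std_normal_distribution" by simp
  show "distr N borel Z = distr std_normal_distribution borel (\<lambda>x. sqrt v * x)"
    unfolding 1[symmetric] using v Zm by (subst distr_distr) (auto simp: comp_def)
qed

locale wiener = prob_space N for N :: "'b measure" +
  fixes W :: "real \<Rightarrow> 'b \<Rightarrow> real"
  assumes wiener: "wiener_process N W"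
begin

lemma W_measurable: "t \<in> {0..1} \<Longrightarrow> W t \<in> borel_measurable N"
  and W_0: "\<omega> \<in> space N \<Longrightarrow> W 0 \<omega> = 0"
  and W_cont: "\<omega> \<in> space N \<Longrightarrow> continuous_on {0..1} (\<lambda>t. W t \<omega>)"
  and W_normal: "0 \<le> s \<Longrightarrow> s < t \<Longrightarrow> t \<le> 1 \<Longrightarrow> distributed N lborel (\<lambda>\<omega>. W t \<omega> - W s \<omega>) (normal_density 0 (sqrt (t - s)))"
  and W_indep: "mono_on {..n} \<tau> \<Longrightarrow> \<tau> ` {..n} \<subseteq> {0..1} \<Longrightarrow>
    indep_vars (\<lambda>_. borel) (\<lambda>i \<omega>. W (\<tau> (Suc i)) \<omega> - W (\<tau> i) \<omega>) {..<n}"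
  using wiener unfolding wiener_process_def by blast+

definition Zm :: "nat \<Rightarrow> nat \<Rightarrow> 'b \<Rightarrow> real" where
  "Zm m i \<omega> = W (real (Suc i) / real m) \<omega> - W (real i / real m) \<omega>"

lemma Zm_measurable: "i < m \<Longrightarrow> Zm m i \<in> borel_measurable N"
  unfolding Zm_def[abs_def] by (intro borel_measurable_diff W_measurable) (auto simp: divide_le_eq)

lemma bounded_meas_W: "\<omega> \<in> space N \<Longrightarrow> bounded_meas (\<lambda>s. W s \<omega>)"
  by (intro bounded_meas_continuous_on W_cont)

lemma stepm_Zm:
  assumes "0 < m" "0 \<le> s" "s < 1" "\<omega> \<in> space N"
  shows "stepm m (\<lambda>i. Zm m i \<omega>) s = W (real (nat \<lfloor>real m * s\<rfloor>) / real m) \<omega>"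
  using stepm_telescope[OF assms(1-3), of "\<lambda>i. W (real i / real m) \<omega>"] W_0[OF assms(4)]
  by (simp add: Zm_def)

text \<open>Paths are uniformly continuous on the compact interval. The index \<open>Suc m\<close>
  avoids the empty grid.\<close>

lemma stepm_W_tendsto:
  assumes w: "\<omega> \<in> space N"
  shows "(\<lambda>m. sq_norm (\<lambda>s. stepm (Suc m) (\<lambda>i. Zm (Suc m) i \<omega>) s - W s \<omega>)) \<longlonglongrightarrow> 0"
proof (rule tendstoI)
  fix e :: real assume e: "e > 0"
  \<comment> \<open>Capping \<open>h\<close> at 1 gives \<open>h^2 <= h < e\<close>.\<close>
  define h where "h = min 1 (e / 2)"
  have h: "0 < h" "h \<le> 1" "h < e" using e unfolding h_def by auto
  have "uniformly_continuous_on {0..1} (\<lambda>t. W t \<omega>)"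
    by (rule compact_uniformly_continuous[OF W_cont[OF w]]) simp
  then obtain d where d: "0 < d" "\<And>s t. s \<in> {0..1} \<Longrightarrow> t \<in> {0..1} \<Longrightarrow> \<bar>t - s\<bar> < d \<Longrightarrow> \<bar>W t \<omega> - W s \<omega>\<bar> < h"
    using h(1) unfolding uniformly_continuous_on_def dist_real_def by metis
  have "(\<lambda>m. 1 / real (Suc m)) \<longlonglongrightarrow> 0" by (rule LIMSEQ_Suc[OF lim_1_over_n])
  from order_tendstoD(2)[OF this d(1)]
  show "\<forall>\<^sub>F m in sequentially. dist (sq_norm (\<lambda>s. stepm (Suc m) (\<lambda>i. Zm (Suc m) i \<omega>) s - W s \<omega>)) 0 < e"
  proof eventually_elim
    case (elim m)
    have "sq_norm (\<lambda>s. stepm (Suc m) (\<lambda>i. Zm (Suc m) i \<omega>) s - W s \<omega>) \<le> h\<^sup>2"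
    proof (rule sq_norm_bounded)
      show "bounded_meas (\<lambda>s. stepm (Suc m) (\<lambda>i. Zm (Suc m) i \<omega>) s - W s \<omega>)" using bounded_meas_W[OF w] by auto
      fix s :: real assume s: "0 \<le> s" "s < 1"
      define q where "q = real (nat \<lfloor>real (Suc m) * s\<rfloor>) / real (Suc m)"
      have f: "real (nat \<lfloor>real (Suc m) * s\<rfloor>) \<le> real (Suc m) * s" "real (Suc m) * s < real (nat \<lfloor>real (Suc m) * s\<rfloor>) + 1"
        using floor_index[of "Suc m" s] s by auto
      have q: "q \<le> s" "s < q + 1 / real (Suc m)" "0 \<le> q"
        using f unfolding q_def by (auto simp: field_simps)
      have "\<bar>W q \<omega> - W s \<omega>\<bar> < h" using q s elim by (intro d(2)) auto
      then show "\<bar>stepm (Suc m) (\<lambda>i. Zm (Suc m) i \<omega>) s - W s \<omega>\<bar> \<le> h"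
        using stepm_Zm[OF _ s w, of "Suc m"] by (simp add: q_def)
    qed
    also have "h\<^sup>2 \<le> h" using h by (simp add: power2_eq_square mult_left_le)
    finally show ?case using h by simp
  qed
qed

lemma Phi_W_tendsto:
  "\<omega> \<in> space N \<Longrightarrow> (\<lambda>m. Phi G r x (stepm (Suc m) (\<lambda>i. Zm (Suc m) i \<omega>))) \<longlonglongrightarrow> Phi G r x (\<lambda>s. W s \<omega>)"
  by (rule Phi_tendsto[OF _ bounded_meas_W stepm_W_tendsto]) auto

lemma Phi_stepm_measurable: "(\<lambda>\<omega>. Phi G r x (stepm m (\<lambda>i. Zm m i \<omega>))) \<in> borel_measurable N"
  by (rule Phi_measurable[OF stepm_joint_measurable[OF Zm_measurable]])

text \<open>The functional of a continuous path is a pointwise limit of functionals of finitely many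
  increments; this avoids joint measurability of \<open>W\<close> in time and sample.\<close>

lemma Phi_W_measurable: "(\<lambda>\<omega>. Phi G r x (\<lambda>s. W s \<omega>)) \<in> borel_measurable N"
  by (rule borel_measurable_LIMSEQ_real[OF Phi_W_tendsto Phi_stepm_measurable])

text \<open>\<open>Phi\<close> at \<open>x = 0\<close> is the numerator, and its value at 0 minus
  that at 1 is the denominator.\<close>

lemma Den_W_measurable: "(\<lambda>\<omega>. sq_norm (detrend G r (\<lambda>s. W s \<omega>))) \<in> borel_measurable N"
  and Num_W_measurable: "(\<lambda>\<omega>. sq_norm (primitive (detrend G r (\<lambda>s. W s \<omega>)))) \<in> borel_measurable N"
proof -
  have "sq_norm (detrend G r (\<lambda>s. W s \<omega>)) = Phi G r 0 (\<lambda>s. W s \<omega>) - Phi G r 1 (\<lambda>s. W s \<omega>)"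
    "sq_norm (primitive (detrend G r (\<lambda>s. W s \<omega>))) = Phi G r 0 (\<lambda>s. W s \<omega>)" for \<omega>
    by (simp_all add: Phi_def)
  then show "(\<lambda>\<omega>. sq_norm (detrend G r (\<lambda>s. W s \<omega>))) \<in> borel_measurable N"
    "(\<lambda>\<omega>. sq_norm (primitive (detrend G r (\<lambda>s. W s \<omega>)))) \<in> borel_measurable N"
    using borel_measurable_diff[OF Phi_W_measurable Phi_W_measurable] Phi_W_measurable by simp_all
qed

text \<open>\<open>W (1 / n)\<close> has standard deviation \<open>n powr (-1/2)\<close>, much larger than \<open>1 / n\<close>.\<close>

lemma W_not_lipschitz: "AE \<omega> in N. \<not> (\<exists>C. \<forall>s\<in>{0..1}. \<bar>W s \<omega>\<bar> \<le> C * s)"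
proof -
  \<comment> \<open>Only countably many times enter, so the event is measurable; every path that is
    Lipschitz at 0 belongs to some \<open>E k\<close>.\<close>
  define E where "E k = {\<omega>\<in>space N. \<forall>n. \<bar>W (1 / real (Suc n)) \<omega>\<bar> \<le> real k / real (Suc n)}" for k :: nat
  have [measurable]: "W (1 / real (Suc n)) \<in> borel_measurable N" for n by (rule W_measurable) simp
  have Es: "E k \<in> sets N" for k unfolding E_def by measurable
  have "measure N (E k) = 0" for k
  proof -
    \<comment> \<open>On \<open>E k\<close> the standard normal variable
      \<open>sqrt (n + 1) * W (1 / (n + 1))\<close> is at most \<open>k / sqrt (n + 1)\<close> in
      absolute value; letting \<open>n\<close> grow forces the probability to 0.\<close>
    have "measure N (E k) \<le> 2 * (real k / sqrt (real (Suc n)))" for n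
    proof -
      let ?v = "1 / real (Suc n)"
      have "distributed N lborel (\<lambda>\<omega>. W ?v \<omega> - W 0 \<omega>) (normal_density 0 (sqrt (?v - 0)))"
        by (rule W_normal) auto
      then have D: "distr N borel (\<lambda>\<omega>. (W ?v \<omega> - W 0 \<omega>) / sqrt ?v) = std_normal_distribution"
        using distr_normal_scale(2)[OF prob_space_axioms, of "\<lambda>\<omega>. W ?v \<omega> - W 0 \<omega>" ?v] by simp
      have [measurable]: "W 0 \<in> borel_measurable N" by (rule W_measurable) simp
      have "measure N (E k) \<le> measure N {\<omega>\<in>space N. \<bar>(W ?v \<omega> - W 0 \<omega>) / sqrt ?v\<bar> \<le> real k / sqrt (real (Suc n))}"
      proof (rule finite_measure_mono)
        show "E k \<subseteq> {\<omega>\<in>space N. \<bar>(W ?v \<omega> - W 0 \<omega>) / sqrt ?v\<bar> \<le> real k / sqrt (real (Suc n))}"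
        proof
          fix \<omega> assume "\<omega> \<in> E k"
          then have w: "\<omega> \<in> space N" and b: "\<bar>W ?v \<omega>\<bar> \<le> real k / real (Suc n)" unfolding E_def by blast+
          have "\<bar>(W ?v \<omega> - W 0 \<omega>) / sqrt ?v\<bar> = \<bar>W ?v \<omega>\<bar> * sqrt (real (Suc n))"
            using W_0[OF w] by (simp add: real_sqrt_divide abs_mult del: of_nat_Suc)
          also have "\<dots> \<le> (real k / real (Suc n)) * sqrt (real (Suc n))" using b by (intro mult_right_mono) auto
          also have "\<dots> = real k * (sqrt (real (Suc n)) / real (Suc n))" by simp
          also have "sqrt (real (Suc n)) / real (Suc n) = 1 / sqrt (real (Suc n))"
            by (subst real_div_sqrt[symmetric]) (auto simp del: of_nat_Suc simp: field_simps)
          finally show "\<omega> \<in> {\<omega>\<in>space N. \<bar>(W ?v \<omega> - W 0 \<omega>) / sqrt ?v\<bar> \<le> real k / sqrt (real (Suc n))}" using w by simp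
        qed
      qed measurable
      also have "\<dots> = measure (distr N borel (\<lambda>\<omega>. (W ?v \<omega> - W 0 \<omega>) / sqrt ?v)) {x. \<bar>x\<bar> \<le> real k / sqrt (real (Suc n))}"
        by (subst measure_distr, intro borel_measurable_divide borel_measurable_diff)
          (auto intro!: arg_cong[where f = "measure N"] W_measurable)
      also have "\<dots> \<le> 2 * (real k / sqrt (real (Suc n)))" unfolding D by (rule normal_ball_le) simp
      finally show ?thesis .
    qed
    moreover have "(\<lambda>n. 2 * (real k / sqrt (real (Suc n)))) \<longlonglongrightarrow> 0" by real_asymp
    ultimately have "measure N (E k) \<le> 0" by (intro LIMSEQ_le_const) auto
    then show ?thesis by (simp add: measure_le_0_iff)
  qed
  then have "E k \<in> null_sets N" for k using Es by (simp add: null_sets_def emeasure_eq_measure)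
  then have nul: "(\<Union>k. E k) \<in> null_sets N" by (rule null_sets_UN)
  have "\<omega> \<in> (\<Union>k. E k)" if w: "\<omega> \<in> space N" and C: "\<forall>s\<in>{0..1}. \<bar>W s \<omega>\<bar> \<le> C * s" for \<omega> C
  proof -
    obtain k :: nat where k: "C \<le> real k" using real_arch_simple by blast
    have "\<omega> \<in> E k"
      unfolding E_def
    proof (intro CollectI conjI allI w)
      fix n
      have "\<bar>W (1 / real (Suc n)) \<omega>\<bar> \<le> C * (1 / real (Suc n))" by (rule bspec[OF C]) simp
      also have "\<dots> \<le> real k * (1 / real (Suc n))" using k by (intro mult_right_mono) auto
      finally show "\<bar>W (1 / real (Suc n)) \<omega>\<bar> \<le> real k / real (Suc n)" by simp
    qed
    then show ?thesis by blast
  qed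
  then show ?thesis by (intro AE_I'[OF nul]) blast
qed

lemma Den_W_pos: "AE \<omega> in N. 0 < sq_norm (detrend G r (\<lambda>s. W s \<omega>))"
  using W_not_lipschitz AE_space
proof eventually_elim
  case (elim \<omega>)
  have "sq_norm (detrend G r (\<lambda>s. W s \<omega>)) \<noteq> 0"
    using detrend_null_lipschitz[OF W_cont[OF elim(2)] W_0[OF elim(2)]] elim(1) by blast
  then show ?case using sq_norm_nonneg[of "detrend G r (\<lambda>s. W s \<omega>)"] by linarith
qed

end

text \<open>An interchange of limits: for fixed \<open>m\<close> the block vectors converge as
  \<open>T\<close> grows, the Wiener block functionals converge as \<open>m\<close> grows, and
  \<open>cts_step_block_error\<close> is small for large \<open>m\<close> uniformly in large
  \<open>T\<close>.\<close>

theorem walk_functional_convergence: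
  fixes M :: "'a measure" and N :: "'b measure"
  assumes "iid_walk M \<xi>" "wiener_process N W" and ab: "a < b"
  shows "(\<lambda>T. integral\<^sup>L M (\<lambda>\<omega>. cts_step a b (Phi G r x (iid_walk.wT \<xi> T \<omega>))))
    \<longlonglongrightarrow> integral\<^sup>L N (\<lambda>\<omega>. cts_step a b (Phi G r x (\<lambda>s. W s \<omega>)))"
proof -
  interpret iid_walk M \<xi> by fact
  interpret N: prob_space N using assms(2) unfolding wiener_process_def by blast
  interpret N: wiener N W by standard fact
  define L where "L m = integral\<^sup>L N (\<lambda>\<omega>. cts_step a b (Phi G r x (stepm m (\<lambda>i. N.Zm m i \<omega>))))" for m
  define L0 where "L0 = integral\<^sup>L N (\<lambda>\<omega>. cts_step a b (Phi G r x (\<lambda>s. W s \<omega>)))"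
  have cont: "isCont (cts_step a b) y" for y
  proof -
    have "continuous_on UNIV (\<lambda>x. cts_step a b x)"
      unfolding cts_step_max_min[OF ab] by (intro continuous_intros) (use ab in auto)
    then show ?thesis by (simp add: continuous_on_eq_continuous_at)
  qed
  have block: "(\<lambda>T. expectation (\<lambda>\<omega>. cts_step a b (Phi G r x (stepm m (\<lambda>i. VT m T i \<omega>))))) \<longlonglongrightarrow> L m" if m: "0 < m" for m
  proof -
    let ?g = "\<lambda>u. cts_step a b (Phi G r x (stepm m u))"
    let ?\<nu> = "distr std_normal_distribution borel (\<lambda>x. sqrt (1 / real m) * x)"
    interpret S: real_distribution std_normal_distribution by (rule real_dist_normal_dist)
    have "(\<lambda>T. expectation (\<lambda>\<omega>. ?g (\<lambda>i\<in>{..<m}. VT m T i \<omega>))) \<longlonglongrightarrow> integral\<^sup>L N (\<lambda>\<omega>. ?g (\<lambda>i\<in>{..<m}. N.Zm m i \<omega>))"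
    proof (rule indep_vector_convergence[OF prob_space_axioms N.prob_space_axioms m, where \<nu> = ?\<nu> and B = 1])
      show "indep_vars (\<lambda>_. borel) (VT m T) {..<m}" for T by (rule block_indep[OF m])
      have "N.indep_vars (\<lambda>_. borel) (\<lambda>i \<omega>. W (real (Suc i) / real m) \<omega> - W (real i / real m) \<omega>) {..<m}"
        by (rule N.W_indep) (use m in \<open>auto intro!: mono_onI divide_right_mono simp: divide_le_eq\<close>)
      then show "N.indep_vars (\<lambda>_. borel) (N.Zm m) {..<m}" by (simp add: N.Zm_def[abs_def])
      show "real_distribution ?\<nu>" by (rule S.real_distribution_distr) simp
      show "weak_conv_m (\<lambda>T. distr M borel (VT m T i)) ?\<nu>" for i by (rule block_clt[OF m])
      show "distr N borel (N.Zm m i) = ?\<nu>" if "i < m" for i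
      proof -
        have "distributed N lborel (\<lambda>\<omega>. W (real (Suc i) / real m) \<omega> - W (real i / real m) \<omega>)
            (normal_density 0 (sqrt (real (Suc i) / real m - real i / real m)))"
          using that m by (intro N.W_normal) (auto simp: divide_strict_right_mono divide_le_eq)
        moreover have "real (Suc i) / real m - real i / real m = 1 / real m"
          by (simp add: diff_divide_distrib[symmetric])
        ultimately have "distributed N lborel (N.Zm m i) (normal_density 0 (sqrt (1 / real m)))"
          by (simp add: N.Zm_def[abs_def])
        then show ?thesis using m by (intro distr_normal_scale(1) N.prob_space_axioms) auto
      qed
      show "?g \<in> borel_measurable (PiM {..<m} (\<lambda>_. borel))"
        by (intro measurable_compose[OF _ cts_step_measurable] Phi_measurable stepm_joint_measurable measurable_component_singleton) auto
      show "\<bar>?g u\<bar> \<le> 1" for u using cts_step_range[OF ab, of "Phi G r x (stepm m u)"] by simp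
      show "(\<lambda>n. ?g (u n)) \<longlonglongrightarrow> ?g v" if "\<And>i. i < m \<Longrightarrow> (\<lambda>n. u n i) \<longlonglongrightarrow> v i" for u v
        by (rule isCont_tendsto_compose[OF cont Phi_stepm_continuous[OF that]])
    qed (auto simp: N.Zm_measurable)
    then show ?thesis by (simp add: L_def)
  qed
  have LL: "(\<lambda>m. L (Suc m)) \<longlonglongrightarrow> L0"
    unfolding L_def L0_def
  proof (rule integral_dominated_convergence[where w = "\<lambda>_. 1"])
    show "(\<lambda>\<omega>. cts_step a b (Phi G r x (\<lambda>s. W s \<omega>))) \<in> borel_measurable N"
      by (rule measurable_compose[OF N.Phi_W_measurable cts_step_measurable])
    show "(\<lambda>\<omega>. cts_step a b (Phi G r x (stepm (Suc m) (\<lambda>i. N.Zm (Suc m) i \<omega>)))) \<in> borel_measurable N" for m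
      by (rule measurable_compose[OF N.Phi_stepm_measurable cts_step_measurable])
    show "AE \<omega> in N. (\<lambda>m. cts_step a b (Phi G r x (stepm (Suc m) (\<lambda>i. N.Zm (Suc m) i \<omega>)))) \<longlonglongrightarrow> cts_step a b (Phi G r x (\<lambda>s. W s \<omega>))"
      by (intro AE_I2 isCont_tendsto_compose[OF cont] N.Phi_W_tendsto)
    show "AE \<omega> in N. norm (cts_step a b (Phi G r x (stepm (Suc m) (\<lambda>i. N.Zm (Suc m) i \<omega>)))) \<le> 1" for m
      using cts_step_range[OF ab] by (simp add: abs_of_nonneg)
  qed simp
  define C where "C = (1 + \<bar>x\<bar>) * detrend_bound G r / (b - a)"
  have "(\<lambda>T. expectation (\<lambda>\<omega>. cts_step a b (Phi G r x (wT T \<omega>)))) \<longlonglongrightarrow> L0"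
  proof (rule tendstoI)
    fix e :: real assume e: "e > 0"
    have "(\<lambda>m. C * (3 / sqrt (real (Suc m)))) \<longlonglongrightarrow> 0" by real_asymp
    from eventually_conj[OF order_tendstoD(2)[OF this, of "e / 4"] tendstoD[OF LL, of "e / 4"]]
    have "\<forall>\<^sub>F m in sequentially. C * (3 / sqrt (real (Suc m))) < e / 4 \<and> dist (L (Suc m)) L0 < e / 4" using e by simp
    \<comment> \<open>The number of blocks is fixed first; only then does \<open>T\<close> grow,
      which removes the remaining error \<open>sqrt m / T\<close>.\<close>
    then obtain k where k: "C * (3 / sqrt (real (Suc k))) < e / 4" "dist (L (Suc k)) L0 < e / 4"
      using eventually_happens trivial_limit_sequentially by blast
    let ?m = "Suc k"
    have "(\<lambda>T. C * (sqrt (real ?m) / real T)) \<longlonglongrightarrow> 0" by real_asymp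
    then have "\<forall>\<^sub>F T in sequentially. C * (sqrt (real ?m) / real T) < e / 4" using e by (intro order_tendstoD(2)) auto
    moreover have "\<forall>\<^sub>F T in sequentially. dist (expectation (\<lambda>\<omega>. cts_step a b (Phi G r x (stepm ?m (\<lambda>i. VT ?m T i \<omega>))))) (L ?m) < e / 4"
      using e by (intro tendstoD[OF block]) auto
    ultimately show "\<forall>\<^sub>F T in sequentially. dist (expectation (\<lambda>\<omega>. cts_step a b (Phi G r x (wT T \<omega>)))) L0 < e"
      using eventually_gt_at_top[of 0]
    proof eventually_elim
      case (elim T)
      have "\<bar>expectation (\<lambda>\<omega>. cts_step a b (Phi G r x (wT T \<omega>))) - expectation (\<lambda>\<omega>. cts_step a b (Phi G r x (stepm ?m (\<lambda>i. VT ?m T i \<omega>))))\<bar>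
        \<le> C * (3 / sqrt (real ?m) + sqrt (real ?m) / real T)"
        unfolding C_def by (rule cts_step_block_error[OF ab _ elim(3)]) simp
      also have "\<dots> = C * (3 / sqrt (real ?m)) + C * (sqrt (real ?m) / real T)" by (rule distrib_left)
      finally show ?case using elim(1,2) k unfolding dist_real_def by linarith
    qed
  qed
  then show ?thesis by (simp add: L0_def)
qed

subsection \<open>Inversion of the autoregressive filter\<close>

text \<open>\<open>1 / \<Theta>\<close> is analytic on a disc of radius larger than 1, so its power
  series converges absolutely at 1. The recursion is the coefficient form of
  \<open>\<Theta> * (1 / \<Theta>) = 1\<close>.\<close>

lemma ar_inverse_coefficients:
  assumes roots: "\<And>z. ar_poly p \<theta> z = 0 \<Longrightarrow> cmod z > 1"
  obtains \<psi> :: "nat \<Rightarrow> real" where "summable (\<lambda>n. \<bar>\<psi> n\<bar>)"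
    "\<And>n. \<psi> n = of_bool (n = 0) + (\<Sum>i=1..p. if i \<le> n then \<theta> i * \<psi> (n - i) else 0)"
proof -
  define q :: "complex poly" where "q = 1 - (\<Sum>i=1..p. monom (complex_of_real (\<theta> i)) i)"
  have pq: "poly q z = ar_poly p \<theta> z" for z
    by (simp add: q_def ar_poly_def poly_sum poly_monom)
  define f where "f = fps_of_poly q"
  have fn: "fps_nth f n = of_bool (n = 0) - (if 1 \<le> n \<and> n \<le> p then complex_of_real (\<theta> n) else 0)" for n
  proof -
    have "(\<Sum>i=1..p. if i = n then complex_of_real (\<theta> i) else 0) = (if 1 \<le> n \<and> n \<le> p then complex_of_real (\<theta> n) else 0)"
      by (simp add: sum.delta)
    then show ?thesis by (simp add: f_def q_def coeff_sum one_poly_eq_simps(2)[symmetric] coeff_pCons split: nat.split)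
  qed
  have f0: "fps_nth f 0 = 1" by (simp add: fn)
  then have q0: "q \<noteq> 0" by (auto simp: f_def)
  define Z where "Z = {z. poly q z = 0}"
  have Z: "finite Z" unfolding Z_def by (rule poly_roots_finite[OF q0])
  \<comment> \<open>The 2 keeps the set nonempty when there are no zeros.\<close>
  define b where "b = Min (insert 2 (cmod ` Z))"
  have b1: "b > 1" unfolding b_def using Z roots pq by (auto simp: Z_def)
  have bz: "poly q z \<noteq> 0" if "cmod z < b" for z
  proof
    assume "poly q z = 0"
    then have "b \<le> cmod z" unfolding b_def using Z by (intro Min_le) (auto simp: Z_def)
    then show False using that by simp
  qed
  define c where "c = fps_nth (inverse f)"
  have "min (ereal b) (fps_conv_radius f) \<le> fps_conv_radius (inverse f)"
    by (rule fps_conv_radius_inverse) (use bz in \<open>auto simp: f_def\<close>)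
  then have "ereal b \<le> conv_radius c" by (simp add: f_def c_def fps_conv_radius_def[symmetric])
  moreover have "ereal (cmod 1) < ereal b" using b1 by simp
  ultimately have "ereal (cmod 1) < conv_radius c" by (rule less_le_trans[rotated])
  then have "summable (\<lambda>n. cmod (c n * 1 ^ n))" by (rule abs_summable_in_conv_radius)
  then have sc: "summable (\<lambda>n. cmod (c n))" by simp
  have rec: "c n = of_bool (n = 0) + (\<Sum>i=1..p. if i \<le> n then complex_of_real (\<theta> i) * c (n - i) else 0)" for n
  proof -
    have "f * inverse f = 1" using f0 by (intro inverse_mult_eq_1') simp
    then have "of_bool (n = 0) = fps_nth (f * inverse f) n" by simp
    also have "\<dots> = (\<Sum>i=0..n. fps_nth f i * c (n - i))" by (simp add: fps_mult_nth c_def)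
    also have "\<dots> = (\<Sum>i=0..n. of_bool (i = 0) * c (n - i)) - (\<Sum>i=0..n. (if 1 \<le> i \<and> i \<le> p then complex_of_real (\<theta> i) else 0) * c (n - i))"
      unfolding fn by (simp only: left_diff_distrib sum_subtractf)
    also have "(\<Sum>i=0..n. of_bool (i = 0) * c (n - i)) = c n"
      by (subst sum.remove[of _ 0]) auto
    also have "(\<Sum>i=0..n. (if 1 \<le> i \<and> i \<le> p then complex_of_real (\<theta> i) else 0) * c (n - i))
      = (\<Sum>i=1..p. if i \<le> n then complex_of_real (\<theta> i) * c (n - i) else 0)"
    proof -
      have "(\<Sum>i=0..n. (if 1 \<le> i \<and> i \<le> p then complex_of_real (\<theta> i) else 0) * c (n - i))
        = (\<Sum>i\<in>{1..p} \<inter> {0..n}. complex_of_real (\<theta> i) * c (n - i))"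
        by (intro sum.mono_neutral_cong_right) auto
      also have "\<dots> = (\<Sum>i=1..p. if i \<le> n then complex_of_real (\<theta> i) * c (n - i) else 0)"
        by (intro sum.mono_neutral_cong_left) auto
      finally show ?thesis .
    qed
    finally show ?thesis by (simp add: algebra_simps)
  qed
  show ?thesis
  \<comment> \<open>Since the \<open>\<theta> i\<close> are real, the real parts obey the same
    recursion.\<close>
  proof (rule that[of "\<lambda>n. Re (c n)"])
    show "summable (\<lambda>n. \<bar>Re (c n)\<bar>)"
      by (rule summable_comparison_test'[OF sc, of 0]) (simp add: abs_Re_le_cmod)
    show "Re (c n) = of_bool (n = 0) + (\<Sum>i=1..p. if i \<le> n then \<theta> i * Re (c (n - i)) else 0)" for n
      by (subst rec) (auto simp: if_distrib[of Re] of_bool_def cong: if_cong intro!: sum.cong)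
  qed
qed

text \<open>A convolution that only sees times at least 1, which encodes the zero initial
  values.\<close>

definition causal :: "(nat \<Rightarrow> real) \<Rightarrow> (nat \<Rightarrow> real) \<Rightarrow> nat \<Rightarrow> real" where
  "causal \<psi> v t = (\<Sum>j<t. \<psi> j * v (t - j))"

text \<open>Strong induction on time: each lag becomes a convolution, the initial values covering
  \<open>i >= t\<close>, and collecting the coefficient of \<open>v (t - n)\<close> reproduces the
  recursion for \<open>\<psi>\<close>.\<close>

lemma ar_solution:
  fixes x :: "int \<Rightarrow> real"
  assumes rec: "\<And>n. \<psi> n = of_bool (n = 0) + (\<Sum>i=1..p. if i \<le> n then \<theta> i * \<psi> (n - i) else 0)"
    and init: "\<And>t. t \<in> {- int p + 1..0} \<Longrightarrow> x t = 0"
    and eq: "\<And>t. t \<in> {1..T} \<Longrightarrow> ar_filter p \<theta> x (int t) = v t"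
    and t: "t \<in> {1..T}"
  shows "x (int t) = causal \<psi> v t"
  using t
proof (induction t rule: less_induct)
  case (less t)
  have lag: "x (int t - int i) = (\<Sum>n<t. if i \<le> n then \<psi> (n - i) * v (t - n) else 0)" if i: "i \<in> {1..p}" for i
  proof (cases "i < t")
    case True
    have "x (int t - int i) = x (int (t - i))" using True by (simp add: of_nat_diff)
    also have "\<dots> = causal \<psi> v (t - i)" using True less i by (intro less.IH) auto
    also have "\<dots> = (\<Sum>j\<in>{0..<t - i}. \<psi> j * v (t - i - j))" by (simp add: causal_def lessThan_atLeast0)
    also have "\<dots> = (\<Sum>n\<in>{i..<t}. \<psi> (n - i) * v (t - n))"
      using True by (intro sum.reindex_bij_witness[of _ "\<lambda>n. n - i" "\<lambda>j. j + i"]) (auto simp: add.commute)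
    also have "\<dots> = (\<Sum>n<t. if i \<le> n then \<psi> (n - i) * v (t - n) else 0)"
      by (intro sum.mono_neutral_cong_left) auto
    finally show ?thesis .
  next
    case False
    have "x (int t - int i) = 0" using False i less.prems by (intro init) auto
    moreover have "(\<Sum>n<t. if i \<le> n then \<psi> (n - i) * v (t - n) else 0) = 0" using False by (intro sum.neutral) auto
    ultimately show ?thesis by simp
  qed
  have "x (int t) = v t + (\<Sum>i=1..p. \<theta> i * x (int t - int i))"
    using eq[OF less.prems] by (simp add: ar_filter_def)
  also have "\<dots> = v t + (\<Sum>i=1..p. \<Sum>n<t. (if i \<le> n then \<theta> i * \<psi> (n - i) else 0) * v (t - n))"
    by (intro arg_cong2[where f = "(+)"] refl sum.cong) (auto simp: lag sum_distrib_left intro!: sum.cong)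
  also have "\<dots> = v t + (\<Sum>n<t. (\<Sum>i=1..p. if i \<le> n then \<theta> i * \<psi> (n - i) else 0) * v (t - n))"
    by (subst sum.swap) (simp add: sum_distrib_right)
  also have "\<dots> = (\<Sum>n<t. of_bool (n = 0) * v (t - n)) + (\<Sum>n<t. (\<Sum>i=1..p. if i \<le> n then \<theta> i * \<psi> (n - i) else 0) * v (t - n))"
    using less.prems by (subst sum.remove[of "{..<t}" 0]) auto
  also have "\<dots> = causal \<psi> v t"
    by (simp only: causal_def sum.distrib[symmetric] distrib_right[symmetric] rec[symmetric])
  finally show ?case .
qed

text \<open>Filtering commutes with summation from a zero start. For \<rho> = -1 this bounds the
  partial sums of the observed path through those of its input.\<close>

lemma causal_cumulative:
  "(\<Sum>k=1..t. causal \<psi> v k) = causal \<psi> (\<lambda>t. \<Sum>k=1..t. v k) t"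
proof (induction t)
  case (Suc t)
  have "causal \<psi> (\<lambda>t. \<Sum>k=1..t. v k) (Suc t) = (\<Sum>j<Suc t. \<psi> j * (\<Sum>k=1..t - j. v k)) + (\<Sum>j<Suc t. \<psi> j * v (Suc t - j))"
    unfolding causal_def sum.distrib[symmetric] by (intro sum.cong refl) (auto simp: Suc_diff_le distrib_left)
  also have "(\<Sum>j<Suc t. \<psi> j * (\<Sum>k=1..t - j. v k)) = causal \<psi> (\<lambda>t. \<Sum>k=1..t. v k) t"
    by (simp add: causal_def)
  finally show ?case using Suc by (simp add: causal_def)
qed (simp add: causal_def)

text \<open>Cauchy-Schwarz for the weights \<open>|\<psi> j|\<close>, each split into two square
  roots; the sign of \<open>\<psi> j\<close> goes with \<open>v\<close>.\<close>

lemma causal_sq_le: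
  "(causal \<psi> v t)\<^sup>2 \<le> (\<Sum>j<t. \<bar>\<psi> j\<bar>) * (\<Sum>j<t. \<bar>\<psi> j\<bar> * (v (t - j))\<^sup>2)"
proof -
  have "causal \<psi> v t = (\<Sum>j<t. sqrt \<bar>\<psi> j\<bar> * (sqrt \<bar>\<psi> j\<bar> * (sgn (\<psi> j) * v (t - j))))"
    unfolding causal_def
  proof (intro sum.cong refl)
    fix j
    have "sqrt \<bar>\<psi> j\<bar> * (sqrt \<bar>\<psi> j\<bar> * (sgn (\<psi> j) * v (t - j))) = (sqrt \<bar>\<psi> j\<bar> * sqrt \<bar>\<psi> j\<bar>) * sgn (\<psi> j) * v (t - j)" by simp
    also have "\<dots> = \<psi> j * v (t - j)" by (simp add: abs_mult_sgn)
    finally show "\<psi> j * v (t - j) = sqrt \<bar>\<psi> j\<bar> * (sqrt \<bar>\<psi> j\<bar> * (sgn (\<psi> j) * v (t - j)))" by (rule sym)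
  qed
  then have "(causal \<psi> v t)\<^sup>2 \<le> (\<Sum>j<t. (sqrt \<bar>\<psi> j\<bar>)\<^sup>2) * (\<Sum>j<t. (sqrt \<bar>\<psi> j\<bar> * (sgn (\<psi> j) * v (t - j)))\<^sup>2)"
    by (simp only: Cauchy_Schwarz_ineq_sum)
  also have "\<dots> \<le> (\<Sum>j<t. \<bar>\<psi> j\<bar>) * (\<Sum>j<t. \<bar>\<psi> j\<bar> * (v (t - j))\<^sup>2)"
  proof (intro mult_mono sum_mono)
    fix j
    have "(sgn (\<psi> j))\<^sup>2 \<le> 1" by (auto simp: sgn_if)
    then have "(sgn (\<psi> j))\<^sup>2 * (v (t - j))\<^sup>2 \<le> 1 * (v (t - j))\<^sup>2" by (intro mult_right_mono) auto
    then show "(sqrt \<bar>\<psi> j\<bar> * (sgn (\<psi> j) * v (t - j)))\<^sup>2 \<le> \<bar>\<psi> j\<bar> * (v (t - j))\<^sup>2"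
      by (simp add: power_mult_distrib mult_left_mono)
  qed (auto intro!: sum_nonneg)
  finally show ?thesis .
qed

lemma (in prob_space) causal_second_moment:
  assumes \<psi>: "summable (\<lambda>n. \<bar>\<psi> n\<bar>)" and m: "\<And>k. k \<in> {1..t} \<Longrightarrow> (\<lambda>\<omega>. v k \<omega>) \<in> borel_measurable M"
    and b: "\<And>k. k \<in> {1..t} \<Longrightarrow> integrable M (\<lambda>\<omega>. (v k \<omega>)\<^sup>2) \<and> expectation (\<lambda>\<omega>. (v k \<omega>)\<^sup>2) \<le> B"
    and B: "0 \<le> B"
  shows "integrable M (\<lambda>\<omega>. (causal \<psi> (\<lambda>k. v k \<omega>) t)\<^sup>2)"
    and "expectation (\<lambda>\<omega>. (causal \<psi> (\<lambda>k. v k \<omega>) t)\<^sup>2) \<le> (\<Sum>n. \<bar>\<psi> n\<bar>)\<^sup>2 * B"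
proof -
  let ?P = "\<Sum>n. \<bar>\<psi> n\<bar>"
  let ?g = "\<lambda>\<omega>. (\<Sum>j<t. \<bar>\<psi> j\<bar>) * (\<Sum>j<t. \<bar>\<psi> j\<bar> * (v (t - j) \<omega>)\<^sup>2)"
  have [measurable]: "(\<lambda>\<omega>. causal \<psi> (\<lambda>k. v k \<omega>) t) \<in> borel_measurable M"
    unfolding causal_def using m by (intro borel_measurable_sum borel_measurable_times) auto
  have ig: "integrable M ?g" using b by (intro integrable_mult_right Bochner_Integration.integrable_sum) auto
  show i: "integrable M (\<lambda>\<omega>. (causal \<psi> (\<lambda>k. v k \<omega>) t)\<^sup>2)"
    by (rule Bochner_Integration.integrable_bound[OF ig]) (auto intro!: AE_I2 order_trans[OF causal_sq_le])
  have le: "(\<Sum>j<t. \<bar>\<psi> j\<bar>) \<le> ?P" by (rule sum_le_suminf[OF \<psi>]) auto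
  have P: "0 \<le> ?P" by (rule suminf_nonneg[OF \<psi>]) auto
  have "expectation (\<lambda>\<omega>. (causal \<psi> (\<lambda>k. v k \<omega>) t)\<^sup>2) \<le> expectation ?g"
    by (rule integral_mono[OF i ig]) (rule causal_sq_le)
  also have "\<dots> = (\<Sum>j<t. \<bar>\<psi> j\<bar>) * (\<Sum>j<t. \<bar>\<psi> j\<bar> * expectation (\<lambda>\<omega>. (v (t - j) \<omega>)\<^sup>2))"
    using b by (subst integral_mult_right_zero, subst Bochner_Integration.integral_sum) (auto intro!: integrable_mult_right)
  also have "\<dots> \<le> (\<Sum>j<t. \<bar>\<psi> j\<bar>) * (\<Sum>j<t. \<bar>\<psi> j\<bar> * B)"
    using b by (intro mult_left_mono sum_mono sum_nonneg) auto
  also have "\<dots> = (\<Sum>j<t. \<bar>\<psi> j\<bar>) * (\<Sum>j<t. \<bar>\<psi> j\<bar>) * B" by (simp add: sum_distrib_right[symmetric] mult.assoc)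
  also have "\<dots> \<le> ?P * ?P * B"
    using le P B by (intro mult_right_mono mult_mono sum_nonneg) auto
  finally show "expectation (\<lambda>\<omega>. (causal \<psi> (\<lambda>k. v k \<omega>) t)\<^sup>2) \<le> ?P\<^sup>2 * B" by (simp add: power2_eq_square)
qed

subsection \<open>White noise\<close>

text \<open>The singletons \<open>{Suc j}\<close> re-index the independent family from 0. Only the
  square of \<sigma> is a variance, so its sign is free.\<close>

lemma white_noise_walk:
  assumes e: "strong_white_noise M e (\<sigma>\<^sup>2)" and \<sigma>: "\<sigma> \<noteq> 0"
  shows "iid_walk M (\<lambda>i \<omega>. e (Suc i) \<omega> / \<sigma>)"
proof -
  interpret prob_space M using e unfolding strong_white_noise_def by blast
  have ind: "indep_vars (\<lambda>_. borel) e {1..}" and id: "\<And>s t. s \<ge> 1 \<Longrightarrow> t \<ge> 1 \<Longrightarrow> distr M borel (e s) = distr M borel (e t)"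
    and sq: "\<And>t. t \<ge> 1 \<Longrightarrow> integrable M (\<lambda>\<omega>. (e t \<omega>)\<^sup>2)" and mean: "\<And>t. t \<ge> 1 \<Longrightarrow> expectation (e t) = 0"
    and var: "\<And>t. t \<ge> 1 \<Longrightarrow> expectation (\<lambda>\<omega>. (e t \<omega> - expectation (e t))\<^sup>2) = \<sigma>\<^sup>2"
    using e unfolding strong_white_noise_def by blast+
  have shift: "indep_vars (\<lambda>_. borel) (\<lambda>i \<omega>. f i (e (Suc i) \<omega>)) UNIV" if "\<And>i. f i \<in> borel_measurable borel" for f :: "nat \<Rightarrow> real \<Rightarrow> real"
  proof -
    have "indep_vars (\<lambda>j. PiM {Suc j} (\<lambda>_. borel)) (\<lambda>j \<omega>. restrict (\<lambda>i. e i \<omega>) {Suc j}) UNIV"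
      by (rule indep_vars_restrict[OF ind]) (auto simp: disjoint_family_on_def)
    then have "indep_vars (\<lambda>_. borel) (\<lambda>j \<omega>. (\<lambda>x. f j (x (Suc j))) (restrict (\<lambda>i. e i \<omega>) {Suc j})) UNIV"
    proof (rule indep_vars_compose2)
      fix j show "(\<lambda>x. f j (x (Suc j))) \<in> borel_measurable (PiM {Suc j} (\<lambda>_. borel))"
        by (rule measurable_compose[OF _ that]) (rule measurable_component_singleton, simp)
    qed
    then show ?thesis by simp
  qed
  have rv: "e t \<in> borel_measurable M" if "t \<ge> 1" for t using ind that unfolding indep_vars_def2 by simp
  show ?thesis
  proof
    show "indep_vars (\<lambda>_. borel) (\<lambda>i \<omega>. e (Suc i) \<omega> / \<sigma>) UNIV"
      by (rule shift[of "\<lambda>_ x. x / \<sigma>"]) simp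
    fix n
    show "expectation (\<lambda>\<omega>. e (Suc n) \<omega> / \<sigma>) = 0" using mean[of "Suc n"] by simp
    show "integrable M (\<lambda>\<omega>. (e (Suc n) \<omega> / \<sigma>)\<^sup>2)" using sq[of "Suc n"] by (simp add: power_divide)
    show "expectation (\<lambda>\<omega>. (e (Suc n) \<omega> / \<sigma>)\<^sup>2) = 1"
      using var[of "Suc n"] mean[of "Suc n"] \<sigma> by (simp add: power_divide)
    have "distr M borel (\<lambda>\<omega>. e (Suc k) \<omega> / \<sigma>) = distr (distr M borel (e (Suc k))) borel (\<lambda>x. x / \<sigma>)" for k
      using rv[of "Suc k"] by (subst distr_distr) (auto simp: comp_def)
    then show "distr M borel (\<lambda>\<omega>. e (Suc n) \<omega> / \<sigma>) = distr M borel (\<lambda>\<omega>. e (Suc 0) \<omega> / \<sigma>)"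
      using id[of "Suc n" "Suc 0"] by simp
  qed
qed

lemma S_eta_weights: "S_eta \<rho> h t = (\<Sum>i<t. \<rho> ^ (t - 1 - i) * h (Suc i))"
proof (induction t)
  case (Suc t)
  have "(\<Sum>i<t. \<rho> ^ (t - i) * h (Suc i)) = \<rho> * (\<Sum>i<t. \<rho> ^ (t - 1 - i) * h (Suc i))"
    unfolding sum_distrib_left by (intro sum.cong refl) (auto simp: power_Suc[symmetric] mult.assoc[symmetric] Suc_diff_Suc simp del: power_Suc)
  then show ?case using Suc by simp
qed simp

text \<open>For \<rho> = -1 consecutive values satisfy \<open>S k + S (k - 1) = h k\<close>, so
  twice the partial sum telescopes up to the last value. This keeps partial sums at the order of a
  random walk instead of that of its integral.\<close>

lemma S_eta_sum_minus: "2 * (\<Sum>k=1..t. S_eta (-1) h k) = (\<Sum>k=1..t. h k) + S_eta (-1) h t"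
  by (induction t) (auto simp: algebra_simps)

context iid_walk
begin

lemma S_eta_second_moment:
  assumes \<rho>: "\<bar>\<rho>\<bar> = 1"
  shows "integrable M (\<lambda>\<omega>. (S_eta \<rho> (\<lambda>k. \<xi> (k - 1) \<omega>) t)\<^sup>2)"
    "expectation (\<lambda>\<omega>. (S_eta \<rho> (\<lambda>k. \<xi> (k - 1) \<omega>) t)\<^sup>2) = real t"
proof -
  have "(\<rho> ^ n)\<^sup>2 = 1" for n using \<rho> by (metis power2_abs power_abs power_one)
  then show "integrable M (\<lambda>\<omega>. (S_eta \<rho> (\<lambda>k. \<xi> (k - 1) \<omega>) t)\<^sup>2)"
    "expectation (\<lambda>\<omega>. (S_eta \<rho> (\<lambda>k. \<xi> (k - 1) \<omega>) t)\<^sup>2) = real t"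
    using weighted_second_moment[of "{..<t}" "\<lambda>i. \<rho> ^ (t - 1 - i)"] unfolding S_eta_weights by simp_all
qed

text \<open>Consecutive pairs are disjoint, so their differences are again i.i.d.; division by
  \<open>sqrt 2\<close> restores unit variance. For \<rho> = -1 they are the increments between even
  times.\<close>

lemma paired_walk: "iid_walk M (\<lambda>i \<omega>. (\<xi> (2 * i + 1) \<omega> - \<xi> (2 * i) \<omega>) / sqrt 2)"
proof
  let ?J = "\<lambda>i. {2 * i, 2 * i + 1::nat}"
  have "indep_vars (\<lambda>j. PiM (?J j) (\<lambda>_. borel)) (\<lambda>j \<omega>. restrict (\<lambda>i. \<xi> i \<omega>) (?J j)) UNIV"
  proof (rule indep_vars_restrict[OF indep])
    show "disjoint_family ?J"
      unfolding disjoint_family_on_def by (auto; presburger)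
  qed simp
  then have "indep_vars (\<lambda>_. borel) (\<lambda>j \<omega>. (\<lambda>x. (x (2 * j + 1) - x (2 * j)) / sqrt 2) (restrict (\<lambda>i. \<xi> i \<omega>) (?J j))) UNIV"
    by (rule indep_vars_compose2) measurable
  then show "indep_vars (\<lambda>_. borel) (\<lambda>i \<omega>. (\<xi> (2 * i + 1) \<omega> - \<xi> (2 * i) \<omega>) / sqrt 2) UNIV" by simp
  fix n
  show "expectation (\<lambda>\<omega>. (\<xi> (2 * n + 1) \<omega> - \<xi> (2 * n) \<omega>) / sqrt 2) = 0"
    using xi_integrable mean by simp
  have e: "((\<xi> (2 * n + 1) \<omega> - \<xi> (2 * n) \<omega>) / sqrt 2)\<^sup>2 = (\<Sum>i\<in>?J n. (if i = 2 * n then -1 else 1) * \<xi> i \<omega>)\<^sup>2 / 2" for \<omega>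
    by (simp add: power_divide)
  show "integrable M (\<lambda>\<omega>. ((\<xi> (2 * n + 1) \<omega> - \<xi> (2 * n) \<omega>) / sqrt 2)\<^sup>2)"
    unfolding e by (intro Bochner_Integration.integrable_divide weighted_second_moment) simp
  have "expectation (\<lambda>\<omega>. (\<Sum>i\<in>?J n. (if i = 2 * n then -1 else 1) * \<xi> i \<omega>)\<^sup>2) = (\<Sum>i\<in>?J n. (if i = 2 * n then -1 else 1)\<^sup>2)"
    by (rule weighted_second_moment) simp
  then show "expectation (\<lambda>\<omega>. ((\<xi> (2 * n + 1) \<omega> - \<xi> (2 * n) \<omega>) / sqrt 2)\<^sup>2) = 1"
    unfolding e by simp
  \<comment> \<open>Each pair has the law of two independent copies of \<open>\<xi> 0\<close>,
    whatever its position.\<close>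
  have d: "distr M borel (\<lambda>\<omega>. (\<xi> (2 * k + 1) \<omega> - \<xi> (2 * k) \<omega>) / sqrt 2)
    = distr (PiM {0, 1::nat} (\<lambda>_. distr M borel (\<xi> 0))) borel (\<lambda>x. (x 1 - x 0) / sqrt 2)" for k
  proof -
    let ?f = "\<lambda>i::nat. \<xi> (2 * k + i)"
    have "indep_vars (\<lambda>j. PiM {2 * k + j} (\<lambda>_. borel)) (\<lambda>j \<omega>. restrict (\<lambda>i. \<xi> i \<omega>) {2 * k + j}) {0, 1}"
      by (rule indep_vars_restrict[OF indep]) (auto simp: disjoint_family_on_def)
    then have "indep_vars (\<lambda>_. borel) (\<lambda>j \<omega>. (\<lambda>x. x (2 * k + j)) (restrict (\<lambda>i. \<xi> i \<omega>) {2 * k + j})) {0, 1}"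
      by (rule indep_vars_compose2) (intro measurable_component_singleton, simp)
    then have iv: "indep_vars (\<lambda>_. borel) ?f {0, 1}" by simp
    have "distr M (PiM {0, 1} (\<lambda>_. borel)) (\<lambda>\<omega>. \<lambda>i\<in>{0, 1}. ?f i \<omega>) = PiM {0, 1} (\<lambda>i. distr M borel (?f i))"
      using indep_vars_iff_distr_eq_PiM'[of "{0, 1}" ?f "\<lambda>_. borel"] iv by simp
    also have "\<dots> = PiM {0, 1} (\<lambda>_. distr M borel (\<xi> 0))" by (rule PiM_cong[OF refl]) (rule ident)
    finally have P: "PiM {0, 1} (\<lambda>_. distr M borel (\<xi> 0)) = distr M (PiM {0, 1} (\<lambda>_. borel)) (\<lambda>\<omega>. \<lambda>i\<in>{0, 1}. ?f i \<omega>)" ..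
    have m: "(\<lambda>x. (x 1 - x (0::nat)) / sqrt 2) \<in> borel_measurable (PiM {0, 1} (\<lambda>_. borel :: real measure))"
      by (intro borel_measurable_divide borel_measurable_diff measurable_component_singleton borel_measurable_const) auto
    have m2: "(\<lambda>\<omega>. \<lambda>i\<in>{0, 1}. ?f i \<omega>) \<in> measurable M (PiM {0, 1} (\<lambda>_. borel))"
      by (intro measurable_restrict) measurable
    show ?thesis unfolding P by (subst distr_distr[OF m m2]) (simp add: comp_def)
  qed
  show "distr M borel (\<lambda>\<omega>. (\<xi> (2 * n + 1) \<omega> - \<xi> (2 * n) \<omega>) / sqrt 2) = distr M borel (\<lambda>\<omega>. (\<xi> (2 * 0 + 1) \<omega> - \<xi> (2 * 0) \<omega>) / sqrt 2)"
    unfolding d[of n] d[of 0] ..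
qed

end

section \<open>Squared norms of approximating random paths\<close>

lemma (in prob_space) small_sq_norm_diff:
  assumes d: "small M (\<lambda>n \<omega>. sq_norm (\<lambda>s. f n \<omega> s - g n \<omega> s))" and b: "bounded_in_prob M (\<lambda>n \<omega>. sq_norm (g n \<omega>))"
    and m: "\<forall>\<^sub>F n in sequentially. \<forall>\<omega>\<in>space M. bounded_meas (f n \<omega>) \<and> bounded_meas (g n \<omega>)"
  shows "small M (\<lambda>n \<omega>. sq_norm (f n \<omega>) - sq_norm (g n \<omega>))"
proof (rule smallI)
  fix e :: real assume e: "e > 0"
  then obtain B where B: "B > 0" "\<forall>\<^sub>F n in sequentially. mostly M (e / 2) (\<lambda>\<omega>. \<bar>sq_norm (g n \<omega>)\<bar> \<le> B)"
    using bounded_in_probE[OF b, of "e / 2"] by auto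
  \<comment> \<open>Near \<open>g\<close> the two squared norms add up to at most
    \<open>3 * B\<close> plus a multiple of \<open>h\<close>; this \<open>l\<close> makes
    \<open>3 * B / l\<close> half the tolerance, and the choice of \<open>h\<close> settles the
    rest.\<close>
  define l where "l = 6 * B / e"
  have l: "l > 0" "3 * B / l = e / 2" using e B(1) unfolding l_def by auto
  define h where "h = min (e / 2) (e / (2 * (l + 2 / l)))"
  have l2: "l + 2 / l > 0" using l(1) by (intro add_pos_pos) auto
  have h: "h > 0" "h + e / 2 \<le> e" "(l + 2 / l) * h \<le> e / 2"
  proof -
    show "h > 0" "h + e / 2 \<le> e" using e l2 unfolding h_def by auto
    have "(l + 2 / l) * h \<le> (l + 2 / l) * (e / (2 * (l + 2 / l)))"
      using l2 unfolding h_def by (intro mult_left_mono) auto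
    also have "q * (e / (2 * q)) = e / 2" if "q > 0" for q :: real using that by simp
    note this[OF l2]
    finally show "(l + 2 / l) * h \<le> e / 2" .
  qed
  show "\<forall>\<^sub>F n in sequentially. mostly M e (\<lambda>\<omega>. \<bar>sq_norm (f n \<omega>) - sq_norm (g n \<omega>)\<bar> \<le> e)"
    using smallD[OF d h(1)] B(2) m
  proof eventually_elim
    case (elim n)
    show ?case
    proof (rule mostly_conj[OF prob_space_axioms elim(1,2) _ h(2)])
      fix \<omega> assume w: "\<omega> \<in> space M" and 1: "\<bar>sq_norm (\<lambda>s. f n \<omega> s - g n \<omega> s)\<bar> \<le> h" and 2: "\<bar>sq_norm (g n \<omega>)\<bar> \<le> B"
      have bounded_meas: "bounded_meas (f n \<omega>)" "bounded_meas (g n \<omega>)" using elim(3) w by auto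
      let ?d = "sq_norm (\<lambda>s. f n \<omega> s - g n \<omega> s)"
      have f: "sq_norm (f n \<omega>) \<le> 2 * ?d + 2 * sq_norm (g n \<omega>)"
        using sq_norm_add_le[of "\<lambda>s. f n \<omega> s - g n \<omega> s" "g n \<omega>"] bounded_meas by auto
      have "\<bar>sq_norm (f n \<omega>) - sq_norm (g n \<omega>)\<bar> \<le> l * ?d + (sq_norm (f n \<omega>) + sq_norm (g n \<omega>)) / l"
        by (rule sq_norm_diff_abs_le[OF bounded_meas l(1)])
      also have "\<dots> \<le> l * h + (2 * h + 3 * B) / l"
      proof -
        have "sq_norm (f n \<omega>) + sq_norm (g n \<omega>) \<le> 2 * h + 3 * B" "?d \<le> h" using f 1 2 by linarith+
        then show ?thesis using l(1) by (intro add_mono[OF mult_left_mono divide_right_mono]) auto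
      qed
      also have "\<dots> = (l + 2 / l) * h + 3 * B / l" by (simp add: algebra_simps add_divide_distrib)
      finally show "\<bar>sq_norm (f n \<omega>) - sq_norm (g n \<omega>)\<bar> \<le> e" using h(3) l(2) by linarith
    qed
  qed
qed

lemma (in prob_space) bounded_in_prob_sq_norm_approx:
  assumes d: "small M (\<lambda>n \<omega>. sq_norm (\<lambda>s. f n \<omega> s - g n \<omega> s))" and b: "bounded_in_prob M (\<lambda>n \<omega>. sq_norm (g n \<omega>))"
    and m: "\<forall>\<^sub>F n in sequentially. \<forall>\<omega>\<in>space M. bounded_meas (f n \<omega>) \<and> bounded_meas (g n \<omega>)"
  shows "bounded_in_prob M (\<lambda>n \<omega>. sq_norm (f n \<omega>))"
proof -
  have "small M (\<lambda>n \<omega>. sq_norm (f n \<omega>) - sq_norm (g n \<omega>))" by (rule small_sq_norm_diff[OF assms])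
  then have "bounded_in_prob M (\<lambda>n \<omega>. sq_norm (f n \<omega>) - sq_norm (g n \<omega>))" unfolding bounded_in_prob_def small_def by blast
  from bounded_in_prob_add[OF this b] show ?thesis by simp
qed

lemma bounded_away_in_prob_subseq:
  assumes "bounded_away_in_prob M Y" "filterlim k at_top sequentially" shows "bounded_away_in_prob M (\<lambda>n. Y (k n))"
  unfolding bounded_away_in_prob_def
proof (intro allI impI)
  fix d :: real assume "d > 0"
  then obtain c where c: "c > 0" "\<forall>\<^sub>F n in sequentially. mostly M d (\<lambda>\<omega>. c \<le> Y n \<omega>)"
    using assms(1) unfolding bounded_away_in_prob_def by blast
  show "\<exists>c>0. \<forall>\<^sub>F n in sequentially. mostly M d (\<lambda>\<omega>. c \<le> Y (k n) \<omega>)"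
    using c(1) eventually_compose_filterlim[OF c(2) assms(2)] by blast
qed

lemma bounded_away_in_prob_cmult: assumes "bounded_away_in_prob M Y" "0 < (a::real)" shows "bounded_away_in_prob M (\<lambda>n \<omega>. a * Y n \<omega>)"
  unfolding bounded_away_in_prob_def
proof (intro allI impI)
  fix d :: real assume "d > 0"
  then obtain c where c: "c > 0" "\<forall>\<^sub>F n in sequentially. mostly M d (\<lambda>\<omega>. c \<le> Y n \<omega>)"
    using assms(1) unfolding bounded_away_in_prob_def by blast
  show "\<exists>c>0. \<forall>\<^sub>F n in sequentially. mostly M d (\<lambda>\<omega>. c \<le> a * Y n \<omega>)"
    using c assms(2) by (intro exI[of _ "a * c"] conjI) (auto elim!: eventually_mono mostly_mono)
qed

text \<open>Only a vanishing fraction of the times \<open>j \<le> n\<close> can satisfy \<open>\<bar>R j\<bar> \<le> \<delta> sqrt n\<close> as \<open>\<delta>\<close> tends to 0,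
  by the central limit theorem at each single time.\<close>

lemma (in iid_walk) R_sum_bounded_away_in_prob: "bounded_away_in_prob M (\<lambda>n \<omega>. (\<Sum>j=1..n. (R j \<omega>)\<^sup>2) / (real n)\<^sup>2)"
  unfolding bounded_away_in_prob_def
proof (intro allI impI)
  fix d :: real assume d: "d > 0"
  \<comment> \<open>By \<open>normal_ball_le\<close> the mass of \<open>[-c, c]\<close> is at most
    \<open>2 * c = d / 8\<close>, below \<open>d / 4\<close>. The early times up to
    \<open>\<beta> * n\<close> are discarded, and \<open>\<delta>\<close> is such that
    \<open>|R j| <= \<delta> * sqrt n\<close> with \<open>j >= \<beta> * n\<close> implies
    \<open>|R j| <= c * sqrt j\<close>.\<close>
  define c where "c = d / 16"
  have c: "c > 0" using d by (simp add: c_def)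
  define \<beta> where "\<beta> = d / 8"
  have \<beta>: "\<beta> > 0" using d by (simp add: \<beta>_def)
  define \<delta> where "\<delta> = c * sqrt \<beta>"
  have \<delta>: "\<delta> > 0" using c \<beta> by (simp add: \<delta>_def)
  interpret S: real_distribution std_normal_distribution by (rule real_dist_normal_dist)
  have rd: "real_distribution (distr M borel (\<lambda>\<omega>. R n \<omega> / sqrt (real n)))" for n by (rule real_distribution_distr) measurable
  \<comment> \<open>The normal law does not charge the end points, so the interval is a continuity
    set.\<close>
  have "emeasure std_normal_distribution (frontier {-c..c}) = 0"
  proof -
    have f: "frontier {-c..c} = {-c, c}" using c by (simp add: frontier_def)
    have "AE x in lborel. ennreal (std_normal_density x) * indicator {-c, c} x = 0"
      using AE_lborel_singleton[of c] AE_lborel_singleton[of "-c"] by eventually_elim auto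
    then have "emeasure std_normal_distribution {-c, c} = 0"
      by (subst emeasure_density) (auto simp: nn_integral_0_iff_AE)
    then show ?thesis by (simp add: f)
  qed
  then have "(\<lambda>n. measure (distr M borel (\<lambda>\<omega>. R n \<omega> / sqrt (real n))) {-c..c}) \<longlonglongrightarrow> measure std_normal_distribution {-c..c}"
    by (intro weak_conv_imp_continuity_set_conv[OF rd real_dist_normal_dist R_clt]) auto
  moreover have "measure std_normal_distribution {-c..c} < d / 4"
  proof -
    have "{x. \<bar>x\<bar> \<le> c} = {-c..c}" by auto
    then show ?thesis using normal_ball_le[of c] c d by (simp add: c_def)
  qed
  ultimately have "\<forall>\<^sub>F n in sequentially. measure (distr M borel (\<lambda>\<omega>. R n \<omega> / sqrt (real n))) {-c..c} < d / 4"
    by (rule order_tendstoD)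
  then obtain J where J: "\<And>n. n \<ge> J \<Longrightarrow> measure (distr M borel (\<lambda>\<omega>. R n \<omega> / sqrt (real n))) {-c..c} < d / 4"
    unfolding eventually_sequentially by blast
  show "\<exists>b>0. \<forall>\<^sub>F n in sequentially. mostly M d (\<lambda>\<omega>. b \<le> (\<Sum>j=1..n. (R j \<omega>)\<^sup>2) / (real n)\<^sup>2)"
  proof (intro exI[of _ "\<delta>\<^sup>2 / 2"] conjI)
    show "\<delta>\<^sup>2 / 2 > 0" using \<delta> by simp
    show "\<forall>\<^sub>F n in sequentially. mostly M d (\<lambda>\<omega>. \<delta>\<^sup>2 / 2 \<le> (\<Sum>j=1..n. (R j \<omega>)\<^sup>2) / (real n)\<^sup>2)"
      using eventually_gt_at_top[of "nat \<lceil>(real J + 1) / \<beta>\<rceil>"] eventually_gt_at_top[of 0]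
    proof eventually_elim
      case (elim n)
      have "(real J + 1) / \<beta> \<le> real n" using elim(1) by linarith
      then have Jn: "real J + 1 \<le> \<beta> * real n" using \<beta> by (simp add: divide_le_eq mult.commute)
      define b where "b j = {\<omega>\<in>space M. \<bar>R j \<omega>\<bar> \<le> \<delta> * sqrt (real n)}" for j
      have bs [measurable]: "b j \<in> sets M" for j unfolding b_def by measurable
      have pb: "measure M (b j) \<le> d / 4" if j: "\<beta> * real n \<le> real j" for j
      proof -
        have jJ: "j \<ge> J" using Jn j by linarith
        have j0: "real j > 0" using Jn j by linarith
        have "measure M (b j) \<le> measure M ((\<lambda>\<omega>. R j \<omega> / sqrt (real j)) -` {-c..c} \<inter> space M)"
        proof (rule finite_measure_mono)
          show "b j \<subseteq> (\<lambda>\<omega>. R j \<omega> / sqrt (real j)) -` {-c..c} \<inter> space M"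
          proof
            fix \<omega> assume w: "\<omega> \<in> b j"
            have "\<delta> * sqrt (real n) = c * sqrt (\<beta> * real n)" by (simp add: \<delta>_def real_sqrt_mult)
            also have "\<dots> \<le> c * sqrt (real j)" using j c by (intro mult_left_mono) auto
            finally have "\<bar>R j \<omega>\<bar> \<le> c * sqrt (real j)" using w unfolding b_def by auto
            then have "\<bar>R j \<omega> / sqrt (real j)\<bar> \<le> c" using j0 by (simp add: abs_divide divide_le_eq)
            then have "R j \<omega> / sqrt (real j) \<in> {-c..c}" unfolding atLeastAtMost_iff by linarith
            then show "\<omega> \<in> (\<lambda>\<omega>. R j \<omega> / sqrt (real j)) -` {-c..c} \<inter> space M"
              using w unfolding b_def by blast
          qed
        qed measurable
        also have "\<dots> = measure (distr M borel (\<lambda>\<omega>. R j \<omega> / sqrt (real j))) {-c..c}"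
          by (subst measure_distr) auto
        finally show ?thesis using J[OF jJ] by linarith
      qed
      \<comment> \<open>\<open>Y\<close> is the proportion of times at which the walk is small. Its
        mean is at most \<open>d / 4 + \<beta> <= d / 2\<close>, so by Markov it exceeds 1/2 with
        probability at most \<open>d\<close>.\<close>
      define Y where "Y \<omega> = (\<Sum>j=1..n. indicator (b j) \<omega>) / real n" for \<omega>
      have iY: "integrable M Y" unfolding Y_def[abs_def]
        by (intro Bochner_Integration.integrable_divide Bochner_Integration.integrable_sum integrable_real_indicator)
          (auto simp: emeasure_eq_measure)
      have "expectation Y = (\<Sum>j=1..n. measure M (b j)) / real n"
        unfolding Y_def by (subst integral_divide_zero, subst Bochner_Integration.integral_sum)
          (auto simp: emeasure_eq_measure intro!: integrable_real_indicator)
      also have "\<dots> \<le> (\<Sum>j=1..n. d / 4 + (if real j < \<beta> * real n then 1 else 0)) / real n"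
        using pb d by (intro divide_right_mono sum_mono) (auto simp: not_less intro: order_trans[OF prob_le_1])
      also have "\<dots> = (real n * (d / 4) + real (card {j\<in>{1..n}. real j < \<beta> * real n})) / real n"
        by (simp add: sum.distrib sum.If_cases Int_def)
      also have "\<dots> \<le> (real n * (d / 4) + \<beta> * real n) / real n"
      proof (intro divide_right_mono add_left_mono)
        have "{j\<in>{1..n}. real j < \<beta> * real n} \<subseteq> {1..nat \<lfloor>\<beta> * real n\<rfloor>}" by (auto simp: le_nat_floor)
        then have "card {j\<in>{1..n}. real j < \<beta> * real n} \<le> card {1..nat \<lfloor>\<beta> * real n\<rfloor>}" by (intro card_mono) auto
        also have "real (card {1..nat \<lfloor>\<beta> * real n\<rfloor>}) \<le> \<beta> * real n" using \<beta> by simp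
        finally show "real (card {j\<in>{1..n}. real j < \<beta> * real n}) \<le> \<beta> * real n" by simp
      qed simp
      also have "\<dots> = d / 4 + \<beta>" using elim(2) by (simp add: add_divide_distrib)
      also have "\<dots> \<le> d * (1 / 2)" using d by (simp add: \<beta>_def)
      finally have eY: "expectation Y \<le> d * (1 / 2)" .
      have "mostly M d (\<lambda>\<omega>. \<bar>Y \<omega>\<bar> \<le> 1 / 2)"
        by (rule markov_mostly[OF iY _ eY]) (auto simp: Y_def intro!: divide_nonneg_nonneg sum_nonneg)
      then show ?case
      proof (rule mostly_mono)
        fix \<omega> assume w: "\<omega> \<in> space M" and "\<bar>Y \<omega>\<bar> \<le> 1 / 2"
        then have "(\<Sum>j=1..n. indicator (b j) \<omega>) \<le> real n / 2" using elim(2) by (simp add: Y_def divide_le_eq)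
        \<comment> \<open>At no fewer than half of the times the squared walk is at least
          \<open>\<delta>^2 * n\<close>.\<close>
        then have "real n / 2 \<le> (\<Sum>j=1..n. 1 - indicator (b j) \<omega>)" by (simp add: sum_subtractf)
        then have "(\<delta>\<^sup>2 * real n) * (real n / 2) \<le> (\<delta>\<^sup>2 * real n) * (\<Sum>j=1..n. 1 - indicator (b j) \<omega>)"
          by (intro mult_left_mono) auto
        also have "\<dots> = (\<Sum>j=1..n. (\<delta> * sqrt (real n))\<^sup>2 * (1 - indicator (b j) \<omega>))"
          by (simp add: sum_distrib_left power_mult_distrib)
        also have "\<dots> \<le> (\<Sum>j=1..n. (R j \<omega>)\<^sup>2)"
        proof (rule sum_mono)
          fix j
          show "(\<delta> * sqrt (real n))\<^sup>2 * (1 - indicator (b j) \<omega>) \<le> (R j \<omega>)\<^sup>2"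
          proof (cases "\<omega> \<in> b j")
            case False
            then have "\<delta> * sqrt (real n) \<le> \<bar>R j \<omega>\<bar>" using w unfolding b_def by auto
            then have "(\<delta> * sqrt (real n))\<^sup>2 \<le> \<bar>R j \<omega>\<bar>\<^sup>2" using \<delta> by (intro power_mono) auto
            then show ?thesis using False by simp
          qed simp
        qed
        finally show "\<delta>\<^sup>2 / 2 \<le> (\<Sum>j=1..n. (R j \<omega>)\<^sup>2) / (real n)\<^sup>2"
          using elim(2) by (simp add: field_simps power2_eq_square)
      qed
    qed
  qed
qed

subsection \<open>Partial summation and lags\<close>

lemma Abel_identity:
  "(\<Sum>t=1..n. a t * z t) = a n * (\<Sum>i=1..n. z i) - (\<Sum>t<n. (a (Suc t) - a t) * (\<Sum>i=1..t. z i :: real))"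
  by (induction n) (auto simp: algebra_simps)

text \<open>Summation by parts; the increments of \<open>(t / T) ^ k\<close> are at most
  \<open>r / T\<close>. For \<rho> = -1 it transfers the smallness of partial sums to the moments
  that determine the fit.\<close>

lemma scaled_power_sum_le:
  assumes T: "T > 0" and k: "k \<le> r"
  shows "\<bar>\<Sum>t=1..T. scaled_power T k t * z t\<bar> \<le> \<bar>\<Sum>i=1..T. z i\<bar> + real r / real T * (\<Sum>t=1..T. \<bar>\<Sum>i=1..t. z i\<bar>)"
proof -
  define J where "J t = (\<Sum>i=1..t. z i)" for t
  have pT: "scaled_power T k T = 1" using T by (simp add: scaled_power_def)
  have dp: "\<bar>scaled_power T k (Suc t) - scaled_power T k t\<bar> \<le> real r / real T" if "t < T" for t
  proof -
    have "\<bar>scaled_power T k (Suc t) - scaled_power T k t\<bar> \<le> real k * \<bar>real (Suc t) / real T - real t / real T\<bar>"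
      unfolding scaled_power_def using that by (intro abs_power_diff_le) auto
    also have "\<bar>real (Suc t) / real T - real t / real T\<bar> = 1 / real T" by (simp add: diff_divide_distrib[symmetric])
    finally show ?thesis using k T by (simp add: divide_right_mono order_trans)
  qed
  have "\<bar>\<Sum>t=1..T. scaled_power T k t * z t\<bar> = \<bar>J T - (\<Sum>t<T. (scaled_power T k (Suc t) - scaled_power T k t) * J t)\<bar>"
    unfolding Abel_identity by (simp add: pT J_def)
  also have "\<dots> \<le> \<bar>J T\<bar> + (\<Sum>t<T. \<bar>(scaled_power T k (Suc t) - scaled_power T k t) * J t\<bar>)"
    using abs_triangle_ineq4[of "J T" "\<Sum>t<T. (scaled_power T k (Suc t) - scaled_power T k t) * J t"] sum_abs[of "\<lambda>t. (scaled_power T k (Suc t) - scaled_power T k t) * J t" "{..<T}"] by linarith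
  also have "\<dots> \<le> \<bar>J T\<bar> + (\<Sum>t<T. real r / real T * \<bar>J t\<bar>)"
    unfolding abs_mult by (intro add_left_mono sum_mono mult_right_mono dp) auto
  also have "(\<Sum>t<T. real r / real T * \<bar>J t\<bar>) = real r / real T * (\<Sum>t<T. \<bar>J t\<bar>)" by (simp add: sum_distrib_left)
  also have "(\<Sum>t<T. \<bar>J t\<bar>) = (\<Sum>t\<in>{1..<T}. \<bar>J t\<bar>)"
    by (intro sum.mono_neutral_right) (auto simp: J_def not_less_eq_eq)
  also have "\<bar>J T\<bar> + real r / real T * (\<Sum>t\<in>{1..<T}. \<bar>J t\<bar>) \<le> \<bar>J T\<bar> + real r / real T * (\<Sum>t=1..T. \<bar>J t\<bar>)"
    by (intro add_left_mono mult_left_mono sum_mono2) auto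
  finally show ?thesis by (simp add: J_def)
qed

text \<open>With \<open>f 0 = 0\<close>, truncated subtraction supplies zeros for the first
  \<open>i\<close> times.\<close>

lemma lag_sum_eq:
  fixes f :: "nat \<Rightarrow> real"
  assumes "f 0 = 0" shows "(\<Sum>t=1..T. f (t - i)) = (\<Sum>t=1..T - i. f t)"
proof -
  have "(\<Sum>t=1..T. f (t - i)) = (\<Sum>t\<in>{i<..T}. f (t - i))"
    using assms by (intro sum.mono_neutral_right) auto
  also have "\<dots> = (\<Sum>t\<in>{1..T - i}. f t)"
    by (intro sum.reindex_bij_witness[of _ "\<lambda>t. t + i" "\<lambda>t. t - i"]) auto
  finally show ?thesis .
qed

lemma lag_sum_le:
  fixes f :: "nat \<Rightarrow> real"
  assumes "f 0 = 0" "\<And>t. 0 \<le> f t" shows "(\<Sum>t=1..T. f (t - i)) \<le> (\<Sum>t=1..T. f t)"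
  unfolding lag_sum_eq[of f, OF assms(1)] using assms(2) by (intro sum_mono2) auto

lemma lagged_sq_le:
  fixes D :: "nat \<Rightarrow> real"
  shows "(\<Sum>i=1..p. D i * y (t - i))\<^sup>2 \<le> (\<Sum>i=1..p. (D i)\<^sup>2) * (\<Sum>i=1..p. (y (t - i))\<^sup>2)"
  by (rule Cauchy_Schwarz_ineq_sum)

text \<open>Cauchy-Schwarz separates the estimation error \<open>D\<close> from the path, and each
  lagged sum of squares is at most the unlagged one.\<close>

lemma lagged_sum_sq_le:
  fixes D y :: "nat \<Rightarrow> real" assumes "y 0 = 0"
  shows "(\<Sum>t=1..T. (\<Sum>i=1..p. D i * y (t - i))\<^sup>2) \<le> (\<Sum>i=1..p. (D i)\<^sup>2) * (real p * (\<Sum>t=1..T. (y t)\<^sup>2))"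
proof -
  have "(\<Sum>t=1..T. (\<Sum>i=1..p. D i * y (t - i))\<^sup>2) \<le> (\<Sum>t=1..T. (\<Sum>i=1..p. (D i)\<^sup>2) * (\<Sum>i=1..p. (y (t - i))\<^sup>2))"
    by (intro sum_mono lagged_sq_le)
  also have "\<dots> = (\<Sum>i=1..p. (D i)\<^sup>2) * (\<Sum>i=1..p. \<Sum>t=1..T. (y (t - i))\<^sup>2)"
    unfolding sum_distrib_left[symmetric] by (subst (2) sum.swap) simp
  also have "\<dots> \<le> (\<Sum>i=1..p. (D i)\<^sup>2) * (\<Sum>i=1..p. \<Sum>t=1..T. (y t)\<^sup>2)"
  proof (rule mult_left_mono)
    show "(\<Sum>i=1..p. \<Sum>t=1..T. (y (t - i))\<^sup>2) \<le> (\<Sum>i=1..p. \<Sum>t=1..T. (y t)\<^sup>2)"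
      by (rule sum_mono) (rule lag_sum_le[of "\<lambda>t. (y t)\<^sup>2"], use assms in auto)
  qed (auto intro: sum_nonneg)
  finally show ?thesis by simp
qed

subsection \<open>The fitted model\<close>

locale ar_model = prob_space M for M :: "'a measure" +
  fixes p r :: nat and \<kappa> \<rho> \<sigma>e \<sigma>h :: real and \<theta> \<alpha> :: "nat \<Rightarrow> real"
    and \<epsilon> \<eta> :: "nat \<Rightarrow> 'a \<Rightarrow> real" and X :: "nat \<Rightarrow> int \<Rightarrow> 'a \<Rightarrow> real"
    and th :: "nat \<Rightarrow> nat \<Rightarrow> 'a \<Rightarrow> real"
  assumes rho: "\<bar>\<rho>\<bar> = 1"
    and roots: "\<And>z. ar_poly p \<theta> z = 0 \<Longrightarrow> cmod z > 1"
    and eps_noise: "strong_white_noise M \<epsilon> (\<sigma>e\<^sup>2)" and eps_pos: "\<sigma>e \<noteq> 0"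
    and eta_noise: "strong_white_noise M \<eta> (\<sigma>h\<^sup>2)" and eta_pos: "\<sigma>h \<noteq> 0"
    and path: "\<And>T \<omega>. T \<ge> 1 \<Longrightarrow> \<omega> \<in> space M \<Longrightarrow>
           model_path p r \<kappa> \<rho> \<theta> \<alpha> (\<lambda>t. \<epsilon> t \<omega>) (\<lambda>t. \<eta> t \<omega>) T (\<lambda>t. X T t \<omega>)"
    and consistent: "consistent_estimator M p th \<theta>"
begin

sublocale E: iid_walk M "\<lambda>i \<omega>. \<epsilon> (Suc i) \<omega> / \<sigma>e"
  by (rule white_noise_walk[OF eps_noise eps_pos])

sublocale H: iid_walk M "\<lambda>i \<omega>. \<eta> (Suc i) \<omega> / \<sigma>h"
  by (rule white_noise_walk[OF eta_noise eta_pos])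

lemma eps_measurable: "\<epsilon> (Suc i) \<in> borel_measurable M"
  and eta_measurable: "\<eta> (Suc i) \<in> borel_measurable M"
proof -
  have "(\<lambda>\<omega>. \<sigma>e * (\<epsilon> (Suc i) \<omega> / \<sigma>e)) \<in> borel_measurable M" by measurable
  then show "\<epsilon> (Suc i) \<in> borel_measurable M" using eps_pos by simp
  have "(\<lambda>\<omega>. \<sigma>h * (\<eta> (Suc i) \<omega> / \<sigma>h)) \<in> borel_measurable M" by measurable
  then show "\<eta> (Suc i) \<in> borel_measurable M" using eta_pos by simp
qed

lemma th_measurable: "i \<in> {1..p} \<Longrightarrow> th T i \<in> borel_measurable M"
  using consistent unfolding consistent_estimator_def by blast

definition \<psi> :: "nat \<Rightarrow> real" where
  "\<psi> = (SOME \<psi>. summable (\<lambda>n. \<bar>\<psi> n\<bar>) \<and>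
     (\<forall>n. \<psi> n = of_bool (n = 0) + (\<Sum>i=1..p. if i \<le> n then \<theta> i * \<psi> (n - i) else 0)))"

lemma psi_summable: "summable (\<lambda>n. \<bar>\<psi> n\<bar>)"
  and psi_rec: "\<psi> n = of_bool (n = 0) + (\<Sum>i=1..p. if i \<le> n then \<theta> i * \<psi> (n - i) else 0)"
proof -
  have "\<exists>\<psi>::nat \<Rightarrow> real. summable (\<lambda>n. \<bar>\<psi> n\<bar>) \<and>
     (\<forall>n. \<psi> n = of_bool (n = 0) + (\<Sum>i=1..p. if i \<le> n then \<theta> i * \<psi> (n - i) else 0))"
    by (rule ar_inverse_coefficients[OF roots]) blast+
  from someI_ex[OF this, folded \<psi>_def]
  show "summable (\<lambda>n. \<bar>\<psi> n\<bar>)" "\<psi> n = of_bool (n = 0) + (\<Sum>i=1..p. if i \<le> n then \<theta> i * \<psi> (n - i) else 0)" by blast+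
qed

text \<open>\<open>x T t\<close> is \<open>X\<^sub>t\<close> written as a causal moving average. Truncated subtraction in \<open>x T (t - i)\<close>
  supplies the zero initial values.\<close>

definition S :: "nat \<Rightarrow> 'a \<Rightarrow> real" where "S t \<omega> = S_eta \<rho> (\<lambda>k. \<eta> k \<omega>) t"
definition u :: "nat \<Rightarrow> 'a \<Rightarrow> real" where "u t \<omega> = S t \<omega> + \<epsilon> t \<omega>"
definition d :: "nat \<Rightarrow> nat \<Rightarrow> real" where "d T t = trend r \<alpha> T t * of_bool (\<kappa> \<noteq> 0)"
definition x :: "nat \<Rightarrow> nat \<Rightarrow> 'a \<Rightarrow> real" where "x T t \<omega> = causal \<psi> (\<lambda>t. d T t + u t \<omega>) t"
text \<open>The error made by filtering with the estimator instead of \<theta>.\<close>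

definition lag :: "nat \<Rightarrow> nat \<Rightarrow> 'a \<Rightarrow> real" where
  "lag T t \<omega> = (\<Sum>i=1..p. (th T i \<omega> - \<theta> i) * x T (t - i) \<omega>)"
text \<open>The path filtered by the estimator, freed of its deterministic trend.\<close>

definition Z :: "nat \<Rightarrow> nat \<Rightarrow> 'a \<Rightarrow> real" where "Z T t \<omega> = u t \<omega> - lag T t \<omega>"
definition a :: "nat \<Rightarrow> 'a \<Rightarrow> nat \<Rightarrow> real" where
  "a T \<omega> j = (if \<kappa> \<noteq> 0 then ols_trend r T (\<lambda>t. Z T t \<omega>) j else 0)"
definition res :: "nat \<Rightarrow> nat \<Rightarrow> 'a \<Rightarrow> real" where
  "res T t \<omega> = Z T t \<omega> - (\<Sum>j\<le>r. a T \<omega> j * scaled_power T j t)"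
text \<open>With both \<open>a\<close> and \<open>G\<close> zero for \<kappa> = 0, the cases with
  and without a trend share one argument.\<close>

definition G :: "nat \<Rightarrow> nat \<Rightarrow> real" where "G = (if \<kappa> \<noteq> 0 then hilbert_entry r else (\<lambda>_ _. 0))"
definition dist2 :: "nat \<Rightarrow> 'a \<Rightarrow> real" where "dist2 T \<omega> = (\<Sum>i=1..p. (th T i \<omega> - \<theta> i)\<^sup>2)"

lemma x_0 [simp]: "x T 0 \<omega> = 0" by (simp add: x_def causal_def)

lemma X_eq:
  assumes "T \<ge> 1" "\<omega> \<in> space M" "t \<in> {1..T}" shows "X T (int t) \<omega> = x T t \<omega>"
  unfolding x_def
proof (rule ar_solution[OF psi_rec _ _ assms(3)])
  show "X T s \<omega> = 0" if "s \<in> {- int p + 1..0}" for s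
    using path[OF assms(1,2)] that unfolding model_path_def by blast
  show "ar_filter p \<theta> (\<lambda>t. X T t \<omega>) (int s) = d T s + u s \<omega>" if "s \<in> {1..T}" for s
    using path[OF assms(1,2)] that unfolding model_path_def d_def u_def S_def by simp
qed

lemma X_lag:
  assumes "T \<ge> 1" "\<omega> \<in> space M" "t \<in> {1..T}" "i \<in> {1..p}" shows "X T (int t - int i) \<omega> = x T (t - i) \<omega>"
proof (cases "i < t")
  case True
  then have e: "int t - int i = int (t - i)" by (simp add: of_nat_diff)
  have m: "t - i \<in> {1..T}" using True assms(3) by auto
  show ?thesis unfolding e by (rule X_eq[OF assms(1,2) m])
next
  case False
  then have "X T (int t - int i) \<omega> = 0"
    using path[OF assms(1,2)] assms(3,4) unfolding model_path_def by auto
  then show ?thesis using False by simp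
qed

lemma filtered_eq:
  assumes "T \<ge> 1" "\<omega> \<in> space M" "t \<in> {1..T}"
  shows "ar_filter p (\<lambda>i. th T i \<omega>) (\<lambda>t. X T t \<omega>) (int t) = d T t + Z T t \<omega>"
proof -
  have "ar_filter p \<theta> (\<lambda>t. X T t \<omega>) (int t) = d T t + u t \<omega>"
    using path[OF assms(1,2)] assms(3) unfolding model_path_def d_def u_def S_def by simp
  moreover have "ar_filter p \<theta> (\<lambda>t. X T t \<omega>) (int t) - ar_filter p (\<lambda>i. th T i \<omega>) (\<lambda>t. X T t \<omega>) (int t) = lag T t \<omega>"
    unfolding ar_filter_def lag_def using X_lag[OF assms]
    by (simp add: sum_subtractf[symmetric] left_diff_distrib)
  ultimately show ?thesis by (simp add: Z_def)
qed

lemma ols_trend_cong: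
  assumes "\<And>t. t \<in> {1..T} \<Longrightarrow> y t = z t" shows "ols_trend r T y = ols_trend r T z"
proof -
  have "(\<lambda>a. \<Sum>t=1..T. (y t - trend r a T t)\<^sup>2) = (\<lambda>a. \<Sum>t=1..T. (z t - trend r a T t)\<^sup>2)"
    using assms by (intro ext sum.cong) auto
  then show ?thesis by (simp add: ols_trend_def)
qed

text \<open>Least squares removes the deterministic trend exactly, so the residuals only involve \<open>Z\<close>.\<close>

lemma fit:
  obtains C T0 where "0 \<le> C" "0 < T0"
    "\<And>T \<omega> t. T \<ge> T0 \<Longrightarrow> \<omega> \<in> space M \<Longrightarrow> t \<in> {1..T} \<Longrightarrow>
       residual p r \<kappa> T (\<lambda>i. th T i \<omega>) (\<lambda>t. X T t \<omega>) t = res T t \<omega>"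
    "\<And>T \<omega> j. T \<ge> T0 \<Longrightarrow> j \<le> r \<Longrightarrow>
       \<bar>a T \<omega> j - (\<Sum>k\<le>r. G j k * moment T (\<lambda>t. Z T t \<omega>) k)\<bar> \<le> C / real T * (\<Sum>k\<le>r. \<bar>moment T (\<lambda>t. Z T t \<omega>) k\<bar>)"
    "\<And>T \<omega>. T \<ge> T0 \<Longrightarrow> (\<Sum>j\<le>r. \<bar>a T \<omega> j\<bar>) \<le> C * (\<Sum>k\<le>r. \<bar>moment T (\<lambda>t. Z T t \<omega>) k\<bar>)"
    "\<And>T. T \<ge> T0 \<Longrightarrow> \<exists>B. \<forall>\<omega>. \<forall>j\<le>r. a T \<omega> j = (\<Sum>k\<le>r. B j k * moment T (\<lambda>t. Z T t \<omega>) k)"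
proof (rule ols_asymptotics[of r])
  fix C T0 assume o: "0 \<le> C" "0 < T0"
    "\<And>T y j. T \<ge> T0 \<Longrightarrow> j \<le> r \<Longrightarrow>
       \<bar>ols_trend r T y j - (\<Sum>k\<le>r. hilbert_entry r j k * moment T y k)\<bar> \<le> C / real T * (\<Sum>k\<le>r. \<bar>moment T y k\<bar>)"
    "\<And>T y. T \<ge> T0 \<Longrightarrow> (\<Sum>j\<le>r. \<bar>ols_trend r T y j\<bar>) \<le> C * (\<Sum>k\<le>r. \<bar>moment T y k\<bar>)"
    "\<And>T. T \<ge> T0 \<Longrightarrow> \<exists>B. \<forall>y. \<forall>j\<le>r. ols_trend r T y j = (\<Sum>k\<le>r. B j k * moment T y k)"
    "\<And>T y \<alpha> j. T \<ge> T0 \<Longrightarrow> j \<le> r \<Longrightarrow>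
       ols_trend r T (\<lambda>t. y t + trend r \<alpha> T t) j = ols_trend r T y j + \<alpha> j"
  have nn: "0 \<le> (\<Sum>k\<le>r. \<bar>moment T y k\<bar>)" for T y by (auto intro: sum_nonneg)
  show ?thesis
  proof (rule that[of C T0])
    fix T \<omega> t assume T: "T \<ge> T0" and w: "\<omega> \<in> space M" and t: "t \<in> {1..T}"
    have T1: "T \<ge> 1" using T o(2) by simp
    let ?y = "\<lambda>s. ar_filter p (\<lambda>i. th T i \<omega>) (\<lambda>t. X T t \<omega>) (int s)"
    have y: "?y s = d T s + Z T s \<omega>" if "s \<in> {1..T}" for s using filtered_eq[OF T1 w that] .
    show "residual p r \<kappa> T (\<lambda>i. th T i \<omega>) (\<lambda>t. X T t \<omega>) t = res T t \<omega>"
    proof (cases "\<kappa> = 0")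
      case True
      have "d T t = 0" "\<And>j. a T \<omega> j = 0" using True unfolding d_def a_def by simp_all
      moreover have "residual p r \<kappa> T (\<lambda>i. th T i \<omega>) (\<lambda>t. X T t \<omega>) t = ?y t"
        using True by (simp add: residual_def)
      ultimately show ?thesis using y[OF t] by (simp add: res_def)
    next
      case False
      have "ols_trend r T ?y = ols_trend r T (\<lambda>t. Z T t \<omega> + trend r \<alpha> T t)"
        by (rule ols_trend_cong) (use y False in \<open>auto simp: d_def\<close>)
      then have "ols_trend r T ?y j = a T \<omega> j + \<alpha> j" if "j \<le> r" for j
        using o(6)[OF T that] False by (simp add: a_def)
      then have "trend r (ols_trend r T ?y) T t = (\<Sum>j\<le>r. a T \<omega> j * scaled_power T j t) + trend r \<alpha> T t"
        by (simp add: trend_eq distrib_right sum.distrib)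
      then show ?thesis using y[OF t] False by (simp add: residual_def res_def d_def)
    qed
  next
    fix T \<omega> j assume "T \<ge> T0" "j \<le> r"
    then show "\<bar>a T \<omega> j - (\<Sum>k\<le>r. G j k * moment T (\<lambda>t. Z T t \<omega>) k)\<bar> \<le> C / real T * (\<Sum>k\<le>r. \<bar>moment T (\<lambda>t. Z T t \<omega>) k\<bar>)"
      using o(1,3) nn by (auto simp: a_def G_def)
  next
    fix T \<omega> assume T: "T \<ge> T0"
    have "a T \<omega> = (\<lambda>_. 0) \<or> a T \<omega> = ols_trend r T (\<lambda>t. Z T t \<omega>)" by (auto simp: a_def fun_eq_iff)
    then show "(\<Sum>j\<le>r. \<bar>a T \<omega> j\<bar>) \<le> C * (\<Sum>k\<le>r. \<bar>moment T (\<lambda>t. Z T t \<omega>) k\<bar>)"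
      using mult_nonneg_nonneg[OF o(1) nn] o(4)[OF T] by auto
  next
    fix T assume T: "T \<ge> T0"
    show "\<exists>B. \<forall>\<omega>. \<forall>j\<le>r. a T \<omega> j = (\<Sum>k\<le>r. B j k * moment T (\<lambda>t. Z T t \<omega>) k)"
    proof (cases "\<kappa> = 0")
      case True
      then have "a T \<omega> j = 0" for \<omega> j unfolding a_def by simp
      then show ?thesis by (intro exI[of _ "\<lambda>_ _. 0"]) simp
    next
      case False
      obtain B where "\<forall>y. \<forall>j\<le>r. ols_trend r T y j = (\<Sum>k\<le>r. B j k * moment T y k)" using o(5)[OF T] by blast
      moreover have "a T \<omega> j = ols_trend r T (\<lambda>t. Z T t \<omega>) j" for \<omega> j using False by (simp add: a_def)
      ultimately show ?thesis by (intro exI[of _ B]) simp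
    qed
  qed (use o in auto)
qed

lemma K_stat_eq:
  assumes "\<And>t. t \<in> {1..T} \<Longrightarrow> residual p r \<kappa> T (\<lambda>i. th T i \<omega>) (\<lambda>t. X T t \<omega>) t = res T t \<omega>"
  shows "K_stat p r \<kappa> T (\<lambda>i. th T i \<omega>) (\<lambda>t. X T t \<omega>)
    = (\<Sum>t=1..T. (\<Sum>k=1..t. res T k \<omega>)\<^sup>2) / (real T * (\<Sum>k=1..T. (res T k \<omega>)\<^sup>2))"
proof -
  have "(\<Sum>k=1..t. residual p r \<kappa> T (\<lambda>i. th T i \<omega>) (\<lambda>t. X T t \<omega>) k) = (\<Sum>k=1..t. res T k \<omega>)" if "t \<in> {1..T}" for t
    using that assms by (intro sum.cong) auto
  then show ?thesis unfolding K_stat_def Let_def using assms by simp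
qed

lemma S_measurable [measurable]: "S t \<in> borel_measurable M"
  unfolding S_def[abs_def] S_eta_weights by (intro borel_measurable_sum borel_measurable_times eta_measurable) simp

lemma u_measurable: "t \<ge> 1 \<Longrightarrow> u t \<in> borel_measurable M"
  unfolding u_def[abs_def] using eps_measurable[of "t - 1"] by (intro borel_measurable_add S_measurable) simp

lemma x_measurable [measurable]: "x T t \<in> borel_measurable M"
  unfolding x_def[abs_def] causal_def
  by (intro borel_measurable_sum borel_measurable_times borel_measurable_add borel_measurable_const u_measurable) auto

lemma Z_measurable: "t \<ge> 1 \<Longrightarrow> Z T t \<in> borel_measurable M"
  unfolding Z_def[abs_def] lag_def
  by (intro borel_measurable_diff borel_measurable_sum borel_measurable_times borel_measurable_const u_measurable x_measurable th_measurable)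

text \<open>An \<open>arg_min\<close> is not visibly measurable in the sample; a linear formula
  whose matrix is free of \<omega> is.\<close>

lemma res_measurable:
  assumes "\<exists>B. \<forall>\<omega>. \<forall>j\<le>r. a T \<omega> j = (\<Sum>k\<le>r. B j k * moment T (\<lambda>t. Z T t \<omega>) k)" "t \<ge> 1"
  shows "res T t \<in> borel_measurable M"
proof -
  obtain B where B: "\<And>\<omega> j. j \<le> r \<Longrightarrow> a T \<omega> j = (\<Sum>k\<le>r. B j k * moment T (\<lambda>t. Z T t \<omega>) k)" using assms(1) by blast
  have "(\<lambda>\<omega>. a T \<omega> j) \<in> borel_measurable M" if "j \<le> r" for j
    unfolding B[OF that] moment_def
    by (intro borel_measurable_sum borel_measurable_times borel_measurable_const borel_measurable_divide Z_measurable) auto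
  then show ?thesis unfolding res_def[abs_def]
    by (intro borel_measurable_diff borel_measurable_sum borel_measurable_times borel_measurable_const Z_measurable assms(2)) auto
qed

section \<open>Second moments of the components of the model\<close>

lemma S_sq: "integrable M (\<lambda>\<omega>. (S t \<omega>)\<^sup>2)" "expectation (\<lambda>\<omega>. (S t \<omega>)\<^sup>2) = \<sigma>h\<^sup>2 * real t"
proof -
  have e: "S t \<omega> = \<sigma>h * S_eta \<rho> (\<lambda>k. \<eta> (Suc (k - 1)) \<omega> / \<sigma>h) t" for \<omega>
    unfolding S_def S_eta_weights using eta_pos by (simp add: sum_distrib_left)
  show "integrable M (\<lambda>\<omega>. (S t \<omega>)\<^sup>2)" "expectation (\<lambda>\<omega>. (S t \<omega>)\<^sup>2) = \<sigma>h\<^sup>2 * real t"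
    unfolding e power_mult_distrib using H.S_eta_second_moment[OF rho, of t] by simp_all
qed

lemma partial_sum_sq:
  "integrable M (\<lambda>\<omega>. (\<Sum>k=1..t. \<epsilon> k \<omega>)\<^sup>2)" "expectation (\<lambda>\<omega>. (\<Sum>k=1..t. \<epsilon> k \<omega>)\<^sup>2) = \<sigma>e\<^sup>2 * real t"
  "integrable M (\<lambda>\<omega>. (\<Sum>k=1..t. \<eta> k \<omega>)\<^sup>2)" "expectation (\<lambda>\<omega>. (\<Sum>k=1..t. \<eta> k \<omega>)\<^sup>2) = \<sigma>h\<^sup>2 * real t"
proof -
  have s: "(\<Sum>k=1..t. f k) = (\<Sum>i<t. f (Suc i))" for f :: "nat \<Rightarrow> real"
    by (rule sum.reindex_bij_witness[of _ Suc "\<lambda>k. k - 1"]) auto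
  have e: "(\<Sum>k=1..t. \<epsilon> k \<omega>) = \<sigma>e * E.R t \<omega>" "(\<Sum>k=1..t. \<eta> k \<omega>) = \<sigma>h * H.R t \<omega>" for \<omega>
    unfolding s E.R_def H.R_def using eps_pos eta_pos by (simp_all add: sum_distrib_left)
  show "integrable M (\<lambda>\<omega>. (\<Sum>k=1..t. \<epsilon> k \<omega>)\<^sup>2)" "expectation (\<lambda>\<omega>. (\<Sum>k=1..t. \<epsilon> k \<omega>)\<^sup>2) = \<sigma>e\<^sup>2 * real t"
    "integrable M (\<lambda>\<omega>. (\<Sum>k=1..t. \<eta> k \<omega>)\<^sup>2)" "expectation (\<lambda>\<omega>. (\<Sum>k=1..t. \<eta> k \<omega>)\<^sup>2) = \<sigma>h\<^sup>2 * real t"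
    unfolding e power_mult_distrib using E.R_sq[of t] H.R_sq[of t] by simp_all
qed

lemma noise_sq:
  assumes "t \<ge> 1"
  shows "integrable M (\<lambda>\<omega>. (\<epsilon> t \<omega>)\<^sup>2)" "expectation (\<lambda>\<omega>. (\<epsilon> t \<omega>)\<^sup>2) = \<sigma>e\<^sup>2"
    "integrable M (\<lambda>\<omega>. (\<eta> t \<omega>)\<^sup>2)" "expectation (\<lambda>\<omega>. (\<eta> t \<omega>)\<^sup>2) = \<sigma>h\<^sup>2"
proof -
  have e: "\<epsilon> t \<omega> = \<sigma>e * (\<epsilon> (Suc (t - 1)) \<omega> / \<sigma>e)" "\<eta> t \<omega> = \<sigma>h * (\<eta> (Suc (t - 1)) \<omega> / \<sigma>h)" for \<omega>
    using assms eps_pos eta_pos by simp_all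
  show "integrable M (\<lambda>\<omega>. (\<epsilon> t \<omega>)\<^sup>2)" "expectation (\<lambda>\<omega>. (\<epsilon> t \<omega>)\<^sup>2) = \<sigma>e\<^sup>2"
    by (subst e(1), unfold power_mult_distrib, use E.sq_int[of "t - 1"] E.var[of "t - 1"] in simp)+
  show "integrable M (\<lambda>\<omega>. (\<eta> t \<omega>)\<^sup>2)" "expectation (\<lambda>\<omega>. (\<eta> t \<omega>)\<^sup>2) = \<sigma>h\<^sup>2"
    by (subst e(2), unfold power_mult_distrib, use H.sq_int[of "t - 1"] H.var[of "t - 1"] in simp)+
qed

text \<open>The bound \<open>(f + g)^2 <= 2 f^2 + 2 g^2\<close> leaves no cross term to control, at
  the cost of a factor 2.\<close>

lemma sum_second_moment:
  fixes f g :: "'a \<Rightarrow> real"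
  assumes [measurable]: "f \<in> borel_measurable M" "g \<in> borel_measurable M"
    and f: "integrable M (\<lambda>\<omega>. (f \<omega>)\<^sup>2)" "expectation (\<lambda>\<omega>. (f \<omega>)\<^sup>2) \<le> A"
    and g: "integrable M (\<lambda>\<omega>. (g \<omega>)\<^sup>2)" "expectation (\<lambda>\<omega>. (g \<omega>)\<^sup>2) \<le> B"
  shows "integrable M (\<lambda>\<omega>. (f \<omega> + g \<omega>)\<^sup>2)" "expectation (\<lambda>\<omega>. (f \<omega> + g \<omega>)\<^sup>2) \<le> 2 * A + 2 * B"
proof -
  have i: "integrable M (\<lambda>\<omega>. 2 * (f \<omega>)\<^sup>2 + 2 * (g \<omega>)\<^sup>2)" using f g by auto
  show j: "integrable M (\<lambda>\<omega>. (f \<omega> + g \<omega>)\<^sup>2)"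
    by (rule Bochner_Integration.integrable_bound[OF i]) (auto intro!: AE_I2 sq_add_le)
  have "expectation (\<lambda>\<omega>. (f \<omega> + g \<omega>)\<^sup>2) \<le> expectation (\<lambda>\<omega>. 2 * (f \<omega>)\<^sup>2 + 2 * (g \<omega>)\<^sup>2)"
    by (rule integral_mono[OF j i]) (rule sq_add_le)
  also have "\<dots> \<le> 2 * A + 2 * B" using f g by simp
  finally show "expectation (\<lambda>\<omega>. (f \<omega> + g \<omega>)\<^sup>2) \<le> 2 * A + 2 * B" .
qed

definition Cu :: real where "Cu = 2 * \<sigma>h\<^sup>2 + 2 * \<sigma>e\<^sup>2"
definition Dd :: real where "Dd = (\<Sum>j\<le>r. \<bar>\<alpha> j\<bar>)"
text \<open>The filter contributes the square of its total mass; the bracket bounds the second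
  moment of its input, trend plus \<open>u\<close>, per unit of \<open>T\<close>.\<close>

definition Cx :: real where "Cx = (\<Sum>n. \<bar>\<psi> n\<bar>)\<^sup>2 * (2 * Dd\<^sup>2 + 2 * Cu)"

lemma Cu_nonneg: "0 \<le> Cu" and Dd_nonneg: "0 \<le> Dd" and Cx_nonneg: "0 \<le> Cx"
  unfolding Cu_def Dd_def Cx_def by (auto intro!: sum_nonneg)

lemma d_bound: assumes "t \<in> {1..T}" shows "\<bar>d T t\<bar> \<le> Dd"
proof -
  have "\<bar>trend r \<alpha> T t\<bar> \<le> (\<Sum>j\<le>r. \<bar>\<alpha> j * scaled_power T j t\<bar>)" unfolding trend_eq by (rule sum_abs)
  also have "\<dots> \<le> Dd"
    unfolding Dd_def
  proof (rule sum_mono)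
    fix j have "scaled_power T j t \<le> 1" "0 \<le> scaled_power T j t" using assms unfolding scaled_power_def by (auto intro!: power_le_one)
    then show "\<bar>\<alpha> j * scaled_power T j t\<bar> \<le> \<bar>\<alpha> j\<bar>" by (simp add: abs_mult mult_left_le)
  qed
  finally show ?thesis using Dd_nonneg by (simp add: d_def)
qed

lemma const_sq:
  fixes c :: real
  shows "integrable M (\<lambda>\<omega>. c\<^sup>2)" "\<bar>c\<bar> \<le> b \<Longrightarrow> expectation (\<lambda>\<omega>. c\<^sup>2) \<le> b\<^sup>2"
  by (simp_all add: prob_space abs_le_square_iff[symmetric] abs_le_iff)

lemma u_sq: assumes "t \<ge> 1" shows "integrable M (\<lambda>\<omega>. (u t \<omega>)\<^sup>2)" "expectation (\<lambda>\<omega>. (u t \<omega>)\<^sup>2) \<le> Cu * real t"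
proof -
  have m: "\<epsilon> t \<in> borel_measurable M" using eps_measurable[of "t - 1"] assms by simp
  note s = sum_second_moment[OF S_measurable m S_sq(1) eq_refl[OF S_sq(2)] noise_sq(1)[OF assms] eq_refl[OF noise_sq(2)[OF assms]]]
  show "integrable M (\<lambda>\<omega>. (u t \<omega>)\<^sup>2)" unfolding u_def by (rule s)
  have "2 * \<sigma>e\<^sup>2 * 1 \<le> 2 * \<sigma>e\<^sup>2 * real t" using assms by (intro mult_left_mono) auto
  then show "expectation (\<lambda>\<omega>. (u t \<omega>)\<^sup>2) \<le> Cu * real t"
    using s(2)[of t] unfolding u_def Cu_def by (simp add: algebra_simps)
qed

lemma x_sq: assumes "t \<le> T" "T \<ge> 1" shows "integrable M (\<lambda>\<omega>. (x T t \<omega>)\<^sup>2)" "expectation (\<lambda>\<omega>. (x T t \<omega>)\<^sup>2) \<le> Cx * real T"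
proof -
  have b: "integrable M (\<lambda>\<omega>. (d T k + u k \<omega>)\<^sup>2) \<and> expectation (\<lambda>\<omega>. (d T k + u k \<omega>)\<^sup>2) \<le> (2 * Dd\<^sup>2 + 2 * Cu) * real T"
    if k: "k \<in> {1..t}" for k
  proof -
    have k1: "k \<ge> 1" "k \<in> {1..T}" using k assms by auto
    note s = sum_second_moment[OF borel_measurable_const u_measurable[OF k1(1)] const_sq(1) const_sq(2)[OF d_bound[OF k1(2)]] u_sq[OF k1(1)]]
    \<comment> \<open>Both contributions are enlarged to multiples of \<open>T\<close>, using
      \<open>k <= T\<close> and \<open>1 <= T\<close>.\<close>
    have "Cu * real k \<le> Cu * real T" using k assms Cu_nonneg by (intro mult_left_mono) auto
    moreover have "Dd\<^sup>2 * 1 \<le> Dd\<^sup>2 * real T" using assms by (intro mult_left_mono) auto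
    ultimately show ?thesis using s by (auto simp: algebra_simps)
  qed
  note c = causal_second_moment[OF psi_summable _ b]
  have m: "(\<lambda>\<omega>. d T k + u k \<omega>) \<in> borel_measurable M" if "k \<in> {1..t}" for k using u_measurable[of k] that by simp
  have n: "0 \<le> (2 * Dd\<^sup>2 + 2 * Cu) * real T" using Cu_nonneg by auto
  show "integrable M (\<lambda>\<omega>. (x T t \<omega>)\<^sup>2)" unfolding x_def by (rule c(1)[OF m _ n])
  show "expectation (\<lambda>\<omega>. (x T t \<omega>)\<^sup>2) \<le> Cx * real T"
    using c(2)[OF m _ n] unfolding x_def Cx_def by (simp add: mult.assoc)
qed

section \<open>Negligible mean squares\<close>

lemma dist2_small: "small M dist2"
proof -
  have "small M (\<lambda>T \<omega>. L2_set (\<lambda>i. th T i \<omega> - \<theta> i) {1..p})"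
  proof (rule tendsto_in_prob_imp_small)
    show "tendsto_in_prob M (\<lambda>T \<omega>. L2_set (\<lambda>i. th T i \<omega> - \<theta> i) {1..p}) 0"
      using consistent unfolding consistent_estimator_def by blast
    show "(\<lambda>\<omega>. L2_set (\<lambda>i. th T i \<omega> - \<theta> i) {1..p}) \<in> borel_measurable M" for T
      unfolding L2_set_def
      by (intro measurable_compose[OF _ borel_measurable_sqrt] borel_measurable_sum borel_measurable_power borel_measurable_diff borel_measurable_const th_measurable)
  qed
  note l = this
  have "bounded_in_prob M (\<lambda>T \<omega>. L2_set (\<lambda>i. th T i \<omega> - \<theta> i) {1..p})"
    using l unfolding bounded_in_prob_def small_def by blast
  from small_mult[OF l this] show ?thesis
    by (rule small_mono) (auto simp: dist2_def L2_set_def sum_nonneg)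
qed

text \<open>Scaled for a path whose values are of order \<open>sqrt T\<close>.\<close>

definition xm :: "nat \<Rightarrow> 'a \<Rightarrow> real" where "xm T \<omega> = (\<Sum>t=1..T. (x T t \<omega>)\<^sup>2) / (real T)\<^sup>2"

lemma xm_bounded_in_prob: "bounded_in_prob M xm"
proof (rule bounded_in_prob_of_expectation[where c = Cx], rule eventually_mono[OF eventually_ge_at_top[of 1]], intro conjI ballI)
  fix T :: nat assume T: "1 \<le> T"
  show "integrable M (xm T)" unfolding xm_def[abs_def]
    using x_sq(1)[OF _ T] by (intro Bochner_Integration.integrable_divide Bochner_Integration.integrable_sum) auto
  have "expectation (xm T) = (\<Sum>t=1..T. expectation (\<lambda>\<omega>. (x T t \<omega>)\<^sup>2)) / (real T)\<^sup>2"
    unfolding xm_def using x_sq(1)[OF _ T] by (subst integral_divide_zero, subst Bochner_Integration.integral_sum) auto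
  also have "\<dots> \<le> (\<Sum>t=1..T. Cx * real T) / (real T)\<^sup>2"
    using x_sq(2)[OF _ T] by (intro divide_right_mono sum_mono) auto
  also have "\<dots> = Cx" using T by (simp add: power2_eq_square)
  finally show "expectation (xm T) \<le> Cx" .
  show "0 \<le> xm T \<omega>" for \<omega> unfolding xm_def by (auto intro!: divide_nonneg_nonneg sum_nonneg)
qed

definition lagm :: "nat \<Rightarrow> 'a \<Rightarrow> real" where "lagm T \<omega> = (\<Sum>t=1..T. (lag T t \<omega>)\<^sup>2) / (real T)\<^sup>2"

text \<open>Consistency comes without a rate, so the estimation error is paired with a factor that
  is merely bounded in probability: the product \<open>dist2 * xm\<close> dominates.\<close>

lemma lagm_small: "small M lagm"
proof -
  have "small M (\<lambda>T \<omega>. real p * (dist2 T \<omega> * xm T \<omega>))"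
    by (intro small_cmult small_mult dist2_small xm_bounded_in_prob)
  then show ?thesis
  proof (rule small_mono[OF _ always_eventually], intro allI ballI)
    fix T \<omega>
    have "(\<Sum>t=1..T. (lag T t \<omega>)\<^sup>2) \<le> dist2 T \<omega> * (real p * (\<Sum>t=1..T. (x T t \<omega>)\<^sup>2))"
      unfolding lag_def dist2_def by (rule lagged_sum_sq_le) simp
    then have "lagm T \<omega> \<le> dist2 T \<omega> * (real p * (\<Sum>t=1..T. (x T t \<omega>)\<^sup>2)) / (real T)\<^sup>2"
      unfolding lagm_def by (intro divide_right_mono) auto
    also have "\<dots> = real p * (dist2 T \<omega> * xm T \<omega>)" by (simp add: xm_def)
    finally have "lagm T \<omega> \<le> real p * (dist2 T \<omega> * xm T \<omega>)" .
    moreover have "0 \<le> lagm T \<omega>" unfolding lagm_def by (auto intro!: divide_nonneg_nonneg sum_nonneg)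
    ultimately show "\<bar>lagm T \<omega>\<bar> \<le> \<bar>real p * (dist2 T \<omega> * xm T \<omega>)\<bar>" by linarith
  qed
qed

text \<open>The sum of \<open>T\<close> equal second moments grows like \<open>T\<close>, against
  the normalisation \<open>T^2\<close>.\<close>

lemma noise_mean_square_small:
  assumes "\<And>t. t \<ge> 1 \<Longrightarrow> integrable M (\<lambda>\<omega>. (f t \<omega>)\<^sup>2) \<and> expectation (\<lambda>\<omega>. (f t \<omega>)\<^sup>2) = c"
  shows "small M (\<lambda>T \<omega>. (\<Sum>t=1..T. (f t \<omega>)\<^sup>2) / (real T)\<^sup>2)"
proof (rule small_of_expectation[where c = "\<lambda>T. c / real T"])
  show "(\<lambda>T. c / real T) \<longlonglongrightarrow> 0" by (rule lim_const_over_n)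
  show "\<forall>\<^sub>F T in sequentially. integrable M (\<lambda>\<omega>. (\<Sum>t=1..T. (f t \<omega>)\<^sup>2) / (real T)\<^sup>2) \<and>
    (\<forall>\<omega>\<in>space M. 0 \<le> (\<Sum>t=1..T. (f t \<omega>)\<^sup>2) / (real T)\<^sup>2) \<and> expectation (\<lambda>\<omega>. (\<Sum>t=1..T. (f t \<omega>)\<^sup>2) / (real T)\<^sup>2) \<le> c / real T"
    using eventually_gt_at_top[of 0]
  proof eventually_elim
    case (elim T)
    have "expectation (\<lambda>\<omega>. (\<Sum>t=1..T. (f t \<omega>)\<^sup>2) / (real T)\<^sup>2) = (\<Sum>t=1..T. expectation (\<lambda>\<omega>. (f t \<omega>)\<^sup>2)) / (real T)\<^sup>2"
      using assms by (subst integral_divide_zero, subst Bochner_Integration.integral_sum) auto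
    also have "\<dots> = (\<Sum>t=1..T. c) / (real T)\<^sup>2" using assms by (intro arg_cong2[where f = "(/)"] sum.cong) auto
    also have "\<dots> = c / real T" using elim by (simp add: power2_eq_square)
    finally show ?case using assms
      by (auto intro!: Bochner_Integration.integrable_divide Bochner_Integration.integrable_sum divide_nonneg_nonneg sum_nonneg)
  qed
qed

end

text \<open>The difference of the two sides is
  \<open>(a - b)^2 + (a + c)^2 + (b + c)^2\<close>.\<close>

lemma sum3_sq_le: "(a + b - c)\<^sup>2 \<le> 3 * (a\<^sup>2 + b\<^sup>2 + (c::real)\<^sup>2)"
proof -
  have "0 \<le> (a - b)\<^sup>2 + (a + c)\<^sup>2 + (b + c)\<^sup>2" by simp
  then show ?thesis by (simp add: power2_eq_square algebra_simps)
qed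

context ar_model
begin

subsection \<open>A random walk component\<close>

lemma S_random_walk: "\<rho> = 1 \<Longrightarrow> S t \<omega> = \<sigma>h * H.R t \<omega>"
  unfolding S_def H.R_def S_eta_weights using eta_pos by (simp add: sum_distrib_left)

lemma eps_mean_square: "small M (\<lambda>T \<omega>. (\<Sum>t=1..T. (\<epsilon> t \<omega>)\<^sup>2) / (real T)\<^sup>2)"
  and eta_mean_square: "small M (\<lambda>T \<omega>. (\<Sum>t=1..T. (\<eta> t \<omega>)\<^sup>2) / (real T)\<^sup>2)"
  by (rule noise_mean_square_small, use noise_sq in blast)+

text \<open>Turns the walk in \<open>S\<close> into a standard one. The square of this factor is
  common to numerator and denominator and cancels in the ratio.\<close>

definition sc :: "nat \<Rightarrow> real" where "sc T = 1 / (\<sigma>h * sqrt (real T))"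

text \<open>After scaling, the distance consists of \<epsilon>, the estimation error and a single
  increment of the walk; each has a sum of squares of smaller order than \<open>T^2\<close>.\<close>

lemma path_approximation:
  assumes rho1: "\<rho> = 1"
  shows "small M (\<lambda>T \<omega>. sq_norm (\<lambda>s. step_fun T (\<lambda>t. sc T * Z T t \<omega>) s - H.wT T \<omega> s))"
proof -
  let ?b = "\<lambda>T \<omega>. (3 / \<sigma>h\<^sup>2) * ((\<Sum>t=1..T. (\<eta> t \<omega>)\<^sup>2) / (real T)\<^sup>2 + (\<Sum>t=1..T. (\<epsilon> t \<omega>)\<^sup>2) / (real T)\<^sup>2 + lagm T \<omega>)"
  have "small M ?b"
    by (intro small_cmult small_add eps_mean_square eta_mean_square lagm_small)
  then show ?thesis
  proof (rule small_mono)
    show "\<forall>\<^sub>F T in sequentially. \<forall>\<omega>\<in>space M. \<bar>sq_norm (\<lambda>s. step_fun T (\<lambda>t. sc T * Z T t \<omega>) s - H.wT T \<omega> s)\<bar> \<le> \<bar>?b T \<omega>\<bar>"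
      using eventually_gt_at_top[of 0]
    proof (eventually_elim, intro ballI)
      fix T :: nat and \<omega> assume T: "0 < T"
      \<comment> \<open>\<open>\<eta> t\<close> appears because cell \<open>t\<close> of
        \<open>H.wT\<close> carries the walk at time \<open>t - 1\<close>.\<close>
      have e: "sc T * Z T t \<omega> - H.R (t - 1) \<omega> / sqrt (real T) = sc T * (\<eta> t \<omega> + \<epsilon> t \<omega> - lag T t \<omega>)" if t: "t \<in> {1..T}" for t
      proof -
        have "H.R t \<omega> = H.R (t - 1) \<omega> + \<eta> t \<omega> / \<sigma>h"
          using t unfolding H.R_def by (cases t) auto
        then have "u t \<omega> = \<sigma>h * H.R (t - 1) \<omega> + \<eta> t \<omega> + \<epsilon> t \<omega>"
          using eta_pos by (simp add: u_def S_random_walk[OF rho1] distrib_left)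
        moreover have "H.R (t - 1) \<omega> / sqrt (real T) = sc T * (\<sigma>h * H.R (t - 1) \<omega>)"
          using eta_pos by (simp add: sc_def)
        ultimately show ?thesis by (simp add: Z_def algebra_simps)
      qed
      have sc2: "(sc T)\<^sup>2 = 1 / (\<sigma>h\<^sup>2 * real T)" by (simp add: sc_def power_divide power_mult_distrib)
      have "sq_norm (\<lambda>s. step_fun T (\<lambda>t. sc T * Z T t \<omega>) s - H.wT T \<omega> s) = sq_norm (step_fun T (\<lambda>t. sc T * Z T t \<omega> - H.R (t - 1) \<omega> / sqrt (real T)))"
        by (rule arg_cong[where f = sq_norm]) (simp add: fun_eq_iff H.wT_step_fun step_fun_def)
      also have "\<dots> = (\<Sum>t=1..T. (sc T * (\<eta> t \<omega> + \<epsilon> t \<omega> - lag T t \<omega>))\<^sup>2) / real T"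
        unfolding sq_norm_step_fun[OF T] using e by (intro arg_cong2[where f = "(/)"] sum.cong) auto
      also have "\<dots> \<le> (\<Sum>t=1..T. (sc T)\<^sup>2 * (3 * ((\<eta> t \<omega>)\<^sup>2 + (\<epsilon> t \<omega>)\<^sup>2 + (lag T t \<omega>)\<^sup>2))) / real T"
        unfolding power_mult_distrib by (intro divide_right_mono sum_mono mult_left_mono sum3_sq_le) auto
      also have "\<dots> = ?b T \<omega>"
        unfolding sum_distrib_left[symmetric] sum.distrib sc2 lagm_def add_divide_distrib[symmetric]
        by (simp add: power2_eq_square)
      finally show "\<bar>sq_norm (\<lambda>s. step_fun T (\<lambda>t. sc T * Z T t \<omega>) s - H.wT T \<omega> s)\<bar> \<le> \<bar>?b T \<omega>\<bar>"
        using sq_norm_nonneg[of "\<lambda>s. step_fun T (\<lambda>t. sc T * Z T t \<omega>) s - H.wT T \<omega> s"] by linarith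
    qed
  qed
qed

lemma wT_bounded_in_prob: "bounded_in_prob M (\<lambda>T \<omega>. sq_norm (H.wT T \<omega>))"
  by (rule bounded_in_prob_of_expectation[where c = 1], rule eventually_mono[OF eventually_gt_at_top[of 0]]) (simp add: H.wT_sq_norm)

lemma moment_cmult: "moment T (\<lambda>t. c * y t) k = c * moment T y k"
  by (simp add: moment_def sum_distrib_left mult_ac)

text \<open>\<open>K / T\<close> is \<open>A / B\<close> for the squared norms of the cumulated and
  of the plain rescaled residual path. The plain path is close to the detrended walk and the
  cumulated one to its primitive, so \<open>A - x * B\<close> differs from \<open>Phi\<close> along
  the walk by a negligible term, for every \<open>x\<close>.\<close>

theorem random_walk_limit:
  fixes N :: "'b measure" and K :: "nat \<Rightarrow> 'a \<Rightarrow> real"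
  assumes rho1: "\<rho> = 1" and W: "wiener_process N W"
    and K: "\<And>T \<omega>. K T \<omega> = K_stat p r \<kappa> T (\<lambda>i. th T i \<omega>) (\<lambda>t. X T t \<omega>)"
  shows "weak_conv_m (\<lambda>T. distr M borel (\<lambda>\<omega>. K T \<omega> / real T))
    (distr N borel (\<lambda>\<omega>. sq_norm (primitive (detrend G r (\<lambda>s. W s \<omega>))) / sq_norm (detrend G r (\<lambda>s. W s \<omega>))))"
proof (rule fit)
  fix C T0 assume f: "0 \<le> C" "0 < T0"
    "\<And>T \<omega> t. T \<ge> T0 \<Longrightarrow> \<omega> \<in> space M \<Longrightarrow> t \<in> {1..T} \<Longrightarrow>
       residual p r \<kappa> T (\<lambda>i. th T i \<omega>) (\<lambda>t. X T t \<omega>) t = res T t \<omega>"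
    "\<And>T \<omega> j. T \<ge> T0 \<Longrightarrow> j \<le> r \<Longrightarrow>
       \<bar>a T \<omega> j - (\<Sum>k\<le>r. G j k * moment T (\<lambda>t. Z T t \<omega>) k)\<bar> \<le> C / real T * (\<Sum>k\<le>r. \<bar>moment T (\<lambda>t. Z T t \<omega>) k\<bar>)"
    "\<And>T \<omega>. T \<ge> T0 \<Longrightarrow> (\<Sum>j\<le>r. \<bar>a T \<omega> j\<bar>) \<le> C * (\<Sum>k\<le>r. \<bar>moment T (\<lambda>t. Z T t \<omega>) k\<bar>)"
    "\<And>T. T \<ge> T0 \<Longrightarrow> \<exists>B. \<forall>\<omega>. \<forall>j\<le>r. a T \<omega> j = (\<Sum>k\<le>r. B j k * moment T (\<lambda>t. Z T t \<omega>) k)"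
  interpret N: prob_space N using W unfolding wiener_process_def by blast
  interpret N: wiener N W by standard fact
  define y where "y T \<omega> t = sc T * res T t \<omega>" for T \<omega> t
  define cum where "cum T \<omega> t = (\<Sum>k=1..t. y T \<omega> k) / real T" for T \<omega> t
  define w where "w T \<omega> = detrend G r (H.wT T \<omega>)" for T \<omega>
  define A where "A T \<omega> = sq_norm (step_fun T (cum T \<omega>))" for T \<omega>
  define B where "B T \<omega> = sq_norm (step_fun T (y T \<omega>))" for T \<omega>
  have ev: "\<forall>\<^sub>F T in sequentially. T0 \<le> T \<and> 0 < T"
    using eventually_ge_at_top[of T0] by eventually_elim (use f(2) in auto)
  have bounded_meas: "\<forall>\<^sub>F T in sequentially. \<forall>\<omega>\<in>space M. bounded_meas (step_fun T (y T \<omega>)) \<and> bounded_meas (w T \<omega>)"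
    "\<forall>\<^sub>F T in sequentially. \<forall>\<omega>\<in>space M. bounded_meas (step_fun T (cum T \<omega>)) \<and> bounded_meas (primitive (w T \<omega>))"
    using ev by (eventually_elim, auto simp: w_def)+
  obtain C2 where C2: "0 \<le> C2" and disc: "\<And>T z a w. T > 0 \<Longrightarrow> bounded_meas w \<Longrightarrow>
      (\<And>j. j \<le> r \<Longrightarrow> \<bar>a j - (\<Sum>k\<le>r. G j k * ((\<Sum>t=1..T. scaled_power T k t * z t) / real T))\<bar>
          \<le> C / real T * (\<Sum>k\<le>r. \<bar>(\<Sum>t=1..T. scaled_power T k t * z t) / real T\<bar>)) \<Longrightarrow>
      sq_norm (\<lambda>s. step_fun T (\<lambda>t. z t - (\<Sum>j\<le>r. a j * scaled_power T j t)) s - detrend G r w s)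
        \<le> C2 * (sq_norm (\<lambda>s. step_fun T z s - w s) + sq_norm w / (real T)\<^sup>2)"
    using discretisation[OF f(1), of r G] by blast
  have "(\<lambda>T. 1 / (real T)\<^sup>2) \<longlonglongrightarrow> 0" by real_asymp
  then have "small M (\<lambda>T \<omega>. 1 / (real T)\<^sup>2 * sq_norm (H.wT T \<omega>))" by (intro small_mult small_seq wT_bounded_in_prob)
  then have "small M (\<lambda>T \<omega>. C2 * (sq_norm (\<lambda>s. step_fun T (\<lambda>t. sc T * Z T t \<omega>) s - H.wT T \<omega> s) + 1 / (real T)\<^sup>2 * sq_norm (H.wT T \<omega>)))"
    by (intro small_cmult small_add path_approximation[OF rho1])
  \<comment> \<open>The approximate linear relation between coefficients and moments survives
    multiplication by \<open>sc T\<close>, so \<open>discretisation\<close> applies to the scaled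
    sample.\<close>
  then have D1: "small M (\<lambda>T \<omega>. sq_norm (\<lambda>s. step_fun T (y T \<omega>) s - w T \<omega> s))"
  proof (rule small_mono)
    show "\<forall>\<^sub>F T in sequentially. \<forall>\<omega>\<in>space M. \<bar>sq_norm (\<lambda>s. step_fun T (y T \<omega>) s - w T \<omega> s)\<bar>
      \<le> \<bar>C2 * (sq_norm (\<lambda>s. step_fun T (\<lambda>t. sc T * Z T t \<omega>) s - H.wT T \<omega> s) + 1 / (real T)\<^sup>2 * sq_norm (H.wT T \<omega>))\<bar>"
      using ev
    proof (eventually_elim, intro ballI)
      fix T \<omega> assume T: "T0 \<le> T \<and> 0 < T"
      have y: "y T \<omega> = (\<lambda>t. sc T * Z T t \<omega> - (\<Sum>j\<le>r. (sc T * a T \<omega> j) * scaled_power T j t))"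
        by (simp add: fun_eq_iff y_def res_def right_diff_distrib sum_distrib_left mult.assoc)
      have "sq_norm (\<lambda>s. step_fun T (y T \<omega>) s - w T \<omega> s) \<le> C2 * (sq_norm (\<lambda>s. step_fun T (\<lambda>t. sc T * Z T t \<omega>) s - H.wT T \<omega> s) + sq_norm (H.wT T \<omega>) / (real T)\<^sup>2)"
        unfolding y w_def
      proof (rule disc)
        fix j assume j: "j \<le> r"
        let ?m = "moment T (\<lambda>t. Z T t \<omega>)"
        have mm: "(\<Sum>t=1..T. scaled_power T k t * (sc T * Z T t \<omega>)) / real T = sc T * ?m k" for k
          using moment_cmult[of T "sc T" "\<lambda>t. Z T t \<omega>" k] by (simp only: moment_def)
        have "\<bar>sc T * a T \<omega> j - (\<Sum>k\<le>r. G j k * (sc T * ?m k))\<bar> = \<bar>sc T\<bar> * \<bar>a T \<omega> j - (\<Sum>k\<le>r. G j k * ?m k)\<bar>"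
          unfolding abs_mult[symmetric] by (simp add: right_diff_distrib sum_distrib_left mult_ac)
        also have "\<dots> \<le> \<bar>sc T\<bar> * (C / real T * (\<Sum>k\<le>r. \<bar>?m k\<bar>))"
          using f(4) T j by (intro mult_left_mono) auto
        also have "\<dots> = C / real T * (\<Sum>k\<le>r. \<bar>sc T * ?m k\<bar>)"
          by (simp add: abs_mult sum_distrib_left mult_ac)
        finally show "\<bar>sc T * a T \<omega> j - (\<Sum>k\<le>r. G j k * ((\<Sum>t=1..T. scaled_power T k t * (sc T * Z T t \<omega>)) / real T))\<bar>
          \<le> C / real T * (\<Sum>k\<le>r. \<bar>(\<Sum>t=1..T. scaled_power T k t * (sc T * Z T t \<omega>)) / real T\<bar>)"
          unfolding mm .
      qed (use T in auto)
      then show "\<bar>sq_norm (\<lambda>s. step_fun T (y T \<omega>) s - w T \<omega> s)\<bar>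
        \<le> \<bar>C2 * (sq_norm (\<lambda>s. step_fun T (\<lambda>t. sc T * Z T t \<omega>) s - H.wT T \<omega> s) + 1 / (real T)\<^sup>2 * sq_norm (H.wT T \<omega>))\<bar>"
        using sq_norm_nonneg[of "\<lambda>s. step_fun T (y T \<omega>) s - w T \<omega> s"] by simp
    qed
  qed
  have bw: "bounded_in_prob M (\<lambda>T \<omega>. detrend_bound G r * sq_norm (H.wT T \<omega>))"
  proof (rule bounded_in_prob_of_expectation[where c = "detrend_bound G r"], rule eventually_mono[OF eventually_gt_at_top[of 0]])
    fix T :: nat assume "0 < T"
    then show "integrable M (\<lambda>\<omega>. detrend_bound G r * sq_norm (H.wT T \<omega>)) \<and> (\<forall>\<omega>\<in>space M. 0 \<le> detrend_bound G r * sq_norm (H.wT T \<omega>)) \<and>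
      expectation (\<lambda>\<omega>. detrend_bound G r * sq_norm (H.wT T \<omega>)) \<le> detrend_bound G r"
      using H.wT_sq_norm[of T] by (auto intro!: mult_left_le)
  qed
  have b1: "bounded_in_prob M (\<lambda>T \<omega>. sq_norm (w T \<omega>))"
    by (rule bounded_in_prob_mono[OF bw], rule eventually_mono[OF eventually_gt_at_top[of 0]])
      (auto simp: w_def abs_mult intro!: sq_norm_detrend_le)
  have b2: "bounded_in_prob M (\<lambda>T \<omega>. sq_norm (primitive (w T \<omega>)))"
    by (rule bounded_in_prob_mono[OF bw], rule eventually_mono[OF eventually_gt_at_top[of 0]])
      (auto simp: w_def abs_mult intro!: order_trans[OF sq_norm_primitive_le sq_norm_detrend_le])
  have b3: "bounded_in_prob M B" unfolding B_def[abs_def] by (rule bounded_in_prob_sq_norm_approx[OF D1 b1 bounded_meas(1)])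
  have "(\<lambda>T. 1 / (real T)\<^sup>2) \<longlonglongrightarrow> 0" by real_asymp
  then have "small M (\<lambda>T \<omega>. 2 * (1 / (real T)\<^sup>2 * B T \<omega>) + 2 * sq_norm (\<lambda>s. step_fun T (y T \<omega>) s - w T \<omega> s))"
    by (intro small_add small_cmult small_mult small_seq b3 D1)
  \<comment> \<open>Two errors add up: a partial sum against the primitive of its own step function,
    and the primitive of the preceding error.\<close>
  then have D2: "small M (\<lambda>T \<omega>. sq_norm (\<lambda>s. step_fun T (cum T \<omega>) s - primitive (w T \<omega>) s))"
  proof (rule small_mono)
    show "\<forall>\<^sub>F T in sequentially. \<forall>\<omega>\<in>space M. \<bar>sq_norm (\<lambda>s. step_fun T (cum T \<omega>) s - primitive (w T \<omega>) s)\<bar>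
      \<le> \<bar>2 * (1 / (real T)\<^sup>2 * B T \<omega>) + 2 * sq_norm (\<lambda>s. step_fun T (y T \<omega>) s - w T \<omega> s)\<bar>"
      using ev bounded_meas
    proof (eventually_elim, intro ballI)
      fix T \<omega> assume T: "T0 \<le> T \<and> 0 < T" and w: "\<omega> \<in> space M"
        and 1: "\<forall>\<omega>\<in>space M. bounded_meas (step_fun T (y T \<omega>)) \<and> bounded_meas (w T \<omega>)"
        and 2: "\<forall>\<omega>\<in>space M. bounded_meas (step_fun T (cum T \<omega>)) \<and> bounded_meas (primitive (w T \<omega>))"
      have bounded_meas: "bounded_meas (step_fun T (y T \<omega>))" "bounded_meas (w T \<omega>)" "bounded_meas (step_fun T (cum T \<omega>))" "bounded_meas (primitive (w T \<omega>))" using 1 2 w by auto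
      have "sq_norm (\<lambda>s. step_fun T (cum T \<omega>) s - primitive (w T \<omega>) s)
        = sq_norm (\<lambda>s. (step_fun T (cum T \<omega>) s - primitive (step_fun T (y T \<omega>)) s) + primitive (\<lambda>s. step_fun T (y T \<omega>) s - w T \<omega> s) s)"
        using bounded_meas by (intro arg_cong[where f = sq_norm]) (simp add: fun_eq_iff primitive_diff)
      also have "\<dots> \<le> 2 * sq_norm (\<lambda>s. step_fun T (cum T \<omega>) s - primitive (step_fun T (y T \<omega>)) s) + 2 * sq_norm (primitive (\<lambda>s. step_fun T (y T \<omega>) s - w T \<omega> s))"
        using bounded_meas by (intro sq_norm_add_le) auto
      also have "\<dots> \<le> 2 * (sq_norm (step_fun T (y T \<omega>)) / (real T)\<^sup>2) + 2 * sq_norm (\<lambda>s. step_fun T (y T \<omega>) s - w T \<omega> s)"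
        unfolding cum_def[abs_def] using bounded_meas T by (intro add_mono mult_left_mono cumulative_step sq_norm_primitive_le) auto
      finally show "\<bar>sq_norm (\<lambda>s. step_fun T (cum T \<omega>) s - primitive (w T \<omega>) s)\<bar>
        \<le> \<bar>2 * (1 / (real T)\<^sup>2 * B T \<omega>) + 2 * sq_norm (\<lambda>s. step_fun T (y T \<omega>) s - w T \<omega> s)\<bar>"
        using sq_norm_nonneg[of "\<lambda>s. step_fun T (cum T \<omega>) s - primitive (w T \<omega>) s"] by (simp add: B_def)
    qed
  qed
  have sB: "small M (\<lambda>T \<omega>. B T \<omega> - sq_norm (w T \<omega>))" unfolding B_def by (rule small_sq_norm_diff[OF D1 b1 bounded_meas(1)])
  have sA: "small M (\<lambda>T \<omega>. A T \<omega> - sq_norm (primitive (w T \<omega>)))" unfolding A_def by (rule small_sq_norm_diff[OF D2 b2 bounded_meas(2)])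
  have sPhi: "small M (\<lambda>T \<omega>. (A T \<omega> - x * B T \<omega>) - Phi G r x (H.wT T \<omega>))" for x
  proof -
    have "small M (\<lambda>T \<omega>. (A T \<omega> - sq_norm (primitive (w T \<omega>))) + (-x) * (B T \<omega> - sq_norm (w T \<omega>)))"
      by (intro small_add small_cmult sA sB)
    then show ?thesis by (simp add: Phi_def w_def algebra_simps)
  qed
  \<comment> \<open>With these powers of \<open>T\<close>, the ratio \<open>A / B\<close> is the sum
    of squared partial sums over \<open>T^2\<close> times the sum of squared residuals, which is
    \<open>K / T\<close>.\<close>
  have AB: "A T \<omega> = (sc T)\<^sup>2 * (\<Sum>t=1..T. (\<Sum>k=1..t. res T k \<omega>)\<^sup>2) / (real T) ^ 3"
    "B T \<omega> = (sc T)\<^sup>2 * (\<Sum>t=1..T. (res T t \<omega>)\<^sup>2) / real T" if "T > 0" for T \<omega>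
  proof -
    show "B T \<omega> = (sc T)\<^sup>2 * (\<Sum>t=1..T. (res T t \<omega>)\<^sup>2) / real T"
      unfolding B_def sq_norm_step_fun[OF that] y_def power_mult_distrib by (simp add: sum_distrib_left)
    have "cum T \<omega> t = (sc T / real T) * (\<Sum>k=1..t. res T k \<omega>)" for t
      by (simp add: cum_def y_def sum_distrib_left[symmetric])
    then have "(cum T \<omega> t)\<^sup>2 = (sc T / real T)\<^sup>2 * (\<Sum>k=1..t. res T k \<omega>)\<^sup>2" for t
      by (simp only: power_mult_distrib)
    then have "A T \<omega> = (sc T / real T)\<^sup>2 * (\<Sum>t=1..T. (\<Sum>k=1..t. res T k \<omega>)\<^sup>2) / real T"
      unfolding A_def sq_norm_step_fun[OF that] by (simp only: sum_distrib_left)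
    then show "A T \<omega> = (sc T)\<^sup>2 * (\<Sum>t=1..T. (\<Sum>k=1..t. res T k \<omega>)\<^sup>2) / (real T) ^ 3"
      by (simp add: power_divide power2_eq_square power3_eq_cube)
  qed
  have mAB: "\<forall>\<^sub>F T in sequentially. A T \<in> borel_measurable M \<and> B T \<in> borel_measurable M"
    using ev
  proof eventually_elim
    case (elim T)
    have m: "res T t \<in> borel_measurable M" if "t \<ge> 1" for t using res_measurable[OF f(6) that] elim by blast
    have "A T = (\<lambda>\<omega>. (sc T)\<^sup>2 * (\<Sum>t=1..T. (\<Sum>k=1..t. res T k \<omega>)\<^sup>2) / (real T) ^ 3)"
      "B T = (\<lambda>\<omega>. (sc T)\<^sup>2 * (\<Sum>t=1..T. (res T t \<omega>)\<^sup>2) / real T)" using AB elim by (auto simp: fun_eq_iff)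
    moreover have "(\<lambda>\<omega>. (sc T)\<^sup>2 * (\<Sum>t=1..T. (\<Sum>k=1..t. res T k \<omega>)\<^sup>2) / (real T) ^ 3) \<in> borel_measurable M"
      "(\<lambda>\<omega>. (sc T)\<^sup>2 * (\<Sum>t=1..T. (res T t \<omega>)\<^sup>2) / real T) \<in> borel_measurable M"
      by (intro borel_measurable_divide borel_measurable_times borel_measurable_sum borel_measurable_power borel_measurable_const m, simp)+
    ultimately show ?case by simp
  qed
  show ?thesis
  proof (rule ratio_weak_conv[OF prob_space_axioms N.prob_space_axioms mAB _ N.Num_W_measurable N.Den_W_measurable N.Den_W_pos])
    show "\<forall>\<^sub>F T in sequentially. \<forall>\<omega>\<in>space M. 0 \<le> B T \<omega> \<and> (B T \<omega> = 0 \<longrightarrow> A T \<omega> = 0) \<and> K T \<omega> / real T = A T \<omega> / B T \<omega>"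
      using ev
    proof (eventually_elim, intro ballI)
      fix T \<omega> assume T: "T0 \<le> T \<and> 0 < T" and w: "\<omega> \<in> space M"
      have sc: "sc T \<noteq> 0" using T eta_pos by (simp add: sc_def)
      let ?Q = "\<Sum>t=1..T. (res T t \<omega>)\<^sup>2" and ?N = "\<Sum>t=1..T. (\<Sum>k=1..t. res T k \<omega>)\<^sup>2"
      have "0 \<le> B T \<omega>" by (simp add: B_def)
      \<comment> \<open>If all residuals vanish, so do their partial sums.\<close>
      moreover have "A T \<omega> = 0" if "B T \<omega> = 0"
      proof -
        have "?Q = 0" using that AB(2)[of T \<omega>] T sc by simp
        then have "res T t \<omega> = 0" if "t \<in> {1..T}" for t using that by (subst (asm) sum_nonneg_eq_0_iff) auto
        then have "?N = 0" by (intro sum.neutral ballI) simp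
        then show ?thesis using AB(1)[of T \<omega>] T by simp
      qed
      moreover have "K T \<omega> / real T = A T \<omega> / B T \<omega>"
      proof -
        have "K T \<omega> = ?N / (real T * ?Q)" unfolding K using f(3) T w by (intro K_stat_eq) auto
        then show ?thesis using AB[of T \<omega>] T sc by (simp add: power3_eq_cube)
      qed
      ultimately show "0 \<le> B T \<omega> \<and> (B T \<omega> = 0 \<longrightarrow> A T \<omega> = 0) \<and> K T \<omega> / real T = A T \<omega> / B T \<omega>" by blast
    qed
    fix x b c :: real assume bc: "b < c"
    have m: "(\<lambda>\<omega>. Phi G r x (H.wT T \<omega>)) \<in> borel_measurable M" for T
      by (rule Phi_measurable[OF H.wT_joint_measurable])
    have "(\<lambda>T. expectation (\<lambda>\<omega>. cts_step b c (A T \<omega> - x * B T \<omega>))) \<longlonglongrightarrow> N.expectation (\<lambda>\<omega>. cts_step b c (Phi G r x (\<lambda>s. W s \<omega>)))"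
    proof (rule slutsky[OF bc sPhi _ _ walk_functional_convergence[OF H.iid_walk_axioms W bc]])
      show "\<forall>\<^sub>F T in sequentially. (\<lambda>\<omega>. A T \<omega> - x * B T \<omega>) \<in> borel_measurable M"
        using mAB by eventually_elim auto
    qed (use m in auto)
    then show "(\<lambda>T. expectation (\<lambda>\<omega>. cts_step b c (A T \<omega> - x * B T \<omega>)))
      \<longlonglongrightarrow> N.expectation (\<lambda>\<omega>. cts_step b c (sq_norm (primitive (detrend G r (\<lambda>s. W s \<omega>))) - x * sq_norm (detrend G r (\<lambda>s. W s \<omega>))))"
      by (simp add: Phi_def)
  qed
qed

end

lemma sq_diff_le: "(a - b)\<^sup>2 \<le> 2 * a\<^sup>2 + 2 * (b::real)\<^sup>2"
  using sq_add_le[of a "-b"] by simp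

lemma sum3_sq_le': "(a - b - c)\<^sup>2 \<le> 3 * (a\<^sup>2 + b\<^sup>2 + (c::real)\<^sup>2)"
  using sum3_sq_le[of a "-b" c] by simp

text \<open>Squares are replaced by variables so that linear arithmetic applies.\<close>

lemma half_sq_le:
  fixes a1 :: real
  assumes "a1 \<le> 2 * a2 + 2 * a5" "a5 \<le> 3 * (a3 + a4 + a7)" "a7 \<le> a6"
  shows "1 / 2 * a1 \<le> a2 + 3 * (a3 + a4 + a6)"
  using assms by argo

context ar_model
begin

subsection \<open>An alternating component\<close>

definition Ju :: "nat \<Rightarrow> 'a \<Rightarrow> real" where "Ju t \<omega> = (\<Sum>k=1..t. u k \<omega>)"
definition Jx :: "nat \<Rightarrow> nat \<Rightarrow> 'a \<Rightarrow> real" where "Jx T t \<omega> = (\<Sum>k=1..t. x T k \<omega>)"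
definition Jlag :: "nat \<Rightarrow> nat \<Rightarrow> 'a \<Rightarrow> real" where
  "Jlag T t \<omega> = (\<Sum>i=1..p. (th T i \<omega> - \<theta> i) * Jx T (t - i) \<omega>)"
definition JZ :: "nat \<Rightarrow> nat \<Rightarrow> 'a \<Rightarrow> real" where "JZ T t \<omega> = (\<Sum>k=1..t. Z T k \<omega>)"

lemma Jx_0 [simp]: "Jx T 0 \<omega> = 0" by (simp add: Jx_def)

lemma JZ_eq: "JZ T t \<omega> = Ju t \<omega> - Jlag T t \<omega>"
proof -
  have "(\<Sum>k=1..t. lag T k \<omega>) = (\<Sum>i=1..p. (th T i \<omega> - \<theta> i) * (\<Sum>k=1..t. x T (k - i) \<omega>))"
    unfolding lag_def by (subst sum.swap) (simp add: sum_distrib_left)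
  also have "\<dots> = Jlag T t \<omega>"
    unfolding Jlag_def Jx_def by (intro sum.cong refl arg_cong2[where f = "(*)"] lag_sum_eq) simp
  finally show ?thesis by (simp add: JZ_def Ju_def Z_def sum_subtractf)
qed

lemma Ju_measurable [measurable]: "Ju t \<in> borel_measurable M"
  unfolding Ju_def[abs_def] by (intro borel_measurable_sum u_measurable) auto

text \<open>By \<open>S_eta_sum_minus\<close> the partial sum of \<open>S\<close> is half the
  partial sum of \<eta> plus half of \<open>S t\<close>; together with the partial sum of \<epsilon>
  this makes three terms with second moments proportional to \<open>t\<close>.\<close>

lemma Ju_sq:
  assumes rho1: "\<rho> = -1"
  shows "integrable M (\<lambda>\<omega>. (Ju t \<omega>)\<^sup>2)" "expectation (\<lambda>\<omega>. (Ju t \<omega>)\<^sup>2) \<le> Cu * real t"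
proof -
  have m1: "(\<lambda>\<omega>. (\<Sum>k=1..t. \<epsilon> k \<omega>)) \<in> borel_measurable M" "(\<lambda>\<omega>. (\<Sum>k=1..t. \<eta> k \<omega>)) \<in> borel_measurable M"
  proof -
    have "\<epsilon> k \<in> borel_measurable M" "\<eta> k \<in> borel_measurable M" if "k \<in> {1..t}" for k
      using that eps_measurable[of "k - 1"] eta_measurable[of "k - 1"] by auto
    then show "(\<lambda>\<omega>. (\<Sum>k=1..t. \<epsilon> k \<omega>)) \<in> borel_measurable M" "(\<lambda>\<omega>. (\<Sum>k=1..t. \<eta> k \<omega>)) \<in> borel_measurable M"
      by (intro borel_measurable_sum, blast)+
  qed
  let ?h = "\<lambda>\<omega>. (\<Sum>k=1..t. \<eta> k \<omega>) / 2 + S t \<omega> / 2"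
  have hm: "?h \<in> borel_measurable M" using m1 by measurable
  have S: "(\<Sum>k=1..t. S k \<omega>) = ?h \<omega>" for \<omega>
    using S_eta_sum_minus[of "\<lambda>k. \<eta> k \<omega>" t] unfolding S_def unfolding rho1 by (simp add: field_simps)
  have h: "integrable M (\<lambda>\<omega>. (?h \<omega>)\<^sup>2)" "expectation (\<lambda>\<omega>. (?h \<omega>)\<^sup>2) \<le> 2 * (\<sigma>h\<^sup>2 * real t / 4) + 2 * (\<sigma>h\<^sup>2 * real t / 4)"
  proof -
    have a: "integrable M (\<lambda>\<omega>. ((\<Sum>k=1..t. \<eta> k \<omega>) / 2)\<^sup>2)" "expectation (\<lambda>\<omega>. ((\<Sum>k=1..t. \<eta> k \<omega>) / 2)\<^sup>2) \<le> \<sigma>h\<^sup>2 * real t / 4"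
      and b: "integrable M (\<lambda>\<omega>. (S t \<omega> / 2)\<^sup>2)" "expectation (\<lambda>\<omega>. (S t \<omega> / 2)\<^sup>2) \<le> \<sigma>h\<^sup>2 * real t / 4"
      unfolding power_divide using partial_sum_sq(3,4)[of t] S_sq[of t] by simp_all
    show "integrable M (\<lambda>\<omega>. (?h \<omega>)\<^sup>2)" "expectation (\<lambda>\<omega>. (?h \<omega>)\<^sup>2) \<le> 2 * (\<sigma>h\<^sup>2 * real t / 4) + 2 * (\<sigma>h\<^sup>2 * real t / 4)"
      by (rule sum_second_moment[OF _ _ a b], use m1 in measurable)+
  qed
  have J: "Ju t \<omega> = ?h \<omega> + (\<Sum>k=1..t. \<epsilon> k \<omega>)" for \<omega>
    unfolding Ju_def u_def sum.distrib S by simp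
  note s = sum_second_moment[OF hm m1(1) h partial_sum_sq(1) eq_refl[OF partial_sum_sq(2)]]
  show "integrable M (\<lambda>\<omega>. (Ju t \<omega>)\<^sup>2)" unfolding J by (rule s(1))
  show "expectation (\<lambda>\<omega>. (Ju t \<omega>)\<^sup>2) \<le> Cu * real t"
    unfolding J by (rule order_trans[OF s(2)]) (simp add: Cu_def algebra_simps)
qed

text \<open>\<open>Jx\<close> is the filter applied to the partial sums of trend plus
  \<open>u\<close>. A trend may raise it to order \<open>T\<close>, above the order
  \<open>sqrt T\<close> of \<open>Ju\<close>; it is harmless because it only occurs multiplied by
  the estimation error.\<close>

lemma Jx_sq:
  assumes rho1: "\<rho> = -1" and t: "t \<le> T" "T \<ge> 1"
  shows "integrable M (\<lambda>\<omega>. (Jx T t \<omega>)\<^sup>2)" "expectation (\<lambda>\<omega>. (Jx T t \<omega>)\<^sup>2) \<le> Cx * (real T)\<^sup>2"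
proof -
  let ?v = "\<lambda>k \<omega>. (\<Sum>l=1..k. d T l + u l \<omega>)"
  have v: "?v k \<omega> = (\<Sum>l=1..k. d T l) + Ju k \<omega>" for k \<omega> by (simp add: Ju_def sum.distrib)
  have b: "integrable M (\<lambda>\<omega>. (?v k \<omega>)\<^sup>2) \<and> expectation (\<lambda>\<omega>. (?v k \<omega>)\<^sup>2) \<le> (2 * Dd\<^sup>2 + 2 * Cu) * (real T)\<^sup>2"
    if k: "k \<in> {1..t}" for k
  proof -
    have "\<bar>\<Sum>l=1..k. d T l\<bar> \<le> (\<Sum>l=1..k. Dd)"
      using k t by (intro order_trans[OF sum_abs] sum_mono d_bound) auto
    also have "\<dots> = Dd * real k" by simp
    also have "\<dots> \<le> Dd * real T" using k t Dd_nonneg by (intro mult_left_mono) auto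
    finally have D: "\<bar>\<Sum>l=1..k. d T l\<bar> \<le> Dd * real T" .
    note s = sum_second_moment[OF borel_measurable_const Ju_measurable const_sq(1) const_sq(2)[OF D] Ju_sq[OF rho1]]
    have "real k \<le> real T * 1" using k t by simp
    also have "\<dots> \<le> real T * real T" using t by (intro mult_left_mono) auto
    finally have "Cu * real k \<le> Cu * (real T)\<^sup>2" using Cu_nonneg by (simp add: power2_eq_square mult_left_mono)
    then show ?thesis using s[of k] unfolding v by (auto simp: power_mult_distrib algebra_simps)
  qed
  have J: "Jx T t \<omega> = causal \<psi> (\<lambda>k. ?v k \<omega>) t" for \<omega>
    unfolding Jx_def x_def by (rule causal_cumulative)
  have m: "?v k \<in> borel_measurable M" for k unfolding v[abs_def] by measurable
  have n: "0 \<le> (2 * Dd\<^sup>2 + 2 * Cu) * (real T)\<^sup>2" using Cu_nonneg by auto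
  note c = causal_second_moment[OF psi_summable m b n]
  show "integrable M (\<lambda>\<omega>. (Jx T t \<omega>)\<^sup>2)" unfolding J by (rule c(1))
  show "expectation (\<lambda>\<omega>. (Jx T t \<omega>)\<^sup>2) \<le> Cx * (real T)\<^sup>2"
    using c(2) unfolding J Cx_def by (simp add: mult.assoc)
qed

lemma JZ_sq_le: "(JZ T t \<omega>)\<^sup>2 \<le> 2 * (Ju t \<omega>)\<^sup>2 + 2 * (Jlag T t \<omega>)\<^sup>2"
  unfolding JZ_eq by (rule sq_diff_le)

text \<open>The statistic is the sum of squared partial sums over \<open>T^3\<close>, divided by the
  sum of squared residuals over \<open>T^2\<close>; this fixes the power here. The last partial sum
  gets its own normalisation in \<open>n2\<close>, being the boundary term of summation by
  parts.\<close>

definition n1 :: "nat \<Rightarrow> 'a \<Rightarrow> real" where "n1 T \<omega> = (\<Sum>t=1..T. (JZ T t \<omega>)\<^sup>2) / (real T) ^ 3"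
definition n2 :: "nat \<Rightarrow> 'a \<Rightarrow> real" where "n2 T \<omega> = (JZ T T \<omega>)\<^sup>2 / (real T)\<^sup>2"

lemma n1_small: assumes rho1: "\<rho> = -1" shows "small M n1"
proof -
  have U: "small M (\<lambda>T \<omega>. (\<Sum>t=1..T. (Ju t \<omega>)\<^sup>2) / (real T) ^ 3)"
  proof (rule small_of_expectation[where c = "\<lambda>T. Cu / real T"])
    show "(\<lambda>T. Cu / real T) \<longlonglongrightarrow> 0" by (rule lim_const_over_n)
    show "\<forall>\<^sub>F T in sequentially. integrable M (\<lambda>\<omega>. (\<Sum>t=1..T. (Ju t \<omega>)\<^sup>2) / (real T) ^ 3) \<and>
      (\<forall>\<omega>\<in>space M. 0 \<le> (\<Sum>t=1..T. (Ju t \<omega>)\<^sup>2) / (real T) ^ 3) \<and> expectation (\<lambda>\<omega>. (\<Sum>t=1..T. (Ju t \<omega>)\<^sup>2) / (real T) ^ 3) \<le> Cu / real T"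
      using eventually_gt_at_top[of 0]
    proof eventually_elim
      case (elim T)
      have "expectation (\<lambda>\<omega>. (\<Sum>t=1..T. (Ju t \<omega>)\<^sup>2) / (real T) ^ 3) = (\<Sum>t=1..T. expectation (\<lambda>\<omega>. (Ju t \<omega>)\<^sup>2)) / (real T) ^ 3"
        using Ju_sq(1)[OF rho1] by (subst integral_divide_zero, subst Bochner_Integration.integral_sum) auto
      also have "\<dots> \<le> (\<Sum>t=1..T. Cu * real T) / (real T) ^ 3"
        using Cu_nonneg by (intro divide_right_mono sum_mono order_trans[OF Ju_sq(2)[OF rho1]] mult_left_mono) auto
      also have "\<dots> = Cu / real T" using elim by (simp add: power3_eq_cube)
      finally show ?case using Ju_sq(1)[OF rho1]
        by (auto intro!: Bochner_Integration.integrable_divide Bochner_Integration.integrable_sum divide_nonneg_nonneg sum_nonneg)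
    qed
  qed
  let ?X = "\<lambda>T \<omega>. (\<Sum>t=1..T. (Jx T t \<omega>)\<^sup>2) / (real T) ^ 3"
  have X: "bounded_in_prob M ?X"
  proof (rule bounded_in_prob_of_expectation[where c = Cx], rule eventually_mono[OF eventually_ge_at_top[of 1]], intro conjI ballI)
    fix T :: nat assume T: "1 \<le> T"
    note J = Jx_sq[OF rho1 _ T]
    show "integrable M (?X T)"
      using J(1) by (intro Bochner_Integration.integrable_divide Bochner_Integration.integrable_sum) auto
    have "expectation (?X T) = (\<Sum>t=1..T. expectation (\<lambda>\<omega>. (Jx T t \<omega>)\<^sup>2)) / (real T) ^ 3"
      using J(1) by (subst integral_divide_zero, subst Bochner_Integration.integral_sum) auto
    also have "\<dots> \<le> (\<Sum>t=1..T. Cx * (real T)\<^sup>2) / (real T) ^ 3"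
      using J(2) by (intro divide_right_mono sum_mono) auto
    also have "\<dots> = Cx" using T by (simp add: power2_eq_square power3_eq_cube)
    finally show "expectation (?X T) \<le> Cx" .
    show "0 \<le> ?X T \<omega>" for \<omega> by (auto intro!: divide_nonneg_nonneg sum_nonneg)
  qed
  have "small M (\<lambda>T \<omega>. 2 * ((\<Sum>t=1..T. (Ju t \<omega>)\<^sup>2) / (real T) ^ 3) + (2 * real p) * (dist2 T \<omega> * ?X T \<omega>))"
    by (intro small_add small_cmult small_mult U X dist2_small)
  then show ?thesis
  proof (rule small_mono[OF _ always_eventually], intro allI ballI)
    fix T \<omega>
    have "(\<Sum>t=1..T. (Jlag T t \<omega>)\<^sup>2) \<le> dist2 T \<omega> * (real p * (\<Sum>t=1..T. (Jx T t \<omega>)\<^sup>2))"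
      unfolding Jlag_def dist2_def by (rule lagged_sum_sq_le) simp
    moreover have "(\<Sum>t=1..T. (JZ T t \<omega>)\<^sup>2) \<le> 2 * (\<Sum>t=1..T. (Ju t \<omega>)\<^sup>2) + 2 * (\<Sum>t=1..T. (Jlag T t \<omega>)\<^sup>2)"
      unfolding sum_distrib_left sum.distrib[symmetric] by (intro sum_mono JZ_sq_le)
    ultimately have "(\<Sum>t=1..T. (JZ T t \<omega>)\<^sup>2) \<le> 2 * (\<Sum>t=1..T. (Ju t \<omega>)\<^sup>2) + 2 * (dist2 T \<omega> * (real p * (\<Sum>t=1..T. (Jx T t \<omega>)\<^sup>2)))"
      by linarith
    then have "n1 T \<omega> \<le> (2 * (\<Sum>t=1..T. (Ju t \<omega>)\<^sup>2) + 2 * (dist2 T \<omega> * (real p * (\<Sum>t=1..T. (Jx T t \<omega>)\<^sup>2)))) / (real T) ^ 3"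
      unfolding n1_def by (intro divide_right_mono) auto
    also have "\<dots> = 2 * ((\<Sum>t=1..T. (Ju t \<omega>)\<^sup>2) / (real T) ^ 3) + (2 * real p) * (dist2 T \<omega> * ?X T \<omega>)"
      by (simp add: add_divide_distrib mult_ac)
    finally have "n1 T \<omega> \<le> 2 * ((\<Sum>t=1..T. (Ju t \<omega>)\<^sup>2) / (real T) ^ 3) + (2 * real p) * (dist2 T \<omega> * ?X T \<omega>)" .
    moreover have "0 \<le> n1 T \<omega>" unfolding n1_def by (auto intro!: divide_nonneg_nonneg sum_nonneg)
    ultimately show "\<bar>n1 T \<omega>\<bar> \<le> \<bar>2 * ((\<Sum>t=1..T. (Ju t \<omega>)\<^sup>2) / (real T) ^ 3) + (2 * real p) * (dist2 T \<omega> * ?X T \<omega>)\<bar>"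
      by linarith
  qed
qed

lemma n2_small: assumes rho1: "\<rho> = -1" shows "small M n2"
proof -
  have U: "small M (\<lambda>T \<omega>. (Ju T \<omega>)\<^sup>2 / (real T)\<^sup>2)"
  proof (rule small_of_expectation[where c = "\<lambda>T. Cu / real T"])
    show "(\<lambda>T. Cu / real T) \<longlonglongrightarrow> 0" by (rule lim_const_over_n)
    show "\<forall>\<^sub>F T in sequentially. integrable M (\<lambda>\<omega>. (Ju T \<omega>)\<^sup>2 / (real T)\<^sup>2) \<and>
      (\<forall>\<omega>\<in>space M. 0 \<le> (Ju T \<omega>)\<^sup>2 / (real T)\<^sup>2) \<and> expectation (\<lambda>\<omega>. (Ju T \<omega>)\<^sup>2 / (real T)\<^sup>2) \<le> Cu / real T"
      using eventually_gt_at_top[of 0]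
    proof eventually_elim
      case (elim T)
      have "expectation (\<lambda>\<omega>. (Ju T \<omega>)\<^sup>2 / (real T)\<^sup>2) = expectation (\<lambda>\<omega>. (Ju T \<omega>)\<^sup>2) / (real T)\<^sup>2" by simp
      also have "\<dots> \<le> (Cu * real T) / (real T)\<^sup>2"
        by (intro divide_right_mono Ju_sq(2)[OF rho1]) auto
      also have "\<dots> = Cu / real T" using elim by (simp add: power2_eq_square)
      finally show ?case using Ju_sq(1)[OF rho1] by auto
    qed
  qed
  let ?X = "\<lambda>T \<omega>. (\<Sum>i=1..p. (Jx T (T - i) \<omega>)\<^sup>2) / (real T)\<^sup>2"
  have X: "bounded_in_prob M ?X"
  proof (rule bounded_in_prob_of_expectation[where c = "real p * Cx"], rule eventually_mono[OF eventually_ge_at_top[of 1]], intro conjI ballI)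
    fix T :: nat assume T: "1 \<le> T"
    note J = Jx_sq[OF rho1 _ T]
    show "integrable M (?X T)"
      using J(1) by (intro Bochner_Integration.integrable_divide Bochner_Integration.integrable_sum) auto
    have "expectation (?X T) = (\<Sum>i=1..p. expectation (\<lambda>\<omega>. (Jx T (T - i) \<omega>)\<^sup>2)) / (real T)\<^sup>2"
      using J(1) by (subst integral_divide_zero, subst Bochner_Integration.integral_sum) auto
    also have "\<dots> \<le> (\<Sum>i=1..p. Cx * (real T)\<^sup>2) / (real T)\<^sup>2"
      using J(2) by (intro divide_right_mono sum_mono) auto
    also have "\<dots> = real p * Cx" using T by simp
    finally show "expectation (?X T) \<le> real p * Cx" .
    show "0 \<le> ?X T \<omega>" for \<omega> by (auto intro!: divide_nonneg_nonneg sum_nonneg)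
  qed
  have "small M (\<lambda>T \<omega>. 2 * ((Ju T \<omega>)\<^sup>2 / (real T)\<^sup>2) + 2 * (dist2 T \<omega> * ?X T \<omega>))"
    by (intro small_add small_cmult small_mult U X dist2_small)
  then show ?thesis
  proof (rule small_mono[OF _ always_eventually], intro allI ballI)
    fix T \<omega>
    have "(Jlag T T \<omega>)\<^sup>2 \<le> dist2 T \<omega> * (\<Sum>i=1..p. (Jx T (T - i) \<omega>)\<^sup>2)"
      unfolding Jlag_def dist2_def by (rule lagged_sq_le)
    then have "(JZ T T \<omega>)\<^sup>2 \<le> 2 * (Ju T \<omega>)\<^sup>2 + 2 * (dist2 T \<omega> * (\<Sum>i=1..p. (Jx T (T - i) \<omega>)\<^sup>2))"
      using JZ_sq_le[of T T \<omega>] by linarith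
    then have "n2 T \<omega> \<le> (2 * (Ju T \<omega>)\<^sup>2 + 2 * (dist2 T \<omega> * (\<Sum>i=1..p. (Jx T (T - i) \<omega>)\<^sup>2))) / (real T)\<^sup>2"
      unfolding n2_def by (intro divide_right_mono) auto
    also have "\<dots> = 2 * ((Ju T \<omega>)\<^sup>2 / (real T)\<^sup>2) + 2 * (dist2 T \<omega> * ?X T \<omega>)" by (simp add: add_divide_distrib)
    finally have "n2 T \<omega> \<le> 2 * ((Ju T \<omega>)\<^sup>2 / (real T)\<^sup>2) + 2 * (dist2 T \<omega> * ?X T \<omega>)" .
    moreover have "0 \<le> n2 T \<omega>" unfolding n2_def by auto
    ultimately show "\<bar>n2 T \<omega>\<bar> \<le> \<bar>2 * ((Ju T \<omega>)\<^sup>2 / (real T)\<^sup>2) + 2 * (dist2 T \<omega> * ?X T \<omega>)\<bar>" by linarith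
  qed
qed

text \<open>Summation by parts leaves the boundary term \<open>JZ T T\<close> and an average of all
  partial sums, to which Cauchy-Schwarz applies.\<close>

lemma moment_sq_le:
  assumes T: "T > 0" and k: "k \<le> r"
  shows "(moment T (\<lambda>t. Z T t \<omega>) k)\<^sup>2 \<le> 2 * n2 T \<omega> + 2 * (real r)\<^sup>2 * n1 T \<omega>"
proof -
  let ?s = "\<Sum>t=1..T. \<bar>JZ T t \<omega>\<bar>"
  have "\<bar>moment T (\<lambda>t. Z T t \<omega>) k\<bar> = \<bar>\<Sum>t=1..T. scaled_power T k t * Z T t \<omega>\<bar> / real T"
    by (simp add: moment_def)
  also have "\<dots> \<le> (\<bar>JZ T T \<omega>\<bar> + real r / real T * ?s) / real T"
    unfolding JZ_def by (intro divide_right_mono scaled_power_sum_le T k) simp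
  finally have "(moment T (\<lambda>t. Z T t \<omega>) k)\<^sup>2 \<le> ((\<bar>JZ T T \<omega>\<bar> + real r / real T * ?s) / real T)\<^sup>2"
    using power_mono[OF _ abs_ge_zero, of "moment T (\<lambda>t. Z T t \<omega>) k" _ 2] by (simp only: power2_abs)
  also have "\<dots> = (\<bar>JZ T T \<omega>\<bar> + real r / real T * ?s)\<^sup>2 / (real T)\<^sup>2" by (rule power_divide)
  also have "\<dots> \<le> (2 * \<bar>JZ T T \<omega>\<bar>\<^sup>2 + 2 * (real r / real T * ?s)\<^sup>2) / (real T)\<^sup>2"
    by (intro divide_right_mono sq_add_le) simp
  also have "\<dots> \<le> (2 * \<bar>JZ T T \<omega>\<bar>\<^sup>2 + 2 * ((real r)\<^sup>2 / (real T)\<^sup>2 * (real T * (\<Sum>t=1..T. (JZ T t \<omega>)\<^sup>2)))) / (real T)\<^sup>2"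
  proof -
    have "?s\<^sup>2 \<le> (\<Sum>t=1..T. \<bar>JZ T t \<omega>\<bar>\<^sup>2) * real (card {1..T})" by (rule sum_squared_le_sum_of_squares)
    then have "?s\<^sup>2 \<le> real T * (\<Sum>t=1..T. (JZ T t \<omega>)\<^sup>2)" by (simp add: mult.commute)
    then show ?thesis unfolding power_mult_distrib power_divide
      by (intro divide_right_mono add_left_mono mult_left_mono) auto
  qed
  also have "\<dots> = 2 * n2 T \<omega> + 2 * (real r)\<^sup>2 * n1 T \<omega>"
    using T by (simp add: n1_def n2_def add_divide_distrib power2_eq_square power3_eq_cube)
  finally show ?thesis .
qed

text \<open>For \<rho> = -1 the innovations carry alternating signs, so at an even time they pair up
  into differences of neighbours.\<close>

lemma S_even:
  assumes rho1: "\<rho> = -1"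
  shows "S (2 * j) \<omega> = \<sigma>h * sqrt 2 * (\<Sum>i<j. (\<eta> (Suc (2 * i + 1)) \<omega> / \<sigma>h - \<eta> (Suc (2 * i)) \<omega> / \<sigma>h) / sqrt 2)"
proof -
  have "S_eta (-1) h (2 * j) = (\<Sum>i<j. h (Suc (2 * i + 1)) - h (Suc (2 * i)))" for h
    by (induction j) auto
  then have "S (2 * j) \<omega> = (\<Sum>i<j. \<eta> (Suc (2 * i + 1)) \<omega> - \<eta> (Suc (2 * i)) \<omega>)" unfolding S_def unfolding rho1 by simp
  also have "\<dots> = (\<Sum>i<j. \<sigma>h * sqrt 2 * ((\<eta> (Suc (2 * i + 1)) \<omega> / \<sigma>h - \<eta> (Suc (2 * i)) \<omega> / \<sigma>h) / sqrt 2))"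
    using eta_pos by (intro sum.cong refl) (simp add: field_simps)
  finally show ?thesis by (simp add: sum_distrib_left)
qed

text \<open>Even times alone suffice for a lower bound. The factor 2 undoes the normalisation by
  \<open>sqrt 2\<close> in \<open>paired_walk\<close>; the 9 comes from
  \<open>T <= 3 * (T div 2)\<close>, valid for \<open>T >= 2\<close>.\<close>

lemma S_mean_square_lower:
  assumes rho1: "\<rho> = -1"
  shows "bounded_away_in_prob M (\<lambda>T \<omega>. (\<Sum>t=1..T. (S t \<omega>)\<^sup>2) / (real T)\<^sup>2)"
proof -
  interpret P: iid_walk M "\<lambda>i \<omega>. (\<eta> (Suc (2 * i + 1)) \<omega> / \<sigma>h - \<eta> (Suc (2 * i)) \<omega> / \<sigma>h) / sqrt 2"
    by (rule H.paired_walk)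
  have k: "filterlim (\<lambda>T::nat. T div 2) at_top sequentially"
    unfolding filterlim_at_top
  proof
    fix m show "\<forall>\<^sub>F T in sequentially. m \<le> T div 2"
      using eventually_ge_at_top[of "2 * m"] by eventually_elim linarith
  qed
  have "bounded_away_in_prob M (\<lambda>T \<omega>. (2 * \<sigma>h\<^sup>2 / 9) * ((\<Sum>j=1..T div 2. (P.R j \<omega>)\<^sup>2) / (real (T div 2))\<^sup>2))"
    using eta_pos by (intro bounded_away_in_prob_cmult bounded_away_in_prob_subseq[OF P.R_sum_bounded_away_in_prob k]) simp
  then show ?thesis
  \<comment> \<open>The comparison rule allows a negligible correction, here taken to be 0.\<close>
  proof (rule bounded_away_in_prob_diff[OF _ small_seq[OF tendsto_const]])
    show "\<forall>\<^sub>F T in sequentially. \<forall>\<omega>\<in>space M. (2 * \<sigma>h\<^sup>2 / 9) * ((\<Sum>j=1..T div 2. (P.R j \<omega>)\<^sup>2) / (real (T div 2))\<^sup>2) - 0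
      \<le> (\<Sum>t=1..T. (S t \<omega>)\<^sup>2) / (real T)\<^sup>2"
      using eventually_ge_at_top[of 2]
    proof (eventually_elim, intro ballI)
      fix T :: nat and \<omega> assume T: "2 \<le> T"
      let ?n = "T div 2"
      have n: "0 < ?n" "T \<le> 3 * ?n" using T by linarith+
      have "(\<Sum>j=1..?n. (S (2 * j) \<omega>)\<^sup>2) = (\<Sum>t\<in>(\<lambda>j. 2 * j) ` {1..?n}. (S t \<omega>)\<^sup>2)"
        by (subst sum.reindex) (auto simp: inj_on_def)
      also have "\<dots> \<le> (\<Sum>t=1..T. (S t \<omega>)\<^sup>2)" by (intro sum_mono2) auto
      also have "(\<Sum>j=1..?n. (S (2 * j) \<omega>)\<^sup>2) = 2 * \<sigma>h\<^sup>2 * (\<Sum>j=1..?n. (P.R j \<omega>)\<^sup>2)"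
      proof -
        have "S (2 * j) \<omega> = \<sigma>h * sqrt 2 * P.R j \<omega>" for j unfolding P.R_def by (rule S_even[OF rho1])
        then have "(S (2 * j) \<omega>)\<^sup>2 = 2 * \<sigma>h\<^sup>2 * (P.R j \<omega>)\<^sup>2" for j by (simp add: power_mult_distrib)
        then show ?thesis by (simp add: sum_distrib_left)
      qed
      finally have le: "2 * \<sigma>h\<^sup>2 * (\<Sum>j=1..?n. (P.R j \<omega>)\<^sup>2) \<le> (\<Sum>t=1..T. (S t \<omega>)\<^sup>2)" .
      have "(2 * \<sigma>h\<^sup>2 / 9) * ((\<Sum>j=1..?n. (P.R j \<omega>)\<^sup>2) / (real ?n)\<^sup>2) = 2 * \<sigma>h\<^sup>2 * (\<Sum>j=1..?n. (P.R j \<omega>)\<^sup>2) / (3 * real ?n)\<^sup>2"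
        by (simp add: power_mult_distrib)
      also have "\<dots> \<le> 2 * \<sigma>h\<^sup>2 * (\<Sum>j=1..?n. (P.R j \<omega>)\<^sup>2) / (real T)\<^sup>2"
      proof (rule divide_left_mono)
        have "real T \<le> 3 * real ?n" using n(2) by linarith
        then show "(real T)\<^sup>2 \<le> (3 * real ?n)\<^sup>2" by (intro power_mono) auto
        show "0 < (3 * real ?n)\<^sup>2 * (real T)\<^sup>2" using n T by (intro mult_pos_pos) auto
        show "0 \<le> 2 * \<sigma>h\<^sup>2 * (\<Sum>j=1..?n. (P.R j \<omega>)\<^sup>2)" by (intro mult_nonneg_nonneg sum_nonneg) auto
      qed
      also have "\<dots> \<le> (\<Sum>t=1..T. (S t \<omega>)\<^sup>2) / (real T)\<^sup>2" by (intro divide_right_mono le) auto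
      finally show "(2 * \<sigma>h\<^sup>2 / 9) * ((\<Sum>j=1..?n. (P.R j \<omega>)\<^sup>2) / (real ?n)\<^sup>2) - 0 \<le> (\<Sum>t=1..T. (S t \<omega>)\<^sup>2) / (real T)\<^sup>2" by simp
    qed
  qed
qed

text \<open>Numerator and denominator live on the scales \<open>T^3\<close> and \<open>T^2\<close>.
  The first is negligible because the partial sums and hence the fitted coefficients are; the second
  stays away from 0 because negligible terms cannot cancel \<open>S\<close>.\<close>

theorem alternating_limit:
  fixes K :: "nat \<Rightarrow> 'a \<Rightarrow> real"
  assumes rho1: "\<rho> = -1"
    and K: "\<And>T \<omega>. K T \<omega> = K_stat p r \<kappa> T (\<lambda>i. th T i \<omega>) (\<lambda>t. X T t \<omega>)"
  shows "tendsto_in_prob M K 0"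
proof (rule fit)
  fix C T0 assume f: "0 \<le> C" "0 < T0"
    "\<And>T \<omega> t. T \<ge> T0 \<Longrightarrow> \<omega> \<in> space M \<Longrightarrow> t \<in> {1..T} \<Longrightarrow>
       residual p r \<kappa> T (\<lambda>i. th T i \<omega>) (\<lambda>t. X T t \<omega>) t = res T t \<omega>"
    "\<And>T \<omega> j. T \<ge> T0 \<Longrightarrow> j \<le> r \<Longrightarrow>
       \<bar>a T \<omega> j - (\<Sum>k\<le>r. G j k * moment T (\<lambda>t. Z T t \<omega>) k)\<bar> \<le> C / real T * (\<Sum>k\<le>r. \<bar>moment T (\<lambda>t. Z T t \<omega>) k\<bar>)"
    "\<And>T \<omega>. T \<ge> T0 \<Longrightarrow> (\<Sum>j\<le>r. \<bar>a T \<omega> j\<bar>) \<le> C * (\<Sum>k\<le>r. \<bar>moment T (\<lambda>t. Z T t \<omega>) k\<bar>)"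
    "\<And>T. T \<ge> T0 \<Longrightarrow> \<exists>B. \<forall>\<omega>. \<forall>j\<le>r. a T \<omega> j = (\<Sum>k\<le>r. B j k * moment T (\<lambda>t. Z T t \<omega>) k)"
  define as where "as T \<omega> = (\<Sum>j\<le>r. \<bar>a T \<omega> j\<bar>)" for T \<omega>
  define Nb where "Nb T \<omega> = (\<Sum>t=1..T. (\<Sum>k=1..t. res T k \<omega>)\<^sup>2) / (real T) ^ 3" for T \<omega>
  define Qb where "Qb T \<omega> = (\<Sum>t=1..T. (res T t \<omega>)\<^sup>2) / (real T)\<^sup>2" for T \<omega>
  have ev: "\<forall>\<^sub>F T in sequentially. T0 \<le> T \<and> 0 < T"
    using eventually_ge_at_top[of T0] by eventually_elim (use f(2) in auto)
  have as0: "0 \<le> as T \<omega>" for T \<omega> unfolding as_def by (auto intro: sum_nonneg)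
  have "small M (\<lambda>T \<omega>. (C\<^sup>2 * (real r + 1)\<^sup>2) * (2 * n2 T \<omega> + 2 * (real r)\<^sup>2 * n1 T \<omega>))"
    by (intro small_cmult small_add n1_small n2_small rho1)
  \<comment> \<open>The coefficients are bounded by the moments, and these by \<open>n1\<close> and
    \<open>n2\<close>.\<close>
  then have as: "small M (\<lambda>T \<omega>. (as T \<omega>)\<^sup>2)"
  proof (rule small_mono)
    show "\<forall>\<^sub>F T in sequentially. \<forall>\<omega>\<in>space M. \<bar>(as T \<omega>)\<^sup>2\<bar> \<le> \<bar>(C\<^sup>2 * (real r + 1)\<^sup>2) * (2 * n2 T \<omega> + 2 * (real r)\<^sup>2 * n1 T \<omega>)\<bar>"
      using ev
    proof (eventually_elim, intro ballI)
      fix T \<omega> assume T: "T0 \<le> T \<and> 0 < T"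
      let ?m = "moment T (\<lambda>t. Z T t \<omega>)" and ?b = "2 * n2 T \<omega> + 2 * (real r)\<^sup>2 * n1 T \<omega>"
      have "(as T \<omega>)\<^sup>2 \<le> (C * (\<Sum>k\<le>r. \<bar>?m k\<bar>))\<^sup>2"
        using f(5)[of T \<omega>] T as0[of T \<omega>] unfolding as_def by (intro power_mono) auto
      also have "\<dots> = C\<^sup>2 * (\<Sum>k\<le>r. \<bar>?m k\<bar>)\<^sup>2" by (rule power_mult_distrib)
      also have "\<dots> \<le> C\<^sup>2 * ((\<Sum>k\<le>r. \<bar>?m k\<bar>\<^sup>2) * real (card {..r}))"
        by (intro mult_left_mono sum_squared_le_sum_of_squares) simp
      also have "\<dots> \<le> C\<^sup>2 * ((\<Sum>k\<le>r. ?b) * real (card {..r}))"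
        using moment_sq_le T by (intro mult_left_mono mult_right_mono sum_mono) auto
      also have "\<dots> = (C\<^sup>2 * (real r + 1)\<^sup>2) * ?b" by (simp add: power2_eq_square algebra_simps)
      finally show "\<bar>(as T \<omega>)\<^sup>2\<bar> \<le> \<bar>(C\<^sup>2 * (real r + 1)\<^sup>2) * ?b\<bar>" by simp
    qed
  qed
  have scaled_power: "\<bar>\<Sum>j\<le>r. a T \<omega> j * scaled_power T j t\<bar> \<le> as T \<omega>" if "t \<in> {1..T}" for T \<omega> t
  proof -
    have "scaled_power T j t \<le> 1" "0 \<le> scaled_power T j t" for j using that unfolding scaled_power_def by (auto intro!: power_le_one)
    then have "\<bar>a T \<omega> j * scaled_power T j t\<bar> \<le> \<bar>a T \<omega> j\<bar>" for j by (simp add: abs_mult mult_left_le)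
    then show ?thesis unfolding as_def by (intro order_trans[OF sum_abs] sum_mono)
  qed
  have "small M (\<lambda>T \<omega>. 2 * n1 T \<omega> + 2 * (as T \<omega>)\<^sup>2)" by (intro small_add small_cmult n1_small rho1 as)
  then have N: "small M Nb"
  proof (rule small_mono)
    show "\<forall>\<^sub>F T in sequentially. \<forall>\<omega>\<in>space M. \<bar>Nb T \<omega>\<bar> \<le> \<bar>2 * n1 T \<omega> + 2 * (as T \<omega>)\<^sup>2\<bar>"
      using ev
    proof (eventually_elim, intro ballI)
      fix T \<omega> assume T: "T0 \<le> T \<and> 0 < T"
      \<comment> \<open>The fitted trend is at most \<open>as\<close> at each time, so it
        contributes at most \<open>T * as\<close> to a partial sum.\<close>
      have s: "(\<Sum>k=1..t. res T k \<omega>)\<^sup>2 \<le> 2 * (JZ T t \<omega>)\<^sup>2 + 2 * (real T * as T \<omega>)\<^sup>2" if t: "t \<in> {1..T}" for t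
      proof -
        let ?e = "\<Sum>k=1..t. \<Sum>j\<le>r. a T \<omega> j * scaled_power T j k"
        have "\<bar>?e\<bar> \<le> (\<Sum>k=1..t. as T \<omega>)" using t by (intro order_trans[OF sum_abs] sum_mono scaled_power) auto
        also have "\<dots> \<le> real T * as T \<omega>" using t as0[of T \<omega>] by (simp add: mult_right_mono)
        finally have "\<bar>?e\<bar>\<^sup>2 \<le> (real T * as T \<omega>)\<^sup>2" by (intro power_mono) auto
        moreover have "(\<Sum>k=1..t. res T k \<omega>) = JZ T t \<omega> - ?e" by (simp add: res_def JZ_def sum_subtractf)
        ultimately show ?thesis using sq_diff_le[of "JZ T t \<omega>" ?e] by simp
      qed
      have "Nb T \<omega> \<le> (\<Sum>t=1..T. 2 * (JZ T t \<omega>)\<^sup>2 + 2 * (real T * as T \<omega>)\<^sup>2) / (real T) ^ 3"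
        unfolding Nb_def using s by (intro divide_right_mono sum_mono) auto
      also have "\<dots> = 2 * n1 T \<omega> + 2 * (as T \<omega>)\<^sup>2"
        using T by (simp add: n1_def sum.distrib sum_distrib_left[symmetric] add_divide_distrib power_mult_distrib power2_eq_square power3_eq_cube)
      finally have "Nb T \<omega> \<le> 2 * n1 T \<omega> + 2 * (as T \<omega>)\<^sup>2" .
      moreover have "0 \<le> Nb T \<omega>" unfolding Nb_def by (auto intro!: divide_nonneg_nonneg sum_nonneg)
      ultimately show "\<bar>Nb T \<omega>\<bar> \<le> \<bar>2 * n1 T \<omega> + 2 * (as T \<omega>)\<^sup>2\<bar>" by linarith
    qed
  qed
  have e: "small M (\<lambda>T \<omega>. 3 * ((\<Sum>t=1..T. (\<epsilon> t \<omega>)\<^sup>2) / (real T)\<^sup>2 + lagm T \<omega> + (as T \<omega>)\<^sup>2))"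
    by (intro small_cmult small_add eps_mean_square lagm_small as)
  have Q: "bounded_away_in_prob M Qb"
  proof (rule bounded_away_in_prob_diff[OF bounded_away_in_prob_cmult[OF S_mean_square_lower[OF rho1], of "1 / 2"] e])
    show "\<forall>\<^sub>F T in sequentially. \<forall>\<omega>\<in>space M. 1 / 2 * ((\<Sum>t=1..T. (S t \<omega>)\<^sup>2) / (real T)\<^sup>2) -
       3 * ((\<Sum>t=1..T. (\<epsilon> t \<omega>)\<^sup>2) / (real T)\<^sup>2 + lagm T \<omega> + (as T \<omega>)\<^sup>2) \<le> Qb T \<omega>"
      using ev
    proof (eventually_elim, intro ballI)
      fix T \<omega> assume T: "T0 \<le> T \<and> 0 < T"
      \<comment> \<open>\<open>S\<close> is the residual less \<epsilon>, the estimation error and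
        the fitted trend; squaring gives a lower bound for the squared residual.\<close>
      have s: "1 / 2 * (S t \<omega>)\<^sup>2 \<le> (res T t \<omega>)\<^sup>2 + 3 * ((\<epsilon> t \<omega>)\<^sup>2 + (lag T t \<omega>)\<^sup>2 + (as T \<omega>)\<^sup>2)" if t: "t \<in> {1..T}" for t
      proof -
        let ?e = "\<Sum>j\<le>r. a T \<omega> j * scaled_power T j t"
        let ?g = "\<epsilon> t \<omega> - lag T t \<omega> - ?e"
        have "S t \<omega> = res T t \<omega> - ?g" by (simp add: res_def Z_def u_def)
        then have "(S t \<omega>)\<^sup>2 \<le> 2 * (res T t \<omega>)\<^sup>2 + 2 * ?g\<^sup>2" by (metis sq_diff_le)
        moreover have "?g\<^sup>2 \<le> 3 * ((\<epsilon> t \<omega>)\<^sup>2 + (lag T t \<omega>)\<^sup>2 + ?e\<^sup>2)" by (rule sum3_sq_le')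
        moreover have "?e\<^sup>2 \<le> (as T \<omega>)\<^sup>2" using power_mono[OF scaled_power[OF t, of \<omega>] abs_ge_zero, of 2] by simp
        ultimately show ?thesis by (rule half_sq_le)
      qed
      have "1 / 2 * (\<Sum>t=1..T. (S t \<omega>)\<^sup>2) \<le> (\<Sum>t=1..T. (res T t \<omega>)\<^sup>2 + 3 * ((\<epsilon> t \<omega>)\<^sup>2 + (lag T t \<omega>)\<^sup>2 + (as T \<omega>)\<^sup>2))"
        unfolding sum_distrib_left by (rule sum_mono) (rule s)
      also have "\<dots> = (\<Sum>t=1..T. (res T t \<omega>)\<^sup>2) + 3 * ((\<Sum>t=1..T. (\<epsilon> t \<omega>)\<^sup>2) + (\<Sum>t=1..T. (lag T t \<omega>)\<^sup>2) + real T * (as T \<omega>)\<^sup>2)"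
        by (simp add: sum.distrib sum_distrib_left[symmetric])
      finally have "1 / 2 * (\<Sum>t=1..T. (S t \<omega>)\<^sup>2) / (real T)\<^sup>2 \<le>
        ((\<Sum>t=1..T. (res T t \<omega>)\<^sup>2) + 3 * ((\<Sum>t=1..T. (\<epsilon> t \<omega>)\<^sup>2) + (\<Sum>t=1..T. (lag T t \<omega>)\<^sup>2) + real T * (as T \<omega>)\<^sup>2)) / (real T)\<^sup>2"
        by (intro divide_right_mono) auto
      also have "\<dots> = Qb T \<omega> + 3 * ((\<Sum>t=1..T. (\<epsilon> t \<omega>)\<^sup>2) / (real T)\<^sup>2 + lagm T \<omega> + (as T \<omega>)\<^sup>2 / real T)"
        using T by (simp add: Qb_def lagm_def add_divide_distrib power2_eq_square)
      also have "\<dots> \<le> Qb T \<omega> + 3 * ((\<Sum>t=1..T. (\<epsilon> t \<omega>)\<^sup>2) / (real T)\<^sup>2 + lagm T \<omega> + (as T \<omega>)\<^sup>2)"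
      proof -
        have "(as T \<omega>)\<^sup>2 / real T \<le> (as T \<omega>)\<^sup>2 / 1" using T by (intro divide_left_mono) auto
        then show ?thesis by simp
      qed
      finally show "1 / 2 * ((\<Sum>t=1..T. (S t \<omega>)\<^sup>2) / (real T)\<^sup>2) -
       3 * ((\<Sum>t=1..T. (\<epsilon> t \<omega>)\<^sup>2) / (real T)\<^sup>2 + lagm T \<omega> + (as T \<omega>)\<^sup>2) \<le> Qb T \<omega>" by simp
    qed
  qed simp
  have "small M (\<lambda>T \<omega>. Nb T \<omega> * (1 / Qb T \<omega>))" by (rule small_mult[OF N bounded_away_in_prob_inverse[OF Q]])
  then have "small M K"
  proof (rule small_mono)
    show "\<forall>\<^sub>F T in sequentially. \<forall>\<omega>\<in>space M. \<bar>K T \<omega>\<bar> \<le> \<bar>Nb T \<omega> * (1 / Qb T \<omega>)\<bar>"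
      using ev
    proof (eventually_elim, intro ballI)
      fix T \<omega> assume T: "T0 \<le> T \<and> 0 < T" and w: "\<omega> \<in> space M"
      have "K T \<omega> = (\<Sum>t=1..T. (\<Sum>k=1..t. res T k \<omega>)\<^sup>2) / (real T * (\<Sum>k=1..T. (res T k \<omega>)\<^sup>2))"
        unfolding K using f(3) T w by (intro K_stat_eq) auto
      then have "K T \<omega> = Nb T \<omega> * (1 / Qb T \<omega>)"
        using T by (simp add: Nb_def Qb_def power2_eq_square power3_eq_cube)
      then show "\<bar>K T \<omega>\<bar> \<le> \<bar>Nb T \<omega> * (1 / Qb T \<omega>)\<bar>" by simp
    qed
  qed
  then show ?thesis by (rule small_imp_tendsto_in_prob)
qed

end

theorem theorem1p2:
  fixes M :: "'a measure"
    and p r :: nat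
    and \<kappa> \<rho> \<sigma>\<epsilon> \<sigma>\<eta> :: real
    and \<theta> \<alpha> :: "nat \<Rightarrow> real"
    and \<epsilon> \<eta> :: "nat \<Rightarrow> 'a \<Rightarrow> real"
    and X :: "nat \<Rightarrow> int \<Rightarrow> 'a \<Rightarrow> real"
    and th :: "nat \<Rightarrow> nat \<Rightarrow> 'a \<Rightarrow> real"
    and K :: "nat \<Rightarrow> 'a \<Rightarrow> real"
  assumes "prob_space M"
    and "\<bar>\<rho>\<bar> = 1"
    and "\<And>z. ar_poly p \<theta> z = 0 \<Longrightarrow> cmod z > 1"
    and "strong_white_noise M \<epsilon> (\<sigma>\<epsilon>\<^sup>2)" and "\<sigma>\<epsilon>\<^sup>2 > 0"
    and "strong_white_noise M \<eta> (\<sigma>\<eta>\<^sup>2)" and "\<sigma>\<eta>\<^sup>2 > 0"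
    and "uncorrelated_noises M \<epsilon> \<eta>"
    and "\<And>T \<omega>. T \<ge> 1 \<Longrightarrow> \<omega> \<in> space M \<Longrightarrow>
           model_path p r \<kappa> \<rho> \<theta> \<alpha> (\<lambda>t. \<epsilon> t \<omega>) (\<lambda>t. \<eta> t \<omega>) T (\<lambda>t. X T t \<omega>)"
    and "consistent_estimator M p th \<theta>"
    and K_def: "\<And>T \<omega>. K T \<omega> = K_stat p r \<kappa> T (\<lambda>i. th T i \<omega>) (\<lambda>t. X T t \<omega>)"
  shows "(\<kappa> \<noteq> 0 \<and> \<rho> = 1 \<longrightarrow>
           (\<forall>(N :: 'b measure) W. wiener_process N W \<longrightarrow>
              weak_conv_m (\<lambda>T. distr M borel (\<lambda>\<omega>. K T \<omega> / real T))
                          (distr N borel (\<lambda>\<omega>. ratio_trend r (\<lambda>t. W t \<omega>))))) \<and>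
         (\<kappa> = 0 \<and> \<rho> = 1 \<longrightarrow>
           (\<forall>(N :: 'b measure) W. wiener_process N W \<longrightarrow>
              weak_conv_m (\<lambda>T. distr M borel (\<lambda>\<omega>. K T \<omega> / real T))
                          (distr N borel (\<lambda>\<omega>. ratio_no_trend (\<lambda>t. W t \<omega>))))) \<and>
         (\<rho> = -1 \<longrightarrow> tendsto_in_prob M K 0)"
proof -
  interpret prob_space M by (rule assms(1))
  interpret ar_model M p r \<kappa> \<rho> \<sigma>\<epsilon> \<sigma>\<eta> \<theta> \<alpha> \<epsilon> \<eta> X th
  proof
    show "\<bar>\<rho>\<bar> = 1" by (rule assms(2))
    show "\<And>z. ar_poly p \<theta> z = 0 \<Longrightarrow> cmod z > 1" by (rule assms(3))
    show "strong_white_noise M \<epsilon> (\<sigma>\<epsilon>\<^sup>2)" "strong_white_noise M \<eta> (\<sigma>\<eta>\<^sup>2)" by (rule assms(4) assms(6))+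
    show "\<sigma>\<epsilon> \<noteq> 0" "\<sigma>\<eta> \<noteq> 0" using assms(5,7) by auto
    show "\<And>T \<omega>. T \<ge> 1 \<Longrightarrow> \<omega> \<in> space M \<Longrightarrow>
           model_path p r \<kappa> \<rho> \<theta> \<alpha> (\<lambda>t. \<epsilon> t \<omega>) (\<lambda>t. \<eta> t \<omega>) T (\<lambda>t. X T t \<omega>)" by (rule assms(9))
    show "consistent_estimator M p th \<theta>" by (rule assms(10))
  qed
  have cont: "continuous_on {0..1} (\<lambda>t. W t \<omega>)" if "wiener_process N W" "\<omega> \<in> space N" for N :: "'b measure" and W \<omega>
    using that unfolding wiener_process_def by blast
  have trend: "weak_conv_m (\<lambda>T. distr M borel (\<lambda>\<omega>. K T \<omega> / real T)) (distr N borel (\<lambda>\<omega>. ratio_trend r (\<lambda>t. W t \<omega>)))"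
    if "\<kappa> \<noteq> 0" "\<rho> = 1" "wiener_process N W" for N :: "'b measure" and W
  proof -
    have "G = hilbert_entry r" using that(1) by (simp add: G_def)
    \<comment> \<open>Every path on the space of \<open>N\<close> is continuous, so the two
      functionals agree pointwise and not merely almost surely.\<close>
    then have "distr N borel (\<lambda>\<omega>. sq_norm (primitive (detrend G r (\<lambda>s. W s \<omega>))) / sq_norm (detrend G r (\<lambda>s. W s \<omega>)))
        = distr N borel (\<lambda>\<omega>. ratio_trend r (\<lambda>t. W t \<omega>))"
      by (intro distr_cong) (simp_all add: ratio_trend_eq[OF cont[OF that(3)]])
    then show ?thesis using random_walk_limit[OF that(2,3) K_def] by simp
  qed
  have no_trend: "weak_conv_m (\<lambda>T. distr M borel (\<lambda>\<omega>. K T \<omega> / real T)) (distr N borel (\<lambda>\<omega>. ratio_no_trend (\<lambda>t. W t \<omega>)))"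
    if "\<kappa> = 0" "\<rho> = 1" "wiener_process N W" for N :: "'b measure" and W
  proof -
    \<comment> \<open>With the zero kernel detrending is the identity, whatever the degree
      \<open>r\<close>.\<close>
    have "G = (\<lambda>_ _. 0)" using that(1) unfolding G_def by simp
    then have "distr N borel (\<lambda>\<omega>. sq_norm (primitive (detrend G r (\<lambda>s. W s \<omega>))) / sq_norm (detrend G r (\<lambda>s. W s \<omega>)))
        = distr N borel (\<lambda>\<omega>. ratio_no_trend (\<lambda>t. W t \<omega>))"
      by (intro distr_cong) (simp_all only: ratio_no_trend_eq[OF cont[OF that(3)], of _ r])
    then show ?thesis using random_walk_limit[OF that(2,3) K_def] by (simp only:)
  qed
  show ?thesis
    using trend no_trend alternating_limit[OF _ K_def] by blast
qed

end
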